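(* Let $N\ge2$ and let $\Sigma=\mathbb{R}^k\times\tilde\Sigma$, where $k\in\{0,\dots,N\}$ and $\tilde\Sigma\subset\mathbb{R}^{N-k}$ is an open, convex cone with vertex at the origin which contains no lines. Let $H\in C^2(\mathbb{R}^N\setminus\{0\})$ be a positively homogeneous function of degree one which is positive on $\mathbb{S}^{N-1}$ and uniformly elliptic, and let $H_0$ be its dual function. Let $C>0$, $R>0$, $x_0\in\mathbb{R}^k\times\{0\}$ and $\Omega=B_R^{H_0}(x_0)$. Put $\Gamma_0:=\Sigma\cap\partial\Omega$ and $\Gamma_1:=\overline\Omega^c\cap\partial\Sigma$. Then the function $$u(x)=CR\ln\frac{H_0(x-x_0)}{R}$$ is of class $C^2(\mathbb{R}^N\setminus\{x_0\})$ and is the unique (weak) solution to the problem $$\Delta_N^H u=0\ \text{ in }\Sigma\cap\overline\Omega^c,\qquad u=0\ \text{ on }\Gamma_0,\qquad \langle a(\nabla u),\nu\rangle=0\ \text{ on }\Gamma_1,$$ $$\frac1d\le\frac{u(x)}{\ln H_0(x)}\le d\ \text{ for some } d>1,\ \text{ as } H_0(x)\to\infty,$$ $$H(\nabla u)=C\quad\text{on }\Gamma_0.$$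
   Context: Notation. $\overline\Omega^c=\mathbb{R}^N\setminus\overline\Omega$, $\Omega^c=\mathbb{R}^N\setminus\Omega$; $\nu$ is the outer unit normal to $\partial\Sigma$ (defined a.e.). When $k=N$, $\Sigma=\mathbb{R}^N$ and $\Gamma_1=\emptyset$, so the Neumann condition is void. Positively homogeneous of degree one means $H(t\xi)=tH(\xi)$ for all $t>0$, $\xi\in\mathbb{R}^N$ ($H$ need not be even). The dual function is $H_0(x):=\sup_{H(\xi)=1}\langle x,\xi\rangle$, and $B_R^{H_0}(x_0):=\{x\in\mathbb{R}^N: H_0(x-x_0)<R\}$. $H$ is called uniformly elliptic if $B_1^H:=\{\xi: H(\xi)<1\}$ is uniformly convex (its boundary has all principal curvatures bounded below by a positive constant). $a(\xi):=\frac1N\nabla H^N(\xi)$, i.e. $a(\xi)=H^{N-1}(\xi)\nabla H(\xi)$ for $\xi\ne0$ and $a(0)=0$; $\Delta_N^H u:=\mathrm{div}(a(\nabla u))$ in the sense of distributions. $W^{1,N}_{loc}(\overline\Sigma\cap\Omega^c)$ consists of functions on $\Sigma\cap\overline\Omega^c$ whose restrictions to bounded parts of $\Sigma\cap\overline\Omega^c$, up to its boundary, belong to $W^{1,N}$. For a bounded open set $O$, $f\in W^{1,N}(O)$ and a relatively open $\Gamma\subset\partial O$, "$f=0$ on $\Gamma$" means that $f$ is the $W^{1,N}(O)$-limit of functions in $C^\infty(\overline O)$ vanishing in a neighborhood of $\overline\Gamma$ (on the unbounded set $\Sigma\cap\overline\Omega^c$ this is understood on its intersection with large balls). A weak solution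 of the mixed boundary value problem is a function $u\in W^{1,N}_{loc}(\overline\Sigma\cap\Omega^c)$ with $u=0$ on $\Gamma_0$ such that $\int_{\Sigma\cap\overline\Omega^c}\langle a(\nabla u),\nabla\varphi\rangle\,dx=0$ for all $\varphi\in W^{1,N}(\Sigma\cap\overline\Omega^c)$ with $\varphi=0$ on $\Gamma_0$ and with bounded support. The condition at infinity means: there are $d>1$ and $R_0>0$ such that the inequalities hold for all $x\in\Sigma$ with $H_0(x)\ge R_0$. Weak solutions here belong to $C^1((\Sigma\cap\overline\Omega^c)\cup\Gamma_0)$ by known regularity theory, so $H(\nabla u)=C$ on $\Gamma_0$ is meant pointwise. *)

theory Defs
  imports "HOL-Analysis.Analysis"
begin

section \<open>Classical differentiability\<close>

(* Meant for open S only; "at x" is the full (not one-sided) derivative. *)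
primrec Ck_on :: "nat \<Rightarrow> 'a::euclidean_space set \<Rightarrow> ('a \<Rightarrow> real) \<Rightarrow> bool" where
  "Ck_on 0 S f \<longleftrightarrow> continuous_on S f"
| "Ck_on (Suc k) S f \<longleftrightarrow> (\<forall>x\<in>S. f differentiable (at x)) \<and>
     (\<forall>b\<in>Basis. Ck_on k S (\<lambda>x. frechet_derivative f (at x) b))"

definition smooth_on :: "'a::euclidean_space set \<Rightarrow> ('a \<Rightarrow> real) \<Rightarrow> bool" where
  "smooth_on S f \<longleftrightarrow> (\<forall>k. Ck_on k S f)"

definition grad :: "('a::euclidean_space \<Rightarrow> real) \<Rightarrow> 'a \<Rightarrow> 'a" where
  "grad f x = (\<Sum>b\<in>Basis. frechet_derivative f (at x) b *\<^sub>R b)"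

(* S is open and G is a piece of its boundary: f and its gradient on S extend continuously to G. *)
definition C1_up_to_with ::
  "'a::euclidean_space set \<Rightarrow> 'a set \<Rightarrow> ('a \<Rightarrow> real) \<Rightarrow> ('a \<Rightarrow> 'a) \<Rightarrow> bool" where
  "C1_up_to_with S G f Df \<longleftrightarrow>
     continuous_on (S \<union> G) f \<and> continuous_on (S \<union> G) Df \<and> (\<forall>x\<in>S. GDERIV f x :> Df x)"


section \<open>The norm, its dual and uniform ellipticity\<close>

definition pos_homogeneous :: "('a::real_vector \<Rightarrow> real) \<Rightarrow> bool" where
  "pos_homogeneous H \<longleftrightarrow> (\<forall>t>0. \<forall>\<xi>. H (t *\<^sub>R \<xi>) = t * H \<xi>)"

definition dual_fun :: "('a::real_inner \<Rightarrow> real) \<Rightarrow> 'a \<Rightarrow> real" where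
  "dual_fun H x = (SUP \<xi>\<in>{\<xi>. H \<xi> = 1}. x \<bullet> \<xi>)"

definition dual_ball :: "('a::real_inner \<Rightarrow> real) \<Rightarrow> 'a \<Rightarrow> real \<Rightarrow> 'a set" where
  "dual_ball H x0 R = {x. dual_fun H (x - x0) < R}"

(* Outer unit normal of a regular level surface of F, extended to a neighbourhood of it. *)
definition level_normal :: "('a::euclidean_space \<Rightarrow> real) \<Rightarrow> 'a \<Rightarrow> 'a" where
  "level_normal F \<xi> = grad F \<xi> /\<^sub>R norm (grad F \<xi>)"

(* Eigenvalues of the Weingarten map, the derivative of the outer normal along tangent
   directions; with this sign the unit sphere has all principal curvatures equal to 1. *)
definition principal_curvature :: "('a::euclidean_space \<Rightarrow> real) \<Rightarrow> 'a \<Rightarrow> real \<Rightarrow> bool" where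
  "principal_curvature F \<xi> \<kappa> \<longleftrightarrow>
     (\<exists>v. v \<noteq> 0 \<and> grad F \<xi> \<bullet> v = 0 \<and>
          frechet_derivative (level_normal F) (at \<xi>) v = \<kappa> *\<^sub>R v)"

definition uniformly_elliptic :: "('a::euclidean_space \<Rightarrow> real) \<Rightarrow> bool" where
  "uniformly_elliptic H \<longleftrightarrow>
     (\<exists>c>0. \<forall>\<xi>\<in>frontier {\<eta>. H \<eta> < 1}. \<forall>\<kappa>. principal_curvature H \<xi> \<kappa> \<longrightarrow> c \<le> \<kappa>)"

definition flux :: "('a::euclidean_space \<Rightarrow> real) \<Rightarrow> 'a \<Rightarrow> 'a" where
  "flux H \<xi> = (1 / real DIM('a)) *\<^sub>R grad (\<lambda>\<eta>. H \<eta> ^ DIM('a)) \<xi>"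


section \<open>Cones\<close>

(* The type 'n carries no order, so the splitting of the N coordinates into k and N - k ones
   is given by an arbitrary index set K with k elements (K empty and K = UNIV included). *)
definition coord_subspace :: "'n::finite set \<Rightarrow> (real^'n) set" where
  "coord_subspace K = {x. \<forall>i. i \<notin> K \<longrightarrow> x $ i = 0}"

(* Open means relatively open in the subspace W. For W = {0} the only such cone is {0}. *)
definition open_convex_cone_without_lines :: "'a::euclidean_space set \<Rightarrow> 'a set \<Rightarrow> bool" where
  "open_convex_cone_without_lines W T \<longleftrightarrow>
     openin (top_of_set W) T \<and> T \<noteq> {} \<and> convex T \<and> (\<forall>x\<in>T. \<forall>t>0. t *\<^sub>R x \<in> T) \<and>
     \<not> (\<exists>p v. v \<noteq> 0 \<and> range (\<lambda>t::real. p + t *\<^sub>R v) \<subseteq> T)"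

definition product_cone :: "'n::finite set \<Rightarrow> (real^'n) set \<Rightarrow> (real^'n) set" where
  "product_cone K T = {y + z |y z. y \<in> coord_subspace K \<and> z \<in> T}"


section \<open>Sobolev functions\<close>

definition test_function :: "'a::euclidean_space set \<Rightarrow> ('a \<Rightarrow> real) \<Rightarrow> bool" where
  "test_function S \<phi> \<longleftrightarrow> smooth_on UNIV \<phi> \<and>
     compact (closure {x. \<phi> x \<noteq> 0}) \<and> closure {x. \<phi> x \<noteq> 0} \<subseteq> S"

definition has_weak_gradient ::
  "'a::euclidean_space set \<Rightarrow> ('a \<Rightarrow> real) \<Rightarrow> ('a \<Rightarrow> 'a) \<Rightarrow> bool" where
  "has_weak_gradient S f g \<longleftrightarrow>
     (\<forall>C. compact C \<and> C \<subseteq> S \<longrightarrow> f absolutely_integrable_on C \<and> g absolutely_integrable_on C) \<and>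
     (\<forall>\<phi>. test_function S \<phi> \<longrightarrow>
        (LINT x|lebesgue_on S. f x *\<^sub>R grad \<phi> x) = - (LINT x|lebesgue_on S. \<phi> x *\<^sub>R g x))"

definition Lp_on :: "nat \<Rightarrow> 'a::euclidean_space set \<Rightarrow> ('a \<Rightarrow> 'b::euclidean_space) \<Rightarrow> bool" where
  "Lp_on p S f \<longleftrightarrow> f \<in> borel_measurable (lebesgue_on S) \<and>
     integrable (lebesgue_on S) (\<lambda>x. norm (f x) ^ p)"

(* f belongs to the Sobolev space of order (1,p) on the open set S and g is its weak gradient. *)
definition W1p :: "nat \<Rightarrow> 'a::euclidean_space set \<Rightarrow> ('a \<Rightarrow> real) \<Rightarrow> ('a \<Rightarrow> 'a) \<Rightarrow> bool" where
  "W1p p S f g \<longleftrightarrow> Lp_on p S f \<and> Lp_on p S g \<and> has_weak_gradient S f g"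

definition W1p_norm :: "nat \<Rightarrow> 'a::euclidean_space set \<Rightarrow> ('a \<Rightarrow> real) \<Rightarrow> ('a \<Rightarrow> 'a) \<Rightarrow> real" where
  "W1p_norm p S f g =
     root p ((LINT x|lebesgue_on S. \<bar>f x\<bar> ^ p) + (LINT x|lebesgue_on S. norm (g x) ^ p))"

(* "f = 0 on G" for bounded open S. Functions smooth on the closure of S are taken to be the
   restrictions of smooth functions on the whole space. *)
definition vanishes_on ::
  "nat \<Rightarrow> 'a::euclidean_space set \<Rightarrow> 'a set \<Rightarrow> ('a \<Rightarrow> real) \<Rightarrow> bool" where
  "vanishes_on p S G f \<longleftrightarrow>
     (\<exists>g. W1p p S f g \<and>
        (\<exists>F::nat \<Rightarrow> 'a \<Rightarrow> real.
           (\<forall>n. smooth_on UNIV (F n) \<and>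
                (\<exists>U. open U \<and> closure G \<subseteq> U \<and> (\<forall>x\<in>U \<inter> closure S. F n x = 0))) \<and>
           (\<lambda>n. W1p_norm p S (\<lambda>x. F n x - f x) (\<lambda>x. grad (F n) x - g x)) \<longlonglongrightarrow> 0))"

(* Version for unbounded S and bounded G. *)
definition vanishes_on_loc ::
  "nat \<Rightarrow> 'a::euclidean_space set \<Rightarrow> 'a set \<Rightarrow> ('a \<Rightarrow> real) \<Rightarrow> bool" where
  "vanishes_on_loc p S G f \<longleftrightarrow> (\<forall>\<^sub>F r in at_top. vanishes_on p (S \<inter> ball 0 r) G f)"


section \<open>The exterior mixed boundary value problem\<close>

abbreviation ext_dom :: "'a::euclidean_space set \<Rightarrow> 'a set \<Rightarrow> 'a set" where
  "ext_dom \<Sigma> \<Omega> \<equiv> \<Sigma> \<inter> - closure \<Omega>"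

abbreviation Gamma0 :: "'a::euclidean_space set \<Rightarrow> 'a set \<Rightarrow> 'a set" where
  "Gamma0 \<Sigma> \<Omega> \<equiv> \<Sigma> \<inter> frontier \<Omega>"

(* The Neumann condition on the remaining boundary part is encoded by the test functions
   being free there. *)
definition weak_solution ::
  "('a::euclidean_space \<Rightarrow> real) \<Rightarrow> 'a set \<Rightarrow> 'a set \<Rightarrow> ('a \<Rightarrow> real) \<Rightarrow> bool" where
  "weak_solution H \<Sigma> \<Omega> u \<longleftrightarrow>
     (\<exists>g. (\<forall>r>0. W1p DIM('a) (ext_dom \<Sigma> \<Omega> \<inter> ball 0 r) u g) \<and>
        vanishes_on_loc DIM('a) (ext_dom \<Sigma> \<Omega>) (Gamma0 \<Sigma> \<Omega>) u \<and>
        (\<forall>\<phi> \<psi>. W1p DIM('a) (ext_dom \<Sigma> \<Omega>) \<phi> \<psi> \<and>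
           vanishes_on_loc DIM('a) (ext_dom \<Sigma> \<Omega>) (Gamma0 \<Sigma> \<Omega>) \<phi> \<and>
           (\<exists>r. AE x in lebesgue_on (ext_dom \<Sigma> \<Omega>). r \<le> norm x \<longrightarrow> \<phi> x = 0) \<longrightarrow>
           (LINT x|lebesgue_on (ext_dom \<Sigma> \<Omega>). flux H (g x) \<bullet> \<psi> x) = 0))"

definition log_growth ::
  "('a::euclidean_space \<Rightarrow> real) \<Rightarrow> 'a set \<Rightarrow> ('a \<Rightarrow> real) \<Rightarrow> bool" where
  "log_growth H \<Sigma> u \<longleftrightarrow>
     (\<exists>d>1. \<exists>R0>0. \<forall>x\<in>\<Sigma>. R0 \<le> dual_fun H x \<longrightarrow>
        1 / d \<le> u x / ln (dual_fun H x) \<and> u x / ln (dual_fun H x) \<le> d)"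

(* The last condition is pointwise, so a solution is represented by its (unique) version that is
   C^1 up to Gamma0; values outside ext_dom \<union> Gamma0 are irrelevant. *)
definition overdetermined_solution ::
  "('a::euclidean_space \<Rightarrow> real) \<Rightarrow> 'a set \<Rightarrow> 'a set \<Rightarrow> real \<Rightarrow> ('a \<Rightarrow> real) \<Rightarrow> bool" where
  "overdetermined_solution H \<Sigma> \<Omega> C u \<longleftrightarrow>
     weak_solution H \<Sigma> \<Omega> u \<and> log_growth H \<Sigma> u \<and>
     (\<exists>Du. C1_up_to_with (ext_dom \<Sigma> \<Omega>) (Gamma0 \<Sigma> \<Omega>) u Du \<and>
           (\<forall>x\<in>Gamma0 \<Sigma> \<Omega>. H (Du x) = C))"

end

theory Submission imports Defs begin

text \<open>
  \<^emph>\<open>The explicit solution.\<close> Let \<open>a \<xi> = H \<xi> ^ (N - 1) * grad H \<xi>\<close>. Uniform ellipticity makes the duality map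
  \<open>H * grad H\<close> a \<open>C\<^sup>1\<close> diffeomorphism away from the origin, and \<open>H0\<close> is \<open>H\<close> composed with its inverse. Hence
  \<open>H0\<close> is \<open>C\<^sup>2\<close>, the gradient of \<open>u\<close> satisfies \<open>H (grad u) = C R / H0 (x - x0)\<close>, and \<open>a (grad u)\<close> is a constant
  multiple of the radial field \<open>(x - x0) / H0 (x - x0) ^ N\<close>. That this field is divergence free and tangential
  to the boundary of the cone is, in weak form, the dilation invariance of \<open>dx / H0 (x - x0) ^ N\<close> on the
  cone with vertex \<open>x0\<close> (\<open>integral_radial_derivative\<close>); no regularity of the boundary is needed.

  \<^emph>\<open>Uniqueness.\<close> Let \<open>v\<close> be another solution. Its flux through large spheres does not depend on the radius, is
  nonnegative because \<open>v\<close> tends to infinity (\<open>Flux_nonneg\<close>), and so equals the flux of \<open>\<mu> u\<close> for some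
  \<open>\<mu> \<ge> 0\<close>. Put \<open>f = v - \<mu> u\<close> and let \<open>b\<close> be the difference of \<open>a (grad v)\<close> and \<open>a (grad (\<mu> u))\<close>. Testing both
  equations with \<open>f\<close> times a cutoff at scale \<open>r\<close> bounds \<open>\<integral> b \<bullet> grad f\<close> by
  \<open>\<integral> \<bar>b\<bar> \<bar>f - c\<bar> / r\<close> over a ring of radius \<open>r\<close>, with any constant \<open>c\<close> because the fluxes agree. A Poincare
  inequality on conical rings with a constant independent of the scale (\<open>ring_poincare\<close>) turns this into the
  energy of the ring. Logarithmic growth implies that the energy inside radius \<open>r\<close> is \<open>O (ln r)\<close>
  (\<open>energy_linear\<close>), so infinitely many rings of a geometric sequence have bounded energy; along them the bound first shows
  that \<open>\<integral> b \<bullet> grad f\<close> converges and then, by strict monotonicity of \<open>a\<close>, that it vanishes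
  (\<open>solutions_proportional\<close>). Thus \<open>grad v = \<mu> grad u\<close>. As \<open>f\<close> vanishes on \<open>\<Gamma>\<close>, the dilation identity applied to
  approximations of \<open>f\<close> gives \<open>f = 0\<close> (\<open>zero_gradient_zero\<close>), and \<open>H (grad v) = C\<close> on \<open>\<Gamma>\<close> forces \<open>\<mu> = 1\<close>.
\<close>

section \<open>Gradients and the classes of continuously differentiable functions\<close>

lemma grad_works:
 assumes "f differentiable (at x)"
 shows "GDERIV f x :> grad f x"
proof -
 have d: "(f has_derivative frechet_derivative f (at x)) (at x)"
  using assms frechet_derivative_works by blast
 have "frechet_derivative f (at x) h = h \<bullet> grad f x" for h
 proof -
  have "linear (frechet_derivative f (at x))"
   using d has_derivative_linear by blast
  then have "frechet_derivative f (at x) (\<Sum>b\<in>Basis. (h \<bullet> b) *\<^sub>R b)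
    = (\<Sum>b\<in>Basis. (h \<bullet> b) * frechet_derivative f (at x) b)"
   by (simp add: linear_sum linear_scale)
  then show ?thesis
   unfolding euclidean_representation
   by (simp add: grad_def inner_sum_right mult.commute)
 qed
 then show ?thesis
  using d unfolding gderiv_def by presburger
qed

lemma GDERIV_frechet:
 assumes "GDERIV f x :> D"
 shows "frechet_derivative f (at x) h = h \<bullet> D" "f differentiable (at x)"
 using assms unfolding gderiv_def
 by (auto simp: frechet_derivative_at[symmetric] differentiable_def)

lemma GDERIV_grad: "GDERIV f x :> D ==> grad f x = D"
 by (simp add: grad_def GDERIV_frechet euclidean_representation inner_commute[of _ D])

lemma GDERIV_unique: fixes x :: "'a::euclidean_space" shows "GDERIV f x :> D ==> GDERIV f x :> E ==> D = E"
 using GDERIV_grad[of f x D] GDERIV_grad[of f x E] by simp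

lemma GDERIV_transform:
 assumes "GDERIV f x :> D" "open S" "x \<in> S" "\<And>y. y \<in> S ==> f y = g y"
 shows "GDERIV g x :> D"
 using assms unfolding gderiv_def by (rule has_derivative_transform_within_open)

lemma GDERIV_isCont: "GDERIV f x :> D ==> isCont f x"
 unfolding gderiv_def by (rule has_derivative_continuous)

lemma GDERIV_continuous_on: "(\<And>x. x \<in> S ==> GDERIV f x :> D x) ==> continuous_on S f"
 using GDERIV_isCont continuous_at_imp_continuous_on by blast

lemma GDERIV_cmult: "GDERIV f x :> D ==> GDERIV (\<lambda>x. c * f x) x :> c *\<^sub>R D"
 using GDERIV_mult[OF GDERIV_const[of c x]] by fastforce

lemma GDERIV_sum:
 assumes "\<And>i. i \<in> I ==> GDERIV (f i) x :> D i"
 shows "GDERIV (\<lambda>x. \<Sum>i\<in>I. f i x) x :> (\<Sum>i\<in>I. D i)"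
 using assms
proof (induction I rule: infinite_finite_induct)
 case (insert i I)
 then show ?case by (simp add: GDERIV_add)
qed (auto simp: GDERIV_const)

lemma GDERIV_power: "GDERIV f x :> D ==> GDERIV (\<lambda>x. f x ^ n) x :> (of_nat n * f x ^ (n - 1)) *\<^sub>R D"
 by (rule GDERIV_DERIV_compose) (auto intro!: derivative_eq_intros)

lemma GDERIV_affine:
 assumes "GDERIV f (c + a *\<^sub>R x) :> D"
 shows "GDERIV (\<lambda>x. f (c + a *\<^sub>R x)) x :> a *\<^sub>R D"
proof -
 have "((\<lambda>x. f (c + a *\<^sub>R x)) has_derivative (\<lambda>h. (a *\<^sub>R h) \<bullet> D)) (at x)"
  by (rule has_derivative_compose[of "\<lambda>x. c + a *\<^sub>R x" "\<lambda>h. a *\<^sub>R h" x UNIV f])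
    (use assms in \<open>auto simp: gderiv_def intro!: derivative_eq_intros\<close>)
 then show ?thesis by (simp add: gderiv_def)
qed

text \<open>Restriction to a line; the standard way to turn a bound on the gradient into one on increments.\<close>
lemma GDERIV_along_line:
 assumes "GDERIV f (x + t *\<^sub>R d) :> D"
 shows "((\<lambda>t. f (x + t *\<^sub>R d)) has_real_derivative (d \<bullet> D)) (at t)"
proof -
 have "((\<lambda>t. f (x + t *\<^sub>R d)) has_derivative (\<lambda>h. (h *\<^sub>R d) \<bullet> D)) (at t)"
  by (rule has_derivative_compose[of "\<lambda>t. x + t *\<^sub>R d" "\<lambda>h. h *\<^sub>R d" t UNIV f])
    (use assms in \<open>auto simp: gderiv_def intro!: derivative_eq_intros\<close>)
 moreover have "(\<lambda>h. (h *\<^sub>R d) \<bullet> D) = (*) (d \<bullet> D)" by (auto simp: mult.commute)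
 ultimately show ?thesis by (simp only: has_field_derivative_def)
qed

lemma GDERIV_lipschitz:
 fixes f :: "'a::euclidean_space => real"
 assumes "convex S" "\<And>x. x \<in> S ==> GDERIV f x :> D x" "\<And>x. x \<in> S ==> norm (D x) \<le> B"
  and "x \<in> S" "y \<in> S"
 shows "\<bar>f y - f x\<bar> \<le> B * norm (y - x)"
proof -
 have "norm (f y - f x) \<le> B * norm (y - x)"
 proof (rule differentiable_bound[OF assms(1) _ _ assms(5,4), of f "\<lambda>x h. h \<bullet> D x"])
  show "(f has_derivative (\<lambda>h. h \<bullet> D z)) (at z within S)" if "z \<in> S" for z
   using assms(2)[OF that] unfolding gderiv_def by (rule has_derivative_at_withinI)
  show "onorm (\<lambda>h. h \<bullet> D z) \<le> B" if "z \<in> S" for z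
  proof (rule onorm_le)
   show "norm (h \<bullet> D z) \<le> B * norm h" for h
    using Cauchy_Schwarz_ineq2[of h "D z"] mult_right_mono[OF assms(3)[OF that] norm_ge_zero[of h]]
    by (simp add: mult.commute)
  qed
 qed
 then show ?thesis by simp
qed

lemma Ck_on_cong:
 assumes "open S" "\<And>x. x \<in> S ==> f x = g x"
 shows "Ck_on k S f \<longleftrightarrow> Ck_on k S g"
 using assms(2)
proof (induction k arbitrary: f g)
 case 0
 then show ?case by (simp cong: continuous_on_cong)
next
 case (Suc k)
 have 1: "f differentiable (at x) \<longleftrightarrow> g differentiable (at x)" if "x \<in> S" for x
  using Suc.prems that assms(1) has_derivative_transform_within_open[of f _ x UNIV S g]
   has_derivative_transform_within_open[of g _ x UNIV S f]
  unfolding differentiable_def by metis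
 have "Ck_on k S (\<lambda>x. frechet_derivative f (at x) b) \<longleftrightarrow> Ck_on k S (\<lambda>x. frechet_derivative g (at x) b)"
  if "\<forall>x\<in>S. f differentiable (at x)" for b
  using that Suc.prems assms(1)
  by (intro Suc.IH) (metis frechet_derivative_transform_within_open)
 then show ?case using 1 by auto
qed

lemma Ck_on_Suc_iff:
 assumes "open S" "\<And>x. x \<in> S ==> GDERIV f x :> D x"
 shows "Ck_on (Suc k) S f \<longleftrightarrow> (\<forall>b\<in>Basis. Ck_on k S (\<lambda>x. b \<bullet> D x))"
proof -
 have "Ck_on k S (\<lambda>x. frechet_derivative f (at x) b) \<longleftrightarrow> Ck_on k S (\<lambda>x. b \<bullet> D x)" for b
  by (rule Ck_on_cong[OF assms(1)]) (use GDERIV_frechet assms in blast)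
 then show ?thesis using GDERIV_frechet(2)[OF assms(2)] by auto
qed

lemma Ck_on_Suc_GDERIV: "Ck_on (Suc k) S f ==> x \<in> S ==> GDERIV f x :> grad f x"
 by (auto intro: grad_works)

lemma Ck_on_Suc_grad:
 assumes "open S"
 shows "Ck_on (Suc k) S f \<longleftrightarrow> (\<forall>x\<in>S. GDERIV f x :> grad f x) \<and> (\<forall>b\<in>Basis. Ck_on k S (\<lambda>x. b \<bullet> grad f x))"
 using Ck_on_Suc_iff[OF assms, of f "grad f" k] Ck_on_Suc_GDERIV[of k S f] by blast

lemma Ck_on_Suc_imp:
 assumes "open S" "Ck_on (Suc k) S f"
 shows "Ck_on k S f"
 using assms(2)
proof (induction k arbitrary: f)
 case 0
 then show ?case using GDERIV_continuous_on Ck_on_Suc_GDERIV by (metis Ck_on.simps(1))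
next
 case (Suc k)
 show ?case using Suc.prems Suc.IH unfolding Ck_on_Suc_grad[OF assms(1), of "Suc k"] Ck_on_Suc_grad[OF assms(1), of k]
  by blast
qed

lemma Ck_on_const: "open S ==> Ck_on k S (\<lambda>x. c)"
proof (induction k arbitrary: c)
 case (Suc k)
 then show ?case
  by (subst Ck_on_Suc_iff[OF \<open>open S\<close> GDERIV_const]) auto
qed auto

lemma Ck_on_inner: "open S ==> Ck_on k S (\<lambda>x. b \<bullet> x)"
proof (cases k)
 case (Suc j)
 assume "open S"
 have "GDERIV (\<lambda>x. b \<bullet> x) x :> b" for x
  unfolding gderiv_def by (auto intro!: derivative_eq_intros simp: inner_commute)
 then show ?thesis unfolding Suc
  by (subst Ck_on_Suc_iff[OF \<open>open S\<close>]) (auto intro: Ck_on_const[OF \<open>open S\<close>])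
qed (auto intro!: continuous_intros)

lemma Ck_on_add:
 assumes "open S" "Ck_on k S f" "Ck_on k S g"
 shows "Ck_on k S (\<lambda>x. f x + g x)"
 using assms(2,3)
proof (induction k arbitrary: f g)
 case (Suc k)
 note D = Ck_on_Suc_grad[OF assms(1), of k]
 have d: "GDERIV (\<lambda>x. f x + g x) x :> grad f x + grad g x" if "x \<in> S" for x
  using Suc.prems that unfolding D by (blast intro: GDERIV_add)
 show ?case
  by (subst Ck_on_Suc_iff[OF assms(1) d])
    (use Suc.IH Suc.prems[unfolded D] in \<open>auto simp: inner_add_right\<close>)
qed (auto intro: continuous_on_add)

lemma Ck_on_mult:
 assumes "open S" "Ck_on k S f" "Ck_on k S g"
 shows "Ck_on k S (\<lambda>x. f x * g x)"
 using assms(2,3)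
proof (induction k arbitrary: f g)
 case (Suc k)
 note D = Ck_on_Suc_grad[OF assms(1), of k]
 have 1: "Ck_on k S f" "Ck_on k S g" using Suc.prems Ck_on_Suc_imp[OF assms(1)] by blast+
 have d: "GDERIV (\<lambda>x. f x * g x) x :> f x *\<^sub>R grad g x + g x *\<^sub>R grad f x" if "x \<in> S" for x
  using Suc.prems that unfolding D by (blast intro: GDERIV_mult)
 show ?case
  by (subst Ck_on_Suc_iff[OF assms(1) d])
    (use 1 Suc.IH Suc.prems[unfolded D] in \<open>auto simp: inner_add_right intro!: Ck_on_add[OF assms(1)]\<close>)
qed (auto intro: continuous_on_mult)

lemma Ck_on_sum:
 assumes "open S" "\<And>i. i \<in> I ==> Ck_on k S (f i)"
 shows "Ck_on k S (\<lambda>x. \<Sum>i\<in>I. f i x)"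
 using assms(2)
 by (induction I rule: infinite_finite_induct) (auto intro: Ck_on_add Ck_on_const assms(1))

lemma Ck_on_compose:
 fixes g :: "real => real"
 assumes "open S" "Ck_on k UNIV g" "Ck_on k S f"
 shows "Ck_on k S (\<lambda>x. g (f x))"
 using assms(2,3)
proof (induction k arbitrary: f g)
 case 0
 then show ?case by (auto intro: continuous_on_compose2)
next
 case (Suc k)
 note D = Ck_on_Suc_grad[OF assms(1), of k]
 have 1: "Ck_on k S f" using Suc.prems Ck_on_Suc_imp[OF assms(1)] by blast
 have g: "GDERIV g x :> grad g x" "Ck_on k UNIV (grad g)" for x
  using Suc.prems(1) Ck_on_Suc_grad[OF open_UNIV, of k g] by auto
 have d: "GDERIV (\<lambda>x. g (f x)) x :> grad g (f x) *\<^sub>R grad f x" if "x \<in> S" for x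
  using Suc.prems(2) that g(1) unfolding D gderiv_deriv by (blast intro: GDERIV_DERIV_compose)
 show ?case
  by (subst Ck_on_Suc_iff[OF assms(1) d])
    (use 1 g(2) Suc.IH Suc.prems(2)[unfolded D] in \<open>auto intro!: Ck_on_mult[OF assms(1)]\<close>)
qed

lemma Ck_on_affine:
 assumes "Ck_on k UNIV f"
 shows "Ck_on k UNIV (\<lambda>x. f (c + a *\<^sub>R x))"
 using assms
proof (induction k arbitrary: f)
 case 0
 then show ?case by (auto intro!: continuous_on_compose2[of UNIV f] continuous_intros)
next
 case (Suc k)
 note D = Ck_on_Suc_grad[OF open_UNIV, of k]
 have d: "GDERIV (\<lambda>x. f (c + a *\<^sub>R x)) x :> a *\<^sub>R grad f (c + a *\<^sub>R x)" for x
  using Suc.prems unfolding D by (blast intro: GDERIV_affine)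
 have i: "Ck_on k UNIV (\<lambda>x. b \<bullet> grad f (c + a *\<^sub>R x))" if "b \<in> Basis" for b
  using Suc.IH[of "\<lambda>x. b \<bullet> grad f x"] Suc.prems[unfolded D] that by blast
 show ?case
  by (subst Ck_on_Suc_iff[OF open_UNIV d])
    (use i in \<open>auto intro!: Ck_on_mult Ck_on_const\<close>)
qed

lemma smooth_on_const: "smooth_on UNIV (\<lambda>x. c)"
 by (simp add: smooth_on_def Ck_on_const)

lemma smooth_on_add: "smooth_on UNIV f ==> smooth_on UNIV g ==> smooth_on UNIV (\<lambda>x. f x + g x)"
 by (simp add: smooth_on_def Ck_on_add)

lemma smooth_on_mult: "smooth_on UNIV f ==> smooth_on UNIV g ==> smooth_on UNIV (\<lambda>x. f x * g x)"
 by (simp add: smooth_on_def Ck_on_mult)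

lemma smooth_on_cmult: "smooth_on UNIV f ==> smooth_on UNIV (\<lambda>x. c * f x)"
 by (simp add: smooth_on_mult smooth_on_const)

lemma smooth_on_diff: "smooth_on UNIV f ==> smooth_on UNIV g ==> smooth_on UNIV (\<lambda>x. f x - g x)"
 using smooth_on_add[of f "\<lambda>x. (-1) * g x"] smooth_on_cmult[of g "-1"] by simp

lemma smooth_on_sum: "(\<And>i. i \<in> I ==> smooth_on UNIV (f i)) ==> smooth_on UNIV (\<lambda>x. \<Sum>i\<in>I. f i x)"
 by (simp add: smooth_on_def Ck_on_sum)

lemma smooth_on_power: "smooth_on UNIV f ==> smooth_on UNIV (\<lambda>x. f x ^ n)"
 by (induction n) (auto intro: smooth_on_const smooth_on_mult)

lemma smooth_on_affine: "smooth_on UNIV f ==> smooth_on UNIV (\<lambda>x. f (c + a *\<^sub>R x))"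
 by (simp add: smooth_on_def Ck_on_affine)

lemma smooth_on_GDERIV: "smooth_on UNIV f ==> GDERIV f x :> grad f x"
 unfolding smooth_on_def using Ck_on_Suc_GDERIV[of 0 UNIV f x] by (metis UNIV_I)

lemma smooth_on_partial: "smooth_on UNIV f ==> b \<in> Basis ==> smooth_on UNIV (\<lambda>x. b \<bullet> grad f x)"
 using Ck_on_Suc_grad[OF open_UNIV, of _ f] unfolding smooth_on_def by blast

lemma smooth_on_continuous: "smooth_on UNIV f ==> continuous_on S f"
 by (metis Ck_on.simps(1) continuous_on_subset smooth_on_def subset_UNIV)

lemma continuous_on_vector_Basis:
 fixes g :: "'b::topological_space => 'a::euclidean_space"
 assumes "\<And>b. b \<in> Basis ==> continuous_on S (\<lambda>x. b \<bullet> g x)"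
 shows "continuous_on S g"
proof -
 have "continuous_on S (\<lambda>x. \<Sum>b\<in>Basis. (b \<bullet> g x) *\<^sub>R b)"
  by (rule continuous_on_sum, rule continuous_on_scaleR) (use assms in auto)
 moreover have "(\<Sum>b\<in>Basis. (b \<bullet> g x) *\<^sub>R b) = g x" for x
  by (simp add: inner_commute[of _ "g x"] euclidean_representation)
 ultimately show ?thesis by simp
qed

lemma Ck_on_grad_continuous: "open S ==> Ck_on (Suc 0) S f ==> continuous_on S (grad f)"
 unfolding Ck_on_Suc_grad by (auto intro: continuous_on_vector_Basis)

lemma smooth_on_grad_continuous: "smooth_on UNIV f ==> continuous_on S (grad f)"
 using Ck_on_grad_continuous[OF open_UNIV, of f] continuous_on_subset[of UNIV "grad f" S]
 unfolding smooth_on_def by blast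


section \<open>Smooth bump functions and mollification\<close>

text \<open>The functions \<open>t\<^sup>-\<^sup>m exp (-1/t)\<close>, extended by zero to the left half-line, are closed
 under differentiation up to linear combinations; hence all of them are smooth.\<close>
definition flat :: "nat => real => real" where
 "flat m t = (if t > 0 then exp (- (1 / t)) / t ^ m else 0)"

lemma flat_tendsto_0: "(flat m \<longlongrightarrow> 0) (at 0)"
proof -
 have "((\<lambda>s::real. s ^ m / exp s) \<longlongrightarrow> 0) at_top" for m :: nat
  by (rule tendsto_power_div_exp_0)
 then have "((\<lambda>t::real. (1/t) ^ m / exp (1/t)) \<longlongrightarrow> 0) (at_right 0)"
  using filterlim_compose filterlim_inverse_at_top_right by (fastforce simp: inverse_eq_divide)
 then have "(flat m \<longlongrightarrow> 0) (at_right 0)"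
 proof (rule tendsto_cong[THEN iffD1, rotated])
  show "\<forall>\<^sub>F t in at_right 0. (1/t) ^ m / exp (1/t) = flat m t"
   unfolding eventually_at_right_field
   by (rule exI[of _ 1]) (auto simp: flat_def exp_minus divide_simps)
 qed
 moreover have "(flat m \<longlongrightarrow> 0) (at_left 0)"
  by (rule tendsto_eventually) (auto simp: flat_def eventually_at_left_field intro: exI[of _ "-1"])
 ultimately show ?thesis by (simp add: filterlim_split_at)
qed

lemma flat_DERIV: "(flat m has_real_derivative (flat (m + 2) t - m * flat (m + 1) t)) (at t)"
proof (cases t "0::real" rule: linorder_cases)
 case less
 have "((\<lambda>t. 0::real) has_real_derivative 0) (at t)" by simp
 then have "(flat m has_real_derivative 0) (at t)"
  by (rule DERIV_cong_ev[THEN iffD1, rotated -1, OF _ refl _ refl])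
    (use less in \<open>auto simp: flat_def eventually_nhds intro!: exI[of _ "{..<0}"]\<close>)
 then show ?thesis using less by (simp add: flat_def)
next
 case equal
 have "((\<lambda>h. (flat m (0 + h) - flat m 0) / h) \<longlongrightarrow> 0) (at 0)"
 proof (rule tendsto_cong[THEN iffD1, OF _ flat_tendsto_0[of "m + 1"]])
  show "\<forall>\<^sub>F h in at 0. flat (m + 1) h = (flat m (0 + h) - flat m 0) / h"
   by (rule always_eventually) (auto simp: flat_def)
 qed
 then have "(flat m has_real_derivative 0) (at 0)" unfolding DERIV_def .
 then show ?thesis using equal by (simp add: flat_def)
next
 case greater
 have "((\<lambda>t. exp (- (1 / t)) / t ^ m) has_real_derivative (flat (m + 2) t - m * flat (m + 1) t)) (at t)"
  using greater
  by (auto intro!: derivative_eq_intros simp: flat_def)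
    (cases m; simp add: field_simps power2_eq_square)
 then show ?thesis
  by (rule DERIV_cong_ev[THEN iffD1, rotated -1, OF _ refl _ refl])
    (use greater in \<open>auto simp: flat_def eventually_nhds intro!: exI[of _ "{0<..}"]\<close>)
qed

lemma flat_smooth: "smooth_on UNIV (flat m)"
proof -
 have "Ck_on k UNIV (flat m)" for k
 proof (induction k arbitrary: m)
  case 0
  then show ?case
   using DERIV_isCont[OF flat_DERIV] by (auto simp: continuous_on_eq_continuous_at)
 next
  case (Suc k)
  have d: "GDERIV (flat m) x :> (flat (m + 2) x + (- real m) * flat (m + 1) x)" for x
   using flat_DERIV[of m x] by (simp only: gderiv_deriv) simp
  have "Ck_on k UNIV (\<lambda>x. flat (m + 2) x + (- real m) * flat (m + 1) x)"
   by (intro Ck_on_add Ck_on_mult Ck_on_const Suc open_UNIV)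
  then show ?case by (subst Ck_on_Suc_iff[OF open_UNIV d]) simp
 qed
 then show ?thesis by (simp add: smooth_on_def)
qed

definition bump :: "'a::euclidean_space => real" where
 "bump x = flat 0 (1 - x \<bullet> x)"

lemma bump_smooth: "smooth_on UNIV bump"
proof -
 have i: "smooth_on UNIV (\<lambda>x::'a. b \<bullet> x)" for b
  unfolding smooth_on_def by (blast intro: Ck_on_inner)
 have eq: "x \<bullet> x = (\<Sum>b\<in>Basis. (b \<bullet> x) * (b \<bullet> x))" for x :: 'a
  by (subst euclidean_inner) (simp add: inner_commute)
 have "smooth_on UNIV (\<lambda>x::'a. \<Sum>b\<in>Basis. (b \<bullet> x) * (b \<bullet> x))"
  by (rule smooth_on_sum) (rule smooth_on_mult[OF i i])
 from smooth_on_diff[OF smooth_on_const this]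
 have "smooth_on UNIV (\<lambda>x::'a. 1 - x \<bullet> x)"
  by (simp only: eq[symmetric])
 then show ?thesis
  using Ck_on_compose[OF open_UNIV, of _ "flat 0" "\<lambda>x. 1 - x \<bullet> x"] flat_smooth[of 0]
  unfolding bump_def[abs_def] smooth_on_def by blast
qed

lemma bump_pos_iff: "bump x > 0 \<longleftrightarrow> norm x < 1"
 and bump_nonneg: "bump x \<ge> 0"
 and bump_uminus: "bump (- x) = bump x"
 by (auto simp: bump_def flat_def dot_square_norm power2_eq_square abs_square_less_1 power_less_one_iff[symmetric] simp flip: power2_eq_square)

lemma bump_eq_0_iff: "bump x = 0 \<longleftrightarrow> norm x \<ge> 1"
 using bump_pos_iff[of x] bump_nonneg[of x] by linarith

lemma lebesgue_affine_vec:
 fixes t :: "'a::euclidean_space"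
 assumes "c \<noteq> 0"
 shows "lebesgue = density (distr lebesgue lebesgue (\<lambda>x. t + c *\<^sub>R x)) (\<lambda>_. \<bar>c\<bar> ^ DIM('a))"
  and "(\<lambda>x. t + c *\<^sub>R x) \<in> lebesgue \<rightarrow>\<^sub>M lebesgue"
proof -
 have eq: "(\<lambda>x. t + (\<Sum>j\<in>Basis. (c * (x \<bullet> j)) *\<^sub>R j)) = (\<lambda>x. t + c *\<^sub>R x)"
  by (simp flip: scaleR_scaleR scaleR_sum_right add: euclidean_representation)
 show "lebesgue = density (distr lebesgue lebesgue (\<lambda>x. t + c *\<^sub>R x)) (\<lambda>_. \<bar>c\<bar> ^ DIM('a))"
  using lebesgue_affine_euclidean[of "\<lambda>_. c" t] assms unfolding eq by (simp add: prod_constant)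
 show "(\<lambda>x. t + c *\<^sub>R x) \<in> lebesgue \<rightarrow>\<^sub>M lebesgue"
  using lebesgue_affine_measurable[of "\<lambda>_. c" t] assms unfolding eq by simp
qed

lemma nn_integral_lebesgue_affine:
 fixes t :: "'a::euclidean_space"
 assumes c: "c \<noteq> 0" and f: "f \<in> borel_measurable lebesgue"
 shows "(\<integral>\<^sup>+x. f x \<partial>lebesgue) = ennreal (\<bar>c\<bar> ^ DIM('a)) * (\<integral>\<^sup>+x. f (t + c *\<^sub>R x) \<partial>lebesgue)"
proof -
 note [measurable] = f lebesgue_affine_vec(2)[OF c, of t]
 have "(\<integral>\<^sup>+x. f x \<partial>lebesgue)
   = (\<integral>\<^sup>+x. f x \<partial>density (distr lebesgue lebesgue (\<lambda>x. t + c *\<^sub>R x)) (\<lambda>_. ennreal (\<bar>c\<bar> ^ DIM('a))))"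
  using lebesgue_affine_vec(1)[OF c, of t] by simp
 also have "\<dots> = (\<integral>\<^sup>+x. ennreal (\<bar>c\<bar> ^ DIM('a)) * f x \<partial>distr lebesgue lebesgue (\<lambda>x. t + c *\<^sub>R x))"
  by (rule nn_integral_density) auto
 also have "\<dots> = (\<integral>\<^sup>+x. ennreal (\<bar>c\<bar> ^ DIM('a)) * f (t + c *\<^sub>R x) \<partial>lebesgue)"
  by (rule nn_integral_distr) auto
 also have "\<dots> = ennreal (\<bar>c\<bar> ^ DIM('a)) * (\<integral>\<^sup>+x. f (t + c *\<^sub>R x) \<partial>lebesgue)"
  by (rule nn_integral_cmult) auto
 finally show ?thesis .
qed

lemma integrable_lebesgue_affine:
 fixes t :: "'a::euclidean_space" and f :: "'a => 'b::{banach, second_countable_topology}"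
 assumes c: "c \<noteq> 0" and f: "integrable lebesgue f"
 shows "integrable lebesgue (\<lambda>x. f (t + c *\<^sub>R x))"
proof -
 have f': "f \<in> borel_measurable lebesgue" using f by auto
 note [measurable] = f' lebesgue_affine_vec(2)[OF c, of t]
 have "(\<integral>\<^sup>+x. norm (f x) \<partial>lebesgue) = ennreal (\<bar>c\<bar> ^ DIM('a)) * (\<integral>\<^sup>+x. norm (f (t + c *\<^sub>R x)) \<partial>lebesgue)"
  by (rule nn_integral_lebesgue_affine[OF c]) auto
 moreover have "(\<integral>\<^sup>+x. norm (f x) \<partial>lebesgue) < \<infinity>"
  using f by (simp add: integrable_iff_bounded)
 ultimately show ?thesis
  using c by (auto simp: integrable_iff_bounded ennreal_mult_less_top)
qed

lemma integral_lebesgue_affine: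
 fixes t :: "'a::euclidean_space" and f :: "'a => 'b::{banach, second_countable_topology}"
 assumes c: "c \<noteq> 0" and f: "integrable lebesgue f"
 shows "(LINT x|lebesgue. f x) = \<bar>c\<bar> ^ DIM('a) *\<^sub>R (LINT x|lebesgue. f (t + c *\<^sub>R x))"
proof -
 have f': "f \<in> borel_measurable lebesgue" using f by auto
 note [measurable] = f' lebesgue_affine_vec(2)[OF c, of t]
 have "(LINT x|lebesgue. f x)
   = (LINT x|density (distr lebesgue lebesgue (\<lambda>x. t + c *\<^sub>R x)) (\<lambda>_. ennreal (\<bar>c\<bar> ^ DIM('a))). f x)"
  using lebesgue_affine_vec(1)[OF c, of t] by simp
 also have "\<dots> = (LINT x|distr lebesgue lebesgue (\<lambda>x. t + c *\<^sub>R x). \<bar>c\<bar> ^ DIM('a) *\<^sub>R f x)"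
  by (rule integral_density) auto
 also have "\<dots> = (LINT x|lebesgue. \<bar>c\<bar> ^ DIM('a) *\<^sub>R f (t + c *\<^sub>R x))"
  by (rule integral_distr) auto
 finally show ?thesis by simp
qed

text \<open>Boxes are used as domains of integration for compactly supported functions, since the
 library offers differentiation under the integral sign on boxes.\<close>
abbreviation cube :: "real => 'a::euclidean_space set" where
 "cube r \<equiv> cbox (- r *\<^sub>R One) (r *\<^sub>R One)"

lemma cball_subset_cube: "cball 0 r \<subseteq> cube r"
proof
 fix x :: 'a assume "x \<in> cball 0 r"
 then have "\<bar>x \<bullet> b\<bar> \<le> r" if "b \<in> Basis" for b
  using Basis_le_norm[OF that, of x] by simp
 then show "x \<in> cube r" by (auto simp: mem_box abs_le_iff) (metis minus_le_iff)
qed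

lemma integral_supported_in_cbox:
 fixes f :: "'a::euclidean_space => 'b::euclidean_space"
 assumes c: "continuous_on UNIV f" and z: "\<And>x. x \<notin> cbox a b ==> f x = 0"
 shows "integrable lebesgue f" "(LINT x|lebesgue. f x) = integral (cbox a b) f"
proof -
 have i: "integrable (lebesgue_on (cbox a b)) f"
  using c continuous_on_subset by (intro continuous_imp_integrable) blast
 have eq: "(\<lambda>x. if x \<in> cbox a b then f x else 0) = f" using z by auto
 show "integrable lebesgue f"
  using i Lebesgue_Measure.integrable_restrict_UNIV[of "cbox a b" f] by (simp add: eq)
 have "(LINT x|lebesgue. f x) = integral\<^sup>L (lebesgue_on (cbox a b)) f"
  using Lebesgue_Measure.integral_restrict_UNIV[of "cbox a b" f] by (simp add: eq)
 then show "(LINT x|lebesgue. f x) = integral (cbox a b) f"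
  by (simp add: lebesgue_integral_eq_integral[OF i])
qed

lemma GDERIV_integral_cbox:
 fixes k :: "'a::euclidean_space => 'a => real"
 assumes k: "\<And>x z. GDERIV (\<lambda>x. k x z) x :> K x z"
  and c: "\<And>x. continuous_on UNIV (k x)" and K: "continuous_on UNIV (\<lambda>(x, z). K x z)"
 shows "GDERIV (\<lambda>x. integral (cbox a b) (k x)) x :> integral (cbox a b) (K x)"
proof -
 have "((\<lambda>x. integral (cbox a b) (k x)) has_derivative
   integral (cbox a b) (\<lambda>z. blinfun_inner_left (K x z))) (at x within UNIV)"
 proof (rule leibniz_rule)
  show "((\<lambda>x. k x z) has_derivative blinfun_apply (blinfun_inner_left (K x z))) (at x within UNIV)" for x z
   using k[of z x] unfolding gderiv_def by simp
  show "k x integrable_on cbox a b" for x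
   using c continuous_on_subset by (intro integrable_continuous) blast
  show "continuous_on (UNIV \<times> cbox a b) (\<lambda>(x, z). blinfun_inner_left (K x z))"
   using continuous_on_subset[OF K, of "UNIV \<times> cbox a b"]
    bounded_linear.continuous_on[OF bounded_linear_blinfun_inner_left]
   by (fastforce simp: split_beta)
 qed auto
 moreover have "K x integrable_on cbox a b"
  using continuous_on_compose2[OF K, of "cbox a b" "\<lambda>z. (x, z)"]
  by (intro integrable_continuous) (simp add: continuous_on_Pair)
 then have "integral (cbox a b) (\<lambda>z. blinfun_inner_left (K x z)) = blinfun_inner_left (integral (cbox a b) (K x))"
  using integral_linear[OF _ bounded_linear_blinfun_inner_left] by (auto simp: o_def)
 ultimately show ?thesis unfolding gderiv_def by simp
qed

lemma GDERIV_0_outside: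
 fixes g :: "'a::euclidean_space => real"
 assumes g: "\<And>x. GDERIV g x :> Dg x" and z: "\<And>x. x \<notin> cball 0 r ==> g x = 0" and x: "x \<notin> cball 0 r"
 shows "Dg x = 0"
proof -
 have "GDERIV g x :> 0"
  by (rule GDERIV_transform[where f="\<lambda>_. 0" and S="- cball 0 r", OF GDERIV_const]) (use z x in auto)
 then show ?thesis using GDERIV_unique[OF g[of x]] by simp
qed

text \<open>Translations preserve the integral, so its derivative under translations vanishes.\<close>
lemma integral_gradient_compact_support:
 fixes g :: "'a::euclidean_space => real"
 assumes g: "\<And>x. GDERIV g x :> Dg x" and c: "continuous_on UNIV Dg"
  and z: "\<And>x. x \<notin> cball 0 r ==> g x = 0"
 shows "integrable lebesgue Dg" "(LINT x|lebesgue. Dg x) = 0"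
proof -
 let ?Q = "cube (r + 1) :: 'a set"
 have sub: "x \<in> ?Q" if "norm x \<le> r + 1" for x using that cball_subset_cube[of "r + 1"] by auto
 have cg: "continuous_on UNIV g" using g GDERIV_continuous_on by blast
 have Dz: "Dg x = 0" if "x \<notin> ?Q" for x
  by (rule GDERIV_0_outside[OF g z]) (use sub[of x] that in force)+
 have zg: "g x = 0" if "x \<notin> ?Q" for x
  using z[of x] sub[of x] that by force
 note I = integral_supported_in_cbox[OF c Dz]
 show "integrable lebesgue Dg" by (rule I(1))
 have K: "continuous_on UNIV (\<lambda>(x, z). Dg (x + z))"
  by (auto simp: split_beta intro!: continuous_on_compose2[OF c] continuous_intros)
 have k: "GDERIV (\<lambda>x. g (x + z)) x :> Dg (x + z)" for x z
  using GDERIV_affine[of g z 1 x "Dg (x + z)"] g[of "x + z"] by (simp add: add.commute)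
 have d1: "GDERIV (\<lambda>x. integral ?Q (\<lambda>z. g (x + z))) 0 :> integral ?Q (\<lambda>z. Dg (0 + z))"
  by (rule GDERIV_integral_cbox[OF k _ K]) (auto intro!: continuous_on_compose2[OF cg] continuous_intros)
 have d2: "GDERIV (\<lambda>x. integral ?Q (\<lambda>z. g (x + z))) 0 :> 0"
 proof (rule GDERIV_transform[OF GDERIV_const, of "ball 0 1"])
  fix x :: 'a assume x: "x \<in> ball 0 1"
  have z': "g (x + z) = 0" if "z \<notin> ?Q" for z
  proof -
   have "norm z > r + 1" using sub that by force
   then have "norm (x + z) > r" using x norm_diff_ineq[of z x] by (simp add: add.commute)
   then show ?thesis using z by auto
  qed
  have "(LINT z|lebesgue. g z) = 1 *\<^sub>R (LINT z|lebesgue. g (x + 1 *\<^sub>R z))"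
   using integral_lebesgue_affine[of 1 g x] integral_supported_in_cbox(1)[OF cg zg] by simp
  also have "\<dots> = integral ?Q (\<lambda>z. g (x + z))"
  proof -
   have "continuous_on UNIV (\<lambda>z. g (x + z))"
    by (auto intro!: continuous_on_compose2[OF cg] continuous_intros)
   from integral_supported_in_cbox(2)[OF this z'] show ?thesis by simp
  qed
  finally show "(LINT z|lebesgue. g z) = integral ?Q (\<lambda>z. g (x + z))" .
 qed auto
 have "integral ?Q Dg = 0" using GDERIV_unique[OF d1 d2] by simp
 then show "(LINT x|lebesgue. Dg x) = 0" using I(2) by simp
qed

definition mollifier :: "real => ('a::euclidean_space => real) => bool" where
 "mollifier \<delta> \<rho> \<longleftrightarrow> smooth_on UNIV \<rho> \<and> (\<forall>x. 0 \<le> \<rho> x) \<and> (\<forall>x. \<delta> \<le> norm x --> \<rho> x = 0) \<and> (LINT x|lebesgue. \<rho> x) = 1"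

lemma mollifier_exists:
 assumes "\<delta> > 0"
 shows "\<exists>\<rho>::'a::euclidean_space => real. mollifier \<delta> \<rho>"
proof -
 define \<beta> where "\<beta> x = bump (0 + (1/\<delta>) *\<^sub>R x)" for x :: 'a
 have s: "smooth_on UNIV \<beta>" unfolding \<beta>_def by (rule smooth_on_affine[OF bump_smooth])
 have z: "\<beta> x = 0" if "\<delta> \<le> norm x" for x
  using assms that by (simp add: \<beta>_def bump_eq_0_iff)
 have zQ: "\<beta> x = 0" if "x \<notin> cube \<delta>" for x
  using z[of x] that cball_subset_cube[of \<delta>] by force
 have c: "continuous_on UNIV \<beta>" by (rule smooth_on_continuous[OF s])
 have int: "integrable lebesgue \<beta>" by (rule integral_supported_in_cbox[OF c zQ])
 define I where "I = (LINT x|lebesgue. \<beta> x)"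
 have "I \<noteq> 0"
 proof
  assume "I = 0"
  then have "integral (cube \<delta>) \<beta> = 0"
   using integral_supported_in_cbox(2)[OF c zQ] by (simp add: I_def)
  then have "(\<beta> has_integral 0) (cube \<delta>)"
   using continuous_on_subset[OF c] integrable_continuous[of "- \<delta> *\<^sub>R One" "\<delta> *\<^sub>R One" \<beta>] by (metis integrable_integral subset_UNIV)
  then have "\<beta> 0 = 0"
   using continuous_on_subset[OF c] assms
   by (intro has_integral_0_cbox_imp_0[of "- \<delta> *\<^sub>R One" "\<delta> *\<^sub>R One" \<beta>])
     (auto simp: \<beta>_def bump_nonneg mem_box box_ne_empty intro!: exI[of _ 0])
  then show False by (simp add: \<beta>_def bump_eq_0_iff)
 qed
 moreover have "I \<ge> 0" unfolding I_def by (rule integral_nonneg_AE) (simp add: \<beta>_def bump_nonneg)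
 ultimately have "I > 0" by simp
 then have "mollifier \<delta> (\<lambda>x. (1/I) * \<beta> x)"
  unfolding mollifier_def
  using z int smooth_on_cmult[OF s, of "1 / I"] by (simp add: \<beta>_def bump_nonneg I_def)
 then show ?thesis by blast
qed

definition mollify :: "('a::euclidean_space => real) => real => ('a => real) => 'a => real" where
 "mollify \<rho> r f x = integral (cube r) (\<lambda>z. f z * \<rho> (x - z))"

lemma GDERIV_mollify:
 assumes s: "smooth_on UNIV \<rho>" and f: "continuous_on UNIV f"
 shows "GDERIV (mollify \<rho> r f) x :> integral (cube r) (\<lambda>z. f z *\<^sub>R grad \<rho> (x - z))"
 unfolding mollify_def[abs_def]
proof (rule GDERIV_integral_cbox)
 show "GDERIV (\<lambda>x. f z * \<rho> (x - z)) x :> f z *\<^sub>R grad \<rho> (x - z)" for x z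
  using GDERIV_cmult[OF GDERIV_affine[of \<rho> "-z" 1 x "grad \<rho> (x - z)"]] smooth_on_GDERIV[OF s, of "x - z"] by simp
 show "continuous_on UNIV (\<lambda>z. f z * \<rho> (x - z))" for x
  by (intro continuous_intros f continuous_on_compose2[OF smooth_on_continuous[OF s]]) auto
 show "continuous_on UNIV (\<lambda>(x, z). f z *\<^sub>R grad \<rho> (x - z))"
  unfolding split_beta
  by (intro continuous_intros continuous_on_compose2[OF f] continuous_on_compose2[OF smooth_on_grad_continuous[OF s]]) auto
qed

lemma mollify_smooth:
 assumes s: "smooth_on UNIV \<rho>" and f: "continuous_on UNIV f"
 shows "smooth_on UNIV (mollify \<rho> r f)"
proof -
 have "Ck_on k UNIV (mollify \<rho> r f)" for k
  using s
 proof (induction k arbitrary: \<rho>)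
  case 0
  then show ?case using GDERIV_continuous_on[OF GDERIV_mollify[OF _ f]] by simp
 next
  case (Suc k)
  have "b \<bullet> integral (cube r) (\<lambda>z. f z *\<^sub>R grad \<rho> (x - z)) = mollify (\<lambda>y. b \<bullet> grad \<rho> y) r f x" for b x
  proof -
   have "(\<lambda>z. f z *\<^sub>R grad \<rho> (x - z)) integrable_on cube r"
    by (intro integrable_continuous continuous_intros continuous_on_compose2[OF f]
       continuous_on_compose2[OF smooth_on_grad_continuous[OF Suc.prems]]) auto
   from integral_linear[OF this bounded_linear_inner_right[of b]] show ?thesis
    by (simp add: o_def mollify_def)
  qed
  then show ?case
   using Suc.IH smooth_on_partial[OF Suc.prems]
   by (subst Ck_on_Suc_iff[OF open_UNIV GDERIV_mollify[OF Suc.prems f]]) simp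
 qed
 then show ?thesis by (simp add: smooth_on_def)
qed

lemma mollify_eq_0:
 assumes "mollifier \<delta> \<rho>" "\<And>z. z \<in> ball x \<delta> ==> f z = 0"
 shows "mollify \<rho> r f x = 0"
proof -
 have "f z * \<rho> (x - z) = 0" for z
  using assms unfolding mollifier_def by (cases "z \<in> ball x \<delta>") (auto simp: dist_norm)
 then show ?thesis unfolding mollify_def by (simp only: integral_0)
qed

lemma mollify_average:
 fixes v :: "'a::euclidean_space => 'b::euclidean_space"
 assumes m: "mollifier \<delta> \<rho>" and v: "continuous_on UNIV v" and sub: "ball x \<delta> \<subseteq> cube r"
  and b: "\<And>z. z \<in> ball x \<delta> ==> norm (v z - y) \<le> e"
 shows "norm (integral (cube r) (\<lambda>z. \<rho> (x - z) *\<^sub>R v z) - y) \<le> e"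
proof -
 have s: "smooth_on UNIV \<rho>" and p: "\<And>x. 0 \<le> \<rho> x" and z: "\<And>x. \<delta> \<le> norm x ==> \<rho> x = 0"
  and one: "(LINT x|lebesgue. \<rho> x) = 1" using m by (auto simp: mollifier_def)
 have c: "continuous_on UNIV (\<lambda>z. \<rho> (x - z))" 
  by (intro continuous_on_compose2[OF smooth_on_continuous[OF s]] continuous_intros) auto
 have zQ: "\<rho> (x - z) = 0" if "z \<notin> cube r" for z
  using z[of "x - z"] that sub by (force simp: dist_norm)
 have zQ': "\<rho> z = 0" if "z \<notin> cube \<delta>" for z
  using z[of z] that cball_subset_cube[of \<delta>] by force
 have "integral (cube r) (\<lambda>z. \<rho> (x - z)) = (LINT z|lebesgue. \<rho> (x - z))"
  using integral_supported_in_cbox(2)[OF c zQ] by simp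
 also have "\<dots> = 1"
  using integral_lebesgue_affine[of "-1" \<rho> x] one integral_supported_in_cbox(1)[OF smooth_on_continuous[OF s] zQ'] by simp
 finally have 1: "integral (cube r) (\<lambda>z. \<rho> (x - z)) = 1" .
 have i1: "(\<lambda>z. \<rho> (x - z)) integrable_on cube r"
  by (rule integrable_continuous) (use c continuous_on_subset in blast)
 have iv: "(\<lambda>z. \<rho> (x - z) *\<^sub>R v z) integrable_on cube r"
  by (rule integrable_continuous) (use c v continuous_on_subset in \<open>blast intro: continuous_on_scaleR\<close>)
 have iy: "(\<lambda>z. \<rho> (x - z) *\<^sub>R y) integrable_on cube r"
  using integrable_linear[OF i1 bounded_linear_scaleR_left[of y]] by (simp add: o_def)
 have iy': "integral (cube r) (\<lambda>z. \<rho> (x - z) *\<^sub>R y) = y"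
  using integral_linear[OF i1 bounded_linear_scaleR_left[of y]] 1 by (simp add: o_def)
 have "norm (integral (cube r) (\<lambda>z. \<rho> (x - z) *\<^sub>R v z - \<rho> (x - z) *\<^sub>R y)) \<le> integral (cube r) (\<lambda>z. \<rho> (x - z) * e)"
 proof (rule integral_norm_bound_integral)
  show "(\<lambda>z. \<rho> (x - z) *\<^sub>R v z - \<rho> (x - z) *\<^sub>R y) integrable_on cube r" using iv iy by (rule integrable_diff)
  show "(\<lambda>z. \<rho> (x - z) * e) integrable_on cube r" using i1 by (simp add: integrable_on_mult_left)
  show "norm (\<rho> (x - z) *\<^sub>R v z - \<rho> (x - z) *\<^sub>R y) \<le> \<rho> (x - z) * e" for z
  proof (cases "z \<in> ball x \<delta>")
   case True
   then show ?thesis using b[OF True] p[of "x - z"]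
    by (simp add: mult_left_mono flip: scaleR_diff_right)
  qed (use z[of "x - z"] in \<open>simp add: dist_norm\<close>)
 qed
 then show ?thesis using iv iy iy' 1 by (simp add: integral_diff)
qed

lemma mollify_close:
 assumes "mollifier \<delta> \<rho>" "continuous_on UNIV f" "ball x \<delta> \<subseteq> cube r"
  and "\<And>z. z \<in> ball x \<delta> ==> \<bar>f z - y\<bar> \<le> e"
 shows "\<bar>mollify \<rho> r f x - y\<bar> \<le> e"
 using mollify_average[of \<delta> \<rho> f x r y e] assms by (simp add: mollify_def mult.commute)

text \<open>Integrating by parts moves the derivative from the kernel to the mollified function.\<close>
lemma grad_mollify_close:
 assumes m: "mollifier \<delta> \<rho>" and f: "\<And>z. GDERIV f z :> Df z" and D: "continuous_on UNIV Df"
  and sub: "ball x \<delta> \<subseteq> cube r" and b: "\<And>z. z \<in> ball x \<delta> ==> norm (Df z - y) \<le> e"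
 shows "norm (grad (mollify \<rho> r f) x - y) \<le> e"
proof -
 have s: "smooth_on UNIV \<rho>" and z: "\<And>x. \<delta> \<le> norm x ==> \<rho> x = 0"
  using m by (auto simp: mollifier_def)
 have cf: "continuous_on UNIV f" using f GDERIV_continuous_on by blast
 have c: "continuous_on UNIV (\<lambda>z. \<rho> (x - z))" 
  by (intro continuous_on_compose2[OF smooth_on_continuous[OF s]] continuous_intros) auto
 have c': "continuous_on UNIV (\<lambda>z. grad \<rho> (x - z))" 
  by (intro continuous_on_compose2[OF smooth_on_grad_continuous[OF s]] continuous_intros) auto
 let ?G = "\<lambda>z. f z *\<^sub>R (- grad \<rho> (x - z)) + \<rho> (x - z) *\<^sub>R Df z"
 have G: "GDERIV (\<lambda>z. f z * \<rho> (x - z)) z :> ?G z" for z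
  using GDERIV_mult[OF f[of z] GDERIV_affine[of \<rho> x "-1" z "grad \<rho> (x - z)"]] smooth_on_GDERIV[OF s, of "x - z"] by simp
 have z1: "f z * \<rho> (x - z) = 0" if "z \<notin> cball 0 (norm x + \<delta>)" for z
  using that norm_triangle_ineq2[of z x] z[of "x - z"] by (simp add: norm_minus_commute)
 have cG: "continuous_on UNIV ?G" by (intro continuous_intros cf D c c')
 have zG: "?G z = 0" if "z \<notin> cube r" for z
 proof -
  have *: "dist x z \<ge> \<delta>" using that sub by (force simp: not_less)
  have "\<rho> (x - z) = 0" using z[of "x - z"] * by (simp add: dist_norm)
  moreover have "grad \<rho> (x - z) = 0"
  proof (rule ccontr)
   txt \<open>\<open>\<rho>\<close> is nonnegative and vanishes at \<open>x - z\<close>, so this point is a minimum.\<close>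
   assume a: "grad \<rho> (x - z) \<noteq> 0"
   have "(\<lambda>h. h \<bullet> grad \<rho> (x - z)) = (\<lambda>h. 0)"
    by (rule differential_zero_maxmin[of "x - z" UNIV \<rho>])
      (use smooth_on_GDERIV[OF s, of "x - z"] \<open>\<rho> (x - z) = 0\<close> m in \<open>auto simp: gderiv_def mollifier_def\<close>)
   then show False using a by (metis inner_eq_zero_iff)
  qed
  ultimately show ?thesis by simp
 qed
 have "0 = integral (cube r) ?G"
  using integral_gradient_compact_support(2)[OF G cG z1] integral_supported_in_cbox(2)[OF cG zG] by simp
 also have "\<dots> = integral (cube r) (\<lambda>z. \<rho> (x - z) *\<^sub>R Df z) - integral (cube r) (\<lambda>z. f z *\<^sub>R grad \<rho> (x - z))"
  using continuous_on_subset[OF continuous_on_scaleR[OF cf c']] continuous_on_subset[OF continuous_on_scaleR[OF c D]]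
  by (subst integral_diff[symmetric]) (auto intro!: integrable_continuous simp: algebra_simps)
 finally have "grad (mollify \<rho> r f) x = integral (cube r) (\<lambda>z. \<rho> (x - z) *\<^sub>R Df z)"
  using GDERIV_grad[OF GDERIV_mollify[OF s cf]] by simp
 then show ?thesis using mollify_average[OF m D sub b] by simp
qed

section \<open>Weak gradients\<close>

lemma absolutely_integrable_iff_lebesgue_on:
 "S \<in> sets lebesgue ==> f absolutely_integrable_on S \<longleftrightarrow> integrable (lebesgue_on S) f"
 by (simp add: set_integrable_def integrable_restrict_space)

lemma absolutely_integrable_continuous_compact:
 fixes f :: "'a::euclidean_space => 'b::euclidean_space"
 assumes "compact K" "continuous_on K f"
 shows "f absolutely_integrable_on K"
 using borel_integrable_compact[OF assms]
 by (simp add: set_integrable_def integrable_completion borel_measurable_integrable)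

lemma integrable_compactly_supported:
 fixes f :: "'a::euclidean_space => 'b::euclidean_space"
 assumes "compact K" "K \<subseteq> S" "continuous_on K f" "\<And>x. x \<in> S - K ==> f x = 0" "S \<in> sets lebesgue"
 shows "integrable (lebesgue_on S) f"
proof -
 have "integrable lebesgue (\<lambda>x. indicator K x *\<^sub>R f x)"
  using absolutely_integrable_continuous_compact[OF assms(1,3)] by (simp add: set_integrable_def)
 moreover have "(\<lambda>x. indicator K x *\<^sub>R f x) = (\<lambda>x. if x \<in> S then f x else 0)"
  using assms(2,4) by (auto simp: fun_eq_iff indicator_def)
 ultimately show ?thesis
  using Lebesgue_Measure.integrable_restrict_UNIV[OF assms(5), of f] by simp
qed

lemma test_function_support:
 assumes "test_function S \<phi>"
 obtains K where "compact K" "K \<subseteq> S" "\<And>x. x \<notin> K ==> \<phi> x = 0 \<and> grad \<phi> x = 0"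
proof
 let ?K = "closure {x. \<phi> x \<noteq> 0}"
 show "compact ?K" "?K \<subseteq> S" using assms by (auto simp: test_function_def)
 show "\<phi> x = 0 \<and> grad \<phi> x = 0" if "x \<notin> ?K" for x
 proof -
  have z: "\<phi> y = 0" if "y \<in> - ?K" for y using that closure_subset[of "{x. \<phi> x \<noteq> 0}"] by blast
  have "GDERIV \<phi> x :> 0"
  proof (rule GDERIV_transform[where f="\<lambda>_. 0" and S="- ?K"])
   show "GDERIV (\<lambda>_. 0) x :> 0" by (rule GDERIV_const)
   show "open (- ?K)" "x \<in> - ?K" using that by (simp_all add: open_Compl)
   show "0 = \<phi> y" if "y \<in> - ?K" for y using z[OF that] by simp
  qed
  then show ?thesis using z[of x] that GDERIV_grad[of \<phi> x 0] by simp
 qed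
qed

lemma test_function_smooth: "test_function S \<phi> ==> smooth_on UNIV \<phi>"
 by (simp add: test_function_def)

text \<open>The product with a test function, extended by zero, is continuously differentiable on the
 whole space, so the integral of its gradient vanishes.\<close>
lemma has_weak_gradient_C1:
 fixes f :: "'a::euclidean_space => real"
 assumes S: "open S" and f: "\<And>x. x \<in> S ==> GDERIV f x :> Df x" and D: "continuous_on S Df"
 shows "has_weak_gradient S f Df"
proof -
 have cf: "continuous_on S f" using f GDERIV_continuous_on by blast
 have Sm: "S \<in> sets lebesgue" using S by (simp add: lmeasurable_open borel_open sets_completionI_sets)
 have "(LINT x|lebesgue_on S. f x *\<^sub>R grad \<phi> x) = - (LINT x|lebesgue_on S. \<phi> x *\<^sub>R Df x)"
  if t: "test_function S \<phi>" for \<phi>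
 proof -
  obtain K where K: "compact K" "K \<subseteq> S" and z: "\<And>x. x \<notin> K ==> \<phi> x = 0 \<and> grad \<phi> x = 0"
   using test_function_support[OF t] by blast
  have s: "smooth_on UNIV \<phi>" using t by (rule test_function_smooth)
  let ?g = "\<lambda>x. if x \<in> S then f x * \<phi> x else 0"
  let ?D = "\<lambda>x. if x \<in> S then f x *\<^sub>R grad \<phi> x + \<phi> x *\<^sub>R Df x else 0"
  have oK: "open (- K)" using K(1) by (simp add: compact_imp_closed open_Compl)
  have gD: "GDERIV ?g x :> ?D x" for x
  proof (cases "x \<in> S")
   case True
   have "GDERIV (\<lambda>x. f x * \<phi> x) x :> f x *\<^sub>R grad \<phi> x + \<phi> x *\<^sub>R Df x"
    by (rule GDERIV_mult[OF f[OF True] smooth_on_GDERIV[OF s]])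
   then have "GDERIV ?g x :> f x *\<^sub>R grad \<phi> x + \<phi> x *\<^sub>R Df x"
    by (rule GDERIV_transform[OF _ S True]) simp
   then show ?thesis using True by simp
  next
   case False
   have "GDERIV ?g x :> 0"
    by (rule GDERIV_transform[where f="\<lambda>_. 0" and S="- K", OF GDERIV_const oK])
      (use False K z in auto)
   then show ?thesis using False by simp
  qed
  have cD: "continuous_on UNIV ?D"
  proof -
   have "continuous_on S ?D"
    by (rule continuous_on_cong[THEN iffD1, OF refl, of S "\<lambda>x. f x *\<^sub>R grad \<phi> x + \<phi> x *\<^sub>R Df x"])
      (auto intro!: continuous_intros cf D smooth_on_grad_continuous[OF s] smooth_on_continuous[OF s])
   moreover have "continuous_on (- K) ?D"
    by (rule continuous_on_cong[THEN iffD1, OF refl, of "- K" "\<lambda>x. 0"]) (use z in auto)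
   ultimately have "continuous_on (S \<union> - K) ?D"
    by (rule continuous_on_open_Un[OF S oK])
   moreover have "S \<union> - K = UNIV" using K(2) by auto
   ultimately show ?thesis by simp
  qed
  obtain r where r: "K \<subseteq> cball 0 r"
   using compact_imp_bounded[OF K(1)] by (auto simp: bounded_iff subset_iff)
  have "0 = (LINT x|lebesgue. ?D x)"
   by (rule integral_gradient_compact_support(2)[OF gD cD, of r, symmetric]) (metis r z mult_zero_right subsetD)
  also have "\<dots> = (LINT x|lebesgue_on S. f x *\<^sub>R grad \<phi> x + \<phi> x *\<^sub>R Df x)"
   by (rule Lebesgue_Measure.integral_restrict_UNIV[OF Sm])
  also have "\<dots> = (LINT x|lebesgue_on S. f x *\<^sub>R grad \<phi> x) + (LINT x|lebesgue_on S. \<phi> x *\<^sub>R Df x)"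
  proof (rule Bochner_Integration.integral_add)
   show "integrable (lebesgue_on S) (\<lambda>x. f x *\<^sub>R grad \<phi> x)"
    by (rule integrable_compactly_supported[OF K _ _ Sm])
      (use z continuous_on_subset[OF cf K(2)] in \<open>auto intro!: continuous_intros smooth_on_grad_continuous[OF s]\<close>)
   show "integrable (lebesgue_on S) (\<lambda>x. \<phi> x *\<^sub>R Df x)"
    by (rule integrable_compactly_supported[OF K _ _ Sm])
      (use z continuous_on_subset[OF D K(2)] in \<open>auto intro!: continuous_intros smooth_on_continuous[OF s]\<close>)
  qed
  finally show ?thesis by (simp add: eq_neg_iff_add_eq_0)
 qed
 then show ?thesis
  unfolding has_weak_gradient_def
  using absolutely_integrable_continuous_compact continuous_on_subset[OF cf] continuous_on_subset[OF D] by metis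
qed

lemma integral_lebesgue_on_subset:
 fixes f :: "'a::euclidean_space => 'b::euclidean_space"
 assumes "T \<subseteq> S" "S \<in> sets lebesgue" "T \<in> sets lebesgue" "\<And>x. x \<in> S - T ==> f x = 0"
 shows "integral\<^sup>L (lebesgue_on S) f = integral\<^sup>L (lebesgue_on T) f"
  and "integrable (lebesgue_on S) f \<longleftrightarrow> integrable (lebesgue_on T) f"
proof -
 have eq: "(\<lambda>x. if x \<in> S then f x else 0) = (\<lambda>x. if x \<in> T then f x else 0)"
  using assms(1,4) by (auto simp: fun_eq_iff)
 show "integral\<^sup>L (lebesgue_on S) f = integral\<^sup>L (lebesgue_on T) f"
  using Lebesgue_Measure.integral_restrict_UNIV[of S f] Lebesgue_Measure.integral_restrict_UNIV[of T f] assms eq by simp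
 show "integrable (lebesgue_on S) f \<longleftrightarrow> integrable (lebesgue_on T) f"
  using Lebesgue_Measure.integrable_restrict_UNIV[of S f] Lebesgue_Measure.integrable_restrict_UNIV[of T f] assms eq by simp
qed

lemma open_lebesgue [simp]: "open S ==> S \<in> sets lebesgue"
 by (simp add: borel_open sets_completionI_sets)

lemma has_weak_gradient_subset:
 fixes f :: "'a::euclidean_space => real"
 assumes w: "has_weak_gradient S f g" and "T \<subseteq> S" "open T" "open S"
 shows "has_weak_gradient T f g"
 unfolding has_weak_gradient_def
proof (intro conjI allI impI)
 fix C assume "compact C \<and> C \<subseteq> T"
 then show "f absolutely_integrable_on C" "g absolutely_integrable_on C"
  using w assms(2) unfolding has_weak_gradient_def by blast+
next
 fix \<phi> assume t: "test_function T \<phi>"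
 obtain K where K: "compact K" "K \<subseteq> T" "\<And>x. x \<notin> K ==> \<phi> x = 0 \<and> grad \<phi> x = 0"
  using test_function_support[OF t] by blast
 have z: "\<phi> x = 0 \<and> grad \<phi> x = 0" if "x \<in> S - T" for x using K that by blast
 have "test_function S \<phi>" using t assms(2) by (auto simp: test_function_def)
 then have "(LINT x|lebesgue_on S. f x *\<^sub>R grad \<phi> x) = - (LINT x|lebesgue_on S. \<phi> x *\<^sub>R g x)"
  using w by (simp add: has_weak_gradient_def)
 then show "(LINT x|lebesgue_on T. f x *\<^sub>R grad \<phi> x) = - (LINT x|lebesgue_on T. \<phi> x *\<^sub>R g x)"
  using integral_lebesgue_on_subset(1)[OF assms(2), of "\<lambda>x. f x *\<^sub>R grad \<phi> x"]
   integral_lebesgue_on_subset(1)[OF assms(2), of "\<lambda>x. \<phi> x *\<^sub>R g x"] z assms by auto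
qed

lemma smooth_on_prod: "finite I ==> (\<And>i. i \<in> I ==> smooth_on UNIV (f i)) ==> smooth_on UNIV (\<lambda>x. \<Prod>i\<in>I. f i x)"
 by (induction I rule: finite_induct) (simp_all add: smooth_on_const smooth_on_mult)

lemma smooth_on_flat_inner: "smooth_on UNIV (\<lambda>x. flat 0 (c + b \<bullet> x))"
 unfolding smooth_on_def
proof
 fix k
 have f: "Ck_on k UNIV (flat 0)" using flat_smooth[of 0] unfolding smooth_on_def by (rule spec)
 show "Ck_on k UNIV (\<lambda>x. flat 0 (c + b \<bullet> x))"
  by (rule Ck_on_compose[OF open_UNIV f Ck_on_add[OF open_UNIV Ck_on_const[OF open_UNIV] Ck_on_inner[OF open_UNIV]]])
qed

text \<open>In one variable \<open>exp (- 1 / (n t))\<close> for \<open>t > 0\<close>, extended by zero, tends to the indicator of the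
 positive half-line; a box is an intersection of half-spaces.\<close>
lemma test_functions_to_indicator:
 fixes a b :: "'a::euclidean_space"
 assumes sub: "cbox a b \<subseteq> S"
 obtains \<phi> where "\<And>n. test_function S (\<phi> n)" "\<And>n x. x \<notin> cbox a b ==> \<phi> n x = 0" "\<And>n x. \<bar>\<phi> n x\<bar> \<le> 1"
  "\<And>x. (\<lambda>n::nat. \<phi> n x) \<longlonglongrightarrow> indicator (box a b) x"
proof -
 define \<phi> where "\<phi> n x = (\<Prod>i\<in>Basis. flat 0 (- (real n * (a \<bullet> i)) + (real n *\<^sub>R i) \<bullet> x) * flat 0 (real n * (b \<bullet> i) + (- (real n *\<^sub>R i)) \<bullet> x))"
  for n and x :: 'a
 have eq: "\<phi> n x = (\<Prod>i\<in>Basis. flat 0 (real n * (x \<bullet> i - a \<bullet> i)) * flat 0 (real n * (b \<bullet> i - x \<bullet> i)))" for n x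
  by (simp add: \<phi>_def inner_commute algebra_simps)
 have fb: "0 \<le> flat 0 t" "flat 0 t \<le> 1" for t by (simp_all add: flat_def)
 have out: "\<phi> n x = 0" if x: "x \<notin> box a b" for n x
 proof -
  obtain i where i: "i \<in> Basis" "\<not> (a \<bullet> i < x \<bullet> i \<and> x \<bullet> i < b \<bullet> i)" using x by (auto simp: mem_box)
  then have "real n * (x \<bullet> i - a \<bullet> i) \<le> 0 \<or> real n * (b \<bullet> i - x \<bullet> i) \<le> 0"
   by (auto simp: mult_le_0_iff)
  then have "flat 0 (real n * (x \<bullet> i - a \<bullet> i)) * flat 0 (real n * (b \<bullet> i - x \<bullet> i)) = 0" by (auto simp: flat_def)
  then show ?thesis unfolding eq by (intro prod_zero finite_Basis bexI[OF _ i(1)])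
 qed
 have "0 \<le> \<phi> n x" "\<phi> n x \<le> 1" for n x
  unfolding eq using fb by (auto intro!: prod_nonneg prod_le_1 mult_le_one)
 then have one: "\<bar>\<phi> n x\<bar> \<le> 1" for n x by (simp add: abs_le_iff order_trans[of _ 0])
 have flim: "(\<lambda>n. flat 0 (real n * s)) \<longlonglongrightarrow> 1" if s: "s > 0" for s
 proof (rule Lim_transform_eventually)
  have "(\<lambda>n. exp (- (1 / real n * (1 / s)))) \<longlonglongrightarrow> exp (- (0 * (1 / s)))" by (intro tendsto_intros lim_1_over_n)
  then show "(\<lambda>n. exp (- (1 / real n * (1 / s)))) \<longlonglongrightarrow> 1" by simp
  show "\<forall>\<^sub>F n in sequentially. exp (- (1 / real n * (1 / s))) = flat 0 (real n * s)"
   using eventually_gt_at_top[of 0] by eventually_elim (use s in \<open>simp add: flat_def\<close>)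
 qed
 have lim: "(\<lambda>n. \<phi> n x) \<longlonglongrightarrow> indicator (box a b) x" for x
 proof (cases "x \<in> box a b")
  case True
  have "(\<lambda>n. \<phi> n x) \<longlonglongrightarrow> (\<Prod>i\<in>(Basis::'a set). 1 * 1)"
   unfolding eq by (intro tendsto_prod tendsto_mult flim) (use True in \<open>auto simp: mem_box\<close>)
  then show ?thesis using True by simp
 qed (simp add: out)
 have cl: "closure {x. \<phi> n x \<noteq> 0} \<subseteq> cbox a b" for n
  using out box_subset_cbox[of a b] by (intro closure_minimal closed_cbox) blast
 have "test_function S (\<phi> n)" for n
  unfolding test_function_def
 proof (intro conjI)
  show "smooth_on UNIV (\<phi> n)"
   unfolding \<phi>_def[abs_def] by (intro smooth_on_prod smooth_on_mult smooth_on_flat_inner finite_Basis)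
  show "compact (closure {x. \<phi> n x \<noteq> 0})"
   using cl[of n] by (metis bounded_cbox bounded_subset closed_closure compact_eq_bounded_closed)
 qed (use cl sub in blast)
 then show thesis using that out one lim box_subset_cbox[of a b] by blast
qed

text \<open>The fundamental lemma of the calculus of variations, by way of vanishing averages over
 small boxes and Lebesgue's differentiation theorem.\<close>
lemma du_Bois_Reymond:
 fixes h :: "'a::euclidean_space => real"
 assumes S: "open S" and h: "\<And>C. compact C ==> C \<subseteq> S ==> h absolutely_integrable_on C"
  and t: "\<And>\<phi>. test_function S \<phi> ==> (LINT x|lebesgue_on S. \<phi> x * h x) = 0"
 shows "AE x in lebesgue_on S. h x = 0"
proof -
 have box: "integral (cbox a b) h = 0" if sub: "cbox a b \<subseteq> S" for a b
 proof -
  define K where "K = cbox a b"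
  have K: "compact K" "K \<subseteq> S" using sub by (simp_all add: K_def)
  obtain \<phi> where \<phi>: "\<And>n. test_function S (\<phi> n)"
   and \<phi>0': "\<And>n x. x \<notin> cbox a b ==> \<phi> n x = 0" and \<phi>1: "\<And>n x. \<bar>\<phi> n x\<bar> \<le> (1::real)"
   and lim: "\<And>x. (\<lambda>n::nat. \<phi> n x) \<longlonglongrightarrow> indicator (box a b) x"
   by (rule test_functions_to_indicator[OF sub]) (rule that)
  have \<phi>0: "\<phi> n x = 0" if "x \<notin> K" for n x using that unfolding K_def by (rule \<phi>0')
  have i: "integrable lebesgue (\<lambda>x. indicator K x * h x)"
   using h[OF K] by (simp add: set_integrable_def)
  have "(\<lambda>n. LINT x|lebesgue. \<phi> n x * (indicator K x * h x)) \<longlonglongrightarrow>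
    (LINT x|lebesgue. indicator (box a b) x * (indicator K x * h x))"
  proof (rule integral_dominated_convergence[where w="\<lambda>x. \<bar>indicator K x * h x\<bar>"])
   have m1: "(\<lambda>x. indicator K x * h x) \<in> borel_measurable lebesgue" using i by auto
   have m2: "\<phi> n \<in> borel_measurable lebesgue" for n
    using smooth_on_continuous[OF test_function_smooth[OF \<phi>], of UNIV n]
    by (simp add: borel_measurable_continuous_onI measurable_completion)
   show "(\<lambda>x. \<phi> n x * (indicator K x * h x)) \<in> borel_measurable lebesgue" for n
    by (rule borel_measurable_times[OF m2 m1])
   show "(\<lambda>x. indicator (box a b) x * (indicator K x * h x)) \<in> borel_measurable lebesgue"
    by (rule borel_measurable_times[OF borel_measurable_indicator m1]) simp
   show "AE x in lebesgue. (\<lambda>n. \<phi> n x * (indicator K x * h x)) \<longlonglongrightarrow> indicator (box a b) x * (indicator K x * h x)"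
    by (intro AE_I2 tendsto_mult lim tendsto_const)
   show "AE x in lebesgue. norm (\<phi> n x * (indicator K x * h x)) \<le> \<bar>indicator K x * h x\<bar>" for n
    using \<phi>1[of n] by (intro AE_I2) (simp add: abs_mult mult_left_le_one_le)
  qed (use i in auto)
  moreover have "(LINT x|lebesgue. \<phi> n x * (indicator K x * h x)) = 0" for n
  proof -
   have "(LINT x|lebesgue. \<phi> n x * (indicator K x * h x)) = (LINT x|lebesgue. (if x \<in> S then \<phi> n x * h x else 0))"
    by (rule Bochner_Integration.integral_cong) (use \<phi>0 K in \<open>auto simp: indicator_def\<close>)
   then show ?thesis using t[OF \<phi>] Lebesgue_Measure.integral_restrict_UNIV[of S "\<lambda>x. \<phi> n x * h x"] S by simp
  qed
  ultimately have "(LINT x|lebesgue. indicator (box a b) x * (indicator K x * h x)) = 0"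
   by (simp add: LIMSEQ_const_iff)
  moreover have "(\<lambda>x. indicator (box a b) x * (indicator K x * h x)) = (\<lambda>x. if x \<in> box a b then h x else 0)"
   using box_subset_cbox[of a b] by (auto simp: indicator_def fun_eq_iff K_def)
  ultimately have "integral\<^sup>L (lebesgue_on (box a b)) h = 0"
   using Lebesgue_Measure.integral_restrict_UNIV[of "box a b" h] by simp
  moreover have "h absolutely_integrable_on box a b"
   using h[OF compact_cbox sub] by (rule set_integrable_subset) (use box_subset_cbox in auto)
  ultimately show ?thesis
   using lebesgue_integral_eq_integral[of "box a b" h] integral_open_interval[of a b h]
   by (simp add: absolutely_integrable_iff_lebesgue_on)
 qed
 have null: "negligible {x \<in> cbox a b. h x \<noteq> 0}" if sub: "cbox a b \<subseteq> S" for a b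
 proof -
  let ?h = "\<lambda>x. if x \<in> cbox a b then h x else 0"
  have hi: "h integrable_on cbox a b" using h[OF compact_cbox sub] absolutely_integrable_on_def by blast
  have z: "integral (cbox c d) ?h = 0" and i: "?h integrable_on cbox c d" for c d
  proof -
   obtain p q where pq: "cbox a b \<inter> cbox c d = cbox p q" using Int_interval[of a b c d] by blast
   then have *: "cbox p q \<subseteq> cbox a b" by blast
   have "h integrable_on cbox p q" by (rule integrable_on_subcbox[OF hi *])
   then show "?h integrable_on cbox c d" using pq by (simp add: Henstock_Kurzweil_Integration.integrable_restrict_Int)
   show "integral (cbox c d) ?h = 0" 
    using box[OF subset_trans[OF * sub]] pq by (simp add: Henstock_Kurzweil_Integration.integral_restrict_Int)
  qed
  obtain N where N: "negligible N" and
   lim: "\<And>x e. [|x \<notin> N; 0 < e|] ==> \<exists>d>0. \<forall>k. 0 < k \<and> k < d -->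
     norm (integral (cbox x (x + k *\<^sub>R One)) ?h /\<^sub>R k ^ DIM('a) - ?h x) < e"
   by (rule integrable_ccontinuous_explicit[where f="?h", OF i]) (rule that)
  have zero: "y = 0" if "x \<notin> N" and y: "?h x = y" for x y
  proof (rule ccontr)
   assume "y \<noteq> 0"
   then have "0 < norm y" by simp
   from lim[OF \<open>x \<notin> N\<close> this] obtain d where d: "d > 0"
    "\<forall>k. 0 < k \<and> k < d --> norm (integral (cbox x (x + k *\<^sub>R One)) ?h /\<^sub>R k ^ DIM('a) - ?h x) < norm y"
    by blast
   have "norm (integral (cbox x (x + (d/2) *\<^sub>R One)) ?h /\<^sub>R (d/2) ^ DIM('a) - ?h x) < norm y"
    using d(1) d(2)[rule_format, of "d/2"] by linarith
   then show False unfolding z y by simp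
  qed
  have "{x \<in> cbox a b. h x \<noteq> 0} \<subseteq> N"
  proof
   fix x assume "x \<in> {x \<in> cbox a b. h x \<noteq> 0}"
   then show "x \<in> N" using zero[of x "h x"] by (cases "x \<in> N") simp_all
  qed
  then show ?thesis using N negligible_subset by blast
 qed
 obtain \<D> where D: "countable \<D>" "\<D> \<subseteq> Pow S" "\<And>X. X \<in> \<D> ==> \<exists>a b. X = cbox a b" "\<Union>\<D> = S"
  using open_countable_Union_open_cbox[OF S] by metis
 have "negligible (\<Union>X\<in>\<D>. {x \<in> X. h x \<noteq> 0})"
 proof (rule negligible_countable_Union)
  show "countable ((\<lambda>X. {x \<in> X. h x \<noteq> 0}) ` \<D>)" using D(1) by simp
  fix Y assume "Y \<in> (\<lambda>X. {x \<in> X. h x \<noteq> 0}) ` \<D>"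
  then obtain a b where "Y = {x \<in> cbox a b. h x \<noteq> 0}" "cbox a b \<subseteq> S" using D(2,3) by blast
  then show "negligible Y" using null by simp
 qed
 moreover have "(\<Union>X\<in>\<D>. {x \<in> X. h x \<noteq> 0}) = {x \<in> S. h x \<noteq> 0}" using D(4) by auto
 ultimately have "{x \<in> S. h x \<noteq> 0} \<in> null_sets lebesgue" by (simp add: negligible_iff_null_sets)
 then have "AE x in lebesgue. x \<in> S --> h x = 0"
  by (rule AE_I') auto
 then show ?thesis using S by (simp add: AE_restrict_space_iff)
qed

lemma weak_gradient_unique:
 fixes f :: "'a::euclidean_space => real"
 assumes S: "open S" and g: "has_weak_gradient S f g" and k: "has_weak_gradient S f k"
 shows "AE x in lebesgue_on S. g x = k x"
proof -
 have "AE x in lebesgue_on S. b \<bullet> (g x - k x) = 0" if b: "b \<in> Basis" for b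
 proof (rule du_Bois_Reymond[OF S])
  show "(\<lambda>x. b \<bullet> (g x - k x)) absolutely_integrable_on C" if "compact C" "C \<subseteq> S" for C
  proof -
   have "(\<lambda>x. g x - k x) absolutely_integrable_on C"
    using g k that by (auto simp: has_weak_gradient_def)
   from absolutely_integrable_component[OF this, of b] show ?thesis by (simp add: inner_commute)
  qed
  fix \<phi> assume t: "test_function S \<phi>"
  obtain K where K: "compact K" "K \<subseteq> S" and z: "\<And>x. x \<notin> K ==> \<phi> x = 0 \<and> grad \<phi> x = 0"
   using test_function_support[OF t] by blast
  have c: "continuous_on UNIV \<phi>" by (rule smooth_on_continuous[OF test_function_smooth[OF t]])
  have i: "integrable (lebesgue_on S) (\<lambda>x. \<phi> x *\<^sub>R v x)" if w: "has_weak_gradient S f v" for v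
  proof -
   have Km: "K \<in> sets lebesgue" using K(1) by (simp add: borel_compact sets_completionI_sets)
   have v: "integrable (lebesgue_on K) v"
    using w K unfolding has_weak_gradient_def by (metis Km absolutely_integrable_iff_lebesgue_on)
   obtain B where B: "\<And>x. x \<in> K ==> \<bar>\<phi> x\<bar> \<le> B"
    using compact_imp_bounded[OF compact_continuous_image[OF continuous_on_subset[OF c] K(1)]]
    by (force simp: bounded_iff)
   have "integrable (lebesgue_on K) (\<lambda>x. \<phi> x *\<^sub>R v x)"
   proof (rule Bochner_Integration.integrable_bound[of _ "\<lambda>x. B *\<^sub>R v x"])
    have "\<phi> \<in> borel_measurable (lebesgue_on K)"
     using continuous_on_subset[OF c] Km by (intro continuous_imp_measurable_on_sets_lebesgue) auto
    then show "(\<lambda>x. \<phi> x *\<^sub>R v x) \<in> borel_measurable (lebesgue_on K)" using v by (intro borel_measurable_scaleR) auto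
    show "AE x in lebesgue_on K. norm (\<phi> x *\<^sub>R v x) \<le> norm (B *\<^sub>R v x)"
     by (rule AE_I2) (use B in \<open>force intro!: mult_right_mono\<close>)
   qed (use v in auto)
   then show ?thesis
    using integral_lebesgue_on_subset(2)[OF K(2), of "\<lambda>x. \<phi> x *\<^sub>R v x"] z S Km by auto
  qed
  have "(LINT x|lebesgue_on S. \<phi> x * (b \<bullet> (g x - k x))) = (LINT x|lebesgue_on S. (\<phi> x *\<^sub>R g x - \<phi> x *\<^sub>R k x) \<bullet> b)"
   by (simp add: inner_diff_left inner_diff_right right_diff_distrib inner_commute[of b])
  also have "\<dots> = (LINT x|lebesgue_on S. \<phi> x *\<^sub>R g x - \<phi> x *\<^sub>R k x) \<bullet> b"
   using i[OF g] i[OF k] by (intro integral_inner_left) auto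
  also have "\<dots> = ((LINT x|lebesgue_on S. \<phi> x *\<^sub>R g x) - (LINT x|lebesgue_on S. \<phi> x *\<^sub>R k x)) \<bullet> b"
   using i[OF g] i[OF k] by simp
  also have "\<dots> = 0" using g k t unfolding has_weak_gradient_def by (metis cancel_comm_monoid_add_class.diff_cancel inner_zero_left neg_equal_iff_equal)
  finally show "(LINT x|lebesgue_on S. \<phi> x * (b \<bullet> (g x - k x))) = 0" .
 qed
 then have "AE x in lebesgue_on S. \<forall>b\<in>Basis. b \<bullet> (g x - k x) = 0"
  by (simp add: AE_finite_all)
 then show ?thesis
  by eventually_elim (metis euclidean_all_zero_iff inner_commute right_minus_eq)
qed

section \<open>Convergence in the Sobolev norm\<close>

lemma norm_add_power_le: "norm (x + y) ^ p \<le> 2 ^ p * (norm x ^ p + norm y ^ p)"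
proof -
 have "norm (x + y) \<le> 2 * max (norm x) (norm y)"
  using norm_triangle_ineq[of x y] by simp
 then have "norm (x + y) ^ p \<le> (2 * max (norm x) (norm y)) ^ p" by (intro power_mono) auto
 also have "\<dots> \<le> 2 ^ p * (norm x ^ p + norm y ^ p)"
  by (auto simp: power_mult_distrib max_def)
 finally show ?thesis .
qed

lemma Lp_on_add:
 assumes "Lp_on p S f" "Lp_on p S g"
 shows "Lp_on p S (\<lambda>x. f x + g x)"
 unfolding Lp_on_def
proof
 note [measurable] = assms[unfolded Lp_on_def, THEN conjunct1]
 show "(\<lambda>x. f x + g x) \<in> borel_measurable (lebesgue_on S)" by measurable
 show "integrable (lebesgue_on S) (\<lambda>x. norm (f x + g x) ^ p)"
 proof (rule Bochner_Integration.integrable_bound[of _ "\<lambda>x. 2 ^ p * (norm (f x) ^ p + norm (g x) ^ p)"])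
  show "AE x in lebesgue_on S. norm (norm (f x + g x) ^ p) \<le> norm (2 ^ p * (norm (f x) ^ p + norm (g x) ^ p))"
   by (rule AE_I2) (use norm_add_power_le in fastforce)
 qed (use assms in \<open>auto simp: Lp_on_def\<close>)
qed

text \<open>Anything dominated by a multiple of a function in \<open>L\<^sup>p\<close> is in \<open>L\<^sup>p\<close>.\<close>
lemma Lp_on_bound:
 fixes g :: "'a::euclidean_space => 'b::euclidean_space" and f :: "'a => 'c::euclidean_space"
 assumes "Lp_on p S f" "g \<in> borel_measurable (lebesgue_on S)" "\<And>x. x \<in> S ==> norm (g x) \<le> B * norm (f x)"
 shows "Lp_on p S g"
 unfolding Lp_on_def
proof
 note [measurable] = assms(2)
 show "g \<in> borel_measurable (lebesgue_on S)" by fact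
 show "integrable (lebesgue_on S) (\<lambda>x. norm (g x) ^ p)"
 proof (rule Bochner_Integration.integrable_bound[of _ "\<lambda>x. B ^ p * norm (f x) ^ p"])
  show "AE x in lebesgue_on S. norm (norm (g x) ^ p) \<le> norm (B ^ p * norm (f x) ^ p)"
  proof (rule AE_I2)
   fix x assume "x \<in> space (lebesgue_on S)"
   then have "norm (g x) ^ p \<le> (B * norm (f x)) ^ p" using assms(3) by (intro power_mono) auto
   then show "norm (norm (g x) ^ p) \<le> norm (B ^ p * norm (f x) ^ p)" by (simp add: power_mult_distrib)
  qed
 qed (use assms in \<open>auto simp: Lp_on_def\<close>)
qed

lemma Lp_on_bounded:
 fixes g :: "'a::euclidean_space => 'b::euclidean_space"
 assumes "S \<in> lmeasurable" "g \<in> borel_measurable (lebesgue_on S)" "\<And>x. x \<in> S ==> norm (g x) \<le> B"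
 shows "Lp_on p S g"
proof (rule Lp_on_bound[of p S "\<lambda>x. 1::real" g B])
 show "Lp_on p S (\<lambda>x. 1::real)"
  using assms(1) by (auto simp: Lp_on_def finite_measure.integrable_const finite_measure_lebesgue_on)
qed (use assms in auto)

lemma Lp_on_minus: "Lp_on p S f ==> Lp_on p S (\<lambda>x. - f x)"
 by (auto simp: Lp_on_def)

lemma Lp_on_diff: "Lp_on p S f ==> Lp_on p S g ==> Lp_on p S (\<lambda>x. f x - g x)"
 using Lp_on_add[OF _ Lp_on_minus] by simp

lemma Lp_on_subset:
 fixes f :: "'a::euclidean_space => 'b::euclidean_space"
 assumes "Lp_on p S f" "T \<subseteq> S" "T \<in> sets lebesgue" "S \<in> sets lebesgue"
 shows "Lp_on p T f"
proof -
 have "integrable (lebesgue_on S) (\<lambda>x. if x \<in> T then norm (f x) ^ p else 0)"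
 proof (rule Bochner_Integration.integrable_bound[of _ "\<lambda>x. norm (f x) ^ p"])
  have [measurable]: "f \<in> borel_measurable (lebesgue_on S)" using assms(1) by (simp add: Lp_on_def)
  have "T \<in> sets (lebesgue_on S)" using assms by (auto simp: sets_restrict_space)
  then show "(\<lambda>x. if x \<in> T then norm (f x) ^ p else 0) \<in> borel_measurable (lebesgue_on S)"
   by measurable
 qed (use assms in \<open>auto simp: Lp_on_def\<close>)
 then have "integrable (lebesgue_on T) (\<lambda>x. norm (f x) ^ p)"
  using integral_lebesgue_on_subset(2)[OF assms(2,4,3), of "\<lambda>x. if x \<in> T then norm (f x) ^ p else 0"]
   Bochner_Integration.integrable_cong[OF refl, of "lebesgue_on T" "\<lambda>x. if x \<in> T then norm (f x) ^ p else 0" "\<lambda>x. norm (f x) ^ p"]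
  by simp
 moreover have "f \<in> borel_measurable (lebesgue_on T)"
  by (rule measurable_restrict_mono[OF _ assms(2)]) (use assms(1) in \<open>simp add: Lp_on_def\<close>)
 ultimately show ?thesis by (simp add: Lp_on_def)
qed

definition Lp_tendsto ::
 "nat => 'a::euclidean_space set => (nat => 'a => 'b::euclidean_space) => ('a => 'b) => bool" where
 "Lp_tendsto p S F f \<longleftrightarrow> (\<forall>n. Lp_on p S (\<lambda>x. F n x - f x)) \<and>
   (\<lambda>n. LINT x|lebesgue_on S. norm (F n x - f x) ^ p) \<longlonglongrightarrow> 0"

lemma Lp_tendsto_bound:
 assumes F: "Lp_tendsto p S F f" and m: "\<And>n. (\<lambda>x. G n x - g x) \<in> borel_measurable (lebesgue_on S)"
  and B: "\<And>n x. x \<in> S ==> norm (G n x - g x) \<le> B * norm (F n x - f x)"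
 shows "Lp_tendsto p S G g"
 unfolding Lp_tendsto_def
proof (intro conjI allI)
 have L: "Lp_on p S (\<lambda>x. F n x - f x)" for n using F by (simp add: Lp_tendsto_def)
 show LG: "Lp_on p S (\<lambda>x. G n x - g x)" for n by (rule Lp_on_bound[OF L m B])
 have le: "(LINT x|lebesgue_on S. norm (G n x - g x) ^ p) \<le> B ^ p * (LINT x|lebesgue_on S. norm (F n x - f x) ^ p)" for n
 proof -
  have "(LINT x|lebesgue_on S. norm (G n x - g x) ^ p) \<le> (LINT x|lebesgue_on S. B ^ p * norm (F n x - f x) ^ p)"
  proof (rule integral_mono)
   fix x assume "x \<in> space (lebesgue_on S)"
   then have "norm (G n x - g x) ^ p \<le> (B * norm (F n x - f x)) ^ p" using B by (intro power_mono) auto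
   then show "norm (G n x - g x) ^ p \<le> B ^ p * norm (F n x - f x) ^ p" by (simp add: power_mult_distrib)
  qed (use L LG in \<open>auto simp: Lp_on_def\<close>)
  then show ?thesis by simp
 qed
 have "(\<lambda>n. B ^ p * (LINT x|lebesgue_on S. norm (F n x - f x) ^ p)) \<longlonglongrightarrow> 0"
  using F by (auto simp: Lp_tendsto_def intro: tendsto_mult_right_zero)
 then show "(\<lambda>n. LINT x|lebesgue_on S. norm (G n x - g x) ^ p) \<longlonglongrightarrow> 0"
  by (rule Lim_null_comparison[rotated]) (use le in auto)
qed

lemma Lp_tendsto_add:
 assumes F: "Lp_tendsto p S F f" and G: "Lp_tendsto p S G g"
 shows "Lp_tendsto p S (\<lambda>n x. F n x + G n x) (\<lambda>x. f x + g x)"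
 unfolding Lp_tendsto_def
proof (intro conjI allI)
 have L: "Lp_on p S (\<lambda>x. F n x - f x)" "Lp_on p S (\<lambda>x. G n x - g x)" for n
  using F G by (simp_all add: Lp_tendsto_def)
 show L': "Lp_on p S (\<lambda>x. F n x + G n x - (f x + g x))" for n
  using Lp_on_add[OF L(1)[of n] L(2)[of n]] by (simp add: algebra_simps)
 have le: "(LINT x|lebesgue_on S. norm (F n x + G n x - (f x + g x)) ^ p)
   \<le> 2 ^ p * ((LINT x|lebesgue_on S. norm (F n x - f x) ^ p) + (LINT x|lebesgue_on S. norm (G n x - g x) ^ p))" for n
 proof -
  have "(LINT x|lebesgue_on S. norm (F n x + G n x - (f x + g x)) ^ p)
   \<le> (LINT x|lebesgue_on S. 2 ^ p * (norm (F n x - f x) ^ p + norm (G n x - g x) ^ p))"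
  proof (rule integral_mono)
   show "norm (F n x + G n x - (f x + g x)) ^ p \<le> 2 ^ p * (norm (F n x - f x) ^ p + norm (G n x - g x) ^ p)" for x
    using norm_add_power_le[of "F n x - f x" "G n x - g x" p] by (simp add: algebra_simps)
  qed (use L L' in \<open>auto simp: Lp_on_def\<close>)
  also have "\<dots> = 2 ^ p * ((LINT x|lebesgue_on S. norm (F n x - f x) ^ p) + (LINT x|lebesgue_on S. norm (G n x - g x) ^ p))"
   using L by (subst integral_mult_right_zero, subst Bochner_Integration.integral_add) (auto simp: Lp_on_def)
  finally show ?thesis .
 qed
 have "(\<lambda>n. 2 ^ p * ((LINT x|lebesgue_on S. norm (F n x - f x) ^ p) + (LINT x|lebesgue_on S. norm (G n x - g x) ^ p))) \<longlonglongrightarrow> 2 ^ p * (0 + 0)"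
  using F G unfolding Lp_tendsto_def by (intro tendsto_mult tendsto_add tendsto_const) auto
 then have lim: "(\<lambda>n. 2 ^ p * ((LINT x|lebesgue_on S. norm (F n x - f x) ^ p) + (LINT x|lebesgue_on S. norm (G n x - g x) ^ p))) \<longlonglongrightarrow> 0"
  by simp
 show "(\<lambda>n. LINT x|lebesgue_on S. norm (F n x + G n x - (f x + g x)) ^ p) \<longlonglongrightarrow> 0"
  by (rule Lim_null_comparison[OF _ lim]) (use le in simp)
qed

text \<open>An elementary form of Young's inequality; all applications of Hoelder's inequality
 below are replaced by it.\<close>
lemma young_power:
 fixes a b e :: real
 assumes "a \<ge> 0" "b \<ge> 0" "e > 0" "p \<ge> 1"
 shows "a ^ (p - 1) * b \<le> e * a ^ p + b ^ p / e ^ (p - 1)"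
proof (cases "b \<le> e * a")
 case True
 have "a ^ (p - 1) * b \<le> a ^ (p - 1) * (e * a)" using True assms by (intro mult_left_mono) auto
 also have "\<dots> = e * a ^ p" using assms(4) by (cases p) auto
 also have "\<dots> \<le> e * a ^ p + b ^ p / e ^ (p - 1)" using assms by simp
 finally show ?thesis .
next
 case False
 then have "a \<le> b / e" using assms by (simp add: field_simps)
 then have "a ^ (p - 1) * b \<le> (b / e) ^ (p - 1) * b" using assms by (intro mult_right_mono power_mono) auto
 also have "\<dots> = b ^ p / e ^ (p - 1)" using assms(4) by (cases p) (auto simp: power_divide)
 also have "\<dots> \<le> e * a ^ p + b ^ p / e ^ (p - 1)" using assms by simp
 finally show ?thesis .
qed

lemma Lp_on_imp_integrable:
 assumes "Lp_on p S f" "S \<in> lmeasurable" "p \<ge> 1"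
 shows "integrable (lebesgue_on S) f"
proof (rule Bochner_Integration.integrable_bound[of _ "\<lambda>x. 1 + norm (f x) ^ p"])
 interpret finite_measure "lebesgue_on S" by (rule finite_measure_lebesgue_on[OF assms(2)])
 show "integrable (lebesgue_on S) (\<lambda>x. 1 + norm (f x) ^ p)"
  using assms(1) by (auto simp: Lp_on_def)
 show "AE x in lebesgue_on S. norm (f x) \<le> norm (1 + norm (f x) ^ p)"
  using young_power[of 1 "norm (f x)" 1 p for x] assms(3) by (intro AE_I2) simp
qed (use assms in \<open>auto simp: Lp_on_def\<close>)

lemma Lp_tendsto_integral:
 assumes F: "Lp_tendsto p S F f" and S: "S \<in> lmeasurable" and p: "p \<ge> 1"
  and v: "v \<in> borel_measurable (lebesgue_on S)" "\<And>x. x \<in> S ==> norm (v x) \<le> B"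
  and f: "integrable (lebesgue_on S) f"
 shows "(\<lambda>n. LINT x|lebesgue_on S. v x \<bullet> F n x) \<longlonglongrightarrow> (LINT x|lebesgue_on S. v x \<bullet> f x)"
proof -
 interpret finite_measure "lebesgue_on S" by (rule finite_measure_lebesgue_on[OF S])
 note [measurable] = v(1)
 define a where "a n = (LINT x|lebesgue_on S. norm (F n x - f x) ^ p)" for n
 have L: "Lp_on p S (\<lambda>x. F n x - f x)" for n using F by (simp add: Lp_tendsto_def)
 have i: "integrable (lebesgue_on S) (\<lambda>x. F n x - f x)" for n by (rule Lp_on_imp_integrable[OF L S p])
 have vi: "integrable (lebesgue_on S) (\<lambda>x. v x \<bullet> k x)" if k: "integrable (lebesgue_on S) k" for k
 proof (rule Bochner_Integration.integrable_bound[of _ "\<lambda>x. B *\<^sub>R k x"])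
  have [measurable]: "k \<in> borel_measurable (lebesgue_on S)" using k by auto
  show "(\<lambda>x. v x \<bullet> k x) \<in> borel_measurable (lebesgue_on S)" by measurable
  show "AE x in lebesgue_on S. norm (v x \<bullet> k x) \<le> norm (B *\<^sub>R k x)"
  proof (rule AE_I2)
   fix x assume "x \<in> space (lebesgue_on S)"
   then have "norm (v x) * norm (k x) \<le> B * norm (k x)" using v(2) by (intro mult_right_mono) auto
   then show "norm (v x \<bullet> k x) \<le> norm (B *\<^sub>R k x)"
    using Cauchy_Schwarz_ineq2[of "v x" "k x"] abs_ge_self[of B] mult_right_mono[OF abs_ge_self[of B] norm_ge_zero[of "k x"]]
    by simp
  qed
 qed (use k in auto)
 have B0: "\<bar>B\<bar> \<ge> B" by simp
 have le: "\<bar>(LINT x|lebesgue_on S. v x \<bullet> F n x) - (LINT x|lebesgue_on S. v x \<bullet> f x)\<bar>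
   \<le> \<bar>B\<bar> * (e * measure lebesgue S + a n / e ^ (p - 1))" if e: "e > 0" for n e
 proof -
  have iF: "integrable (lebesgue_on S) (F n)"
   using Bochner_Integration.integrable_add[OF i[of n] f] by simp
  have "(LINT x|lebesgue_on S. v x \<bullet> F n x) - (LINT x|lebesgue_on S. v x \<bullet> f x) = (LINT x|lebesgue_on S. v x \<bullet> (F n x - f x))"
   unfolding inner_diff_right by (rule Bochner_Integration.integral_diff[symmetric]) (use vi[OF iF] vi[OF f] in auto)
  moreover have "norm (LINT x|lebesgue_on S. v x \<bullet> (F n x - f x)) \<le> (LINT x|lebesgue_on S. \<bar>B\<bar> * (e + norm (F n x - f x) ^ p / e ^ (p - 1)))"
  proof (rule Bochner_Integration.integral_norm_bound_integral)
   show "integrable (lebesgue_on S) (\<lambda>x. v x \<bullet> (F n x - f x))" by (rule vi[OF i])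
   show "integrable (lebesgue_on S) (\<lambda>x. \<bar>B\<bar> * (e + norm (F n x - f x) ^ p / e ^ (p - 1)))"
    using L[of n] by (auto simp: Lp_on_def)
   fix x assume "x \<in> space (lebesgue_on S)"
   then have "\<bar>v x \<bullet> (F n x - f x)\<bar> \<le> B * norm (F n x - f x)"
    using order_trans[OF Cauchy_Schwarz_ineq2 mult_right_mono[OF v(2) norm_ge_zero]] by simp
   also have "\<dots> \<le> \<bar>B\<bar> * norm (F n x - f x)" by (rule mult_right_mono) auto
   also have "\<dots> \<le> \<bar>B\<bar> * (e + norm (F n x - f x) ^ p / e ^ (p - 1))"
    using young_power[of 1 "norm (F n x - f x)" e p] e p by (intro mult_left_mono) auto
   finally show "norm (v x \<bullet> (F n x - f x)) \<le> \<bar>B\<bar> * (e + norm (F n x - f x) ^ p / e ^ (p - 1))" by simp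
  qed
  moreover have "(LINT x|lebesgue_on S. \<bar>B\<bar> * (e + norm (F n x - f x) ^ p / e ^ (p - 1))) = \<bar>B\<bar> * (e * measure lebesgue S + a n / e ^ (p - 1))"
   using L[of n] S by (simp add: Lp_on_def a_def measure_restrict_space fmeasurableD)
  ultimately show ?thesis by (metis real_norm_def)
 qed
 have a0: "a \<longlonglongrightarrow> 0" using F by (simp add: Lp_tendsto_def a_def[abs_def])
 have "(\<lambda>n. (LINT x|lebesgue_on S. v x \<bullet> F n x) - (LINT x|lebesgue_on S. v x \<bullet> f x)) \<longlonglongrightarrow> 0"
 proof (rule LIMSEQ_I)
  fix r :: real assume r: "0 < r"
  define e where "e = r / (2 * (\<bar>B\<bar> + 1) * (measure lebesgue S + 1))"
  have m: "measure lebesgue S \<ge> 0" by simp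
  have e: "e > 0" using r m by (simp add: e_def add_nonneg_pos)
  have "(\<lambda>n. \<bar>B\<bar> * (e * measure lebesgue S + a n / e ^ (p - 1))) \<longlonglongrightarrow> \<bar>B\<bar> * (e * measure lebesgue S + 0 / e ^ (p - 1))"
   by (intro tendsto_intros a0) (use e in auto)
  moreover have "\<bar>B\<bar> * (e * measure lebesgue S + 0 / e ^ (p - 1)) < r"
  proof -
   have "\<bar>B\<bar> * (e * measure lebesgue S) \<le> (\<bar>B\<bar> + 1) * (e * (measure lebesgue S + 1))"
    using e m by (intro mult_mono) auto
   also have "\<dots> = r / 2" using m by (simp add: e_def field_simps add_nonneg_eq_0_iff)
   also have "\<dots> < r" using r by simp
   finally show ?thesis by simp
  qed
  ultimately have "\<forall>\<^sub>F n in sequentially. \<bar>B\<bar> * (e * measure lebesgue S + a n / e ^ (p - 1)) < r"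
   by (rule order_tendstoD(2))
  then obtain N where N: "\<And>n. n \<ge> N ==> \<bar>B\<bar> * (e * measure lebesgue S + a n / e ^ (p - 1)) < r"
   by (auto simp: eventually_sequentially)
  show "\<exists>no. \<forall>n\<ge>no. norm ((LINT x|lebesgue_on S. v x \<bullet> F n x) - (LINT x|lebesgue_on S. v x \<bullet> f x) - 0) < r"
  proof (intro exI[of _ N] allI impI)
   fix n assume "N \<le> n"
   then show "norm ((LINT x|lebesgue_on S. v x \<bullet> F n x) - (LINT x|lebesgue_on S. v x \<bullet> f x) - 0) < r"
    using order_le_less_trans[OF le[OF e, of n] N] by simp
  qed
 qed
 then show ?thesis by (simp add: LIM_zero_iff)
qed

text \<open>The condition \<open>f = 0\<close> on \<open>G\<close> in a form in which function and gradient enter separately.\<close>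
definition Sobolev_limit ::
 "nat => 'a::euclidean_space set => 'a set => ('a => real) => ('a => 'a) => (nat => 'a => real) => bool" where
 "Sobolev_limit p S G f g F \<longleftrightarrow>
   (\<forall>n. smooth_on UNIV (F n) \<and> (\<exists>U. open U \<and> closure G \<subseteq> U \<and> (\<forall>x\<in>U \<inter> closure S. F n x = 0))) \<and>
   Lp_tendsto p S F f \<and> Lp_tendsto p S (\<lambda>n. grad (F n)) g"

lemma smooth_Lp_on:
 assumes "open S" "bounded S" "smooth_on UNIV F"
 shows "Lp_on p S F" "Lp_on p S (grad F)"
proof -
 have S: "S \<in> lmeasurable" "S \<in> sets lebesgue" using assms by (auto intro: lmeasurable_open)
 have c: "compact (closure S)" using assms by simp
 have 1: "continuous_on (closure S) F" "continuous_on (closure S) (grad F)"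
  using smooth_on_continuous[OF assms(3)] smooth_on_grad_continuous[OF assms(3)] by auto
 obtain B where B: "\<And>x. x \<in> closure S ==> norm (F x) \<le> B"
  using compact_imp_bounded[OF compact_continuous_image[OF 1(1) c]] by (force simp: bounded_iff)
 obtain B' where B': "\<And>x. x \<in> closure S ==> norm (grad F x) \<le> B'"
  using compact_imp_bounded[OF compact_continuous_image[OF 1(2) c]] by (force simp: bounded_iff)
 have cl: "S \<subseteq> closure S" by (rule closure_subset)
 show "Lp_on p S F"
  by (rule Lp_on_bounded[OF S(1) continuous_imp_measurable_on_sets_lebesgue[OF continuous_on_subset[OF 1(1) cl] S(2)]])
    (use B cl in auto)
 show "Lp_on p S (grad F)"
  by (rule Lp_on_bounded[OF S(1) continuous_imp_measurable_on_sets_lebesgue[OF continuous_on_subset[OF 1(2) cl] S(2)]])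
    (use B' cl in auto)
qed

lemma vanishes_on_iff:
 assumes S: "open S" "bounded S" and p: "p \<ge> 1"
 shows "vanishes_on p S G f \<longleftrightarrow> (\<exists>g. W1p p S f g \<and> (\<exists>F. Sobolev_limit p S G f g F))"
proof -
 have eq: "Sobolev_limit p S G f g F \<longleftrightarrow>
   (\<forall>n. smooth_on UNIV (F n) \<and> (\<exists>U. open U \<and> closure G \<subseteq> U \<and> (\<forall>x\<in>U \<inter> closure S. F n x = 0))) \<and>
   (\<lambda>n. W1p_norm p S (\<lambda>x. F n x - f x) (\<lambda>x. grad (F n) x - g x)) \<longlonglongrightarrow> 0" if W: "W1p p S f g" for g F
 proof (cases "\<forall>n. smooth_on UNIV (F n)")
  case True
  define a where "a n = (LINT x|lebesgue_on S. \<bar>F n x - f x\<bar> ^ p)" for n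
  define b where "b n = (LINT x|lebesgue_on S. norm (grad (F n) x - g x) ^ p)" for n
  have ab: "a n \<ge> 0" "b n \<ge> 0" for n by (auto simp: a_def b_def)
  have r: "W1p_norm p S (\<lambda>x. F n x - f x) (\<lambda>x. grad (F n) x - g x) = root p (a n + b n)" for n
   by (simp add: W1p_norm_def a_def b_def)
  have "(\<lambda>n. root p (a n + b n)) \<longlonglongrightarrow> 0 \<longleftrightarrow> a \<longlonglongrightarrow> 0 \<and> b \<longlonglongrightarrow> 0"
  proof
   assume "(\<lambda>n. root p (a n + b n)) \<longlonglongrightarrow> 0"
   then have "(\<lambda>n. root p (a n + b n) ^ p) \<longlonglongrightarrow> 0 ^ p" by (rule tendsto_power)
   then have lim: "(\<lambda>n. a n + b n) \<longlonglongrightarrow> 0" using p ab by (simp add: power_0_left)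
   have "a \<longlonglongrightarrow> 0" by (rule Lim_null_comparison[OF _ lim]) (use ab in simp)
   moreover have "b \<longlonglongrightarrow> 0" by (rule Lim_null_comparison[OF _ lim]) (use ab in simp)
   ultimately show "a \<longlonglongrightarrow> 0 \<and> b \<longlonglongrightarrow> 0" by simp
  next
   assume "a \<longlonglongrightarrow> 0 \<and> b \<longlonglongrightarrow> 0"
   then have "(\<lambda>n. root p (a n + b n)) \<longlonglongrightarrow> root p (0 + 0)"
    by (intro tendsto_real_root tendsto_add) auto
   then show "(\<lambda>n. root p (a n + b n)) \<longlonglongrightarrow> 0" by simp
  qed
  moreover have "Lp_on p S (\<lambda>x. F n x - f x)" "Lp_on p S (\<lambda>x. grad (F n) x - g x)" for n
   using W smooth_Lp_on[OF S True[rule_format, of n]] by (auto simp: W1p_def intro: Lp_on_diff)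
  ultimately show ?thesis
   unfolding Sobolev_limit_def Lp_tendsto_def r by (simp add: a_def[abs_def] b_def[abs_def])
 next
  case False
  then show ?thesis unfolding Sobolev_limit_def by blast
 qed
 show ?thesis unfolding vanishes_on_def using eq by blast
qed

lemma Sobolev_limit_add:
 assumes F: "Sobolev_limit p S G f g F" and F': "Sobolev_limit p S G f' g' F'"
 shows "Sobolev_limit p S G (\<lambda>x. f x + f' x) (\<lambda>x. g x + g' x) (\<lambda>n x. F n x + F' n x)"
 unfolding Sobolev_limit_def
proof (intro conjI allI)
 have s: "smooth_on UNIV (F n)" "smooth_on UNIV (F' n)" for n using F F' by (auto simp: Sobolev_limit_def)
 show "smooth_on UNIV (\<lambda>x. F n x + F' n x)" for n by (intro smooth_on_add s)
 have "grad (\<lambda>x. F n x + F' n x) = (\<lambda>x. grad (F n) x + grad (F' n) x)" for n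
  by (rule ext) (intro GDERIV_grad GDERIV_add smooth_on_GDERIV s)
 then show "Lp_tendsto p S (\<lambda>n. grad (\<lambda>x. F n x + F' n x)) (\<lambda>x. g x + g' x)"
  using F F' by (simp add: Sobolev_limit_def Lp_tendsto_add)
 show "Lp_tendsto p S (\<lambda>n x. F n x + F' n x) (\<lambda>x. f x + f' x)"
  using F F' by (simp add: Sobolev_limit_def Lp_tendsto_add)
 fix n
 obtain U U' where "open U" "closure G \<subseteq> U" "\<forall>x\<in>U \<inter> closure S. F n x = 0"
  "open U'" "closure G \<subseteq> U'" "\<forall>x\<in>U' \<inter> closure S. F' n x = 0"
  using F F' unfolding Sobolev_limit_def by metis
 then show "\<exists>U. open U \<and> closure G \<subseteq> U \<and> (\<forall>x\<in>U \<inter> closure S. F n x + F' n x = 0)"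
  by (intro exI[of _ "U \<inter> U'"]) auto
qed

lemma Sobolev_limit_mult:
 assumes S: "open S" "bounded S" and F: "Sobolev_limit p S G f g F" and \<eta>: "smooth_on UNIV \<eta>"
 shows "Sobolev_limit p S G (\<lambda>x. \<eta> x * f x) (\<lambda>x. \<eta> x *\<^sub>R g x + f x *\<^sub>R grad \<eta> x) (\<lambda>n x. \<eta> x * F n x)"
 unfolding Sobolev_limit_def
proof (intro conjI allI)
 have S': "S \<in> sets lebesgue" using S by simp
 have s: "smooth_on UNIV (F n)" for n using F by (auto simp: Sobolev_limit_def)
 have F': "Lp_tendsto p S F f" "Lp_tendsto p S (\<lambda>n. grad (F n)) g" using F by (auto simp: Sobolev_limit_def)
 have c: "compact (closure S)" using S by simp
 have 1: "continuous_on A \<eta>" "continuous_on A (grad \<eta>)" for A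
  using smooth_on_continuous[OF \<eta>] smooth_on_grad_continuous[OF \<eta>] by auto
 have [measurable]: "\<eta> \<in> borel_measurable (lebesgue_on S)" "grad \<eta> \<in> borel_measurable (lebesgue_on S)"
  using continuous_imp_measurable_on_sets_lebesgue[OF 1(1) S'] continuous_imp_measurable_on_sets_lebesgue[OF 1(2) S'] by auto
 obtain B where B: "\<And>x. x \<in> closure S ==> norm (\<eta> x) \<le> B"
  using compact_imp_bounded[OF compact_continuous_image[OF 1(1) c]] by (force simp: bounded_iff)
 obtain B' where B': "\<And>x. x \<in> closure S ==> norm (grad \<eta> x) \<le> B'"
  using compact_imp_bounded[OF compact_continuous_image[OF 1(2) c]] by (force simp: bounded_iff)
 have cl: "S \<subseteq> closure S" by (rule closure_subset)
 have [measurable]: "(\<lambda>x. F n x - f x) \<in> borel_measurable (lebesgue_on S)"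
  "(\<lambda>x. grad (F n) x - g x) \<in> borel_measurable (lebesgue_on S)" for n
  using F' by (auto simp: Lp_tendsto_def Lp_on_def)
 show "smooth_on UNIV (\<lambda>x. \<eta> x * F n x)" for n by (intro smooth_on_mult s \<eta>)
 show "Lp_tendsto p S (\<lambda>n x. \<eta> x * F n x) (\<lambda>x. \<eta> x * f x)"
 proof (rule Lp_tendsto_bound[OF F'(1), of _ _ B])
  show "norm (\<eta> x * F n x - \<eta> x * f x) \<le> B * norm (F n x - f x)" if "x \<in> S" for n x
   using B[of x] cl that by (auto simp: abs_mult intro!: mult_right_mono simp flip: right_diff_distrib)
  show "(\<lambda>x. \<eta> x * F n x - \<eta> x * f x) \<in> borel_measurable (lebesgue_on S)" for n
   unfolding right_diff_distrib[symmetric] by measurable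
 qed
 have t1: "Lp_tendsto p S (\<lambda>n x. \<eta> x *\<^sub>R grad (F n) x) (\<lambda>x. \<eta> x *\<^sub>R g x)"
 proof (rule Lp_tendsto_bound[OF F'(2), of _ _ B])
  show "norm (\<eta> x *\<^sub>R grad (F n) x - \<eta> x *\<^sub>R g x) \<le> B * norm (grad (F n) x - g x)" if "x \<in> S" for n x
   using B[of x] cl that by (auto intro!: mult_right_mono simp flip: scaleR_diff_right)
  show "(\<lambda>x. \<eta> x *\<^sub>R grad (F n) x - \<eta> x *\<^sub>R g x) \<in> borel_measurable (lebesgue_on S)" for n
   unfolding scaleR_diff_right[symmetric] by measurable
 qed
 have t2: "Lp_tendsto p S (\<lambda>n x. F n x *\<^sub>R grad \<eta> x) (\<lambda>x. f x *\<^sub>R grad \<eta> x)"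
 proof (rule Lp_tendsto_bound[OF F'(1), of _ _ B'])
  show "norm (F n x *\<^sub>R grad \<eta> x - f x *\<^sub>R grad \<eta> x) \<le> B' * norm (F n x - f x)" if "x \<in> S" for n x
   using B'[of x] cl that by (auto simp: mult.commute[of B'] intro!: mult_left_mono simp flip: scaleR_diff_left)
  show "(\<lambda>x. F n x *\<^sub>R grad \<eta> x - f x *\<^sub>R grad \<eta> x) \<in> borel_measurable (lebesgue_on S)" for n
   unfolding scaleR_diff_left[symmetric] by measurable
 qed
 have "grad (\<lambda>x. \<eta> x * F n x) = (\<lambda>x. \<eta> x *\<^sub>R grad (F n) x + F n x *\<^sub>R grad \<eta> x)" for n
  by (rule ext) (intro GDERIV_grad GDERIV_mult smooth_on_GDERIV s \<eta>)
 then show "Lp_tendsto p S (\<lambda>n. grad (\<lambda>x. \<eta> x * F n x)) (\<lambda>x. \<eta> x *\<^sub>R g x + f x *\<^sub>R grad \<eta> x)"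
  using Lp_tendsto_add[OF t1 t2] by simp
 fix n
 obtain U where "open U" "closure G \<subseteq> U" "\<forall>x\<in>U \<inter> closure S. F n x = 0"
  using F unfolding Sobolev_limit_def by metis
 then show "\<exists>U. open U \<and> closure G \<subseteq> U \<and> (\<forall>x\<in>U \<inter> closure S. \<eta> x * F n x = 0)"
  by (intro exI[of _ U]) auto
qed

section \<open>Anisotropic norms and their duals\<close>

text \<open>Young's form of the symmetry of second derivatives: second-order differences of \<open>f\<close>
 are symmetric in the two directions.\<close>
lemma second_derivative_symmetric:
 fixes f :: "'a::euclidean_space => real"
 assumes S: "open S" "x \<in> S" and f: "\<And>y. y \<in> S ==> GDERIV f y :> g y" and g: "(g has_derivative G) (at x)"
 shows "h \<bullet> G k = k \<bullet> G h"
proof -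
 interpret G: bounded_linear G using g by (rule has_derivative_bounded_linear)
 have main: "\<exists>d>0. \<forall>t. 0 < t \<and> t < d -->
   \<bar>f (x + t *\<^sub>R h + t *\<^sub>R k) - f (x + t *\<^sub>R h) - f (x + t *\<^sub>R k) + f x - t\<^sup>2 * (h \<bullet> G k)\<bar> \<le> e * t\<^sup>2"
  if e: "e > 0" for e h k
 proof -
  define c where "c = norm h * (2 * norm h + norm k + 1) + 1"
  have c: "c > 0" unfolding c_def by (intro add_nonneg_pos mult_nonneg_nonneg) auto
  obtain d where d: "d > 0" and dg: "\<And>y. norm (y - x) < d ==> norm (g y - g x - G (y - x)) \<le> (e / c) * norm (y - x)"
   using g[unfolded has_derivative_at_alt] e c by (metis divide_pos_pos)
  obtain d' where d': "d' > 0" "ball x d' \<subseteq> S" using S open_contains_ball by metis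
  define D where "D = min d d' / (norm h + norm k + 1)"
  have nn: "norm h + norm k + 1 > 0" by (intro add_nonneg_pos add_nonneg_nonneg) auto
  have D: "D > 0" using d d' nn by (simp add: D_def)
  have small: "norm (s *\<^sub>R (t *\<^sub>R h) + r *\<^sub>R (t *\<^sub>R k)) < min d d'"
   if t: "0 < t" "t < D" and s: "0 \<le> s" "s \<le> 1" "0 \<le> r" "r \<le> 1" for s t r
  proof -
   have "norm (s *\<^sub>R (t *\<^sub>R h) + r *\<^sub>R (t *\<^sub>R k)) \<le> s * (t * norm h) + r * (t * norm k)"
    by (rule norm_triangle_le) (use t s in simp)
   also have "\<dots> \<le> 1 * (t * norm h) + 1 * (t * norm k)"
    using t s by (intro add_mono mult_right_mono) auto
   also have "\<dots> \<le> t * (norm h + norm k + 1)" using t by (simp add: algebra_simps)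
   also have "\<dots> < D * (norm h + norm k + 1)" using t nn by (intro mult_strict_right_mono)
   also have "\<dots> = min d d'" using nn by (simp add: D_def)
   finally show ?thesis .
  qed
  have "\<bar>f (x + t *\<^sub>R h + t *\<^sub>R k) - f (x + t *\<^sub>R h) - f (x + t *\<^sub>R k) + f x - t\<^sup>2 * (h \<bullet> G k)\<bar> \<le> e * t\<^sup>2"
   if t: "0 < t" "t < D" for t
  proof -
   let ?p = "\<lambda>s. x + s *\<^sub>R (t *\<^sub>R h)" and ?q = "\<lambda>s. (x + t *\<^sub>R k) + s *\<^sub>R (t *\<^sub>R h)"
   have inS: "?p s \<in> S" "?q s \<in> S" if "0 \<le> s" "s \<le> 1" for s
    using small[OF t that, of 0] small[OF t that, of 1] d'(2) by (auto simp: dist_norm subset_iff norm_minus_commute add.assoc)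
      (metis add.commute add.left_commute add_diff_cancel_left' dist_norm mem_ball norm_minus_commute)+
   have dq: "((\<lambda>s. f (?q s) - f (?p s)) has_real_derivative ((t *\<^sub>R h) \<bullet> g (?q s) - (t *\<^sub>R h) \<bullet> g (?p s))) (at s)"
    if "0 \<le> s" "s \<le> 1" for s
    by (intro DERIV_diff GDERIV_along_line f inS that)
   have "\<exists>s>0. s < 1 \<and> (f (?q 1) - f (?p 1)) - (f (?q 0) - f (?p 0)) = (1 - 0) * ((t *\<^sub>R h) \<bullet> g (?q s) - (t *\<^sub>R h) \<bullet> g (?p s))"
    by (rule MVT2[of 0 1 "\<lambda>s. f (?q s) - f (?p s)"]) (use dq in \<open>auto simp only: zero_less_one\<close>)
   then obtain s where s: "0 < s" "s < 1" and
    eq: "(f (?q 1) - f (?p 1)) - (f (?q 0) - f (?p 0)) = t * (h \<bullet> (g (?q s) - g (?p s)))"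
    by (auto simp: inner_diff_right right_diff_distrib)
   have q: "?q s - x = s *\<^sub>R (t *\<^sub>R h) + 1 *\<^sub>R (t *\<^sub>R k)" and p: "?p s - x = s *\<^sub>R (t *\<^sub>R h) + 0 *\<^sub>R (t *\<^sub>R k)"
    by auto
   have nq: "norm (g (?q s) - g x - G (?q s - x)) \<le> (e / c) * norm (?q s - x)"
    using small[OF t, of s 1] s by (intro dg) (simp only: q, simp)
   have np: "norm (g (?p s) - g x - G (?p s - x)) \<le> (e / c) * norm (?p s - x)"
    using small[OF t, of s 0] s by (intro dg) (simp only: p, simp)
   have nq': "norm (?q s - x) \<le> t * (norm h + norm k)"
   proof -
    have "norm (?q s - x) \<le> s * (t * norm h) + t * norm k"
     unfolding q by (rule norm_triangle_le) (use t s in simp)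
    also have "\<dots> \<le> 1 * (t * norm h) + t * norm k" using s t by (intro add_mono mult_right_mono) auto
    finally show ?thesis by (simp add: algebra_simps)
   qed
   have np': "norm (?p s - x) \<le> t * norm h"
    unfolding p using s t mult_right_mono[of s 1 "t * norm h"] by simp
   have Gk: "G (?q s - x) - G (?p s - x) = t *\<^sub>R G k"
    by (subst G.diff[symmetric]) (simp add: G.scaleR)
   have "norm (g (?q s) - g (?p s) - t *\<^sub>R G k)
     = norm ((g (?q s) - g x - G (?q s - x)) - (g (?p s) - g x - G (?p s - x)))"
    unfolding Gk[symmetric] by (simp add: algebra_simps)
   also have "\<dots> \<le> (e / c) * norm (?q s - x) + (e / c) * norm (?p s - x)"
    using norm_triangle_ineq4 nq np by (rule order_trans[OF _ add_mono])
   also have "\<dots> \<le> (e / c) * (t * (norm h + norm k)) + (e / c) * (t * norm h)"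
    using nq' np' e c by (intro add_mono mult_left_mono) auto
   also have "\<dots> = (e / c) * t * (2 * norm h + norm k)" by (simp add: algebra_simps)
   finally have b: "norm (g (?q s) - g (?p s) - t *\<^sub>R G k) \<le> (e / c) * t * (2 * norm h + norm k)" .
   have "f (x + t *\<^sub>R h + t *\<^sub>R k) - f (x + t *\<^sub>R h) - f (x + t *\<^sub>R k) + f x - t\<^sup>2 * (h \<bullet> G k)
     = (f (?q 1) - f (?p 1)) - (f (?q 0) - f (?p 0)) - t\<^sup>2 * (h \<bullet> G k)"
    by (simp add: algebra_simps)
   also have "\<dots> = t * (h \<bullet> (g (?q s) - g (?p s) - t *\<^sub>R G k))"
    unfolding eq by (simp add: inner_diff_right algebra_simps power2_eq_square)
   finally have "\<bar>f (x + t *\<^sub>R h + t *\<^sub>R k) - f (x + t *\<^sub>R h) - f (x + t *\<^sub>R k) + f x - t\<^sup>2 * (h \<bullet> G k)\<bar>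
     = t * \<bar>h \<bullet> (g (?q s) - g (?p s) - t *\<^sub>R G k)\<bar>"
    using t by (simp add: abs_mult)
   also have "\<dots> \<le> t * (norm h * ((e / c) * t * (2 * norm h + norm k)))"
    using t by (intro mult_left_mono order_trans[OF Cauchy_Schwarz_ineq2 mult_left_mono[OF b]]) auto
   also have "\<dots> = e * t\<^sup>2 * (norm h * (2 * norm h + norm k) / c)"
    by (simp add: power2_eq_square)
   also have "\<dots> \<le> e * t\<^sup>2 * 1"
   proof (rule mult_left_mono)
    show "norm h * (2 * norm h + norm k) / c \<le> 1" using c by (simp add: c_def algebra_simps)
   qed (use e in simp)
   finally show ?thesis by simp
  qed
  then show ?thesis using D by blast
 qed
 have "\<bar>h \<bullet> G k - k \<bullet> G h\<bar> \<le> 0 + e" if e: "e > 0" for e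
 proof -
  obtain d where d: "d > 0" "\<And>t. 0 < t \<and> t < d ==>
   \<bar>f (x + t *\<^sub>R h + t *\<^sub>R k) - f (x + t *\<^sub>R h) - f (x + t *\<^sub>R k) + f x - t\<^sup>2 * (h \<bullet> G k)\<bar> \<le> (e/2) * t\<^sup>2"
   using main[of "e/2" h k] e by auto
  obtain d' where d': "d' > 0" "\<And>t. 0 < t \<and> t < d' ==>
   \<bar>f (x + t *\<^sub>R k + t *\<^sub>R h) - f (x + t *\<^sub>R k) - f (x + t *\<^sub>R h) + f x - t\<^sup>2 * (k \<bullet> G h)\<bar> \<le> (e/2) * t\<^sup>2"
   using main[of "e/2" k h] e by auto
  define t where "t = min d d' / 2"
  have t: "0 < t" "t < d" "t < d'" using d d' by (auto simp: t_def)
  have sw: "x + t *\<^sub>R k + t *\<^sub>R h = x + t *\<^sub>R h + t *\<^sub>R k" by (simp add: algebra_simps)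
  have "\<bar>t\<^sup>2 * (h \<bullet> G k) - t\<^sup>2 * (k \<bullet> G h)\<bar> \<le> e * t\<^sup>2"
   using d(2)[OF conjI[OF t(1,2)]] d'(2)[OF conjI[OF t(1,3)]] unfolding sw by linarith
  then have "t\<^sup>2 * \<bar>h \<bullet> G k - k \<bullet> G h\<bar> \<le> t\<^sup>2 * e"
   by (simp add: abs_mult flip: right_diff_distrib) (simp add: mult.commute)
  then show ?thesis using t by simp
 qed
 then have "\<bar>h \<bullet> G k - k \<bullet> G h\<bar> \<le> 0" by (rule field_le_epsilon)
 then show ?thesis by simp
qed

locale elliptic_norm =
 fixes H :: "real^'n => real"
 assumes dim: "2 \<le> CARD('n)" and C2: "Ck_on 2 (UNIV - {0}) H" and hom: "pos_homogeneous H"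
  and pos_sphere: "\<forall>\<xi>\<in>sphere 0 1. 0 < H \<xi>" and elliptic: "uniformly_elliptic H"
begin

abbreviation DH :: "real^'n => real^'n" where "DH \<equiv> grad H"

lemma H_scale: "t > 0 ==> H (t *\<^sub>R x) = t * H x"
 using hom by (auto simp: pos_homogeneous_def)

lemma H_0 [simp]: "H 0 = 0"
 using H_scale[of 2 0] by simp

lemma H_pos: "x \<noteq> 0 ==> 0 < H x"
 using H_scale[of "norm x" "x /\<^sub>R norm x"] pos_sphere by auto

lemma H_nonneg: "0 \<le> H x"
 using H_pos[of x] by (cases "x = 0") auto

lemma H_eq_0_iff: "H x = 0 \<longleftrightarrow> x = 0"
 using H_pos[of x] H_0 by (metis less_irrefl)

lemma op: "open (UNIV - {0::real^'n})"
 by (simp add: open_Diff)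

lemma C2': "Ck_on (Suc (Suc 0)) (UNIV - {0}) H"
 using C2 by (simp add: numeral_2_eq_2)

lemma H_GDERIV: "x \<noteq> 0 ==> GDERIV H x :> DH x"
 by (rule Ck_on_Suc_GDERIV[OF C2']) simp

lemma DH_C1: "b \<in> Basis ==> Ck_on (Suc 0) (UNIV - {0}) (\<lambda>x. b \<bullet> DH x)"
 using C2' unfolding Ck_on_Suc_grad[OF op, of "Suc 0"] by blast

lemma DH_continuous: "continuous_on (UNIV - {0}) DH"
 by (rule Ck_on_grad_continuous[OF op Ck_on_Suc_imp[OF op C2']])

lemma H_continuous_off_0: "continuous_on (UNIV - {0}) H"
 by (rule GDERIV_continuous_on) (use H_GDERIV in auto)

definition hess :: "real^'n => real^'n => real^'n" where
 "hess x h = (\<Sum>b\<in>Basis. (h \<bullet> grad (\<lambda>y. b \<bullet> DH y) x) *\<^sub>R b)"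

lemma hess: assumes "x \<noteq> 0" shows "(DH has_derivative hess x) (at x)"
proof -
 have "((\<lambda>y. \<Sum>b\<in>Basis. (b \<bullet> DH y) *\<^sub>R b) has_derivative hess x) (at x)"
  unfolding hess_def[abs_def]
 proof (rule has_derivative_sum)
  fix b :: "real^'n" assume b: "b \<in> Basis"
  have "GDERIV (\<lambda>y. b \<bullet> DH y) x :> grad (\<lambda>y. b \<bullet> DH y) x"
   by (rule Ck_on_Suc_GDERIV[OF DH_C1[OF b]]) (use assms in simp)
  then show "((\<lambda>y. (b \<bullet> DH y) *\<^sub>R b) has_derivative (\<lambda>h. (h \<bullet> grad (\<lambda>y. b \<bullet> DH y) x) *\<^sub>R b)) (at x)"
   unfolding gderiv_def by (rule has_derivative_scaleR_left)
 qed
 moreover have "(\<Sum>b\<in>Basis. (b \<bullet> DH y) *\<^sub>R b) = DH y" for y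
  by (simp add: inner_commute[of _ "DH y"] euclidean_representation)
 ultimately show ?thesis by simp
qed

lemma hess_linear: "linear (hess x)"
 unfolding hess_def[abs_def]
 by (rule linearI) (auto simp: inner_add_left scaleR_add_left sum.distrib scaleR_sum_right)

lemma hess_continuous: "continuous_on ((UNIV - {0}) \<times> UNIV) (\<lambda>(x, h). hess x h)"
proof -
 have "continuous_on (UNIV - {0}) (grad (\<lambda>y. b \<bullet> DH y))" if "b \<in> Basis" for b
  by (rule Ck_on_grad_continuous[OF op DH_C1[OF that]])
 then have "continuous_on ((UNIV - {0}) \<times> UNIV) (\<lambda>z. grad (\<lambda>y. b \<bullet> DH y) (fst z))" if "b \<in> Basis" for b
  by (rule continuous_on_compose2) (use that in \<open>auto intro!: continuous_intros\<close>)
 then show ?thesis unfolding split_beta hess_def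
  by (intro continuous_on_sum continuous_on_scaleR continuous_on_inner continuous_intros) auto
qed

lemma hess_symmetric: "x \<noteq> 0 ==> h \<bullet> hess x k = k \<bullet> hess x h"
 by (rule second_derivative_symmetric[OF op _ H_GDERIV hess]) auto

lemma DH_scale:
 assumes "t > 0" "x \<noteq> 0" shows "DH (t *\<^sub>R x) = DH x"
proof -
 have "GDERIV (\<lambda>y. H (0 + t *\<^sub>R y)) x :> t *\<^sub>R DH (t *\<^sub>R x)"
  by (rule GDERIV_affine) (use assms in \<open>simp add: H_GDERIV\<close>)
 moreover have "GDERIV (\<lambda>y. H (0 + t *\<^sub>R y)) x :> t *\<^sub>R DH x"
  using GDERIV_cmult[OF H_GDERIV[OF assms(2)], of t] assms(1) by (simp add: H_scale)
 ultimately have "t *\<^sub>R DH (t *\<^sub>R x) = t *\<^sub>R DH x" by (rule GDERIV_unique)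
 then show ?thesis using assms(1) by simp
qed

lemma Euler: assumes "x \<noteq> 0" shows "x \<bullet> DH x = H x"
proof -
 have "((\<lambda>t. H (0 + t *\<^sub>R x)) has_real_derivative x \<bullet> DH x) (at 1)"
  by (rule GDERIV_along_line) (use assms in \<open>simp add: H_GDERIV\<close>)
 moreover have "((\<lambda>t. H (0 + t *\<^sub>R x)) has_real_derivative H x) (at 1)"
 proof (rule DERIV_cong_ev[THEN iffD1, OF refl _ refl])
  show "\<forall>\<^sub>F t in nhds 1. t * H x = H (0 + t *\<^sub>R x)"
   unfolding eventually_nhds by (intro exI[of _ "{0<..}"]) (auto simp: H_scale)
  show "((\<lambda>t. t * H x) has_real_derivative H x) (at 1)" by (auto intro!: derivative_eq_intros)
 qed
 ultimately show ?thesis by (rule DERIV_unique)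
qed

lemma DH_nonzero: "x \<noteq> 0 ==> DH x \<noteq> 0"
 using Euler[of x] H_pos[of x] by auto

lemma hess_self: assumes "x \<noteq> 0" shows "hess x x = 0"
proof -
 have "((\<lambda>t. DH (t *\<^sub>R x)) has_derivative (\<lambda>h. hess x (h *\<^sub>R x))) (at 1)"
  by (rule has_derivative_compose[of "\<lambda>t. t *\<^sub>R x" "\<lambda>h. h *\<^sub>R x" 1 UNIV DH "hess x"])
    (use hess[OF assms] in \<open>auto intro!: derivative_eq_intros\<close>)
 moreover have "((\<lambda>t. DH (t *\<^sub>R x)) has_derivative (\<lambda>h. 0)) (at 1)"
  by (rule has_derivative_transform_within_open[of "\<lambda>_. DH x" _ _ UNIV "{0<..}"])
    (use assms in \<open>auto simp: DH_scale\<close>)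
 ultimately have "(\<lambda>h. hess x (h *\<^sub>R x)) = (\<lambda>h. 0)" by (rule has_derivative_unique)
 from fun_cong[OF this, of 1] show ?thesis by simp
qed

lemma hess_scale:
 assumes "t > 0" "x \<noteq> 0" shows "hess (t *\<^sub>R x) h = (1 / t) *\<^sub>R hess x h"
proof -
 have "((\<lambda>y. DH (t *\<^sub>R y)) has_derivative (\<lambda>h. hess (t *\<^sub>R x) (t *\<^sub>R h))) (at x)"
  by (rule has_derivative_compose[of "\<lambda>y. t *\<^sub>R y" "\<lambda>h. t *\<^sub>R h" x UNIV DH "hess (t *\<^sub>R x)"])
    (use hess[of "t *\<^sub>R x"] assms in \<open>auto intro!: derivative_eq_intros\<close>)
 moreover have "((\<lambda>y. DH (t *\<^sub>R y)) has_derivative hess x) (at x)"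
  by (rule has_derivative_transform_within_open[OF hess[OF assms(2)] op])
    (use assms in \<open>auto simp: DH_scale\<close>)
 ultimately have "(\<lambda>h. hess (t *\<^sub>R x) (t *\<^sub>R h)) = hess x" by (rule has_derivative_unique)
 from fun_cong[OF this, of h] have "t *\<^sub>R hess (t *\<^sub>R x) h = hess x h"
  by (simp add: linear_scale[OF hess_linear])
 then show ?thesis using assms(1) by (metis divide_self_if less_irrefl scaleR_one scaleR_scaleR times_divide_eq_left mult_1)
qed

lemma in_frontier: assumes "H x = 1" shows "x \<in> frontier {\<eta>. H \<eta> < 1}"
proof -
 have x: "x \<noteq> 0" using assms by auto
 have lim: "((\<lambda>t. t *\<^sub>R x) \<longlongrightarrow> x) (at 1 within S)" for S :: "real set"
  by (rule tendsto_eq_intros | simp)+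
 have "x \<in> closure {\<eta>. H \<eta> < 1}"
 proof (rule Lim_in_closed_set[OF closed_closure _ _ lim[of "{0<..<1}"]])
  show "\<forall>\<^sub>F t in at 1 within {0<..<1}. t *\<^sub>R x \<in> closure {\<eta>. H \<eta> < 1}"
   unfolding eventually_at_topological
   by (intro exI[of _ UNIV]) (auto simp: H_scale assms intro!: closure_subset[THEN subsetD])
  show "at (1::real) within {0<..<1} \<noteq> bot" by (simp add: trivial_limit_within islimpt_greaterThanLessThan2)
 qed
 moreover have "x \<notin> interior {\<eta>. H \<eta> < 1}"
 proof
  assume "x \<in> interior {\<eta>. H \<eta> < 1}"
  then have "\<forall>\<^sub>F t in at 1 within {1<..}. t *\<^sub>R x \<in> interior {\<eta>. H \<eta> < 1}"
   using topological_tendstoD[OF lim open_interior] by blast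
  then have ev: "\<forall>\<^sub>F t in at 1 within {1<..}. H (t *\<^sub>R x) < 1"
   by eventually_elim (use interior_subset in blast)
  moreover have "\<forall>\<^sub>F t in at (1::real) within {1<..}. 1 < t"
   by (simp add: eventually_at_filter)
  ultimately have "\<forall>\<^sub>F t in at (1::real) within {1<..}. False"
   by eventually_elim (auto simp: H_scale assms)
  then show False by (simp add: trivial_limit_def[symmetric])
 qed
 ultimately show ?thesis by (simp add: frontier_def)
qed

text \<open>The least value of the second fundamental form is attained in a principal direction,
 since the Hessian is symmetric; there uniform ellipticity applies.\<close>
lemma hess_tangent_pos_unit:
 assumes x: "H x = 1" and v: "v \<noteq> 0" "DH x \<bullet> v = 0"
 shows "v \<bullet> hess x v > 0"
proof -
 have x0: "x \<noteq> 0" using x by auto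
 let ?n = "DH x"
 have n: "norm ?n > 0" using DH_nonzero[OF x0] by simp
 let ?T = "{w. norm w = 1 \<and> ?n \<bullet> w = 0}"
 have T: "compact ?T"
 proof -
  have "?T = sphere 0 1 \<inter> {w. ?n \<bullet> w = 0}" by auto
  moreover have "closed {w. ?n \<bullet> w = 0}" by (rule closed_hyperplane)
  ultimately show ?thesis by (simp add: compact_Int_closed)
 qed
 have hc: "continuous_on A (hess x)" for A
  using linear_continuous_on hess_linear linear_conv_bounded_linear by blast
 have "v /\<^sub>R norm v \<in> ?T" using v by simp
 then have "?T \<noteq> {}" by blast
 then have "\<exists>w\<in>?T. \<forall>z\<in>?T. w \<bullet> hess x w \<le> z \<bullet> hess x z"
  by (intro continuous_attains_inf[OF T] continuous_intros hc)
 then obtain w where w: "norm w = 1" "?n \<bullet> w = 0" and min: "\<And>z. z \<in> ?T ==> w \<bullet> hess x w \<le> z \<bullet> hess x z"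
  by blast
 define q where "q = w \<bullet> hess x w"
 have qmin: "q * (norm z)\<^sup>2 \<le> z \<bullet> hess x z" if z: "?n \<bullet> z = 0" for z
 proof (cases "z = 0")
  case False
  have "q \<le> (z /\<^sub>R norm z) \<bullet> hess x (z /\<^sub>R norm z)"
   unfolding q_def by (rule min) (use False z in simp)
  also have "\<dots> = (z \<bullet> hess x z) / (norm z)\<^sup>2"
   by (simp add: linear_scale[OF hess_linear] power2_eq_square divide_inverse)
  finally show ?thesis using False by (simp add: field_simps)
 qed (simp add: linear_0[OF hess_linear])
 have crit: "z \<bullet> hess x w = q * (z \<bullet> w)" if z: "?n \<bullet> z = 0" for z
 proof -
  define B where "B = z \<bullet> hess x w - q * (z \<bullet> w)"
  define A where "A = z \<bullet> hess x z - q * (norm z)\<^sup>2"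
  have "0 \<le> 2 * s * B + s\<^sup>2 * A" for s
  proof -
   have "q * (norm (w + s *\<^sub>R z))\<^sup>2 \<le> (w + s *\<^sub>R z) \<bullet> hess x (w + s *\<^sub>R z)"
    by (rule qmin) (use w z in \<open>simp add: inner_add_right\<close>)
   moreover have "(norm (w + s *\<^sub>R z))\<^sup>2 = 1 + 2 * s * (z \<bullet> w) + s\<^sup>2 * (norm z)\<^sup>2"
    unfolding power2_norm_eq_inner using w(1) by (simp add: inner_add_left inner_add_right inner_commute[of z w] norm_eq_1 power2_eq_square algebra_simps)
   moreover have "(w + s *\<^sub>R z) \<bullet> hess x (w + s *\<^sub>R z) = q + 2 * s * (z \<bullet> hess x w) + s\<^sup>2 * (z \<bullet> hess x z)"
    using hess_symmetric[OF x0, of w z]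
    by (simp add: linear_add[OF hess_linear] linear_scale[OF hess_linear] inner_add_left inner_add_right q_def power2_eq_square algebra_simps)
   ultimately show ?thesis unfolding A_def B_def by (simp add: algebra_simps)
  qed
  note * = this
  have "B = 0"
  proof (rule ccontr)
   assume B: "B \<noteq> 0"
   define c where "c = \<bar>A\<bar> + 1"
   have c: "c > 0" "A - 2 * c < 0" by (auto simp: c_def)
   define s where "s = - B / c"
   have "2 * s * B + s\<^sup>2 * A = (B\<^sup>2 / c\<^sup>2) * (A - 2 * c)"
    using c(1) by (simp add: s_def power2_eq_square field_simps)
   moreover have "B\<^sup>2 / c\<^sup>2 > 0" using B c by simp
   moreover note c(2)
   ultimately show False using *[of s] by (smt (verit) mult_pos_neg)
  qed
  then show ?thesis by (simp add: B_def)
 qed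
 define y where "y = hess x w - q *\<^sub>R w"
 define \<alpha> where "\<alpha> = (?n \<bullet> y) / (?n \<bullet> ?n)"
 have nn: "?n \<bullet> ?n > 0" using DH_nonzero[OF x0] by simp
 have "y = \<alpha> *\<^sub>R ?n"
 proof -
  let ?z = "y - \<alpha> *\<^sub>R ?n"
  have z: "?n \<bullet> ?z = 0" using nn by (simp add: inner_diff_right \<alpha>_def)
  then have "?z \<bullet> y = 0" using crit[OF z] by (simp add: y_def inner_diff_right)
  moreover have "?z \<bullet> ?z = ?z \<bullet> y - \<alpha> * (?z \<bullet> ?n)"
   by (simp only: inner_diff_right[of ?z y] inner_scaleR_right)
  moreover have "?z \<bullet> ?n = 0" using z by (simp only: inner_commute[of ?z ?n])
  ultimately have "?z \<bullet> ?z = 0" by simp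
  then show ?thesis by simp
 qed
 then have hw: "hess x w = q *\<^sub>R w + \<alpha> *\<^sub>R ?n" by (simp add: y_def algebra_simps)
 have "(level_normal H has_derivative (\<lambda>h. inverse (norm ?n) *\<^sub>R hess x h
    + (- (inverse (norm ?n) * (hess x h \<bullet> sgn ?n) * inverse (norm ?n))) *\<^sub>R ?n)) (at x)"
 proof -
  have dn: "(norm has_derivative (\<lambda>h. h \<bullet> sgn ?n)) (at ?n)"
   using GDERIV_norm[OF DH_nonzero[OF x0]] unfolding gderiv_def .
  have nd: "((\<lambda>y. norm (DH y)) has_derivative (\<lambda>h. hess x h \<bullet> sgn ?n)) (at x)"
   by (rule has_derivative_compose[OF hess[OF x0] dn])
  have "((\<lambda>y. inverse (norm (DH y))) has_derivative (\<lambda>h. - (inverse (norm ?n) * (hess x h \<bullet> sgn ?n) * inverse (norm ?n)))) (at x)"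
   by (rule Deriv.has_derivative_inverse[OF _ nd]) (use n in simp)
  from has_derivative_scaleR[OF this hess[OF x0]]
  show ?thesis unfolding level_normal_def[abs_def] .
 qed
 from frechet_derivative_at[OF this, symmetric]
 have "frechet_derivative (level_normal H) (at x) w =
   inverse (norm ?n) *\<^sub>R hess x w + (- (inverse (norm ?n) * (hess x w \<bullet> sgn ?n) * inverse (norm ?n))) *\<^sub>R ?n"
  by simp
 also have "hess x w \<bullet> sgn ?n = \<alpha> * norm ?n"
  using w(2) n by (simp add: hw inner_add_left sgn_div_norm inner_commute[of w] dot_square_norm power2_eq_square)
 also have "inverse (norm ?n) *\<^sub>R hess x w + (- (inverse (norm ?n) * (\<alpha> * norm ?n) * inverse (norm ?n))) *\<^sub>R ?n
   = (q / norm ?n) *\<^sub>R w"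
  using n by (simp add: hw scaleR_add_right divide_inverse mult.commute)
 finally have "principal_curvature H x (q / norm ?n)"
  unfolding principal_curvature_def using w by (intro exI[of _ w]) auto
 then have "q / norm ?n > 0"
  using elliptic in_frontier[OF x] unfolding uniformly_elliptic_def by (meson less_le_trans)
 then have "q > 0" using n by (simp add: zero_less_divide_iff)
 moreover have "q * (norm v)\<^sup>2 \<le> v \<bullet> hess x v" by (rule qmin[OF v(2)])
 ultimately show ?thesis using v(1) by (smt (verit) mult_pos_pos zero_less_norm_iff zero_less_power)
qed

lemma hess_tangent_pos:
 assumes x: "x \<noteq> 0" and v: "v \<noteq> 0" "DH x \<bullet> v = 0"
 shows "v \<bullet> hess x v > 0"
proof -
 have h: "H x > 0" by (rule H_pos[OF x])
 let ?y = "(1 / H x) *\<^sub>R x"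
 have "H ?y = 1" using h by (simp add: H_scale)
 moreover have "DH ?y = DH x" using h x by (intro DH_scale) auto
 ultimately have "v \<bullet> hess ?y v > 0" using hess_tangent_pos_unit v by metis
 then have "H x * (v \<bullet> hess x v) > 0" using hess_scale[of "1 / H x" x v] h x by simp
 then show ?thesis using h by (simp add: zero_less_mult_iff)
qed

end

context elliptic_norm begin

text \<open>The gradient of \<open>H\<^sup>p / p\<close>; the case \<open>p = CARD('n)\<close> is the flux, the case \<open>p = 2\<close> the
 duality map.\<close>
definition dpow :: "nat => real^'n => real^'n" where
 "dpow p x = H x ^ (p - 1) *\<^sub>R DH x"

definition dpow' :: "nat => real^'n => real^'n => real^'n" where
 "dpow' p x h = H x ^ (p - 1) *\<^sub>R hess x h + (real (p - 1) * H x ^ (p - 2) * (h \<bullet> DH x)) *\<^sub>R DH x"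

lemma dpow_0: "p \<ge> 2 ==> dpow p 0 = 0"
 by (simp add: dpow_def)

lemma dpow_inner_self: "p \<ge> 2 ==> x \<bullet> dpow p x = H x ^ p"
 using Euler[of x] by (cases "x = 0"; cases p) (auto simp: dpow_def)

lemma dpow_has_derivative:
 assumes "x \<noteq> 0" shows "(dpow p has_derivative dpow' p x) (at x)"
proof -
 have d: "GDERIV (\<lambda>x. H x ^ (p - 1)) x :> (real (p - 1) * H x ^ (p - 1 - 1)) *\<^sub>R DH x"
  by (rule GDERIV_power[OF H_GDERIV[OF assms]])
 have "(dpow p has_derivative (\<lambda>h. H x ^ (p - 1) *\<^sub>R hess x h + (h \<bullet> ((real (p - 1) * H x ^ (p - 1 - 1)) *\<^sub>R DH x)) *\<^sub>R DH x)) (at x)"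
  unfolding dpow_def[abs_def]
  by (rule has_derivative_scaleR[OF d[unfolded gderiv_def] hess[OF assms]])
 moreover have "p - 1 - 1 = p - 2" by simp
 ultimately show ?thesis by (simp add: dpow'_def[abs_def] mult.commute mult.left_commute)
qed

lemma dpow'_linear: "linear (dpow' p x)"
 unfolding dpow'_def[abs_def]
 by (rule linearI) (simp_all add: linear_add[OF hess_linear] linear_scale[OF hess_linear] inner_add_left algebra_simps)

text \<open>Radially the derivative sees the growth of the power, tangentially the curvature of the
 level surface.\<close>
lemma dpow'_pos:
 assumes p: "p \<ge> 2" and x: "x \<noteq> 0" and h: "h \<noteq> 0"
 shows "h \<bullet> dpow' p x h > 0"
proof -
 define b where "b = (h \<bullet> DH x) / H x"
 define v where "v = h - b *\<^sub>R x"
 have Hx: "H x > 0" by (rule H_pos[OF x])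
 have hv: "h = v + b *\<^sub>R x" by (simp add: v_def)
 have tv: "DH x \<bullet> v = 0"
  using Hx Euler[OF x] by (simp add: v_def b_def inner_diff_right inner_commute)
 have "hess x h = hess x v"
  by (simp add: hv linear_add[OF hess_linear] linear_scale[OF hess_linear] hess_self[OF x])
 moreover have "x \<bullet> hess x v = 0" using hess_symmetric[OF x, of x v] hess_self[OF x] by simp
 ultimately have "h \<bullet> hess x h = v \<bullet> hess x v" by (simp add: hv inner_add_left)
 then have eq: "h \<bullet> dpow' p x h = H x ^ (p - 1) * (v \<bullet> hess x v) + real (p - 1) * H x ^ (p - 2) * (h \<bullet> DH x)\<^sup>2"
  by (simp add: dpow'_def inner_add_right power2_eq_square)
 have sq: "real (p - 1) * H x ^ (p - 2) * (h \<bullet> DH x)\<^sup>2 \<ge> 0" using Hx by simp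
 show ?thesis
 proof (cases "v = 0")
  case True
  have "h \<bullet> DH x \<noteq> 0"
  proof
   assume "h \<bullet> DH x = 0"
   then have "b = 0" by (simp add: b_def)
   then show False using True h hv by (metis add_0 scaleR_zero_left)
  qed
  moreover have "real (p - 1) > 0" using p by simp
  ultimately have "real (p - 1) * H x ^ (p - 2) * (h \<bullet> DH x)\<^sup>2 > 0" using Hx by (intro mult_pos_pos) auto
  then show ?thesis by (simp only: eq True inner_zero_left mult_zero_right add_0_left)
 next
  case False
  then have "H x ^ (p - 1) * (v \<bullet> hess x v) > 0" using hess_tangent_pos[OF x False tv] Hx by simp
  then show ?thesis using sq eq by linarith
 qed
qed

lemma dpow_strict_mono:
 assumes p: "p \<ge> 2" and ne: "x \<noteq> y"
 shows "(dpow p x - dpow p y) \<bullet> (x - y) > 0"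
proof (cases "\<exists>t. 0 \<le> t \<and> t \<le> 1 \<and> y + t *\<^sub>R (x - y) = 0")
 case True
 then obtain t where t: "0 \<le> t" "t \<le> 1" and z: "y + t *\<^sub>R (x - y) = 0" by blast
 have hp: "w \<noteq> 0 ==> H w ^ p > 0" for w using H_pos by simp
 show ?thesis
 proof (cases "t = 0")
  case True
  then have "y = 0" using z by simp
  then show ?thesis using ne hp[of x] dpow_inner_self[OF p, of x] by (simp add: dpow_0[OF p] inner_commute)
 next
  case t0: False
  have e: "x - y = - (1 / t) *\<^sub>R y"
  proof -
   have "t *\<^sub>R (x - y) = - y" using z by (simp add: add_eq_0_iff)
   then have "(1 / t) *\<^sub>R (t *\<^sub>R (x - y)) = - (1 / t) *\<^sub>R y" by simp
   then show ?thesis using t0 by simp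
  qed
  have y0: "y \<noteq> 0" using e ne by auto
  have "(1 - t) *\<^sub>R (x - y) = x" using z by (simp add: algebra_simps)
  show ?thesis
  proof (cases "x = 0")
   case True
   then show ?thesis using hp[OF y0] dpow_inner_self[OF p, of y] by (simp add: dpow_0[OF p] inner_commute)
  next
   case False
   then have t1: "t < 1" using \<open>(1 - t) *\<^sub>R (x - y) = x\<close> t by (cases "t = 1") auto
   have e': "x - y = (1 / (1 - t)) *\<^sub>R x"
   proof -
    have "(1 / (1 - t)) *\<^sub>R ((1 - t) *\<^sub>R (x - y)) = (1 / (1 - t)) *\<^sub>R x"
     using \<open>(1 - t) *\<^sub>R (x - y) = x\<close> by simp
    then show ?thesis using t1 by simp
   qed
   have "dpow p x \<bullet> (x - y) = (1 / (1 - t)) * H x ^ p"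
    unfolding e' using dpow_inner_self[OF p, of x] by (simp add: inner_commute)
   moreover have "dpow p y \<bullet> (x - y) = - (1 / t) * H y ^ p"
    unfolding e using dpow_inner_self[OF p, of y] by (simp add: inner_commute)
   moreover have "(1 / (1 - t)) * H x ^ p > 0" "(1 / t) * H y ^ p > 0"
    using t1 t0 t hp False y0 by auto
   ultimately show ?thesis by (simp add: inner_diff_left)
  qed
 qed
next
 case False
 let ?f = "\<lambda>t. dpow p (y + t *\<^sub>R (x - y)) \<bullet> (x - y)"
 have "?f 0 < ?f 1"
 proof (rule DERIV_pos_imp_increasing[of 0 1 ?f])
  fix t :: real assume t: "0 \<le> t" "t \<le> 1"
  let ?z = "y + t *\<^sub>R (x - y)"
  have z: "?z \<noteq> 0" using False t by blast
  have "((\<lambda>t. dpow p (y + t *\<^sub>R (x - y))) has_derivative (\<lambda>h. dpow' p ?z (h *\<^sub>R (x - y)))) (at t)"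
   by (rule has_derivative_compose[of "\<lambda>t. y + t *\<^sub>R (x - y)" "\<lambda>h. h *\<^sub>R (x - y)" t UNIV "dpow p" "dpow' p ?z"])
     (use dpow_has_derivative[OF z] in \<open>auto intro!: derivative_eq_intros\<close>)
  from has_derivative_inner_left[OF this, of "x - y"]
  have "(?f has_derivative (\<lambda>h. h * (dpow' p ?z (x - y) \<bullet> (x - y)))) (at t)"
   by (simp add: linear_scale[OF dpow'_linear])
  then have "(?f has_real_derivative (dpow' p ?z (x - y) \<bullet> (x - y))) (at t)"
   by (rule has_derivative_imp_has_field_derivative) (simp add: mult.commute)
  moreover have "dpow' p ?z (x - y) \<bullet> (x - y) > 0"
   using dpow'_pos[OF p z, of "x - y"] ne by (simp add: inner_commute)
  ultimately show "\<exists>d. (?f has_real_derivative d) (at t) \<and> 0 < d" by blast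
 qed simp
 then show ?thesis by (simp add: inner_diff_left)
qed

lemma dpow_mono: "p \<ge> 2 ==> (dpow p x - dpow p y) \<bullet> (x - y) \<ge> 0"
 using dpow_strict_mono[of p x y] by (cases "x = y") auto

lemma dpow_scale:
 assumes "p \<ge> 2" "t \<ge> 0" shows "dpow p (t *\<^sub>R x) = t ^ (p - 1) *\<^sub>R dpow p x"
proof (cases "t = 0 \<or> x = 0")
 case True
 then show ?thesis using assms dpow_0[of p] by auto
next
 case False
 then show ?thesis using assms by (simp add: dpow_def H_scale DH_scale power_mult_distrib)
qed

lemma bounds_exist: "\<exists>m M L. 0 < m \<and> 0 < M \<and> 0 < L \<and> (\<forall>x. m * norm x \<le> H x \<and> H x \<le> M * norm x) \<and> (\<forall>x. x \<noteq> 0 --> norm (DH x) \<le> L)"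
proof -
 let ?S = "sphere (0::real^'n) 1"
 have c: "compact ?S" by simp
 have ne: "?S \<noteq> {}" by simp
 have sub: "?S \<subseteq> UNIV - {0}" by auto
 have cH: "continuous_on ?S H" by (rule continuous_on_subset[OF H_continuous_off_0 sub])
 have cD: "continuous_on ?S (\<lambda>x. norm (DH x))"
  by (rule continuous_on_norm[OF continuous_on_subset[OF DH_continuous sub]])
 obtain a where a: "a \<in> ?S" "\<And>x. x \<in> ?S ==> H a \<le> H x" using continuous_attains_inf[OF c ne cH] by blast
 obtain b where b: "b \<in> ?S" "\<And>x. x \<in> ?S ==> H x \<le> H b" using continuous_attains_sup[OF c ne cH] by blast
 obtain d where d: "d \<in> ?S" "\<And>x. x \<in> ?S ==> norm (DH x) \<le> norm (DH d)" using continuous_attains_sup[OF c ne cD] by blast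
 have "a \<noteq> 0" "b \<noteq> 0" "d \<noteq> 0" using a(1) b(1) d(1) by auto
 then have "H a > 0" "H b > 0" "norm (DH d) > 0" using H_pos DH_nonzero by auto
 moreover have "H a * norm x \<le> H x \<and> H x \<le> H b * norm x" for x
 proof (cases "x = 0")
  case False
  have "H x = norm x * H (x /\<^sub>R norm x)" using False by (subst H_scale[symmetric]) auto
  moreover have S: "x /\<^sub>R norm x \<in> ?S" using False by simp
  ultimately show ?thesis
   using mult_left_mono[OF a(2)[OF S] norm_ge_zero[of x]] mult_left_mono[OF b(2)[OF S] norm_ge_zero[of x]]
   by (simp only: mult.commute[of _ "norm x"])
 qed simp
 moreover have "norm (DH x) \<le> norm (DH d)" if x: "x \<noteq> 0" for x
 proof -
  have "DH (x /\<^sub>R norm x) = DH x" by (rule DH_scale) (use x in auto)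
  then show ?thesis using d(2)[of "x /\<^sub>R norm x"] x by simp
 qed
 ultimately show ?thesis by blast
qed

lemma H_continuous: "continuous_on UNIV H"
proof -
 obtain M where M: "\<And>x. H x \<le> M * norm x" using bounds_exist by blast
 have "isCont H x" for x
 proof (cases "x = 0")
  case True
  have "(H \<longlongrightarrow> 0) (at 0)"
  proof (rule Lim_null_comparison[of _ "\<lambda>x. M * norm x"])
   show "\<forall>\<^sub>F x in at 0. norm (H x) \<le> M * norm x" using M H_nonneg by simp
   show "((\<lambda>x::real^'n. M * norm x) \<longlongrightarrow> 0) (at 0)" by (auto intro!: tendsto_eq_intros)
  qed
  then show ?thesis using True by (simp add: isCont_def)
 qed (use GDERIV_isCont[OF H_GDERIV] in auto)
 then show ?thesis by (simp add: continuous_on_eq_continuous_at)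
qed

lemma dpow_bound_exists: 
 assumes "p \<ge> 2"
 shows "\<exists>B>0. \<forall>x. norm (dpow p x) \<le> B * norm x ^ (p - 1)"
proof -
 obtain M L where M: "M > 0" "\<And>x. H x \<le> M * norm x" and L: "L > 0" "\<And>x. x \<noteq> 0 ==> norm (DH x) \<le> L"
  using bounds_exist by blast
 have "norm (dpow p x) \<le> (M ^ (p - 1) * L) * norm x ^ (p - 1)" for x
 proof (cases "x = 0")
  case False
  have "norm (dpow p x) = H x ^ (p - 1) * norm (DH x)" using H_nonneg by (simp add: dpow_def)
  also have "\<dots> \<le> (M * norm x) ^ (p - 1) * L"
   using M L H_nonneg False by (intro mult_mono power_mono) auto
  finally show ?thesis by (simp add: power_mult_distrib mult.assoc mult.commute mult.left_commute)
 qed (use assms dpow_0[of p] M L in simp)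
 then show ?thesis using M L by (intro exI[of _ "M ^ (p - 1) * L"]) auto
qed

lemma dpow_continuous:
 assumes p: "p \<ge> 2" shows "continuous_on UNIV (dpow p)"
proof -
 obtain B where B: "\<And>x. norm (dpow p x) \<le> B * norm x ^ (p - 1)" using dpow_bound_exists[OF p] by blast
 have "isCont (dpow p) x" for x
 proof (cases "x = 0")
  case True
  have "(dpow p \<longlongrightarrow> 0) (at 0)"
  proof (rule Lim_null_comparison[of _ "\<lambda>x. B * norm x ^ (p - 1)"])
   show "\<forall>\<^sub>F x in at 0. norm (dpow p x) \<le> B * norm x ^ (p - 1)" using B by simp
   have "((\<lambda>x::real^'n. B * norm x ^ (p - 1)) \<longlongrightarrow> B * norm (0::real^'n) ^ (p - 1)) (at 0)"
    by (intro tendsto_intros)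
   then show "((\<lambda>x::real^'n. B * norm x ^ (p - 1)) \<longlongrightarrow> 0) (at 0)" using p by (simp add: power_0_left)
  qed
  then show ?thesis using True dpow_0[OF p] by (simp add: isCont_def)
 qed (use has_derivative_continuous[OF dpow_has_derivative] in auto)
 then show ?thesis by (simp add: continuous_on_eq_continuous_at)
qed

lemma flux_eq: "flux H = dpow CARD('n)"
proof
 fix x :: "real^'n"
 have "GDERIV (\<lambda>\<eta>. H \<eta> ^ CARD('n)) x :> real CARD('n) *\<^sub>R dpow CARD('n) x"
 proof (cases "x = 0")
  case False
  then show ?thesis using GDERIV_power[OF H_GDERIV[OF False], of "CARD('n)"] by (simp add: dpow_def)
 next
  case True
  obtain M where M: "M > 0" "\<And>x. H x \<le> M * norm x" using bounds_exist by blast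
  have "((\<lambda>\<eta>. H \<eta> ^ CARD('n)) has_derivative (\<lambda>h. 0)) (at 0)"
  proof (rule has_derivativeI)
   show "((\<lambda>y. (H y ^ CARD('n) - H 0 ^ CARD('n) - 0) /\<^sub>R norm (y - 0)) \<longlongrightarrow> 0) (at 0)"
   proof (rule Lim_null_comparison[of _ "\<lambda>y. M ^ CARD('n) * norm y ^ (CARD('n) - 1)"])
    have "((\<lambda>x::real^'n. M ^ CARD('n) * norm x ^ (CARD('n) - 1)) \<longlongrightarrow> M ^ CARD('n) * norm (0::real^'n) ^ (CARD('n) - 1)) (at 0)"
     by (intro tendsto_intros)
    then show "((\<lambda>x::real^'n. M ^ CARD('n) * norm x ^ (CARD('n) - 1)) \<longlongrightarrow> 0) (at 0)" using dim by (simp add: power_0_left)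
    have "norm ((H y ^ CARD('n) - H 0 ^ CARD('n) - 0) /\<^sub>R norm (y - 0)) \<le> M ^ CARD('n) * norm y ^ (CARD('n) - 1)" if "y \<noteq> 0" for y
    proof -
     have "H y ^ CARD('n) \<le> (M * norm y) ^ CARD('n)" using M(2) H_nonneg by (intro power_mono)
     also have "\<dots> = M ^ CARD('n) * norm y ^ (CARD('n) - 1) * norm y"
      using dim by (cases "CARD('n)") (auto simp: power_mult_distrib)
     finally show ?thesis using that H_nonneg[of y] by (simp add: field_simps power_0_left)
    qed
    then show "\<forall>\<^sub>F y in at 0. norm ((H y ^ CARD('n) - H 0 ^ CARD('n) - 0) /\<^sub>R norm (y - 0)) \<le> M ^ CARD('n) * norm y ^ (CARD('n) - 1)"
     by (simp add: eventually_at_filter)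
   qed
  qed simp
  then show ?thesis using True dpow_0[OF dim] by (simp add: gderiv_def)
 qed
 from GDERIV_grad[OF this] show "flux H x = dpow CARD('n) x" by (simp add: flux_def)
qed

end

context elliptic_norm begin

abbreviation H0 :: "real^'n => real" where "H0 \<equiv> dual_fun H"

lemma unit_level: "compact {\<xi>. H \<xi> = 1}" "{\<xi>. H \<xi> = 1} \<noteq> {}"
proof -
 obtain m where m: "m > 0" "\<And>x. m * norm x \<le> H x" using bounds_exist by blast
 have "norm x \<le> 1 / m" if "H x = 1" for x using m(2)[of x] m(1) that by (simp add: field_simps)
 then have "bounded {\<xi>. H \<xi> = 1}" unfolding bounded_iff by blast
 moreover have "closed {\<xi>. H \<xi> = 1}"
  using continuous_closed_preimage_constant[OF H_continuous, of 1] by simp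
 ultimately show "compact {\<xi>. H \<xi> = 1}" using compact_eq_bounded_closed by blast
 obtain b :: "real^'n" where b: "b \<in> Basis" using nonempty_Basis by blast
 then have "H ((1 / H b) *\<^sub>R b) = 1" using H_pos[of b] nonzero_Basis[OF b] by (subst H_scale) auto
 then show "{\<xi>. H \<xi> = 1} \<noteq> {}" by blast
qed

lemma H0_ge: assumes "H \<xi> = 1" shows "x \<bullet> \<xi> \<le> H0 x"
 unfolding dual_fun_def
proof (rule cSUP_upper)
 have "compact ((\<lambda>\<xi>. x \<bullet> \<xi>) ` {\<xi>. H \<xi> = 1})"
  by (intro compact_continuous_image unit_level continuous_intros)
 then show "bdd_above ((\<lambda>\<xi>. x \<bullet> \<xi>) ` {\<xi>. H \<xi> = 1})"
  by (intro bounded_imp_bdd_above compact_imp_bounded)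
qed (use assms in simp)

lemma H0_attained: "\<exists>\<xi>. H \<xi> = 1 \<and> H0 x = x \<bullet> \<xi>"
proof -
 have "\<exists>\<xi>\<in>{\<xi>. H \<xi> = 1}. \<forall>\<eta>\<in>{\<xi>. H \<xi> = 1}. x \<bullet> \<eta> \<le> x \<bullet> \<xi>"
  by (intro continuous_attains_sup[OF unit_level] continuous_intros)
 then obtain \<xi> where \<xi>: "H \<xi> = 1" "\<And>\<eta>. H \<eta> = 1 ==> x \<bullet> \<eta> \<le> x \<bullet> \<xi>" by blast
 have "H0 x \<le> x \<bullet> \<xi>" unfolding dual_fun_def
  by (rule cSUP_least[OF unit_level(2)]) (use \<xi> in auto)
 then show ?thesis using \<xi>(1) H0_ge[OF \<xi>(1)] by (meson antisym)
qed

lemma H0_0 [simp]: "H0 0 = 0"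
 using H0_attained[of 0] by auto

text \<open>A maximizer of \<open>\<langle>x, \<xi>\<rangle> / H \<xi>\<close> is a critical point.\<close>
lemma H0_critical:
 assumes x: "x \<noteq> 0"
 obtains \<xi> where "H \<xi> = 1" "H0 x = x \<bullet> \<xi>" "x = H0 x *\<^sub>R DH \<xi>" "H0 x > 0"
proof -
 obtain \<xi> where \<xi>: "H \<xi> = 1" "H0 x = x \<bullet> \<xi>" using H0_attained by blast
 have \<xi>0: "\<xi> \<noteq> 0" using \<xi>(1) by auto
 have le: "x \<bullet> \<eta> \<le> H0 x * H \<eta>" if "\<eta> \<noteq> 0" for \<eta>
 proof -
  have "H ((1 / H \<eta>) *\<^sub>R \<eta>) = 1" using H_pos[OF that] by (subst H_scale) auto
  from H0_ge[OF this, of x] show ?thesis using H_pos[OF that] by (simp add: field_simps)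
 qed
 have "GDERIV (\<lambda>\<eta>. H0 x * H \<eta> - x \<bullet> \<eta>) \<xi> :> H0 x *\<^sub>R DH \<xi> - x"
 proof (rule GDERIV_diff[OF GDERIV_cmult[OF H_GDERIV[OF \<xi>0]]])
  show "GDERIV (\<lambda>\<eta>. x \<bullet> \<eta>) \<xi> :> x"
   unfolding gderiv_def by (auto intro!: derivative_eq_intros simp: inner_commute)
 qed
 then have "(\<lambda>h. h \<bullet> (H0 x *\<^sub>R DH \<xi> - x)) = (\<lambda>h. 0)"
  unfolding gderiv_def
  by (rule differential_zero_maxmin[of \<xi> "UNIV - {0}", rotated 2]) (use \<xi> \<xi>0 le op in auto)
 from fun_cong[OF this, of "H0 x *\<^sub>R DH \<xi> - x"] have eq: "x = H0 x *\<^sub>R DH \<xi>" by simp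
 have "0 < x \<bullet> x" using x by simp
 also have "\<dots> \<le> H0 x * H x" by (rule le[OF x])
 finally have "H0 x > 0" using H_pos[OF x] by (simp add: zero_less_mult_iff)
 then show thesis using that \<xi> eq by blast
qed

lemma H0_pos: "x \<noteq> 0 ==> H0 x > 0"
 using H0_critical[of x] by metis

lemma H0_nonneg: "H0 x \<ge> 0"
 using H0_pos[of x] by (cases "x = 0") auto

lemma dpow_inj: "dpow 2 x = dpow 2 y ==> x = y"
 using dpow_strict_mono[of 2 x y] by fastforce

text \<open>The inverse of the duality map.\<close>
definition dinv :: "real^'n => real^'n" where
 "dinv x = (if x = 0 then 0 else SOME y. dpow 2 y = x)"

lemma dinv_dpow: "dinv (dpow 2 y) = y"
proof (cases "y = 0")
 case True
 then show ?thesis by (simp add: dinv_def dpow_0)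
next
 case False
 then have "dpow 2 y \<noteq> 0" using dpow_inj[of y 0] by (auto simp: dpow_0)
 moreover have "(SOME z. dpow 2 z = dpow 2 y) = y"
  by (rule some_equality) (auto intro: dpow_inj)
 ultimately show ?thesis by (simp add: dinv_def)
qed

lemma dinv_critical:
 assumes x: "x \<noteq> 0"
 shows "dpow 2 (dinv x) = x" "H (dinv x) = H0 x" "H0 x = x \<bullet> ((1 / H0 x) *\<^sub>R dinv x)" "dinv x \<noteq> 0"
proof -
 obtain \<xi> where \<xi>: "H \<xi> = 1" "H0 x = x \<bullet> \<xi>" "x = H0 x *\<^sub>R DH \<xi>" "H0 x > 0"
  using H0_critical[OF x] by blast
 have \<xi>0: "\<xi> \<noteq> 0" using \<xi>(1) by auto
 have "dpow 2 (H0 x *\<^sub>R \<xi>) = H0 x *\<^sub>R dpow 2 \<xi>" using dpow_scale[of 2 "H0 x" \<xi>] \<xi>(4) by simp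
 also have "dpow 2 \<xi> = DH \<xi>" using \<xi>(1) by (simp add: dpow_def)
 finally have 1: "dpow 2 (H0 x *\<^sub>R \<xi>) = x" using \<xi>(3) by simp
 then have 2: "dinv x = H0 x *\<^sub>R \<xi>" using dinv_dpow by metis
 show "dpow 2 (dinv x) = x" using 1 2 by simp
 show "H (dinv x) = H0 x" using 2 H_scale[OF \<xi>(4), of \<xi>] \<xi>(1) by simp
 show "H0 x = x \<bullet> ((1 / H0 x) *\<^sub>R dinv x)" using 2 \<xi>(2,4) by simp
 show "dinv x \<noteq> 0" using 2 \<xi>(4) \<xi>0 by simp
qed

lemma dinv_scale:
 assumes "t > 0" shows "dinv (t *\<^sub>R x) = t *\<^sub>R dinv x"
proof (cases "x = 0")
 case False
 have "dpow 2 (t *\<^sub>R dinv x) = t *\<^sub>R x" using dpow_scale[of 2 t "dinv x"] dinv_critical(1)[OF False] assms by simp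
 then show ?thesis using dinv_dpow by metis
qed (simp add: dinv_def)

lemma H0_scale: "t > 0 ==> H0 (t *\<^sub>R x) = t * H0 x"
 using dinv_critical(2)[of x] dinv_critical(2)[of "t *\<^sub>R x"] dinv_scale[of t x] H_scale[of t "dinv x"]
 by (cases "x = 0") auto

lemma dpow'_bij: "x \<noteq> 0 ==> dpow' 2 x \<circ> inv (dpow' 2 x) = id" "x \<noteq> 0 ==> inj (dpow' 2 x)"
proof -
 assume x: "x \<noteq> 0"
 show i: "inj (dpow' 2 x)"
  unfolding linear_injective_0[OF dpow'_linear]
  using dpow'_pos[of 2 x] x by (metis inner_zero_right less_irrefl order_refl)
 then have "surj (dpow' 2 x)" using linear_injective_imp_surjective[OF dpow'_linear] by blast
 then show "dpow' 2 x \<circ> inv (dpow' 2 x) = id" by (simp add: surj_iff)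
qed

lemma dinv_has_derivative:
 assumes x: "x \<noteq> 0" shows "(dinv has_derivative inv (dpow' 2 (dinv x))) (at x)"
proof (rule has_derivative_inverse_strong_x[OF op])
 show "dinv x \<in> UNIV - {0}" using dinv_critical(4)[OF x] by simp
 show "continuous_on (UNIV - {0}) (dpow 2)" using dpow_continuous[of 2] continuous_on_subset by auto
 show "dinv (dpow 2 y) = y" for y by (rule dinv_dpow)
 show "(dpow 2 has_derivative dpow' 2 (dinv x)) (at (dinv x))"
  by (rule dpow_has_derivative[OF dinv_critical(4)[OF x]])
 show "dpow' 2 (dinv x) \<circ> inv (dpow' 2 (dinv x)) = id" by (rule dpow'_bij(1)[OF dinv_critical(4)[OF x]])
 show "dpow 2 (dinv x) = x" by (rule dinv_critical(1)[OF x])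
qed

lemma dinv_continuous: "continuous_on (UNIV - {0}) dinv"
 using has_derivative_continuous[OF dinv_has_derivative] by (intro continuous_at_imp_continuous_on) auto

lemma dpow'_continuous: "continuous_on ((UNIV - {0}) \<times> UNIV) (\<lambda>(x, h). dpow' p x h)"
proof -
 have 1: "continuous_on ((UNIV - {0}) \<times> UNIV) (\<lambda>z. H (fst z))"
  by (rule continuous_on_compose2[OF H_continuous]) (auto intro!: continuous_intros)
 have 2: "continuous_on ((UNIV - {0}) \<times> UNIV) (\<lambda>z. DH (fst z))"
  by (rule continuous_on_compose2[OF DH_continuous]) (auto intro!: continuous_intros)
 have 3: "continuous_on ((UNIV - {0}) \<times> UNIV) (\<lambda>z. hess (fst z) (snd z))"
  using hess_continuous by (simp add: split_beta)
 show ?thesis unfolding dpow'_def split_beta by (intro continuous_intros 1 2 3)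
qed

text \<open>The inverse matrices depend continuously on the point because the matrices are uniformly
 positive definite on compact sets.\<close>
lemma inv_dpow'_continuous: "continuous_on (UNIV - {0}) (\<lambda>x. inv (dpow' 2 x) b)"
proof -
 have "isCont (\<lambda>x. inv (dpow' 2 x) b) a" if a: "a \<noteq> 0" for a
 proof -
  let ?r = "norm a / 2"
  let ?K = "cball a ?r \<times> sphere (0::real^'n) 1"
  have nz: "x \<noteq> 0" if "x \<in> cball a ?r" for x using that a by (auto simp: dist_norm)
  have "?K \<subseteq> (UNIV - {0}) \<times> UNIV" using nz[of 0] by auto
  from continuous_on_subset[OF dpow'_continuous[of 2] this]
  have c: "continuous_on ?K (\<lambda>z. snd z \<bullet> dpow' 2 (fst z) (snd z))"
   by (intro continuous_intros) (simp add: split_beta)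
  have "\<exists>w\<in>?K. \<forall>z\<in>?K. snd w \<bullet> dpow' 2 (fst w) (snd w) \<le> snd z \<bullet> dpow' 2 (fst z) (snd z)"
   by (rule continuous_attains_inf[OF _ _ c]) (auto simp: compact_Times)
  then obtain w where w: "w \<in> ?K" and wm: "\<And>z. z \<in> ?K ==> snd w \<bullet> dpow' 2 (fst w) (snd w) \<le> snd z \<bullet> dpow' 2 (fst z) (snd z)"
   by blast
  define \<mu> where "\<mu> = snd w \<bullet> dpow' 2 (fst w) (snd w)"
  have \<mu>: "\<mu> > 0" unfolding \<mu>_def using w nz by (intro dpow'_pos) auto
  have coer: "\<mu> * norm h \<le> norm (dpow' 2 x h)" if x: "x \<in> cball a ?r" for x h
  proof (cases "h = 0")
   case False
   have "\<mu> \<le> (h /\<^sub>R norm h) \<bullet> dpow' 2 x (h /\<^sub>R norm h)"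
    unfolding \<mu>_def using wm[of "(x, h /\<^sub>R norm h)"] x False by simp
   also have "\<dots> = (h \<bullet> dpow' 2 x h) / (norm h * norm h)"
    by (simp add: linear_scale[OF dpow'_linear] divide_inverse)
   finally have "\<mu> * (norm h * norm h) \<le> h \<bullet> dpow' 2 x h" using False by (simp add: field_simps)
   also have "\<dots> \<le> norm h * norm (dpow' 2 x h)" by (rule norm_cauchy_schwarz)
   finally have "norm h * (\<mu> * norm h) \<le> norm h * norm (dpow' 2 x h)" by (simp add: algebra_simps)
   then show ?thesis using False by simp
  qed (simp add: linear_0[OF dpow'_linear])
  have inv: "dpow' 2 x (inv (dpow' 2 x) b) = b" if "x \<noteq> 0" for x
   using fun_cong[OF dpow'_bij(1)[OF that], of b] by simp
  define y where "y = inv (dpow' 2 a) b"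
  have cy: "continuous_on (UNIV - {0}) (\<lambda>x. dpow' 2 x y)"
   using continuous_on_compose2[OF dpow'_continuous[of 2], of "UNIV - {0}" "\<lambda>x. (x, y)"]
   by (auto simp: continuous_on_Pair)
  have "((\<lambda>x. dpow' 2 x y) \<longlongrightarrow> dpow' 2 a y) (at a)"
   using cy a op by (simp add: continuous_on_eq_continuous_at isCont_def)
  then have lim: "((\<lambda>x. norm (dpow' 2 x y - b) / \<mu>) \<longlongrightarrow> norm (b - b) / \<mu>) (at a)"
   using inv[OF a] \<mu> unfolding y_def by (intro tendsto_intros) auto
  have "((\<lambda>x. inv (dpow' 2 x) b - y) \<longlongrightarrow> 0) (at a)"
  proof (rule Lim_null_comparison)
   show "((\<lambda>x. norm (dpow' 2 x y - b) / \<mu>) \<longlongrightarrow> 0) (at a)" using lim by simp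
   have "\<forall>\<^sub>F x in at a. x \<in> cball a ?r"
    using a eventually_at_ball[of ?r a UNIV] by (auto elim!: eventually_mono)
   then show "\<forall>\<^sub>F x in at a. norm (inv (dpow' 2 x) b - y) \<le> norm (dpow' 2 x y - b) / \<mu>"
   proof eventually_elim
    fix x assume x: "x \<in> cball a ?r"
    have "\<mu> * norm (inv (dpow' 2 x) b - y) \<le> norm (dpow' 2 x (inv (dpow' 2 x) b - y))" by (rule coer[OF x])
    also have "\<dots> = norm (dpow' 2 x y - b)"
     using inv[OF nz[OF x]] by (simp add: linear_diff[OF dpow'_linear] norm_minus_commute)
    finally show "norm (inv (dpow' 2 x) b - y) \<le> norm (dpow' 2 x y - b) / \<mu>"
     using \<mu> by (simp add: field_simps)
   qed
  qed
  then show ?thesis by (simp add: isCont_def y_def LIM_zero_iff)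
 qed
 then show ?thesis using op by (simp add: continuous_on_eq_continuous_at)
qed

lemma dinv_C1: "Ck_on (Suc 0) (UNIV - {0}) (\<lambda>x. b \<bullet> dinv x)"
proof -
 have d: "((\<lambda>x. b \<bullet> dinv x) has_derivative (\<lambda>h. b \<bullet> inv (dpow' 2 (dinv x)) h)) (at x)" if "x \<noteq> 0" for x
  by (rule has_derivative_inner_right[OF dinv_has_derivative[OF that]])
 have "continuous_on (UNIV - {0}) (\<lambda>x. frechet_derivative (\<lambda>x. b \<bullet> dinv x) (at x) c)" for c
 proof (rule continuous_on_cong[THEN iffD1, OF refl])
  show "continuous_on (UNIV - {0}) (\<lambda>x. b \<bullet> inv (dpow' 2 (dinv x)) c)"
   using dinv_critical(4)
   by (intro continuous_intros continuous_on_compose2[OF inv_dpow'_continuous dinv_continuous]) auto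
  show "b \<bullet> inv (dpow' 2 (dinv x)) c = frechet_derivative (\<lambda>x. b \<bullet> dinv x) (at x) c" if "x \<in> UNIV - {0}" for x
   using frechet_derivative_at[OF d[of x]] that by (metis Diff_iff singletonI)
 qed
 then show ?thesis using d by (auto simp: differentiable_def)
qed

text \<open>Differentiating the inequality \<open>\<langle>y, \<xi>\<rangle> \<le> H0 y\<close>, an equality at \<open>x\<close> for the maximizer \<open>\<xi>\<close> at \<open>x\<close>,
 gives the gradient of the dual.\<close>
lemma H0_GDERIV:
 assumes x: "x \<noteq> 0" shows "GDERIV H0 x :> (1 / H0 x) *\<^sub>R dinv x"
proof -
 have "((\<lambda>x. H (dinv x)) has_derivative (\<lambda>h. inv (dpow' 2 (dinv x)) h \<bullet> DH (dinv x))) (at x)"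
  by (rule has_derivative_compose[OF dinv_has_derivative[OF x]])
    (use H_GDERIV[OF dinv_critical(4)[OF x]] in \<open>simp add: gderiv_def\<close>)
 then have d: "(H0 has_derivative (\<lambda>h. inv (dpow' 2 (dinv x)) h \<bullet> DH (dinv x))) (at x)"
  by (rule has_derivative_transform_within_open[OF _ op]) (use x dinv_critical(2) in auto)
 then have "H0 differentiable (at x)" by (auto simp: differentiable_def)
 then have g: "GDERIV H0 x :> grad H0 x" by (rule grad_works)
 let ?\<xi> = "(1 / H0 x) *\<^sub>R dinv x"
 have "H ?\<xi> = (1 / H0 x) * H (dinv x)" by (rule H_scale) (use H0_pos[OF x] in simp)
 then have \<xi>: "H ?\<xi> = 1" using H0_pos[OF x] dinv_critical(2)[OF x] by simp
 have "H0 x - x \<bullet> ?\<xi> = 0" by (simp only: dinv_critical(3)[OF x, symmetric] diff_self)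
 then have min: "H0 x - x \<bullet> ?\<xi> \<le> H0 y - y \<bullet> ?\<xi>" for y using H0_ge[OF \<xi>, of y] by linarith
 have "GDERIV (\<lambda>y. H0 y - y \<bullet> ?\<xi>) x :> grad H0 x - ?\<xi>"
  by (rule GDERIV_diff[OF g]) (simp only: gderiv_def bounded_linear_imp_has_derivative[OF bounded_linear_inner_left])
 then have "(\<lambda>h. h \<bullet> (grad H0 x - ?\<xi>)) = (\<lambda>h. 0)"
  unfolding gderiv_def
  by (rule differential_zero_maxmin[of x UNIV, rotated 2]) (use min in blast)+
 from fun_cong[OF this, of "grad H0 x - ?\<xi>"] have "grad H0 x = ?\<xi>" by simp
 then show ?thesis using g by simp
qed

lemma H0_bounds_exist: "\<exists>m M. 0 < m \<and> 0 < M \<and> (\<forall>x. m * norm x \<le> H0 x \<and> H0 x \<le> M * norm x)"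
proof -
 let ?S = "sphere (0::real^'n) 1"
 have c: "compact ?S" and ne: "?S \<noteq> {}" by auto
 have cH: "continuous_on ?S H0"
  by (rule continuous_on_subset[OF GDERIV_continuous_on[of "UNIV - {0}"]]) (use H0_GDERIV in auto)
 obtain a where a: "a \<in> ?S" "\<And>x. x \<in> ?S ==> H0 a \<le> H0 x" using continuous_attains_inf[OF c ne cH] by blast
 obtain b where b: "b \<in> ?S" "\<And>x. x \<in> ?S ==> H0 x \<le> H0 b" using continuous_attains_sup[OF c ne cH] by blast
 have "a \<noteq> 0" "b \<noteq> 0" using a(1) b(1) by auto
 then have "H0 a > 0" "H0 b > 0" using H0_pos by auto
 moreover have "H0 a * norm x \<le> H0 x \<and> H0 x \<le> H0 b * norm x" for x
 proof (cases "x = 0")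
  case False
  have "H0 x = norm x * H0 (x /\<^sub>R norm x)" using False by (subst H0_scale[symmetric]) auto
  moreover have S: "x /\<^sub>R norm x \<in> ?S" using False by simp
  ultimately show ?thesis
   using mult_left_mono[OF a(2)[OF S] norm_ge_zero[of x]] mult_left_mono[OF b(2)[OF S] norm_ge_zero[of x]]
   by (simp only: mult.commute[of _ "norm x"])
 qed simp
 ultimately show ?thesis by blast
qed

lemma H0_continuous: "continuous_on UNIV H0"
proof -
 obtain M where M: "\<And>x. H0 x \<le> M * norm x" using H0_bounds_exist by blast
 have "isCont H0 x" for x
 proof (cases "x = 0")
  case True
  have "(H0 \<longlongrightarrow> 0) (at 0)"
  proof (rule Lim_null_comparison[of _ "\<lambda>x. M * norm x"])
   show "\<forall>\<^sub>F x in at 0. norm (H0 x) \<le> M * norm x" using M H0_nonneg by simp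
   show "((\<lambda>x::real^'n. M * norm x) \<longlongrightarrow> 0) (at 0)" by (auto intro!: tendsto_eq_intros)
  qed
  then show ?thesis using True by (simp add: isCont_def)
 qed (use GDERIV_isCont[OF H0_GDERIV] in auto)
 then show ?thesis by (simp add: continuous_on_eq_continuous_at)
qed

text \<open>The gradient of \<open>ln H0\<close>.\<close>
definition dlog :: "real^'n => real^'n" where
 "dlog x = (1 / (H0 x)\<^sup>2) *\<^sub>R dinv x"

lemma ln_H0_GDERIV:
 assumes x: "x \<noteq> 0" shows "GDERIV (\<lambda>x. ln (H0 x)) x :> dlog x"
proof -
 have "GDERIV (\<lambda>x. ln (H0 x)) x :> (1 / H0 x) *\<^sub>R ((1 / H0 x) *\<^sub>R dinv x)"
  by (rule GDERIV_DERIV_compose[OF H0_GDERIV[OF x]])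
    (use H0_pos[OF x] in \<open>auto intro!: derivative_eq_intros\<close>)
 then show ?thesis by (simp add: dlog_def power2_eq_square)
qed

lemma dlog_C1: "Ck_on (Suc 0) (UNIV - {0}) (\<lambda>x. b \<bullet> dlog x)"
proof -
 have c0: "continuous_on (UNIV - {0}) H0" using H0_continuous continuous_on_subset by blast
 have d: "GDERIV (\<lambda>x. inverse (H0 x)) x :> - (inverse (H0 x))\<^sup>2 *\<^sub>R ((1 / H0 x) *\<^sub>R dinv x)" if "x \<in> UNIV - {0}" for x
  by (rule GDERIV_inverse[OF H0_GDERIV]) (use that H0_pos[of x] in auto)
 have "Ck_on (Suc 0) (UNIV - {0}) (\<lambda>x. inverse (H0 x))"
 proof (rule Ck_on_Suc_iff[OF op d, THEN iffD2], simp_all only: Ck_on.simps, rule ballI)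
  show "continuous_on (UNIV - {0}) (\<lambda>x. b \<bullet> - (inverse (H0 x))\<^sup>2 *\<^sub>R ((1 / H0 x) *\<^sub>R dinv x))" for b
   by (intro continuous_intros c0 dinv_continuous) (use H0_pos in force)+
 qed
 note i = this
 have "Ck_on (Suc 0) (UNIV - {0}) (\<lambda>x. inverse (H0 x) * inverse (H0 x) * (b \<bullet> dinv x))"
  by (intro Ck_on_mult op i dinv_C1)
 then show ?thesis by (simp add: dlog_def power2_eq_square divide_inverse)
qed

lemma ln_H0_C2: "Ck_on 2 (UNIV - {0}) (\<lambda>x. ln (H0 x))"
proof -
 have "Ck_on (Suc (Suc 0)) (UNIV - {0}) (\<lambda>x. ln (H0 x))"
  using Ck_on_Suc_iff[OF op, of "\<lambda>x. ln (H0 x)" dlog "Suc 0"] ln_H0_GDERIV dlog_C1 by blast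
 then show ?thesis by (simp only: numeral_2_eq_2)
qed

lemma dlog_continuous: "continuous_on (UNIV - {0}) dlog"
 using continuous_on_subset[OF H0_continuous, of "UNIV - {0}"] H0_pos
 unfolding dlog_def by (intro continuous_intros dinv_continuous) force+

lemma dlog_radial: assumes "x \<noteq> 0" shows "x \<bullet> dlog x = 1"
proof -
 have h: "H0 x > 0" by (rule H0_pos[OF assms])
 then have "x \<bullet> dinv x = (H0 x)\<^sup>2"
  using dinv_critical(3)[OF assms] by (simp add: power2_eq_square field_simps)
 then show ?thesis using h by (simp add: dlog_def)
qed

lemma H_dlog: "x \<noteq> 0 ==> H (dlog x) = 1 / H0 x"
 using dinv_critical(2)[of x] H0_pos[of x] H_scale[of "1 / (H0 x)\<^sup>2" "dinv x"]
 by (simp add: dlog_def power2_eq_square)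

lemma flux_dlog:
 assumes x: "x \<noteq> 0" and c: "c \<ge> 0"
 shows "flux H (c *\<^sub>R dlog x) = (c ^ (CARD('n) - 1) / H0 x ^ CARD('n)) *\<^sub>R x"
proof -
 obtain N where N: "CARD('n) = Suc (Suc N)" using dim by (metis add_2_eq_Suc le_Suc_ex)
 have h: "H0 x > 0" by (rule H0_pos[OF x])
 have Hd: "H0 x *\<^sub>R DH (dinv x) = x"
  using dinv_critical(1,2)[OF x] by (simp add: dpow_def)
 have "flux H (c *\<^sub>R dlog x) = c ^ (CARD('n) - 1) *\<^sub>R dpow CARD('n) (dlog x)"
  using dpow_scale[OF dim c] by (simp add: flux_eq)
 also have "dpow CARD('n) (dlog x) = (1 / H0 x) ^ (CARD('n) - 1) *\<^sub>R DH (dinv x)"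
  using DH_scale[of "1 / (H0 x)\<^sup>2" "dinv x"] dinv_critical(4)[OF x] h
  by (simp add: dpow_def H_dlog[OF x]) (simp add: dlog_def)
 also have "\<dots> = (1 / H0 x ^ CARD('n)) *\<^sub>R (H0 x *\<^sub>R DH (dinv x))"
  using h by (simp add: N power_divide)
 finally show ?thesis using Hd by simp
qed

end

section \<open>Cut-off functions\<close>

lemma cutoff_exists:
 "\<exists>\<zeta>::'a::euclidean_space => real. smooth_on UNIV \<zeta> \<and> (\<forall>x. 0 \<le> \<zeta> x \<and> \<zeta> x \<le> 1) \<and>
   (\<forall>x. norm x \<le> 1 --> \<zeta> x = 1) \<and> (\<forall>x. 2 \<le> norm x --> \<zeta> x = 0)"
proof -
 obtain \<rho> :: "'a => real" where \<rho>: "mollifier (1/4) \<rho>" using mollifier_exists[of "1/4"] by auto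
 define f where "f z = max 0 (min 1 (7 - 4 * norm z))" for z :: 'a
 have f: "continuous_on UNIV f" unfolding f_def by (intro continuous_intros)
 have f0: "f z = 0" if "7/4 \<le> norm z" for z using that by (simp add: f_def)
 have f1: "f z = 1" if "norm z \<le> 3/2" for z using that by (simp add: f_def)
 have f01': "0 \<le> f z" "f z \<le> 1" for z by (simp_all add: f_def)
 have f01: "\<bar>f z - 1/2\<bar> \<le> 1/2" for z using f01'[of z] by linarith
 define \<zeta> where "\<zeta> = mollify \<rho> 3 f"
 have n: "\<bar>norm z - norm x\<bar> < 1/4" if "z \<in> ball x (1/4)" for x z :: 'a
  using that norm_triangle_ineq3[of z x] by (simp add: dist_norm norm_minus_commute)
 have sub: "ball x (1/4) \<subseteq> cube 3" if "norm x \<le> 2" for x :: 'a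
 proof -
  have "z \<in> cball 0 3" if "z \<in> ball x (1/4)" for z
   using n[OF that] \<open>norm x \<le> 2\<close> unfolding mem_cball_0 by linarith
  then have "ball x (1/4) \<subseteq> cball 0 3" by blast
  then show ?thesis using cball_subset_cube by blast
 qed
 have 0: "\<zeta> x = 0" if "2 \<le> norm x" for x
  unfolding \<zeta>_def
 proof (rule mollify_eq_0[OF \<rho>], rule f0)
  show "7/4 \<le> norm z" if "z \<in> ball x (1/4)" for z using n[OF that] \<open>2 \<le> norm x\<close> by linarith
 qed
 have "\<bar>\<zeta> x - 1\<bar> \<le> 0" if "norm x \<le> 1" for x
  unfolding \<zeta>_def
 proof (rule mollify_close[OF \<rho> f sub])
  show "\<bar>f z - 1\<bar> \<le> 0" if "z \<in> ball x (1/4)" for z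
   using f1[of z] n[OF that] \<open>norm x \<le> 1\<close> by linarith
 qed (use that in simp)
 then have 1: "\<zeta> x = 1" if "norm x \<le> 1" for x using that by simp
 have half: "\<bar>\<zeta> x - 1/2\<bar> \<le> 1/2" for x
 proof (cases "norm x \<le> 2")
  case True
  then show ?thesis unfolding \<zeta>_def
   by (intro mollify_close[OF \<rho> f sub] f01)
 qed (use 0[of x] in simp)
 have "0 \<le> \<zeta> x \<and> \<zeta> x \<le> 1" for x using half[of x] by linarith
 moreover have "smooth_on UNIV \<zeta>"
  unfolding \<zeta>_def using \<rho> f by (intro mollify_smooth) (auto simp: mollifier_def)
 ultimately show ?thesis using 0 1 by blast
qed

lemma compact_continuous_bound:
 fixes f :: "'a::topological_space => 'b::real_normed_vector"
 assumes "compact K" "continuous_on K f"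
 shows "\<exists>B>0. \<forall>x\<in>K. norm (f x) \<le> B"
 using compact_imp_bounded[OF compact_continuous_image[OF assms(2,1)]] unfolding bounded_pos by blast

lemma smooth_compact_grad_bounded:
 assumes s: "smooth_on UNIV f" and z: "\<And>x. r \<le> norm x ==> f x = 0"
 shows "\<exists>B>0. \<forall>x. norm (grad f x) \<le> B"
proof -
 obtain B where B: "B > 0" "\<And>x. x \<in> cball 0 r ==> norm (grad f x) \<le> B"
  using compact_continuous_bound[OF compact_cball smooth_on_grad_continuous[OF s]] by blast
 have "grad f x = 0" if "x \<notin> cball 0 r" for x
  by (rule GDERIV_0_outside[OF smooth_on_GDERIV[OF s] z that]) simp
 then show ?thesis using B by (metis less_imp_le norm_zero)
qed

lemma Lp_tendsto_bounded_pointwise: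
 fixes F :: "nat => 'a::euclidean_space => 'b::euclidean_space"
 assumes S: "S \<in> lmeasurable" and m: "\<And>n. (\<lambda>x. F n x - f x) \<in> borel_measurable (lebesgue_on S)"
  and B: "\<And>n x. x \<in> S ==> norm (F n x - f x) \<le> B" and lim: "\<And>x. x \<in> S ==> (\<lambda>n. F n x - f x) \<longlonglongrightarrow> 0"
  and p: "p \<ge> 1"
 shows "Lp_tendsto p S F f"
 unfolding Lp_tendsto_def
proof (intro conjI allI)
 show "Lp_on p S (\<lambda>x. F n x - f x)" for n by (rule Lp_on_bounded[OF S m B])
 interpret finite_measure "lebesgue_on S" by (rule finite_measure_lebesgue_on[OF S])
 note [measurable] = m
 have "(\<lambda>n. LINT x|lebesgue_on S. norm (F n x - f x) ^ p) \<longlonglongrightarrow> (LINT x|lebesgue_on S. 0)"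
 proof (rule integral_dominated_convergence[where w="\<lambda>_. B ^ p"])
  show "AE x in lebesgue_on S. (\<lambda>n. norm (F n x - f x) ^ p) \<longlonglongrightarrow> 0"
  proof (rule AE_I2)
   fix x assume "x \<in> space (lebesgue_on S)"
   then have "(\<lambda>n. norm (F n x - f x) ^ p) \<longlonglongrightarrow> norm (0::'b) ^ p"
    by (intro tendsto_intros lim) simp
   then show "(\<lambda>n. norm (F n x - f x) ^ p) \<longlonglongrightarrow> 0" using p by (simp add: power_0_left)
  qed
  show "AE x in lebesgue_on S. norm (norm (F n x - f x) ^ p) \<le> B ^ p" for n
   by (rule AE_I2) (use B in \<open>simp add: power_mono\<close>)
 qed auto
 then show "(\<lambda>n. LINT x|lebesgue_on S. norm (F n x - f x) ^ p) \<longlonglongrightarrow> 0" by simp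
qed

lemma has_weak_gradient_AE_zero:
 assumes "has_weak_gradient S f g" "AE x in lebesgue_on S. f x = 0"
 shows "has_weak_gradient S f (\<lambda>_. 0)"
proof -
 have "(LINT x|lebesgue_on S. f x *\<^sub>R grad \<phi> x) = 0" for \<phi>
 proof -
  have "AE x in lebesgue_on S. f x *\<^sub>R grad \<phi> x = 0" using assms(2) by eventually_elim simp
  then show ?thesis by (rule integral_eq_zero_AE)
 qed
 then show ?thesis using assms(1) by (auto simp: has_weak_gradient_def)
qed

section \<open>The exterior domain\<close>

locale exterior_problem = elliptic_norm H for H :: "real^'n => real" +
 fixes K :: "'n set" and T \<Sigma> \<Omega> :: "(real^'n) set" and C R :: real and x0 :: "real^'n"
 assumes cone_T: "open_convex_cone_without_lines (coord_subspace (- K)) T"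
  and Sigma_def: "\<Sigma> = product_cone K T"
  and C_pos: "0 < C" and R_pos: "0 < R" and x0_in: "x0 \<in> coord_subspace K"
  and Omega_def: "\<Omega> = dual_ball H x0 R"
begin

definition S :: "(real^'n) set" where "S = ext_dom \<Sigma> \<Omega>"
definition \<Gamma> :: "(real^'n) set" where "\<Gamma> = Gamma0 \<Sigma> \<Omega>"

text \<open>The anisotropic distance from the vertex and the dilations about the vertex.\<close>
definition rad :: "real^'n => real" where "rad x = H0 (x - x0)"
definition dil :: "real => real^'n => real^'n" where "dil t x = x0 + t *\<^sub>R (x - x0)"

lemma rad_dil: "t > 0 ==> rad (dil t x) = t * rad x"
 by (simp add: rad_def dil_def H0_scale)

lemma dil_dil: "dil s (dil t x) = dil (s * t) x" and dil_1 [simp]: "dil 1 x = x"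
 by (simp_all add: dil_def)

lemma rad_continuous: "continuous_on A rad"
 unfolding rad_def by (intro continuous_on_compose2[OF H0_continuous] continuous_intros) auto

lemma rad_nonneg: "rad x \<ge> 0" by (simp add: rad_def H0_nonneg)

lemma rad_pos_iff: "rad x > 0 \<longleftrightarrow> x \<noteq> x0"
 using H0_pos[of "x - x0"] H0_0 by (metis eq_iff_diff_eq_0 less_irrefl rad_def)

definition drop_K :: "real^'n => real^'n" where "drop_K x = (\<chi> i. if i \<in> K then 0 else x $ i)"

lemma drop_K_linear: "linear drop_K"
 by (rule linearI) (simp_all add: drop_K_def vec_eq_iff)

lemma Sigma_iff: "x \<in> \<Sigma> \<longleftrightarrow> drop_K x \<in> T"
proof
 assume "x \<in> \<Sigma>"
 then obtain y z where x: "x = y + z" and y: "y \<in> coord_subspace K" and z: "z \<in> T"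
  unfolding Sigma_def product_cone_def by blast
 have "z \<in> coord_subspace (- K)" using z cone_T openin_imp_subset
  unfolding open_convex_cone_without_lines_def by blast
 then have "drop_K x = z" using y by (auto simp: x drop_K_def coord_subspace_def vec_eq_iff)
 then show "drop_K x \<in> T" using z by simp
next
 assume "drop_K x \<in> T"
 moreover have "x - drop_K x \<in> coord_subspace K" by (auto simp: drop_K_def coord_subspace_def)
 ultimately show "x \<in> \<Sigma>" unfolding Sigma_def product_cone_def
  by (intro CollectI exI[of _ "x - drop_K x"] exI[of _ "drop_K x"]) simp
qed

lemma drop_K_x0: "drop_K x0 = 0"
 using x0_in by (auto simp: drop_K_def coord_subspace_def vec_eq_iff)

lemma Sigma_open: "open \<Sigma>"
proof -
 obtain U where U: "open U" "T = coord_subspace (- K) \<inter> U"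
  using cone_T unfolding open_convex_cone_without_lines_def openin_open by blast
 have "drop_K x \<in> coord_subspace (- K)" for x by (auto simp: drop_K_def coord_subspace_def)
 then have "\<Sigma> = drop_K -` U" using Sigma_iff U(2) by auto
 moreover have "continuous_on UNIV drop_K"
  using linear_continuous_on drop_K_linear linear_conv_bounded_linear by blast
 ultimately show ?thesis using open_vimage[OF U(1), of drop_K] by simp
qed

lemma Sigma_convex: "convex \<Sigma>"
proof -
 have "\<Sigma> = drop_K -` T" using Sigma_iff by auto
 moreover have "convex T" using cone_T by (simp add: open_convex_cone_without_lines_def)
 ultimately show ?thesis using convex_linear_vimage[OF drop_K_linear] by metis
qed

lemma Sigma_nonempty: "\<Sigma> \<noteq> {}"
proof -
 obtain z where z: "z \<in> T" using cone_T by (auto simp: open_convex_cone_without_lines_def)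
 have "0 \<in> coord_subspace K" by (simp add: coord_subspace_def)
 then have "0 + z \<in> \<Sigma>" unfolding Sigma_def product_cone_def using z by blast
 then show ?thesis by blast
qed

lemma dil_in_Sigma_iff: assumes "t > 0" shows "dil t x \<in> \<Sigma> \<longleftrightarrow> x \<in> \<Sigma>"
proof -
 have imp: "dil s y \<in> \<Sigma>" if "y \<in> \<Sigma>" "s > 0" for s y
 proof -
  have "drop_K (dil s y) = s *\<^sub>R drop_K y"
   by (simp add: dil_def linear_add[OF drop_K_linear] linear_scale[OF drop_K_linear] linear_diff[OF drop_K_linear] drop_K_x0)
  then show ?thesis using that cone_T by (simp add: Sigma_iff open_convex_cone_without_lines_def)
 qed
 show ?thesis using imp[of x t] imp[of "dil t x" "1 / t"] assms by (auto simp: dil_dil)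
qed

lemma Omega_eq: "\<Omega> = {x. rad x < R}"
 by (simp add: Omega_def dual_ball_def rad_def)

lemma closure_Omega: "closure \<Omega> = {x. rad x \<le> R}"
proof
 have "closed {x. rad x \<le> R}" by (rule closed_Collect_le[OF rad_continuous continuous_on_const])
 then show "closure \<Omega> \<subseteq> {x. rad x \<le> R}" unfolding Omega_eq by (intro closure_minimal) auto
 show "{x. rad x \<le> R} \<subseteq> closure \<Omega>"
 proof
  fix x assume x: "x \<in> {x. rad x \<le> R}"
  have lim: "((\<lambda>t. dil t x) \<longlongrightarrow> dil 1 x) (at 1 within {0<..<1})"
   unfolding dil_def by (intro tendsto_intros)
  show "x \<in> closure \<Omega>"
  proof (rule Lim_in_closed_set[OF closed_closure _ _ lim[unfolded dil_1]])
   have "rad (dil t x) < R" if "t \<in> {0<..<1}" for t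
   proof -
    have "rad (dil t x) = t * rad x" using that by (simp add: rad_dil)
    also have "\<dots> \<le> t * R" using that x by (intro mult_left_mono) auto
    also have "\<dots> < 1 * R" using that R_pos by (intro mult_strict_right_mono) auto
    finally show ?thesis by simp
   qed
   then show "\<forall>\<^sub>F t in at 1 within {0<..<1}. dil t x \<in> closure \<Omega>"
    unfolding eventually_at_topological Omega_eq
    by (intro exI[of _ UNIV]) (auto intro!: closure_subset[THEN subsetD])
   show "at (1::real) within {0<..<1} \<noteq> bot" by (simp add: trivial_limit_within islimpt_greaterThanLessThan2)
  qed
 qed
qed

lemma frontier_Omega: "frontier \<Omega> = {x. rad x = R}"
proof -
 have "open \<Omega>" unfolding Omega_eq by (rule open_Collect_less[OF rad_continuous continuous_on_const])
 then show ?thesis by (auto simp: frontier_def interior_open closure_Omega) (auto simp: Omega_eq)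
qed

lemma S_iff: "x \<in> S \<longleftrightarrow> x \<in> \<Sigma> \<and> R < rad x" and \<Gamma>_iff: "x \<in> \<Gamma> \<longleftrightarrow> x \<in> \<Sigma> \<and> rad x = R"
 by (auto simp: S_def \<Gamma>_def closure_Omega frontier_Omega)

lemma S_open: "open S"
 unfolding S_def using Sigma_open by (intro open_Int) auto

lemma S_lebesgue [simp]: "S \<in> sets lebesgue"
 using S_open by simp

lemma S_x0: "x \<in> S ==> x \<noteq> x0"
 using R_pos rad_pos_iff[of x] unfolding S_iff by linarith

lemma dil_in_S: assumes "x \<in> S" "t \<ge> 1" shows "dil t x \<in> S"
proof -
 have "R < rad x" using assms(1) by (simp add: S_iff)
 also have "rad x \<le> t * rad x" using mult_right_mono[OF assms(2) rad_nonneg[of x]] by simp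
 finally show ?thesis using assms by (simp add: S_iff dil_in_Sigma_iff rad_dil)
qed

lemma rad_bounds: obtains m M where "0 < m" "0 < M" "\<And>x. m * norm (x - x0) \<le> rad x" "\<And>x. rad x \<le> M * norm (x - x0)"
 using H0_bounds_exist unfolding rad_def by metis

lemma \<Gamma>_compact: "compact (closure \<Gamma>)"
proof -
 obtain m M where m: "0 < m" "\<And>x. m * norm (x - x0) \<le> rad x" using rad_bounds by metis
 have "\<Gamma> \<subseteq> cball x0 (R / m)"
 proof
  fix x assume "x \<in> \<Gamma>"
  then have "m * norm (x - x0) \<le> R" using m(2)[of x] by (simp add: \<Gamma>_iff)
  then show "x \<in> cball x0 (R / m)" using m(1) by (simp add: dist_norm norm_minus_commute field_simps)
 qed
 then have "bounded \<Gamma>" using bounded_subset bounded_cball by blast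
 then show ?thesis by simp
qed

text \<open>Radial projection: a neighbourhood of the closure of \<open>\<Gamma>\<close> contains a whole collar in \<open>\<Sigma>\<close>.\<close>
lemma collar:
 assumes U: "open U" "closure \<Gamma> \<subseteq> U"
 obtains \<delta> where "\<delta> > 0" "\<And>x. x \<in> \<Sigma> ==> R \<le> rad x ==> rad x < R * (1 + \<delta>) ==> x \<in> U"
proof -
 obtain m M where m: "0 < m" "\<And>x. m * norm (x - x0) \<le> rad x" using rad_bounds by metis
 obtain e where e: "e > 0" "(\<Union>x\<in>closure \<Gamma>. ball x e) \<subseteq> U"
  using compact_subset_open_imp_ball_epsilon_subset[OF \<Gamma>_compact U] by blast
 show thesis
 proof
  show "m * e / R > 0" using m e R_pos by simp
  fix x assume x: "x \<in> \<Sigma>" "R \<le> rad x" "rad x < R * (1 + m * e / R)"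
  have rp: "rad x > 0" using x R_pos by linarith
  let ?y = "dil (R / rad x) x"
  have y: "?y \<in> \<Gamma>" using x rp R_pos by (simp add: \<Gamma>_iff dil_in_Sigma_iff rad_dil)
  have "x - ?y = (1 - R / rad x) *\<^sub>R (x - x0)" by (simp add: dil_def algebra_simps)
  then have "norm (x - ?y) = (1 - R / rad x) * norm (x - x0)" using x rp by simp
  also have "\<dots> \<le> (1 - R / rad x) * (rad x / m)"
   using x rp m by (intro mult_left_mono) (auto simp: field_simps)
  also have "\<dots> = (rad x - R) / m" using rp m(1) by (simp add: field_simps)
  also have "R * (1 + m * e / R) = R + m * e" using R_pos by (simp add: field_simps)
  then have "(rad x - R) / m < e" using x(3) m(1) by (simp add: pos_divide_less_eq mult.commute)
  finally have "x \<in> ball ?y e" by (simp add: dist_norm norm_minus_commute)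
  then show "x \<in> U" using e(2) y closure_subset by blast
 qed
qed

section \<open>The explicit solution\<close>

definition w :: "real^'n => real" where "w x = 1 / rad x ^ CARD('n)"

lemma w_continuous: "continuous_on S w"
 unfolding w_def by (intro continuous_intros rad_continuous) (metis S_x0 less_irrefl power_eq_0_iff rad_pos_iff)

lemma w_bound: "x \<in> S ==> 0 \<le> w x \<and> w x \<le> 1 / R ^ CARD('n)"
 using R_pos power_mono[of R "rad x" "CARD('n)"] rad_nonneg[of x]
 by (auto simp: S_iff w_def frac_le)

text \<open>The measure \<open>w dx\<close> is invariant under dilations, so \<open>\<integral> w(x) f(t x) dx\<close> does not depend on \<open>t\<close>
 as long as \<open>f\<close> vanishes near the inner boundary; the claim is its derivative at \<open>t = 1\<close>.\<close>
lemma integral_radial_derivative: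
 fixes f :: "real^'n => real"
 assumes f: "\<And>x. GDERIV f x :> Df x" and Df: "continuous_on UNIV Df"
  and supp: "\<And>x. r \<le> norm (x - x0) ==> f x = 0" and \<delta>: "\<delta> > 0"
  and col: "\<And>x. x \<in> S ==> rad x < R * (1 + \<delta>) ==> f x = 0"
 shows "(LINT x|lebesgue_on S. w x * ((x - x0) \<bullet> Df x)) = 0"
proof -
 have cf: "continuous_on A f" for A using GDERIV_continuous_on[of A f Df] f by blast
 have Df0: "Df x = 0" if "x \<notin> cball x0 r" for x
 proof -
  have "GDERIV f x :> 0"
  proof (rule GDERIV_transform[where f="\<lambda>_. 0" and S="- cball x0 r"])
   show "GDERIV (\<lambda>_. 0) x :> 0" by (rule GDERIV_const)
   show "open (- cball x0 r)" "x \<in> - cball x0 r" using that by auto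
   show "0 = f y" if "y \<in> - cball x0 r" for y using that supp[of y] by (simp add: dist_norm norm_minus_commute)
  qed
  then show ?thesis using GDERIV_unique[OF f[of x]] by simp
 qed
 obtain B where B: "B > 0" "\<And>x. x \<in> cball x0 r ==> norm (Df x) \<le> B"
  using compact_continuous_bound[OF compact_cball continuous_on_subset[OF Df subset_UNIV]] by blast
 have DfB: "norm (Df x) \<le> B" for x using B Df0[of x] by (cases "x \<in> cball x0 r") auto
 have lip: "\<bar>f y - f x\<bar> \<le> B * norm (y - x)" for x y
  by (rule GDERIV_lipschitz[of UNIV f Df]) (use f DfB in auto)
 let ?A = "S \<inter> cball x0 r"
 have Am: "?A \<in> lmeasurable" using S_open by (intro bounded_set_imp_lmeasurable bounded_Int) auto
 have int: "integrable (lebesgue_on S) (\<lambda>x. w x * g x)"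
  if g: "continuous_on S g" "\<And>x. x \<in> S ==> x \<notin> cball x0 r ==> g x = 0" "\<And>x. \<bar>g x\<bar> \<le> b" for g b
 proof -
  interpret finite_measure "lebesgue_on ?A" by (rule finite_measure_lebesgue_on[OF Am])
  have "integrable (lebesgue_on ?A) (\<lambda>x. w x * g x)"
  proof (rule integrable_const_bound[of _ "(1 / R ^ CARD('n)) * b"])
   have "continuous_on ?A (\<lambda>x. w x * g x)"
    using w_continuous g(1) by (intro continuous_on_mult) (auto intro: continuous_on_subset)
   then show "(\<lambda>x. w x * g x) \<in> borel_measurable (lebesgue_on ?A)"
    using Am by (intro continuous_imp_measurable_on_sets_lebesgue) auto
   show "AE x in lebesgue_on ?A. norm (w x * g x) \<le> (1 / R ^ CARD('n)) * b"
   proof (rule AE_I2)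
    fix x assume "x \<in> space (lebesgue_on ?A)"
    then have "\<bar>w x\<bar> * \<bar>g x\<bar> \<le> (1 / R ^ CARD('n)) * b"
     using w_bound[of x] g(3)[of x] R_pos by (intro mult_mono) auto
    then show "norm (w x * g x) \<le> (1 / R ^ CARD('n)) * b" by (simp add: abs_mult)
   qed
  qed
  then show ?thesis
   using integral_lebesgue_on_subset(2)[of ?A S "\<lambda>x. w x * g x"] g(2) Am by auto
 qed
 have fB: "\<exists>b. \<forall>x. \<bar>f x\<bar> \<le> b"
 proof -
  obtain b where b: "b > 0" "\<And>x. x \<in> cball x0 r ==> norm (f x) \<le> b"
   using compact_continuous_bound[OF compact_cball cf] by blast
  have "\<bar>f x\<bar> \<le> b" for x
   using b supp[of x] by (cases "x \<in> cball x0 r") (auto simp: dist_norm norm_minus_commute)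
  then show ?thesis by blast
 qed
 then obtain b where b: "\<And>x. \<bar>f x\<bar> \<le> b" by blast
 have cd: "continuous_on A (\<lambda>x. f (dil t x))" for A t
  unfolding dil_def by (intro continuous_on_compose2[OF cf[of UNIV]] continuous_intros) auto
 have out: "f (dil t x) = 0" if "t \<ge> 1" "x \<notin> cball x0 r" for t x
 proof (rule supp)
  have "r \<le> norm (x - x0)" using that by (simp add: dist_norm norm_minus_commute)
  also have "\<dots> \<le> t * norm (x - x0)" using that(1) mult_right_mono[of 1 t "norm (x - x0)"] by simp
  finally show "r \<le> norm (dil t x - x0)" using that(1) by (simp add: dil_def)
 qed
 define J where "J t = (LINT x|lebesgue_on S. w x * f (dil t x))" for t
 have J1: "J t = J 1" if t: "1 \<le> t" "t < 1 + \<delta>" for t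
 proof -
  define F where "F z = (if z \<in> S then w z * f z else 0)" for z
  have iF: "integrable lebesgue F"
   unfolding F_def using int[of f, OF cf _ b] supp Lebesgue_Measure.integrable_restrict_UNIV[of S "\<lambda>z. w z * f z"]
   by (auto simp: dist_norm norm_minus_commute)
  have Ft: "t ^ CARD('n) * F ((x0 - t *\<^sub>R x0) + t *\<^sub>R y) = (if y \<in> S then w y * f (dil t y) else 0)" for y
  proof -
   have eq: "(x0 - t *\<^sub>R x0) + t *\<^sub>R y = dil t y" by (simp add: dil_def algebra_simps)
   have wt: "t ^ CARD('n) * w (dil t y) = w y" using t by (simp add: w_def rad_dil power_mult_distrib)
   show ?thesis
   proof (cases "y \<in> S")
    case True
    then have "F (dil t y) = w (dil t y) * f (dil t y)" using dil_in_S t by (simp add: F_def)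
    then have "t ^ CARD('n) * F (dil t y) = (t ^ CARD('n) * w (dil t y)) * f (dil t y)" by simp
    then show ?thesis unfolding eq wt using True by simp
   next
    case False
    have "F (dil t y) = 0"
    proof (cases "dil t y \<in> S")
     case True
     then have "y \<in> \<Sigma>" using t by (simp add: S_iff dil_in_Sigma_iff)
     then have "rad y \<le> R" using False S_iff by auto
     then have "t * rad y \<le> t * R" using t by (intro mult_left_mono) auto
     also have "\<dots> < R * (1 + \<delta>)" using t R_pos by (simp add: mult.commute)
     finally have "rad (dil t y) < R * (1 + \<delta>)" using t by (simp add: rad_dil)
     then show ?thesis using col[OF True] by (simp add: F_def)
    qed (simp add: F_def)
    then show ?thesis using False by (simp add: eq)
   qed
  qed
  have "J 1 = (LINT z|lebesgue. F z)"
   unfolding J_def F_def using Lebesgue_Measure.integral_restrict_UNIV[of S "\<lambda>z. w z * f z"] by simp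
  also have "\<dots> = t ^ CARD('n) * (LINT y|lebesgue. F ((x0 - t *\<^sub>R x0) + t *\<^sub>R y))"
   using integral_lebesgue_affine[OF _ iF, of t "x0 - t *\<^sub>R x0"] t by simp
  also have "\<dots> = (LINT y|lebesgue. t ^ CARD('n) * F ((x0 - t *\<^sub>R x0) + t *\<^sub>R y))" by simp
  also have "\<dots> = (LINT y|lebesgue. (if y \<in> S then w y * f (dil t y) else 0))" unfolding Ft ..
  also have "\<dots> = J t"
   unfolding J_def using Lebesgue_Measure.integral_restrict_UNIV[of S "\<lambda>y. w y * f (dil t y)"] by simp
  finally show ?thesis by simp
 qed
 define s where "s n = \<delta> / (real n + 2)" for n
 have s: "0 < s n" "s n < \<delta>" for n
  using \<delta> mult_strict_left_mono[of 1 "real n + 2" \<delta>] by (auto simp: s_def pos_divide_less_eq)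
 have s0: "s \<longlonglongrightarrow> 0"
 proof -
  have "(\<lambda>n. \<delta> * (1 / real (n + 2))) \<longlonglongrightarrow> \<delta> * 0"
   by (intro tendsto_intros LIMSEQ_ignore_initial_segment[OF lim_1_over_n])
  then show ?thesis by (simp add: s_def[abs_def] add.commute)
 qed
 have "s n \<noteq> 0" for n using s(1)[of n] by simp
 then have sat: "filterlim s (at 0) sequentially" using s0 by (simp add: filterlim_at)
 define D where "D n x = w x * ((f (dil (1 + s n) x) - f x) / s n)" for n x
 have D0: "(LINT x|lebesgue_on S. D n x) = 0" for n
 proof -
  have i1: "integrable (lebesgue_on S) (\<lambda>x. w x * f (dil (1 + s n) x))"
   by (rule int[OF cd _ b]) (use out[of "1 + s n"] s[of n] in auto)
  have i2: "integrable (lebesgue_on S) (\<lambda>x. w x * f x)"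
   using int[OF cd _ b, of 1] out[of 1] by simp
  have "(LINT x|lebesgue_on S. D n x) = (LINT x|lebesgue_on S. (w x * f (dil (1 + s n) x) - w x * f x) / s n)"
   by (simp add: D_def algebra_simps)
  also have "\<dots> = (J (1 + s n) - J 1) / s n"
   using i1 i2 by (simp add: J_def)
  also have "\<dots> = 0" using J1[of "1 + s n"] s[of n] by simp
  finally show ?thesis .
 qed
 have "(\<lambda>n. LINT x|lebesgue_on S. D n x) \<longlonglongrightarrow> (LINT x|lebesgue_on S. w x * ((x - x0) \<bullet> Df x))"
 proof (rule integral_dominated_convergence[where w="\<lambda>x. if x \<in> ?A then (1 / R ^ CARD('n)) * (B * r) else 0"])
  show "(\<lambda>x. w x * ((x - x0) \<bullet> Df x)) \<in> borel_measurable (lebesgue_on S)"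
   by (intro continuous_imp_measurable_on_sets_lebesgue continuous_intros w_continuous continuous_on_subset[OF Df]) auto
  show "D n \<in> borel_measurable (lebesgue_on S)" for n
   unfolding D_def by (intro continuous_imp_measurable_on_sets_lebesgue continuous_intros w_continuous cf cd) (use s[of n] in auto)
  interpret finite_measure "lebesgue_on ?A" by (rule finite_measure_lebesgue_on[OF Am])
  have "integrable (lebesgue_on ?A) (\<lambda>x. if x \<in> ?A then (1 / R ^ CARD('n)) * (B * r) else 0)"
   by (rule Bochner_Integration.integrable_cong[THEN iffD1, OF refl _ integrable_const]) simp
  then show "integrable (lebesgue_on S) (\<lambda>x. if x \<in> ?A then (1 / R ^ CARD('n)) * (B * r) else 0)"
   using integral_lebesgue_on_subset(2)[of ?A S "\<lambda>x. if x \<in> ?A then (1 / R ^ CARD('n)) * (B * r) else 0"] Am by auto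
  show "AE x in lebesgue_on S. norm (D n x) \<le> (if x \<in> ?A then (1 / R ^ CARD('n)) * (B * r) else 0)" for n
  proof (rule AE_I2)
   fix x assume x: "x \<in> space (lebesgue_on S)"
   show "norm (D n x) \<le> (if x \<in> ?A then (1 / R ^ CARD('n)) * (B * r) else 0)"
   proof (cases "x \<in> cball x0 r")
    case True
    have "dil (1 + s n) x - x = s n *\<^sub>R (x - x0)" by (simp add: dil_def algebra_simps)
    then have "\<bar>f (dil (1 + s n) x) - f x\<bar> \<le> B * (s n * norm (x - x0))"
     using lip[of "dil (1 + s n) x" x] s[of n] by simp
    also have "\<dots> \<le> B * (s n * r)"
     using True B(1) s[of n] by (intro mult_left_mono) (auto simp: dist_norm norm_minus_commute)
    finally have "\<bar>(f (dil (1 + s n) x) - f x) / s n\<bar> \<le> B * r" using s[of n] by (simp add: field_simps)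
    then have "\<bar>D n x\<bar> \<le> (1 / R ^ CARD('n)) * (B * r)"
     unfolding D_def abs_mult using w_bound[of x] x R_pos by (intro mult_mono) auto
    then show ?thesis using True x by simp
   next
    case False
    then show ?thesis using out[of 1 x] out[of "1 + s n" x] s[of n] by (simp add: D_def)
   qed
  qed
  show "AE x in lebesgue_on S. (\<lambda>n. D n x) \<longlonglongrightarrow> w x * ((x - x0) \<bullet> Df x)"
  proof (rule AE_I2)
   fix x
   have "((\<lambda>t. f (x + t *\<^sub>R (x - x0))) has_real_derivative ((x - x0) \<bullet> Df x)) (at 0)"
    by (rule GDERIV_along_line) (use f[of x] in simp)
   then have "((\<lambda>h. (f (x + h *\<^sub>R (x - x0)) - f x) / h) \<longlongrightarrow> (x - x0) \<bullet> Df x) (at 0)"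
    by (simp add: DERIV_def)
   then have "(\<lambda>n. (f (x + s n *\<^sub>R (x - x0)) - f x) / s n) \<longlonglongrightarrow> (x - x0) \<bullet> Df x"
    by (rule filterlim_compose[OF _ sat])
   moreover have "x + t *\<^sub>R (x - x0) = dil (1 + t) x" for t by (simp add: dil_def algebra_simps)
   ultimately show "(\<lambda>n. D n x) \<longlonglongrightarrow> w x * ((x - x0) \<bullet> Df x)"
    unfolding D_def by (intro tendsto_mult tendsto_const) simp
  qed
 qed
 then show ?thesis using D0 by (simp add: LIMSEQ_const_iff)
qed

end

context exterior_problem begin

definition u :: "real^'n => real" where "u x = C * R * ln (rad x / R)"
definition Du :: "real^'n => real^'n" where "Du x = (C * R) *\<^sub>R dlog (x - x0)"

lemma u_GDERIV: assumes "x \<noteq> x0" shows "GDERIV u x :> Du x"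
proof -
 have x: "x - x0 \<noteq> 0" using assms by simp
 have "GDERIV (\<lambda>y. ln (H0 (- x0 + 1 *\<^sub>R y))) x :> 1 *\<^sub>R dlog (x - x0)"
  by (rule GDERIV_affine) (use ln_H0_GDERIV[OF x] in simp)
 then have "GDERIV (\<lambda>y. ln (rad y)) x :> dlog (x - x0)" by (simp add: rad_def)
 from GDERIV_cmult[OF GDERIV_diff[OF this GDERIV_const[of "ln R"]], of "C * R"]
 have "GDERIV (\<lambda>y. C * R * (ln (rad y) - ln R)) x :> Du x" by (simp add: Du_def)
 then show ?thesis
 proof (rule GDERIV_transform[where S="- {x0}"])
  show "C * R * (ln (rad y) - ln R) = u y" if "y \<in> - {x0}" for y
   using that R_pos rad_pos_iff[of y] by (simp add: u_def ln_div)
 qed (use assms in auto)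
qed

lemma Du_continuous: "continuous_on (- {x0}) Du"
 unfolding Du_def by (intro continuous_intros continuous_on_compose2[OF dlog_continuous]) auto

lemma u_C2: "Ck_on 2 (UNIV - {x0}) u"
proof -
 have op': "open (UNIV - {x0})" by (simp add: open_Diff)
 have sh: "Ck_on k (UNIV - {x0}) (\<lambda>x. f (x - x0))" if "Ck_on k (UNIV - {0}) f" for k and f :: "real^'n => real"
  using that
 proof (induction k arbitrary: f)
  case 0
  then show ?case by (auto intro!: continuous_on_compose2[of "UNIV - {0}" f] continuous_intros)
 next
  case (Suc k)
  note D = Ck_on_Suc_grad[OF op, of k]
  have d: "GDERIV (\<lambda>x. f (x - x0)) x :> grad f (x - x0)" if "x \<in> UNIV - {x0}" for x
   using GDERIV_affine[of f "- x0" 1 x "grad f (x - x0)"] Suc.prems[unfolded D] that by simp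
  show ?case
   by (subst Ck_on_Suc_iff[OF op' d]) (use Suc.IH Suc.prems[unfolded D] in blast)+
 qed
 have "Ck_on 2 (UNIV - {x0}) (\<lambda>x. C * R * (ln (H0 (x - x0)) + (- ln R)))"
  by (intro Ck_on_mult Ck_on_add op' Ck_on_const sh ln_H0_C2)
 moreover have "Ck_on 2 (UNIV - {x0}) (\<lambda>x. C * R * (ln (H0 (x - x0)) + (- ln R))) \<longleftrightarrow> Ck_on 2 (UNIV - {x0}) u"
 proof (rule Ck_on_cong[OF op'])
  show "C * R * (ln (H0 (x - x0)) + (- ln R)) = u x" if "x \<in> UNIV - {x0}" for x
   using that R_pos rad_pos_iff[of x] by (simp add: u_def ln_div rad_def)
 qed
 ultimately show ?thesis by simp
qed

lemma u_continuous: "continuous_on (- {x0}) u"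
 by (rule GDERIV_continuous_on) (use u_GDERIV in auto)

lemma flux_Du: "x \<noteq> x0 ==> flux H (Du x) = ((C * R) ^ (CARD('n) - 1) * w x) *\<^sub>R (x - x0)"
 using flux_dlog[of "x - x0" "C * R"] C_pos R_pos by (simp add: Du_def w_def rad_def)

lemma H_Du: "x \<noteq> x0 ==> H (Du x) = C * R / rad x"
 using H_dlog[of "x - x0"] C_pos R_pos by (simp add: Du_def H_scale rad_def)

lemma Du_radial: "x \<noteq> x0 ==> (x - x0) \<bullet> Du x = C * R"
 using dlog_radial[of "x - x0"] by (simp add: Du_def)

lemma S_bounded_compact:
 "\<exists>K. compact K \<and> S \<inter> ball 0 r \<subseteq> K \<and> x0 \<notin> K"
proof (intro exI conjI)
 let ?K = "cball 0 r \<inter> {x. R \<le> rad x}"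
 have "closed {x. R \<le> rad x}" by (rule closed_Collect_le[OF continuous_on_const rad_continuous])
 then show "compact ?K" by (intro compact_Int_closed) auto
 show "S \<inter> ball 0 r \<subseteq> ?K" by (auto simp: S_iff)
 show "x0 \<notin> ?K" using R_pos rad_pos_iff[of x0] by auto
qed

lemma S_ball_lmeasurable: "S \<inter> ball 0 r \<in> lmeasurable"
 using S_open by (intro bounded_set_imp_lmeasurable bounded_Int) auto

lemma W1p_u: "W1p CARD('n) (S \<inter> ball 0 r) u Du"
proof -
 obtain K where K: "compact K" "S \<inter> ball 0 r \<subseteq> K" "x0 \<notin> K" using S_bounded_compact by blast
 have sub: "K \<subseteq> - {x0}" using K(3) by blast
 have cu: "continuous_on K u" and cD: "continuous_on K Du"
  using continuous_on_subset[OF u_continuous sub] continuous_on_subset[OF Du_continuous sub] by auto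
 obtain B where B: "\<And>x. x \<in> K ==> norm (u x) \<le> B" using compact_continuous_bound[OF K(1) cu] by blast
 obtain B' where B': "\<And>x. x \<in> K ==> norm (Du x) \<le> B'" using compact_continuous_bound[OF K(1) cD] by blast
 have m: "S \<inter> ball 0 r \<in> lmeasurable" "S \<inter> ball 0 r \<in> sets lebesgue"
  using S_ball_lmeasurable by auto
 have op': "open (S \<inter> ball 0 r)" using S_open by auto
 have "Lp_on CARD('n) (S \<inter> ball 0 r) u"
  by (rule Lp_on_bounded[OF m(1) continuous_imp_measurable_on_sets_lebesgue[OF continuous_on_subset[OF cu K(2)] m(2)]])
    (use B K in blast)
 moreover have "Lp_on CARD('n) (S \<inter> ball 0 r) Du"
  by (rule Lp_on_bounded[OF m(1) continuous_imp_measurable_on_sets_lebesgue[OF continuous_on_subset[OF cD K(2)] m(2)]])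
    (use B' K in blast)
 moreover have "has_weak_gradient (S \<inter> ball 0 r) u Du"
  by (rule has_weak_gradient_C1[OF op' u_GDERIV continuous_on_subset[OF cD K(2)]]) (use S_x0 in blast)
 ultimately show ?thesis by (simp add: W1p_def)
qed

text \<open>Truncation near the zero level: \<open>t \<mapsto> t exp (- 1 / (n t - 1))\<close> for \<open>n t > 1\<close>, and zero below. It
 is smooth, and its derivative is bounded uniformly in \<open>n\<close> and tends to one.\<close>
definition trunc :: "nat => real => real" where
 "trunc n t = t * flat 0 (real n * t - 1)"

definition trunc' :: "nat => real => real" where
 "trunc' n t = flat 0 (real n * t - 1) + t * real n * flat 2 (real n * t - 1)"

lemma trunc_DERIV: "(trunc n has_real_derivative trunc' n t) (at t)"
proof -
 have "((\<lambda>t. flat 0 (real n * t - 1)) has_real_derivative (flat 2 (real n * t - 1) * real n)) (at t)"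
  by (rule DERIV_chain'[of "\<lambda>t. real n * t - 1" "real n" t UNIV "flat 0"])
    (use flat_DERIV[of 0 "real n * t - 1"] in \<open>auto intro!: derivative_eq_intros simp: numeral_2_eq_2\<close>)
 from DERIV_mult[OF DERIV_ident this]
 show ?thesis unfolding trunc_def[abs_def] trunc'_def by (simp add: algebra_simps)
qed

lemma trunc_eq_0: "real n * t \<le> 1 ==> trunc n t = 0"
 by (simp add: trunc_def flat_def)

lemma flat_bounds: "0 \<le> flat m t" "flat 0 t \<le> 1" "flat 1 t \<le> 1" "flat 2 t \<le> 2"
proof -
 show "0 \<le> flat m t" by (simp add: flat_def)
 show "flat 0 t \<le> 1" by (simp add: flat_def)
 have e: "1 + 1 / t + (1 / t)\<^sup>2 / 2 \<le> exp (1 / t)" if "t > 0"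
  using exp_lower_Taylor_quadratic[of "1 / t"] that by simp
 have q: "0 \<le> (1 / t)\<^sup>2" by simp
 show "flat 1 t \<le> 1"
 proof (cases "t > 0")
  case True
  then have "1 / t \<le> exp (1 / t)" using e q by (smt (verit) divide_nonneg_pos zero_less_divide_iff)
  then show ?thesis using True by (simp add: flat_def exp_minus field_simps)
 qed (simp add: flat_def)
 show "flat 2 t \<le> 2"
 proof (cases "t > 0")
  case True
  then have "(1 / t)\<^sup>2 \<le> 2 * exp (1 / t)" using e q by (smt (verit) field_sum_of_halves zero_less_divide_iff)
  then show ?thesis using True by (simp add: flat_def exp_minus field_simps)
 qed (simp add: flat_def)
qed

lemma trunc_bounds: "t \<ge> 0 ==> 0 \<le> trunc n t \<and> trunc n t \<le> t"
 using flat_bounds(1)[of 0 "real n * t - 1"] flat_bounds(2)[of "real n * t - 1"]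
 by (simp add: trunc_def mult_left_le)

lemma trunc'_eq: "trunc' n t = flat 0 (real n * t - 1) + flat 1 (real n * t - 1) + flat 2 (real n * t - 1)"
proof -
 have "(s + 1) * flat 2 s = flat 1 s + flat 2 s" for s
  by (cases "s > 0") (simp_all add: flat_def field_simps power2_eq_square)
 from this[of "real n * t - 1"] show ?thesis by (simp add: trunc'_def mult.commute)
qed

lemma trunc'_bounds: "0 \<le> trunc' n t \<and> trunc' n t \<le> 4"
 unfolding trunc'_eq
 using flat_bounds(1)[of 0 "real n * t - 1"] flat_bounds(1)[of 1 "real n * t - 1"] flat_bounds(1)[of 2 "real n * t - 1"]
  flat_bounds(2,3,4)[of "real n * t - 1"] by linarith

lemma trunc'_eq_0: "real n * t \<le> 1 ==> trunc' n t = 0"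
 by (simp add: trunc'_eq flat_def)

lemma trunc_limits:
 assumes t: "t > 0"
 shows "(\<lambda>n. trunc (Suc n) t) \<longlonglongrightarrow> t" "(\<lambda>n. trunc' (Suc n) t) \<longlonglongrightarrow> 1"
proof -
 define s where "s n = real (Suc n) * t - 1" for n
 have "filterlim (\<lambda>n. t * real (Suc n)) at_top sequentially"
  by (rule filterlim_tendsto_pos_mult_at_top[OF tendsto_const t filterlim_compose[OF filterlim_real_sequentially filterlim_Suc]])
 from filterlim_tendsto_add_at_top[OF tendsto_const[of "-1"] this]
 have s: "filterlim s at_top sequentially"
  by (simp add: s_def[abs_def] mult.commute)
 have inv: "(\<lambda>n. 1 / s n) \<longlonglongrightarrow> 0"
  using tendsto_inverse_0_at_top[OF s] by (simp add: inverse_eq_divide)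
 have ev: "\<forall>\<^sub>F n in sequentially. s n > 0"
  using s by (simp add: filterlim_at_top_dense)
 have "(\<lambda>n. exp (- (1 / s n))) \<longlonglongrightarrow> exp (- 0)" by (intro tendsto_intros inv)
 then have e: "(\<lambda>n. exp (- (1 / s n))) \<longlonglongrightarrow> 1" by simp
 have lim: "(\<lambda>n. flat m (s n)) \<longlonglongrightarrow> 1 * 0 ^ m" for m
 proof (rule Lim_transform_eventually)
  show "(\<lambda>n. exp (- (1 / s n)) * (1 / s n) ^ m) \<longlonglongrightarrow> 1 * 0 ^ m" by (intro tendsto_intros e inv)
  show "\<forall>\<^sub>F n in sequentially. exp (- (1 / s n)) * (1 / s n) ^ m = flat m (s n)"
   using ev by eventually_elim (simp add: flat_def power_divide)
 qed
 have "(\<lambda>n. t * flat 0 (s n)) \<longlonglongrightarrow> t * (1 * 0 ^ 0)" by (intro tendsto_intros lim)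
 then show "(\<lambda>n. trunc (Suc n) t) \<longlonglongrightarrow> t" by (simp add: trunc_def s_def)
 have "(\<lambda>n. flat 0 (s n) + flat 1 (s n) + flat 2 (s n)) \<longlonglongrightarrow> 1 * 0 ^ 0 + 1 * 0 ^ 1 + 1 * 0 ^ 2"
  by (intro tendsto_add lim)
 then show "(\<lambda>n. trunc' (Suc n) t) \<longlonglongrightarrow> 1" by (simp add: trunc'_eq s_def)
qed

definition utr :: "nat => real^'n => real" where
 "utr n x = (if rad x \<le> R then 0 else trunc n (u x))"

definition Dutr :: "nat => real^'n => real^'n" where
 "Dutr n x = (if rad x \<le> R then 0 else trunc' n (u x) *\<^sub>R Du x)"

text \<open>The truncated solutions vanish on open neighbourhoods of the closed ball.\<close>
definition core :: "nat => (real^'n) set" where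
 "core n = {x. rad x < R * exp (1 / (real n * C * R))}"

lemma core_open: "open (core n)"
 unfolding core_def by (rule open_Collect_less[OF rad_continuous continuous_on_const])

lemma rad_le_core: "n > 0 ==> rad x \<le> R ==> x \<in> core n"
 using C_pos R_pos by (auto simp: core_def intro: le_less_trans)

lemma core_zero:
 assumes n: "n > 0" and x: "x \<in> core n"
 shows "utr n x = 0" "Dutr n x = 0"
proof -
 have "real n * u x \<le> 1" if "rad x > R"
 proof -
  have "rad x / R < exp (1 / (real n * C * R))" using x R_pos by (simp add: core_def field_simps)
  moreover have "rad x / R > 0" using that R_pos by simp
  ultimately have "ln (rad x / R) < 1 / (real n * C * R)" by (metis exp_gt_zero ln_exp ln_less_cancel_iff)
  then have "ln (rad x / R) * (real n * C * R) < 1" using n C_pos R_pos by (simp add: field_simps)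
  then show ?thesis by (simp add: u_def mult_ac)
 qed
 then show "utr n x = 0" "Dutr n x = 0" by (auto simp: utr_def Dutr_def trunc_eq_0 trunc'_eq_0)
qed

lemma far_open: "open {x. R < rad x}"
 by (rule open_Collect_less[OF continuous_on_const rad_continuous])

lemma far_x0: "R < rad x ==> x \<noteq> x0"
 using R_pos rad_pos_iff[of x] by auto

lemma utr_GDERIV:
 assumes n: "n > 0" shows "GDERIV (utr n) x :> Dutr n x"
proof (cases "R < rad x")
 case True
 have "GDERIV (\<lambda>y. trunc n (u y)) x :> trunc' n (u x) *\<^sub>R Du x"
  by (rule GDERIV_DERIV_compose[OF u_GDERIV[OF far_x0[OF True]] trunc_DERIV])
 then have "GDERIV (utr n) x :> trunc' n (u x) *\<^sub>R Du x"
  by (rule GDERIV_transform[OF _ far_open]) (use True in \<open>auto simp: utr_def\<close>)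
 then show ?thesis using True by (simp add: Dutr_def)
next
 case False
 then have x: "x \<in> core n" using rad_le_core[OF n] by simp
 have "GDERIV (utr n) x :> 0"
  by (rule GDERIV_transform[where f="\<lambda>_. 0", OF GDERIV_const core_open x]) (simp add: core_zero[OF n])
 then show ?thesis using core_zero[OF n x] by simp
qed

lemma Dutr_continuous:
 assumes n: "n > 0" shows "continuous_on UNIV (Dutr n)"
proof -
 have "continuous_on {x. R < rad x} (Dutr n)"
 proof (rule continuous_on_cong[THEN iffD1, OF refl])
  have ct: "continuous_on UNIV (trunc' n)"
   unfolding trunc'_def
   by (intro continuous_intros continuous_on_compose2[OF smooth_on_continuous[OF flat_smooth], of UNIV]) auto
  show "continuous_on {x. R < rad x} (\<lambda>x. trunc' n (u x) *\<^sub>R Du x)"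
   using far_x0
   by (intro continuous_intros continuous_on_compose2[OF ct] continuous_on_subset[OF u_continuous] continuous_on_subset[OF Du_continuous]) auto
  show "trunc' n (u x) *\<^sub>R Du x = Dutr n x" if "x \<in> {x. R < rad x}" for x using that by (simp add: Dutr_def)
 qed
 moreover have "continuous_on (core n) (Dutr n)"
  by (rule continuous_on_cong[THEN iffD1, OF refl _ continuous_on_const[of _ 0]]) (use core_zero[OF n] in simp)
 ultimately have "continuous_on ({x. R < rad x} \<union> core n) (Dutr n)"
  by (rule continuous_on_open_Un[OF far_open core_open])
 moreover have "{x. R < rad x} \<union> core n = UNIV" using rad_le_core[OF n] not_le by blast
 ultimately show ?thesis by simp
qed

lemma closure_\<Gamma>_rad: "x \<in> closure \<Gamma> ==> rad x \<le> R"
proof -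
 have "closed {x. rad x \<le> R}" by (rule closed_Collect_le[OF rad_continuous continuous_on_const])
 then have "closure \<Gamma> \<subseteq> {x. rad x \<le> R}" by (intro closure_minimal) (auto simp: \<Gamma>_iff)
 then show "x \<in> closure \<Gamma> ==> rad x \<le> R" by blast
qed

lemma utr_smooth_approximation:
 assumes n: "n > 0" and e: "e > 0"
 obtains F U where "smooth_on UNIV F" "open U" "closure \<Gamma> \<subseteq> U" "\<And>x. x \<in> U ==> F x = 0"
  "\<And>x. x \<in> ball 0 r ==> \<bar>F x - utr n x\<bar> \<le> e" "\<And>x. x \<in> ball 0 r ==> norm (grad F x - Dutr n x) \<le> e"
proof -
 let ?B = "cball 0 (r + 1) :: (real^'n) set"
 have cu: "continuous_on UNIV (utr n)" by (rule GDERIV_continuous_on[OF utr_GDERIV[OF n]])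
 have uc1: "uniformly_continuous_on ?B (utr n)"
  by (rule compact_uniformly_continuous[OF continuous_on_subset[OF cu]]) auto
 have uc2: "uniformly_continuous_on ?B (Dutr n)"
  by (rule compact_uniformly_continuous[OF continuous_on_subset[OF Dutr_continuous[OF n]]]) auto
 obtain d1 where d1: "d1 > 0" "\<And>x z. x \<in> ?B ==> z \<in> ?B ==> dist z x < d1 ==> dist (utr n z) (utr n x) < e"
  using uc1 e unfolding uniformly_continuous_on_def by blast
 obtain d2 where d2: "d2 > 0" "\<And>x z. x \<in> ?B ==> z \<in> ?B ==> dist z x < d2 ==> dist (Dutr n z) (Dutr n x) < e"
  using uc2 e unfolding uniformly_continuous_on_def by blast
 have "closure \<Gamma> \<subseteq> core n" using closure_\<Gamma>_rad rad_le_core[OF n] by blast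
 then obtain d3 where d3: "d3 > 0" "(\<Union>x\<in>closure \<Gamma>. ball x d3) \<subseteq> core n"
  using compact_subset_open_imp_ball_epsilon_subset[OF \<Gamma>_compact core_open] by blast
 define \<delta> where "\<delta> = Min {1, d1, d2, d3 / 2}"
 have \<delta>: "\<delta> > 0" "\<delta> \<le> 1" "\<delta> \<le> d1" "\<delta> \<le> d2" "\<delta> \<le> d3 / 2"
  using d1(1) d2(1) d3(1) by (auto simp: \<delta>_def)
 obtain \<rho> :: "real^'n => real" where \<rho>: "mollifier \<delta> \<rho>" using mollifier_exists[OF \<delta>(1)] by blast
 have inB: "z \<in> ?B" if "x \<in> ball 0 r" "z \<in> ball x \<delta>" for x z :: "real^'n"
 proof -
  have "norm z \<le> norm x + dist x z" using norm_triangle_sub[of z x] by (simp add: dist_norm norm_minus_commute)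
  then show ?thesis using that \<delta>(2) by simp
 qed
 have sub: "ball x \<delta> \<subseteq> cube (r + 1)" if "x \<in> ball 0 r" for x :: "real^'n"
  using inB[OF that] cball_subset_cube by blast
 show thesis
 proof (rule that)
  show "smooth_on UNIV (mollify \<rho> (r + 1) (utr n))"
   using \<rho> cu by (intro mollify_smooth) (auto simp: mollifier_def)
  show "open (\<Union>x\<in>closure \<Gamma>. ball x (d3 / 2))" by auto
  show "closure \<Gamma> \<subseteq> (\<Union>x\<in>closure \<Gamma>. ball x (d3 / 2))" using d3(1) by auto
  show "mollify \<rho> (r + 1) (utr n) x = 0" if xU: "x \<in> (\<Union>x\<in>closure \<Gamma>. ball x (d3 / 2))" for x
  proof (rule mollify_eq_0[OF \<rho>])
   fix z assume z: "z \<in> ball x \<delta>"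
   obtain y where y: "y \<in> closure \<Gamma>" "dist y x < d3 / 2" using xU by auto
   have "dist y z < d3" using dist_triangle[of y z x] y(2) z \<delta>(5) by simp
   then have "z \<in> (\<Union>x\<in>closure \<Gamma>. ball x d3)" by (intro UN_I[OF y(1)]) simp
   then have "z \<in> core n" using d3(2) by blast
   then show "utr n z = 0" by (rule core_zero[OF n])
  qed
  show "\<bar>mollify \<rho> (r + 1) (utr n) x - utr n x\<bar> \<le> e" if x: "x \<in> ball 0 r" for x
  proof (rule mollify_close[OF \<rho> cu sub[OF x]])
   fix z assume z: "z \<in> ball x \<delta>"
   have "dist (utr n z) (utr n x) < e"
    by (rule d1(2)) (use x z inB[OF x z] \<delta>(3) in \<open>auto simp: dist_commute\<close>)
   then show "\<bar>utr n z - utr n x\<bar> \<le> e" by (simp add: dist_real_def)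
  qed
  show "norm (grad (mollify \<rho> (r + 1) (utr n)) x - Dutr n x) \<le> e" if x: "x \<in> ball 0 r" for x
  proof (rule grad_mollify_close[OF \<rho> utr_GDERIV[OF n] Dutr_continuous[OF n] sub[OF x]])
   fix z assume z: "z \<in> ball x \<delta>"
   have "dist (Dutr n z) (Dutr n x) < e"
    by (rule d2(2)) (use x z inB[OF x z] \<delta>(4) in \<open>auto simp: dist_commute\<close>)
   then show "norm (Dutr n z - Dutr n x) \<le> e" by (simp add: dist_norm)
  qed
 qed
qed

lemma u_pos: "x \<in> S ==> u x > 0"
 using C_pos R_pos by (auto simp: u_def S_iff intro!: mult_pos_pos ln_gt_zero)

lemma u_Sobolev_limit: "\<exists>F. Sobolev_limit CARD('n) (S \<inter> ball 0 r) \<Gamma> u Du F"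
proof -
 let ?S = "S \<inter> ball 0 r"
 have "\<exists>F. \<forall>n. smooth_on UNIV (F n) \<and> (\<exists>U. open U \<and> closure \<Gamma> \<subseteq> U \<and> (\<forall>x\<in>U. F n x = 0)) \<and>
  (\<forall>x\<in>ball 0 r. \<bar>F n x - utr (Suc n) x\<bar> \<le> 1 / real (Suc n) \<and> norm (grad (F n) x - Dutr (Suc n) x) \<le> 1 / real (Suc n))"
 proof (rule choice, rule allI)
  fix n :: nat
  obtain F U where "smooth_on UNIV F" "open U" "closure \<Gamma> \<subseteq> U" "\<And>x. x \<in> U ==> F x = 0"
   "\<And>x. x \<in> ball 0 r ==> \<bar>F x - utr (Suc n) x\<bar> \<le> 1 / real (Suc n)"
   "\<And>x. x \<in> ball 0 r ==> norm (grad F x - Dutr (Suc n) x) \<le> 1 / real (Suc n)"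
   by (rule utr_smooth_approximation[of "Suc n" "1 / real (Suc n)" r]) (simp, simp, blast)
  then show "\<exists>F. smooth_on UNIV F \<and> (\<exists>U. open U \<and> closure \<Gamma> \<subseteq> U \<and> (\<forall>x\<in>U. F x = 0)) \<and>
   (\<forall>x\<in>ball 0 r. \<bar>F x - utr (Suc n) x\<bar> \<le> 1 / real (Suc n) \<and> norm (grad F x - Dutr (Suc n) x) \<le> 1 / real (Suc n))"
   by blast
 qed
 then obtain F where s: "\<And>n. smooth_on UNIV (F n)"
  and U: "\<And>n. \<exists>U. open U \<and> closure \<Gamma> \<subseteq> U \<and> (\<forall>x\<in>U. F n x = 0)"
  and F: "\<And>n x. x \<in> ball 0 r ==> \<bar>F n x - utr (Suc n) x\<bar> \<le> 1 / real (Suc n)"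
  and DF: "\<And>n x. x \<in> ball 0 r ==> norm (grad (F n) x - Dutr (Suc n) x) \<le> 1 / real (Suc n)"
  by blast
 obtain K where K: "compact K" "?S \<subseteq> K" "x0 \<notin> K" using S_bounded_compact by blast
 have sub: "K \<subseteq> - {x0}" using K(3) by blast
 have cu: "continuous_on K u" and cD: "continuous_on K Du"
  using continuous_on_subset[OF u_continuous sub] continuous_on_subset[OF Du_continuous sub] by auto
 obtain B where B: "\<And>x. x \<in> K ==> norm (u x) \<le> B" using compact_continuous_bound[OF K(1) cu] by blast
 obtain B' where B': "\<And>x. x \<in> K ==> norm (Du x) \<le> B'" using compact_continuous_bound[OF K(1) cD] by blast
 have m: "?S \<in> sets lebesgue" using S_ball_lmeasurable by auto
 have cS: "continuous_on ?S u" "continuous_on ?S Du" using continuous_on_subset[OF cu K(2)] continuous_on_subset[OF cD K(2)] by auto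
 have inS: "utr (Suc n) x = trunc (Suc n) (u x)" "Dutr (Suc n) x = trunc' (Suc n) (u x) *\<^sub>R Du x" if "x \<in> ?S" for n x
  using that by (auto simp: utr_def Dutr_def S_iff)
 have lim0: "(\<lambda>n. 1 / real (Suc n)) \<longlonglongrightarrow> 0" using LIMSEQ_Suc[OF lim_1_over_n] .
 have le1: "1 / real (Suc n) \<le> 1" for n by simp
 have p: "1 \<le> CARD('n)" using dim by simp
 have t1: "Lp_tendsto CARD('n) ?S F u"
 proof (rule Lp_tendsto_bounded_pointwise[OF S_ball_lmeasurable, where B="1 + B"])
  show "(\<lambda>x. F n x - u x) \<in> borel_measurable (lebesgue_on ?S)" for n
   by (intro continuous_imp_measurable_on_sets_lebesgue[OF _ m] continuous_intros cS smooth_on_continuous[OF s])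
  fix x assume x: "x \<in> ?S"
  have u0: "u x > 0" using x u_pos by simp
  have b1: "\<bar>F n x - trunc (Suc n) (u x)\<bar> \<le> 1 / real (Suc n)" for n using F[of x n] x inS(1)[OF x] by simp
  have uB: "\<bar>u x\<bar> \<le> B" using B[of x] x K(2) by auto
  show "norm (F n x - u x) \<le> 1 + B" for n
   using b1[of n] le1[of n] trunc_bounds[OF less_imp_le[OF u0], of "Suc n"] uB unfolding real_norm_def by linarith
  have "(\<lambda>n. F n x - trunc (Suc n) (u x)) \<longlonglongrightarrow> 0"
   by (rule Lim_null_comparison[OF _ lim0]) (use b1 in simp)
  from tendsto_add[OF this tendsto_diff[OF trunc_limits(1)[OF u0] tendsto_const[of "u x"]]]
  show "(\<lambda>n. F n x - u x) \<longlonglongrightarrow> 0" by simp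
 qed (use p in simp)
 have t2: "Lp_tendsto CARD('n) ?S (\<lambda>n. grad (F n)) Du"
 proof (rule Lp_tendsto_bounded_pointwise[OF S_ball_lmeasurable, where B="1 + 5 * B'"])
  show "(\<lambda>x. grad (F n) x - Du x) \<in> borel_measurable (lebesgue_on ?S)" for n
   by (intro continuous_imp_measurable_on_sets_lebesgue[OF _ m] continuous_intros cS smooth_on_grad_continuous[OF s])
  fix x assume x: "x \<in> ?S"
  have u0: "u x > 0" using x u_pos by simp
  have b1: "norm (grad (F n) x - trunc' (Suc n) (u x) *\<^sub>R Du x) \<le> 1 / real (Suc n)" for n
   using DF[of x n] x inS(2)[OF x] by simp
  have nb: "norm (Du x) \<le> B'" using B' x K(2) by blast
  show "norm (grad (F n) x - Du x) \<le> 1 + 5 * B'" for n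
  proof -
   have "norm (trunc' (Suc n) (u x) *\<^sub>R Du x) \<le> 4 * B'"
    using trunc'_bounds[of "Suc n" "u x"] nb by (auto intro!: mult_mono)
   moreover have "norm (grad (F n) x - Du x) \<le> norm (grad (F n) x - trunc' (Suc n) (u x) *\<^sub>R Du x)
     + (norm (trunc' (Suc n) (u x) *\<^sub>R Du x) + norm (Du x))"
    using norm_triangle_ineq[of "grad (F n) x - trunc' (Suc n) (u x) *\<^sub>R Du x" "trunc' (Suc n) (u x) *\<^sub>R Du x - Du x"]
     norm_triangle_ineq4[of "trunc' (Suc n) (u x) *\<^sub>R Du x" "Du x"] by simp
   ultimately show ?thesis using b1[of n] le1[of n] nb by linarith
  qed
  have "(\<lambda>n. grad (F n) x - trunc' (Suc n) (u x) *\<^sub>R Du x) \<longlonglongrightarrow> 0"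
   by (rule Lim_null_comparison[OF _ lim0]) (use b1 in simp)
  from tendsto_add[OF this tendsto_diff[OF tendsto_scaleR[OF trunc_limits(2)[OF u0] tendsto_const[of "Du x"]] tendsto_const[of "Du x"]]]
  show "(\<lambda>n. grad (F n) x - Du x) \<longlonglongrightarrow> 0" by simp
 qed (use p in simp)
 have "Sobolev_limit CARD('n) ?S \<Gamma> u Du F"
  unfolding Sobolev_limit_def
 proof (intro conjI allI t1 t2 s)
  fix n
  obtain V where "open V" "closure \<Gamma> \<subseteq> V" "\<forall>x\<in>V. F n x = 0" using U[of n] by auto
  then show "\<exists>U. open U \<and> closure \<Gamma> \<subseteq> U \<and> (\<forall>x\<in>U \<inter> closure ?S. F n x = 0)"
   by (intro exI[of _ V]) simp
 qed
 then show ?thesis by blast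
qed

lemma u_vanishes: "vanishes_on_loc CARD('n) S \<Gamma> u"
proof -
 have "vanishes_on CARD('n) (S \<inter> ball 0 r) \<Gamma> u" for r
 proof -
  have "open (S \<inter> ball 0 r)" "bounded (S \<inter> ball 0 r)" using S_open by (auto intro: bounded_Int)
  moreover have "1 \<le> CARD('n)" using dim by simp
  ultimately show ?thesis using vanishes_on_iff u_Sobolev_limit[of r] W1p_u[of r] by blast
 qed
 then show ?thesis by (simp add: vanishes_on_loc_def)
qed

end

context exterior_problem begin

lemma flux_Du_continuous: "continuous_on S (\<lambda>x. flux H (Du x))"
proof (rule continuous_on_cong[THEN iffD1, OF refl])
 show "continuous_on S (\<lambda>x. ((C * R) ^ (CARD('n) - 1) * w x) *\<^sub>R (x - x0))"
  by (intro continuous_intros w_continuous)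
 show "((C * R) ^ (CARD('n) - 1) * w x) *\<^sub>R (x - x0) = flux H (Du x)" if "x \<in> S" for x
  using flux_Du[OF S_x0[OF that]] by simp
qed

lemma flux_Du_orthogonal_smooth:
 assumes f: "smooth_on UNIV f" and z: "\<And>x. r \<le> norm x ==> f x = 0"
  and U: "open U" "closure \<Gamma> \<subseteq> U" "\<And>x. x \<in> U \<inter> S ==> f x = 0"
 shows "(LINT x|lebesgue_on S. flux H (Du x) \<bullet> grad f x) = 0"
proof -
 obtain \<delta> where \<delta>: "\<delta> > 0" "\<And>x. x \<in> \<Sigma> ==> R \<le> rad x ==> rad x < R * (1 + \<delta>) ==> x \<in> U"
  using collar[OF U(1,2)] by blast
 have 0: "(LINT x|lebesgue_on S. w x * ((x - x0) \<bullet> grad f x)) = 0"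
 proof (rule integral_radial_derivative[OF smooth_on_GDERIV[OF f] smooth_on_grad_continuous[OF f] _ \<delta>(1)])
  show "f x = 0" if "r + norm x0 \<le> norm (x - x0)" for x
   using that norm_triangle_ineq4[of x x0] by (intro z) simp
  show "f x = 0" if "x \<in> S" "rad x < R * (1 + \<delta>)" for x
   using that \<delta>(2)[of x] U(3)[of x] by (auto simp: S_iff)
 qed
 have "(LINT x|lebesgue_on S. flux H (Du x) \<bullet> grad f x)
   = (LINT x|lebesgue_on S. (C * R) ^ (CARD('n) - 1) * (w x * ((x - x0) \<bullet> grad f x)))"
  by (rule Bochner_Integration.integral_cong) (auto simp: flux_Du[OF S_x0])
 then show ?thesis using 0 by simp
qed

lemma u_weak_equation:
 assumes W: "W1p CARD('n) S \<phi> \<psi>" and van: "vanishes_on_loc CARD('n) S \<Gamma> \<phi>"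
  and supp: "\<exists>r. AE x in lebesgue_on S. r \<le> norm x --> \<phi> x = 0"
 shows "(LINT x|lebesgue_on S. flux H (Du x) \<bullet> \<psi> x) = 0"
proof -
 let ?v = "\<lambda>x. flux H (Du x)"
 obtain r0' where r0': "AE x in lebesgue_on S. r0' \<le> norm x --> \<phi> x = 0" using supp by blast
 define r0 where "r0 = max r0' 1"
 have r0: "r0 \<ge> 1" "AE x in lebesgue_on S. r0 \<le> norm x --> \<phi> x = 0"
  using r0' by (auto simp: r0_def elim!: eventually_mono)
 have wS: "has_weak_gradient S \<phi> \<psi>" using W by (simp add: W1p_def)
 have far: "AE x in lebesgue_on S. r0 < norm x --> \<psi> x = 0"
 proof -
  let ?T = "S \<inter> {x. r0 < norm x}"
  have op': "open ?T" by (intro open_Int S_open open_Collect_less continuous_intros)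
  have wT: "has_weak_gradient ?T \<phi> \<psi>" by (rule has_weak_gradient_subset[OF wS _ op' S_open]) simp
  have "AE x in lebesgue_on ?T. \<phi> x = 0"
   using r0(2) op' by (simp add: AE_restrict_space_iff) (auto elim!: eventually_mono)
  from weak_gradient_unique[OF op' wT has_weak_gradient_AE_zero[OF wT this]]
  show ?thesis using op' by (simp add: AE_restrict_space_iff) (auto elim!: eventually_mono)
 qed
 obtain R1 where R1: "\<And>r. r \<ge> R1 ==> vanishes_on CARD('n) (S \<inter> ball 0 r) \<Gamma> \<phi>"
  using van unfolding vanishes_on_loc_def eventually_at_top_linorder by blast
 define r where "r = max R1 (2 * r0 + 3)"
 let ?S = "S \<inter> ball 0 r"
 have opS: "open ?S" "bounded ?S" using S_open by (auto intro: bounded_Int)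
 have p: "1 \<le> CARD('n)" using dim by simp
 have "vanishes_on CARD('n) ?S \<Gamma> \<phi>" by (rule R1) (simp add: r_def)
 then obtain g F where g: "W1p CARD('n) ?S \<phi> g" and F: "Sobolev_limit CARD('n) ?S \<Gamma> \<phi> g F"
  unfolding vanishes_on_iff[OF opS p] by blast
 have wg: "has_weak_gradient ?S \<phi> g" using g by (simp add: W1p_def)
 have w\<psi>: "has_weak_gradient ?S \<phi> \<psi>" by (rule has_weak_gradient_subset[OF wS _ opS(1) S_open]) simp
 have g\<psi>: "AE x in lebesgue_on ?S. g x = \<psi> x" by (rule weak_gradient_unique[OF opS(1) wg w\<psi>])
 obtain \<zeta> :: "real^'n => real" where \<zeta>: "smooth_on UNIV \<zeta>" "\<And>x. norm x \<le> 1 ==> \<zeta> x = 1" "\<And>x. 2 \<le> norm x ==> \<zeta> x = 0"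
  using cutoff_exists by blast
 define \<eta> where "\<eta> x = \<zeta> (0 + (1 / (r0 + 1)) *\<^sub>R x)" for x
 have \<eta>s: "smooth_on UNIV \<eta>" unfolding \<eta>_def by (rule smooth_on_affine[OF \<zeta>(1)])
 have \<eta>1: "\<eta> x = 1" if "norm x \<le> r0 + 1" for x
  unfolding \<eta>_def using that r0(1) by (intro \<zeta>(2)) (simp add: field_simps)
 have \<eta>0: "\<eta> x = 0" if "2 * (r0 + 1) \<le> norm x" for x
  unfolding \<eta>_def using that r0(1) by (intro \<zeta>(3)) (simp add: field_simps)
 have g\<eta>: "grad \<eta> x = 0" if "norm x < r0 + 1" for x
 proof -
  have "GDERIV \<eta> x :> 0"
  proof (rule GDERIV_transform[where f="\<lambda>_. 1" and S="ball 0 (r0 + 1)"])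
   show "GDERIV (\<lambda>_. 1) x :> 0" by (rule GDERIV_const)
   show "1 = \<eta> y" if "y \<in> ball 0 (r0 + 1)" for y using \<eta>1[of y] that by simp
  qed (use that in auto)
  then show ?thesis by (rule GDERIV_grad)
 qed
 define f where "f x = \<eta> x *\<^sub>R g x + \<phi> x *\<^sub>R grad \<eta> x" for x
 define G where "G n x = \<eta> x * F n x" for n x
 have L: "Sobolev_limit CARD('n) ?S \<Gamma> (\<lambda>x. \<eta> x * \<phi> x) f G"
  using Sobolev_limit_mult[OF opS F \<eta>s] by (simp add: f_def[abs_def] G_def[abs_def])
 have Gs: "smooth_on UNIV (G n)" for n using L by (simp add: Sobolev_limit_def)
 have GL: "Lp_tendsto CARD('n) ?S (\<lambda>n. grad (G n)) f" using L by (simp add: Sobolev_limit_def)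
 have "Lp_on CARD('n) ?S (\<lambda>x. grad (G 0) x - (grad (G 0) x - f x))"
  by (rule Lp_on_diff[OF smooth_Lp_on(2)[OF opS Gs]]) (use GL in \<open>simp add: Lp_tendsto_def\<close>)
 then have fL: "Lp_on CARD('n) ?S f" by simp
 have Sm: "?S \<in> lmeasurable" by (rule S_ball_lmeasurable)
 have vm: "?v \<in> borel_measurable (lebesgue_on S)"
  by (rule continuous_imp_measurable_on_sets_lebesgue[OF flux_Du_continuous]) simp
 have vm': "?v \<in> borel_measurable (lebesgue_on ?S)"
  by (rule continuous_imp_measurable_on_sets_lebesgue[OF continuous_on_subset[OF flux_Du_continuous]]) (use Sm in auto)
 have vB: "norm (?v x) \<le> (C * R) ^ (CARD('n) - 1) * (1 / R ^ CARD('n)) * (r + norm x0)" if x: "x \<in> ?S" for x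
 proof -
  have "norm (x - x0) \<le> r + norm x0" using x norm_triangle_ineq4[of x x0] by simp
  then have "(C * R) ^ (CARD('n) - 1) * w x * norm (x - x0) \<le> (C * R) ^ (CARD('n) - 1) * (1 / R ^ CARD('n)) * (r + norm x0)"
   using w_bound[of x] x C_pos R_pos by (intro mult_mono mult_nonneg_nonneg) auto
  then show ?thesis using flux_Du[of x] S_x0[of x] x w_bound[of x] C_pos R_pos by simp
 qed
 have lim: "(\<lambda>n. LINT x|lebesgue_on ?S. ?v x \<bullet> grad (G n) x) \<longlonglongrightarrow> (LINT x|lebesgue_on ?S. ?v x \<bullet> f x)"
  by (rule Lp_tendsto_integral[OF GL Sm p vm' vB Lp_on_imp_integrable[OF fL Sm p]])
 have zero: "(LINT x|lebesgue_on ?S. ?v x \<bullet> grad (G n) x) = 0" for n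
 proof -
  have Gz: "G n x = 0" if "2 * (r0 + 1) \<le> norm x" for x using \<eta>0[OF that] by (simp add: G_def)
  obtain U where U: "open U" "closure \<Gamma> \<subseteq> U" "\<forall>x\<in>U \<inter> closure ?S. F n x = 0"
   using F unfolding Sobolev_limit_def by blast
  have "(LINT x|lebesgue_on S. ?v x \<bullet> grad (G n) x) = 0"
  proof (rule flux_Du_orthogonal_smooth[OF Gs Gz U(1,2)])
   fix x assume x: "x \<in> U \<inter> S"
   show "G n x = 0"
   proof (cases "norm x < r")
    case True
    then have "x \<in> closure ?S" using x closure_subset[of ?S] by auto
    then show ?thesis using U(3) x by (simp add: G_def)
   next
    case False
    then show ?thesis by (intro Gz) (simp add: r_def)
   qed
  qed
  moreover have "grad (G n) x = 0" if "x \<in> S - ?S" for x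
   by (rule GDERIV_0_outside[OF smooth_on_GDERIV[OF Gs], of "2 * (r0 + 1)"]) (use Gz that in \<open>auto simp: r_def\<close>)
  ultimately show ?thesis
   using integral_lebesgue_on_subset(1)[of ?S S "\<lambda>x. ?v x \<bullet> grad (G n) x"] Sm by auto
 qed
 have 0: "(LINT x|lebesgue_on ?S. ?v x \<bullet> f x) = 0"
  using lim unfolding zero by (simp add: LIMSEQ_const_iff)
 have \<psi>m: "\<psi> \<in> borel_measurable (lebesgue_on S)" using W by (simp add: W1p_def Lp_on_def)
 have \<psi>m': "\<psi> \<in> borel_measurable (lebesgue_on ?S)"
  by (rule measurable_restrict_mono[OF \<psi>m]) simp
 have fm: "f \<in> borel_measurable (lebesgue_on ?S)" using fL by (simp add: Lp_on_def)
 have sub: "AE x in lebesgue_on ?S. P x" if "AE x in lebesgue_on S. P x" for P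
  using that Sm by (auto simp: AE_restrict_space_iff elim!: eventually_mono)
 have "(LINT x|lebesgue_on ?S. ?v x \<bullet> f x) = (LINT x|lebesgue_on ?S. ?v x \<bullet> \<psi> x)"
 proof (rule integral_cong_AE)
  show "(\<lambda>x. ?v x \<bullet> f x) \<in> borel_measurable (lebesgue_on ?S)" "(\<lambda>x. ?v x \<bullet> \<psi> x) \<in> borel_measurable (lebesgue_on ?S)"
   using vm' fm \<psi>m' by (auto intro: borel_measurable_inner)
  show "AE x in lebesgue_on ?S. ?v x \<bullet> f x = ?v x \<bullet> \<psi> x"
   using g\<psi> sub[OF far] sub[OF r0(2)]
  proof eventually_elim
   fix x assume a: "g x = \<psi> x" "r0 < norm x --> \<psi> x = 0" "r0 \<le> norm x --> \<phi> x = 0"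
   show "?v x \<bullet> f x = ?v x \<bullet> \<psi> x"
    using a \<eta>1[of x] g\<eta>[of x] by (cases "norm x \<le> r0") (auto simp: f_def)
  qed
 qed
 also have "\<dots> = (LINT x|lebesgue_on ?S. (if norm x < r then ?v x \<bullet> \<psi> x else 0))"
  by (rule Bochner_Integration.integral_cong) auto
 also have "\<dots> = (LINT x|lebesgue_on S. (if norm x < r then ?v x \<bullet> \<psi> x else 0))"
  using integral_lebesgue_on_subset(1)[of ?S S "\<lambda>x. (if norm x < r then ?v x \<bullet> \<psi> x else 0)"] Sm by auto
 also have "\<dots> = (LINT x|lebesgue_on S. ?v x \<bullet> \<psi> x)"
 proof (rule integral_cong_AE)
  have m: "(\<lambda>x. ?v x \<bullet> \<psi> x) \<in> borel_measurable (lebesgue_on S)" using vm \<psi>m by (rule borel_measurable_inner)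
  then show "(\<lambda>x. ?v x \<bullet> \<psi> x) \<in> borel_measurable (lebesgue_on S)" .
  have "{x \<in> space (lebesgue_on S). norm x < r} \<in> sets (lebesgue_on S)"
   using Sm by (auto simp: sets_restrict_space intro!: image_eqI[of _ _ ?S])
  then show "(\<lambda>x. (if norm x < r then ?v x \<bullet> \<psi> x else 0)) \<in> borel_measurable (lebesgue_on S)"
   using m by (intro measurable_If) auto
  show "AE x in lebesgue_on S. (if norm x < r then ?v x \<bullet> \<psi> x else 0) = ?v x \<bullet> \<psi> x"
   using far
  proof eventually_elim
   fix x assume "r0 < norm x --> \<psi> x = 0"
   moreover have "r0 < r" using r0(1) by (simp add: r_def)
   ultimately show "(if norm x < r then ?v x \<bullet> \<psi> x else 0) = ?v x \<bullet> \<psi> x" by auto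
  qed
 qed
 finally show ?thesis using 0 by simp
qed

lemma norm_shift:
 assumes "2 * norm x0 \<le> norm x" shows "norm x / 2 \<le> norm (x - x0)" "norm (x - x0) \<le> 2 * norm x"
 using assms norm_triangle_ineq2[of x x0] norm_triangle_ineq4[of x x0] norm_ge_zero[of x] by linarith+

lemma u_log_growth: "log_growth H \<Sigma> u"
proof -
 obtain m M where m: "0 < m" "\<And>x. m * norm x \<le> H0 x" and M: "0 < M" "\<And>x. H0 x \<le> M * norm x"
  using H0_bounds_exist by blast
 define q where "q = 2 * M / m"
 have q: "q > 0" using m M by (simp add: q_def)
 define A where "A = \<bar>ln q\<bar> + \<bar>ln R\<bar>"
 define c where "c = C * R"
 have c: "c > 0" using C_pos R_pos by (simp add: c_def)
 define d where "d = 2 * c + 2 / c + 2"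
 define R0 where "R0 = exp (2 * A + 1) + 2 * M * norm x0"
 have "1 / d \<le> u x / ln (H0 x) \<and> u x / ln (H0 x) \<le> d" if x: "R0 \<le> H0 x" for x
 proof -
  have h: "exp (2 * A + 1) \<le> H0 x" using x M by (smt (verit) R0_def mult_nonneg_nonneg norm_ge_zero)
  then have hp: "H0 x > 0" by (meson exp_gt_zero less_le_trans)
  have l: "2 * A + 1 \<le> ln (H0 x)" using h hp by (simp add: ln_ge_iff)
  have "2 * M * norm x0 \<le> H0 x" using x by (smt (verit) R0_def exp_gt_zero)
  also have "\<dots> \<le> M * norm x" by (rule M)
  finally have n: "2 * norm x0 \<le> norm x" using M(1) by simp
  have "rad x \<le> M * norm (x - x0)" unfolding rad_def by (rule M)
  also have "\<dots> \<le> M * (2 * norm x)" using M(1) norm_shift(2)[OF n] by simp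
  also have "\<dots> \<le> q * H0 x" using m(1) M(1) m(2)[of x] by (simp add: q_def field_simps)
  finally have up: "rad x \<le> q * H0 x" .
  have "H0 x / q \<le> M * norm x / q" using M(2)[of x] q by (simp add: divide_right_mono)
  also have "\<dots> = m * (norm x / 2)" using m(1) M(1) by (simp add: q_def)
  also have "\<dots> \<le> m * norm (x - x0)" using m(1) norm_shift(1)[OF n] by simp
  also have "\<dots> \<le> rad x" unfolding rad_def by (rule m)
  finally have lo: "H0 x / q \<le> rad x" .
  have rp: "rad x > 0" using lo hp q by (meson divide_pos_pos less_le_trans)
  have "ln (rad x) \<le> ln (q * H0 x)" using up rp by simp
  moreover have "ln (H0 x / q) \<le> ln (rad x)" using lo hp q rp by simp
  moreover have "u x = c * (ln (rad x) - ln R)" using rp R_pos by (simp add: u_def c_def ln_div)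
  ultimately have lx: "ln (H0 x) - A \<le> ln (rad x) - ln R" "ln (rad x) - ln R \<le> ln (H0 x) + A" and ux: "u x = c * (ln (rad x) - ln R)"
   using q hp by (auto simp: ln_mult ln_div A_def)
  have A0: "A \<ge> 0" by (simp add: A_def)
  have lp: "ln (H0 x) > 0" using l A0 by linarith
  have "c * (ln (H0 x) / 2) \<le> u x" unfolding ux using c lx(1) l by (intro mult_left_mono) auto
  then have 1: "c / 2 \<le> u x / ln (H0 x)" using lp by (simp add: field_simps)
  have "u x \<le> c * (2 * ln (H0 x))" unfolding ux using c lx(2) l A0 by (intro mult_left_mono) auto
  then have 2: "u x / ln (H0 x) \<le> 2 * c" using lp by (simp add: field_simps)
  have "2 / c \<le> d" using c by (simp add: d_def)
  moreover have "d > 0" using c by (simp add: d_def add_pos_pos)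
  ultimately have "1 / d \<le> c / 2" using c by (simp add: field_simps)
  moreover have "2 * c \<le> d" using c by (simp add: d_def)
  ultimately show ?thesis using 1 2 by linarith
 qed
 moreover have "d > 1" using c by (simp add: d_def add_pos_pos less_add_same_cancel2 add_strict_increasing2)
 moreover have "R0 > 0" using M by (simp add: R0_def add_pos_nonneg)
 ultimately show ?thesis unfolding log_growth_def by blast
qed

lemma u_solution: "overdetermined_solution H \<Sigma> \<Omega> C u"
proof -
 have "weak_solution H \<Sigma> \<Omega> u"
  unfolding weak_solution_def S_def[symmetric] \<Gamma>_def[symmetric]
  using W1p_u u_vanishes u_weak_equation by (intro exI[of _ Du]) auto
 moreover have "C1_up_to_with S \<Gamma> u Du"
 proof -
  have "S \<union> \<Gamma> \<subseteq> - {x0}" using R_pos rad_pos_iff[of x0] by (auto simp: S_iff \<Gamma>_iff)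
  then show ?thesis unfolding C1_up_to_with_def
   using continuous_on_subset[OF u_continuous] continuous_on_subset[OF Du_continuous] u_GDERIV S_x0 by blast
 qed
 moreover have "H (Du x) = C" if "x \<in> \<Gamma>" for x
  using that H_Du[of x] R_pos rad_pos_iff[of x] by (auto simp: \<Gamma>_iff)
 ultimately show ?thesis
  unfolding overdetermined_solution_def S_def[symmetric] \<Gamma>_def[symmetric] using u_log_growth by blast
qed

end

section \<open>A Poincare inequality on conical rings\<close>

text \<open>Both half-segments are treated by a homothety of ratio at least one half, about the end
 point that is held fixed.\<close>
lemma segment_half_integral:
 fixes g :: "'a::euclidean_space => real"
 assumes g: "g \<in> borel_measurable borel" and s: "0 \<le> s" "s \<le> 1/2"
 shows "(\<integral>\<^sup>+x. ennreal (g (x + s *\<^sub>R (y - x))) \<partial>lborel) \<le> ennreal (2 ^ DIM('a)) * (\<integral>\<^sup>+x. ennreal (g x) \<partial>lborel)"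
proof -
 let ?c = "1 - s"
 have c: "?c \<noteq> 0" "\<bar>?c\<bar> = ?c" "?c > 0" using s by auto
 have gm: "(\<lambda>x. ennreal (g x)) \<in> borel_measurable lebesgue" using g by (simp add: measurable_completion)
 have eq: "s *\<^sub>R y + ?c *\<^sub>R x = x + s *\<^sub>R (y - x)" for x by (simp add: algebra_simps)
 have m2: "(\<lambda>x. ennreal (g (x + s *\<^sub>R (y - x)))) \<in> borel_measurable borel"
  using g by measurable
 have "(\<integral>\<^sup>+x. ennreal (g x) \<partial>lborel) = (\<integral>\<^sup>+x. ennreal (g x) \<partial>lebesgue)"
  using g by (simp add: nn_integral_completion)
 also have "\<dots> = ennreal (?c ^ DIM('a)) * (\<integral>\<^sup>+x. ennreal (g (x + s *\<^sub>R (y - x))) \<partial>lebesgue)"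
  using nn_integral_lebesgue_affine[OF c(1) gm, of "s *\<^sub>R y"] c(2) by (simp add: eq)
 also have "\<dots> = ennreal (?c ^ DIM('a)) * (\<integral>\<^sup>+x. ennreal (g (x + s *\<^sub>R (y - x))) \<partial>lborel)"
  using m2 by (simp add: nn_integral_completion)
 finally have e: "(\<integral>\<^sup>+x. ennreal (g x) \<partial>lborel) = ennreal (?c ^ DIM('a)) * (\<integral>\<^sup>+x. ennreal (g (x + s *\<^sub>R (y - x))) \<partial>lborel)" .
 have "1 \<le> (2 * ?c) ^ DIM('a)" using s by (intro one_le_power) simp
 then have "1 \<le> 2 ^ DIM('a) * ?c ^ DIM('a)" by (simp only: power_mult_distrib)
 then have "1 \<le> ennreal (2 ^ DIM('a)) * ennreal (?c ^ DIM('a))"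
  using c by (simp add: ennreal_mult[symmetric])
 then have "1 * (\<integral>\<^sup>+x. ennreal (g (x + s *\<^sub>R (y - x))) \<partial>lborel)
   \<le> (ennreal (2 ^ DIM('a)) * ennreal (?c ^ DIM('a))) * (\<integral>\<^sup>+x. ennreal (g (x + s *\<^sub>R (y - x))) \<partial>lborel)"
  by (rule mult_right_mono) simp
 then show ?thesis by (simp add: e mult.assoc)
qed

text \<open>The difference of two values is bounded by the integral of the gradient over the segment. In
 the average over both end points the half of the segment near one end is handled by
 integrating over that end point first.\<close>
lemma double_integral_difference:
 fixes f :: "'a::euclidean_space => real"
 assumes G: "open G" and f: "\<And>x. x \<in> G ==> GDERIV f x :> Df x" and Df: "continuous_on G Df"
  and X: "X \<in> sets borel" and Y: "Y \<in> sets borel"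
  and seg: "\<And>x y. x \<in> X ==> y \<in> Y ==> closed_segment x y \<subseteq> G"
  and d: "\<And>x y. x \<in> X ==> y \<in> Y ==> norm (y - x) \<le> d" and p: "p \<ge> 1"
 shows "(\<integral>\<^sup>+y. (\<integral>\<^sup>+x. ennreal (indicator X x * indicator Y y * \<bar>f x - f y\<bar> ^ p) \<partial>lborel) \<partial>lborel)
   \<le> ennreal (d ^ p * 2 ^ DIM('a)) * (emeasure lborel X + emeasure lborel Y) * (\<integral>\<^sup>+z. ennreal (indicator G z * norm (Df z) ^ p) \<partial>lborel)"
proof -
 define g where "g z = indicator G z * norm (Df z) ^ p" for z
 have gm [measurable]: "g \<in> borel_measurable borel"
 proof -
  have "continuous_on G (\<lambda>z. norm (Df z) ^ p)" using Df by (intro continuous_intros)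
  then have "(\<lambda>z. indicator G z *\<^sub>R norm (Df z) ^ p) \<in> borel_measurable borel"
   using G by (intro borel_measurable_continuous_on_indicator) auto
  then show ?thesis by (simp add: g_def[abs_def])
 qed
 have g0: "g z \<ge> 0" for z by (simp add: g_def)
 note [measurable] = X Y
 define k where "k x y = (\<integral>\<^sup>+s. ennreal (indicator {0..1} s * (indicator X x * indicator Y y * (d ^ p * g (x + s *\<^sub>R (y - x))))) \<partial>lborel)" for x y
 have pt: "ennreal (indicator X x * indicator Y y * \<bar>f x - f y\<bar> ^ p) \<le> k x y" for x y
 proof (cases "x \<in> X \<and> y \<in> Y")
  case True
  then have sg: "closed_segment x y \<subseteq> G" using seg by blast
  have inG: "x + s *\<^sub>R (y - x) \<in> G" if "0 \<le> s" "s \<le> 1" for s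
  proof -
   have "x + s *\<^sub>R (y - x) = (1 - s) *\<^sub>R x + s *\<^sub>R y" by (simp add: algebra_simps)
   then show ?thesis using sg that unfolding closed_segment_def by force
  qed
  define h where "h s = norm (Df (x + s *\<^sub>R (y - x)))" for s
  have ch: "continuous_on {0..1} h" unfolding h_def
   by (intro continuous_intros continuous_on_compose2[OF Df]) (use inG in auto)
  have dd: "norm (y - x) \<le> d" using d True by blast
  have d0: "0 \<le> d" using dd norm_ge_zero order_trans by blast
  have "((\<lambda>s. (y - x) \<bullet> Df (x + s *\<^sub>R (y - x))) has_integral (f (x + 1 *\<^sub>R (y - x)) - f (x + 0 *\<^sub>R (y - x)))) {0..1}"
  proof (rule fundamental_theorem_of_calculus)
   fix s :: real assume s: "s \<in> {0..1}"
   have "((\<lambda>t. f (x + t *\<^sub>R (y - x))) has_real_derivative ((y - x) \<bullet> Df (x + s *\<^sub>R (y - x)))) (at s)"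
    by (rule GDERIV_along_line[OF f[OF inG]]) (use s in auto)
   then show "((\<lambda>t. f (x + t *\<^sub>R (y - x))) has_vector_derivative ((y - x) \<bullet> Df (x + s *\<^sub>R (y - x)))) (at s within {0..1})"
    by (simp add: has_real_derivative_iff_has_vector_derivative has_vector_derivative_at_within)
  qed simp
  then have ftc: "((\<lambda>s. (y - x) \<bullet> Df (x + s *\<^sub>R (y - x))) has_integral (f y - f x)) {0..1}" by simp
  have ih: "h integrable_on {0..1}" using ch by (rule integrable_continuous_interval)
  define I where "I = integral {0..1} h"
  have I0: "I \<ge> 0" unfolding I_def by (rule integral_nonneg[OF ih]) (simp add: h_def)
  have "norm (f y - f x) \<le> integral {0..1} (\<lambda>s. d * h s)"
  proof -
   have "norm (integral {0..1} (\<lambda>s. (y - x) \<bullet> Df (x + s *\<^sub>R (y - x)))) \<le> integral {0..1} (\<lambda>s. d * h s)"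
   proof (rule integral_norm_bound_integral)
    show "(\<lambda>s. (y - x) \<bullet> Df (x + s *\<^sub>R (y - x))) integrable_on {0..1}" using ftc by blast
    show "(\<lambda>s. d * h s) integrable_on {0..1}" by (intro integrable_continuous_interval continuous_intros ch)
    show "norm ((y - x) \<bullet> Df (x + s *\<^sub>R (y - x))) \<le> d * h s" for s
     using Cauchy_Schwarz_ineq2[of "y - x" "Df (x + s *\<^sub>R (y - x))"] mult_right_mono[OF dd, of "h s"]
     by (simp add: h_def)
   qed
   then show ?thesis using ftc by (simp add: integral_unique)
  qed
  then have fI: "\<bar>f x - f y\<bar> \<le> d * I" using ih by (simp add: I_def abs_minus_commute)
  have ihp: "(\<lambda>s. h s ^ p) integrable_on {0..1}"
   using ch by (intro integrable_continuous_interval continuous_intros)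
  \<comment> \<open>Jensen's inequality, by integrating the tangent line inequality at the mean value.\<close>
  have J: "I ^ p \<le> integral {0..1} (\<lambda>s. h s ^ p)"
  proof (cases "I = 0")
   case True
   have "0 \<le> integral {0..1} (\<lambda>s. h s ^ p)" by (rule integral_nonneg[OF ihp]) (simp add: h_def)
   then show ?thesis using True p by (simp add: power_0_left)
  next
   case False
   then have Ip: "I > 0" using I0 by simp
   have tan: "I ^ p + (real p * I ^ (p - 1)) * (h s - I) \<le> h s ^ p" for s
   proof -
    have hs: "h s \<ge> 0" by (simp add: h_def)
    have "-1 \<le> h s / I - 1" using hs Ip by simp
    from Bernoulli_inequality[OF this, of p]
    have "1 + real p * (h s / I - 1) \<le> (h s / I) ^ p" by simp
    then have "I ^ p * (1 + real p * (h s / I - 1)) \<le> I ^ p * (h s / I) ^ p"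
     using Ip by (intro mult_left_mono) auto
    moreover have "I ^ p * (h s / I) ^ p = h s ^ p" using Ip by (simp add: power_divide)
    moreover have "I ^ p = I ^ (p - 1) * I" using p by (cases p) auto
    then have "I ^ p * (1 + real p * (h s / I - 1)) = I ^ p + (real p * I ^ (p - 1)) * (h s - I)"
     using Ip by (simp add: field_simps)
    ultimately show ?thesis by simp
   qed
   have "((\<lambda>s. I ^ p + (real p * I ^ (p - 1)) * (h s - I)) has_integral
     (1 * I ^ p + (real p * I ^ (p - 1)) * (I - 1 * I))) {0..1}"
   proof (intro has_integral_add has_integral_mult_right has_integral_diff)
    show "(h has_integral I) {0..1}" unfolding I_def by (rule integrable_integral[OF ih])
    show "((\<lambda>s::real. I ^ p) has_integral 1 * I ^ p) {0..1}" "((\<lambda>s::real. I) has_integral 1 * I) {0..1}"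
     using has_integral_const_real[of "I ^ p" 0 1] has_integral_const_real[of I 0 1] by simp_all
   qed
   then have "((\<lambda>s. I ^ p + (real p * I ^ (p - 1)) * (h s - I)) has_integral I ^ p) {0..1}" by simp
   from has_integral_le[OF this integrable_integral[OF ihp]] tan show ?thesis by simp
  qed
  have "\<bar>f x - f y\<bar> ^ p \<le> (d * I) ^ p" using fI by (intro power_mono) auto
  also have "\<dots> \<le> d ^ p * integral {0..1} (\<lambda>s. h s ^ p)"
   using J d0 by (simp add: power_mult_distrib mult_left_mono)
  finally have b: "\<bar>f x - f y\<bar> ^ p \<le> d ^ p * integral {0..1} (\<lambda>s. h s ^ p)" .
  have "((\<lambda>s. d ^ p * h s ^ p) has_integral d ^ p * integral {0..1} (\<lambda>s. h s ^ p)) {0..1}"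
   by (intro has_integral_mult_right integrable_integral ihp)
  then have "(\<integral>\<^sup>+s. ennreal (indicator {0..1} s * (d ^ p * h s ^ p)) \<partial>lborel) = ennreal (d ^ p * integral {0..1} (\<lambda>s. h s ^ p))"
   using d0 by (intro nn_integral_has_integral_lebesgue) (auto simp: h_def)
  moreover have "k x y = (\<integral>\<^sup>+s. ennreal (indicator {0..1} s * (d ^ p * h s ^ p)) \<partial>lborel)"
   unfolding k_def using True inG by (intro nn_integral_cong) (auto simp: indicator_def g_def h_def)
  ultimately have "ennreal (\<bar>f x - f y\<bar> ^ p) \<le> k x y" using b by (simp add: ennreal_leI)
  then show ?thesis using True by simp
 next
  case False
  then show ?thesis by auto
 qed
 define E where "E = (\<integral>\<^sup>+z. ennreal (g z) \<partial>lborel)"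
 define M where "M = ennreal (d ^ p * 2 ^ DIM('a)) * E"
 define K1 where "K1 x y s = ennreal (indicator {0..1/2::real} s * (indicator X x * indicator Y y * (d ^ p * g (x + s *\<^sub>R (y - x)))))" for x y and s :: real
 define K2 where "K2 x y s = ennreal (indicator {1/2..1::real} s * (indicator X x * indicator Y y * (d ^ p * g (x + s *\<^sub>R (y - x)))))" for x y and s :: real
 have K_measurable [measurable (raw)]:
   "(\<lambda>z. K1 (a z) (b z) (c z)) \<in> borel_measurable L" "(\<lambda>z. K2 (a z) (b z) (c z)) \<in> borel_measurable L"
  if [measurable]: "a \<in> borel_measurable L" "b \<in> borel_measurable L" "c \<in> borel_measurable L"
  for a b :: "'b => 'a" and c :: "'b => real" and L :: "'b measure"
  unfolding K1_def K2_def by measurable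
 show ?thesis
 proof (cases "X = {} \<or> Y = {}")
  case True
  then show ?thesis by auto
 next
  case False
  then have d0: "0 \<le> d" using d norm_ge_zero order_trans by (metis all_not_in_conv)
  have half: "(\<integral>\<^sup>+s. ennreal (indicator A s) * M \<partial>lborel) \<le> M" if "A = {0..1/2} \<or> A = {1/2..1}" for A :: "real set"
  proof -
   have [measurable]: "A \<in> sets borel" using that by auto
   have "(\<integral>\<^sup>+s. ennreal (indicator A s) * M \<partial>lborel) = M * (\<integral>\<^sup>+s. indicator A s \<partial>lborel)"
    by (subst nn_integral_cmult[symmetric]) (auto simp: mult.commute ennreal_indicator)
   also have "emeasure lborel A \<le> emeasure lborel {0..1::real}" using that by (intro emeasure_mono) auto
   then have "M * (\<integral>\<^sup>+s. indicator A s \<partial>lborel) \<le> M * 1" by (intro mult_left_mono) auto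
   finally show ?thesis by simp
  qed
  have c1: "(\<integral>\<^sup>+x. K1 x y s \<partial>lborel) \<le> ennreal (indicator Y y) * (ennreal (indicator {0..1/2::real} s) * M)" for y s
  proof (cases "y \<in> Y \<and> s \<in> {0..1/2}")
   case True
   have "(\<integral>\<^sup>+x. K1 x y s \<partial>lborel) \<le> (\<integral>\<^sup>+x. ennreal (d ^ p) * ennreal (g (x + s *\<^sub>R (y - x))) \<partial>lborel)"
    using True d0 g0 by (intro nn_integral_mono) (auto simp: K1_def indicator_def ennreal_mult[symmetric])
   also have "\<dots> = ennreal (d ^ p) * (\<integral>\<^sup>+x. ennreal (g (x + s *\<^sub>R (y - x))) \<partial>lborel)"
    by (rule nn_integral_cmult) measurable
   also have "\<dots> \<le> ennreal (d ^ p) * (ennreal (2 ^ DIM('a)) * E)"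
    unfolding E_def by (intro mult_left_mono segment_half_integral gm) (use True in auto)
   finally show ?thesis using True d0 by (simp add: M_def ennreal_mult mult.assoc)
  qed (auto simp: K1_def)
  have c2: "(\<integral>\<^sup>+y. K2 x y s \<partial>lborel) \<le> ennreal (indicator X x) * (ennreal (indicator {1/2..1::real} s) * M)" for x s
  proof (cases "x \<in> X \<and> s \<in> {1/2..1}")
   case True
   have eq: "x + s *\<^sub>R (y - x) = y + (1 - s) *\<^sub>R (x - y)" for y by (simp add: algebra_simps)
   have "(\<integral>\<^sup>+y. K2 x y s \<partial>lborel) \<le> (\<integral>\<^sup>+y. ennreal (d ^ p) * ennreal (g (y + (1 - s) *\<^sub>R (x - y))) \<partial>lborel)"
    using True d0 g0 by (intro nn_integral_mono) (auto simp: K2_def indicator_def ennreal_mult[symmetric] eq)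
   also have "\<dots> = ennreal (d ^ p) * (\<integral>\<^sup>+y. ennreal (g (y + (1 - s) *\<^sub>R (x - y))) \<partial>lborel)"
    by (rule nn_integral_cmult) measurable
   also have "\<dots> \<le> ennreal (d ^ p) * (ennreal (2 ^ DIM('a)) * E)"
    unfolding E_def by (intro mult_left_mono segment_half_integral gm) (use True in auto)
   finally show ?thesis using True d0 by (simp add: M_def ennreal_mult mult.assoc)
  qed (auto simp: K2_def)
  have "(\<integral>\<^sup>+y. (\<integral>\<^sup>+x. ennreal (indicator X x * indicator Y y * \<bar>f x - f y\<bar> ^ p) \<partial>lborel) \<partial>lborel)
    \<le> (\<integral>\<^sup>+y. (\<integral>\<^sup>+x. k x y \<partial>lborel) \<partial>lborel)"
   by (intro nn_integral_mono pt)
  also have "\<dots> \<le> (\<integral>\<^sup>+y. (\<integral>\<^sup>+x. (\<integral>\<^sup>+s. K1 x y s + K2 x y s \<partial>lborel) \<partial>lborel) \<partial>lborel)"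
   unfolding k_def K1_def K2_def
   by (intro nn_integral_mono) (auto simp: indicator_def ennreal_plus[symmetric] simp del: ennreal_plus)
  also have "\<dots> = (\<integral>\<^sup>+y. (\<integral>\<^sup>+x. (\<integral>\<^sup>+s. K1 x y s \<partial>lborel) \<partial>lborel) \<partial>lborel)
    + (\<integral>\<^sup>+y. (\<integral>\<^sup>+x. (\<integral>\<^sup>+s. K2 x y s \<partial>lborel) \<partial>lborel) \<partial>lborel)"
  proof -
   define A1 where "A1 x y = (\<integral>\<^sup>+s. K1 x y s \<partial>lborel)" for x y
   define A2 where "A2 x y = (\<integral>\<^sup>+s. K2 x y s \<partial>lborel)" for x y
   have [measurable]: "(\<lambda>(x, y). A1 x y) \<in> borel_measurable (lborel \<Otimes>\<^sub>M lborel)"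
    "(\<lambda>(x, y). A2 x y) \<in> borel_measurable (lborel \<Otimes>\<^sub>M lborel)"
    unfolding A1_def A2_def by measurable
   have "(\<integral>\<^sup>+s. K1 x y s + K2 x y s \<partial>lborel) = A1 x y + A2 x y" for x y
    unfolding A1_def A2_def by (rule nn_integral_add) measurable
   moreover have "(\<integral>\<^sup>+x. A1 x y + A2 x y \<partial>lborel) = (\<integral>\<^sup>+x. A1 x y \<partial>lborel) + (\<integral>\<^sup>+x. A2 x y \<partial>lborel)" for y
    by (rule nn_integral_add) measurable
   moreover have "(\<integral>\<^sup>+y. (\<integral>\<^sup>+x. A1 x y \<partial>lborel) + (\<integral>\<^sup>+x. A2 x y \<partial>lborel) \<partial>lborel)
     = (\<integral>\<^sup>+y. (\<integral>\<^sup>+x. A1 x y \<partial>lborel) \<partial>lborel) + (\<integral>\<^sup>+y. (\<integral>\<^sup>+x. A2 x y \<partial>lborel) \<partial>lborel)"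
    by (rule nn_integral_add) measurable
   ultimately show ?thesis unfolding A1_def A2_def by simp
  qed
  also have "(\<integral>\<^sup>+y. (\<integral>\<^sup>+x. (\<integral>\<^sup>+s. K1 x y s \<partial>lborel) \<partial>lborel) \<partial>lborel)
    = (\<integral>\<^sup>+y. (\<integral>\<^sup>+s. (\<integral>\<^sup>+x. K1 x y s \<partial>lborel) \<partial>lborel) \<partial>lborel)"
   by (rule nn_integral_cong, rule lborel_pair.Fubini'[symmetric]) measurable
  also have "\<dots> \<le> (\<integral>\<^sup>+y. (\<integral>\<^sup>+s. ennreal (indicator Y y) * (ennreal (indicator {0..1/2::real} s) * M) \<partial>lborel) \<partial>lborel)"
   by (intro nn_integral_mono c1)
  also have "\<dots> = (\<integral>\<^sup>+y. ennreal (indicator Y y) * (\<integral>\<^sup>+s. ennreal (indicator {0..1/2::real} s) * M \<partial>lborel) \<partial>lborel)"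
   by (simp add: nn_integral_cmult)
  also have "\<dots> \<le> (\<integral>\<^sup>+y. ennreal (indicator Y y) * M \<partial>lborel)"
   by (intro nn_integral_mono mult_left_mono half) auto
  also have "\<dots> = M * emeasure lborel Y"
   by (simp add: mult.commute[of _ M] nn_integral_cmult ennreal_indicator)
  also have "(\<integral>\<^sup>+y. (\<integral>\<^sup>+x. (\<integral>\<^sup>+s. K2 x y s \<partial>lborel) \<partial>lborel) \<partial>lborel)
    = (\<integral>\<^sup>+x. (\<integral>\<^sup>+y. (\<integral>\<^sup>+s. K2 x y s \<partial>lborel) \<partial>lborel) \<partial>lborel)"
   by (rule lborel_pair.Fubini') measurable
  also have "\<dots> = (\<integral>\<^sup>+x. (\<integral>\<^sup>+s. (\<integral>\<^sup>+y. K2 x y s \<partial>lborel) \<partial>lborel) \<partial>lborel)"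
   by (rule nn_integral_cong, rule lborel_pair.Fubini'[symmetric]) measurable
  also have "\<dots> \<le> (\<integral>\<^sup>+x. (\<integral>\<^sup>+s. ennreal (indicator X x) * (ennreal (indicator {1/2..1::real} s) * M) \<partial>lborel) \<partial>lborel)"
   by (intro nn_integral_mono c2)
  also have "\<dots> = (\<integral>\<^sup>+x. ennreal (indicator X x) * (\<integral>\<^sup>+s. ennreal (indicator {1/2..1::real} s) * M \<partial>lborel) \<partial>lborel)"
   by (simp add: nn_integral_cmult)
  also have "\<dots> \<le> (\<integral>\<^sup>+x. ennreal (indicator X x) * M \<partial>lborel)"
   by (intro nn_integral_mono mult_left_mono half) auto
  also have "\<dots> = M * emeasure lborel X"
   by (simp add: mult.commute[of _ M] nn_integral_cmult ennreal_indicator)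
  finally show ?thesis
   unfolding M_def E_def g_def by (simp add: algebra_simps add_mono)
 qed
qed

text \<open>Some point of \<open>Y\<close> does no worse than twice the average over \<open>Y\<close>; its value serves as the
 constant in the Poincare inequality.\<close>
lemma poincare_two_sets:
 fixes f :: "'a::euclidean_space => real"
 assumes G: "open G" and f: "\<And>x. x \<in> G ==> GDERIV f x :> Df x" and Df: "continuous_on G Df"
  and X: "X \<in> sets borel" and Y: "Y \<in> sets borel" and XG: "X \<subseteq> G" and YG: "Y \<subseteq> G"
  and seg: "\<And>x y. x \<in> X ==> y \<in> Y ==> closed_segment x y \<subseteq> G"
  and d: "\<And>x y. x \<in> X ==> y \<in> Y ==> norm (y - x) \<le> d" and p: "p \<ge> 1" and d0: "d \<ge> 0"
  and mX: "emeasure lborel X \<le> ennreal (a * b)" and mY: "emeasure lborel Y = ennreal b" and b: "b > 0" and a: "a \<ge> 0"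
  and E: "(\<integral>\<^sup>+z. ennreal (indicator G z * norm (Df z) ^ p) \<partial>lborel) = ennreal E" "E \<ge> 0"
 shows "\<exists>y\<in>Y. (\<integral>\<^sup>+x. ennreal (indicator X x * \<bar>f x - f y\<bar> ^ p) \<partial>lborel)
   \<le> ennreal (2 * (d ^ p * 2 ^ DIM('a)) * (a + 1) * E)"
proof -
 note [measurable] = X Y
 have cf: "continuous_on G f" using f by (rule GDERIV_continuous_on)
 have GB [measurable]: "G \<in> sets borel" using G by simp
 define fG where "fG x = indicator G x *\<^sub>R f x" for x
 have [measurable]: "fG \<in> borel_measurable borel"
  unfolding fG_def[abs_def] by (rule borel_measurable_continuous_on_indicator[OF GB cf])
 have fG: "fG x = f x" if "x \<in> X \<or> x \<in> Y" for x using that XG YG by (auto simp: fG_def)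
 define D where "D = d ^ p * 2 ^ DIM('a)"
 have D0: "D \<ge> 0" using d0 by (simp add: D_def)
 define Phi where "Phi y = (\<integral>\<^sup>+x. ennreal (indicator X x * \<bar>fG x - fG y\<bar> ^ p) \<partial>lborel)" for y
 have Phi: "Phi y = (\<integral>\<^sup>+x. ennreal (indicator X x * \<bar>f x - f y\<bar> ^ p) \<partial>lborel)" if "y \<in> Y" for y
  unfolding Phi_def using that fG by (intro nn_integral_cong) (auto simp: indicator_def)
 have "(\<lambda>(x, y). ennreal (indicator X x * \<bar>fG x - fG y\<bar> ^ p)) \<in> borel_measurable (lborel \<Otimes>\<^sub>M lborel)"
  by measurable
 then have [measurable]: "Phi \<in> borel_measurable borel"
  unfolding Phi_def[abs_def] using lborel_pair.borel_measurable_nn_integral_fst by measurable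
 have I: "(\<integral>\<^sup>+y. indicator Y y * Phi y \<partial>lborel) \<le> ennreal (D * (a + 1) * b * E)"
 proof -
  have "(\<integral>\<^sup>+y. indicator Y y * Phi y \<partial>lborel)
    = (\<integral>\<^sup>+y. (\<integral>\<^sup>+x. ennreal (indicator X x * indicator Y y * \<bar>f x - f y\<bar> ^ p) \<partial>lborel) \<partial>lborel)"
  proof (rule nn_integral_cong)
   fix y show "indicator Y y * Phi y = (\<integral>\<^sup>+x. ennreal (indicator X x * indicator Y y * \<bar>f x - f y\<bar> ^ p) \<partial>lborel)"
    using Phi[of y] by (cases "y \<in> Y") auto
  qed
  also have "\<dots> \<le> ennreal D * (emeasure lborel X + emeasure lborel Y) * ennreal E"
   using double_integral_difference[OF G f Df X Y seg d p] E(1) by (simp add: D_def)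
  also have "\<dots> \<le> ennreal D * (ennreal (a * b) + ennreal b) * ennreal E"
   using mX by (intro mult_right_mono mult_left_mono add_mono) (auto simp: mY)
  also have "\<dots> = ennreal (D * (a + 1) * b * E)"
   using D0 a b E(2) by (simp add: ennreal_mult[symmetric] ennreal_plus[symmetric] algebra_simps del: ennreal_plus)
  finally show ?thesis .
 qed
 have "\<exists>y\<in>Y. Phi y \<le> ennreal (2 * D * (a + 1) * E)"
 proof (rule ccontr)
  assume "\<not> (\<exists>y\<in>Y. Phi y \<le> ennreal (2 * D * (a + 1) * E))"
  then have big: "ennreal (2 * D * (a + 1) * E) < Phi y" if "y \<in> Y" for y using that by (auto simp: not_le)
  show False
  proof (cases "D * (a + 1) * E = 0")
   case True
   have z: "D * (a + 1) * b * E = 0" using True by auto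
   have "(\<integral>\<^sup>+y. indicator Y y * Phi y \<partial>lborel) = 0" using I unfolding z by simp
   then have "AE y in lborel. indicator Y y * Phi y = 0"
    by (subst (asm) nn_integral_0_iff_AE) auto
   then have "AE y in lborel. y \<notin> Y"
   proof eventually_elim
    fix y assume "indicator Y y * Phi y = 0"
    then show "y \<notin> Y" using big[of y] by (cases "y \<in> Y") auto
   qed
   then have "emeasure lborel Y = 0" using AE_iff_measurable[of Y lborel "\<lambda>y. y \<notin> Y"] by auto
   then show False using mY b by simp
  next
   case False
   then have pos: "D * (a + 1) * E > 0" using D0 a E(2) by (simp add: less_le)
   have "ennreal (2 * D * (a + 1) * E) * emeasure lborel Y = (\<integral>\<^sup>+y. ennreal (2 * D * (a + 1) * E) * indicator Y y \<partial>lborel)"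
    by (simp add: nn_integral_cmult)
   also have "\<dots> \<le> (\<integral>\<^sup>+y. indicator Y y * Phi y \<partial>lborel)"
   proof (rule nn_integral_mono)
    fix y show "ennreal (2 * D * (a + 1) * E) * indicator Y y \<le> indicator Y y * Phi y"
     using big[of y] by (cases "y \<in> Y") (auto simp: less_imp_le)
   qed
   also have "\<dots> \<le> ennreal (D * (a + 1) * b * E)" by (rule I)
   finally have "ennreal (2 * D * (a + 1) * E * b) \<le> ennreal (D * (a + 1) * b * E)"
    using pos b by (simp add: mY ennreal_mult[symmetric] mult.assoc)
   then have "2 * D * (a + 1) * E * b \<le> D * (a + 1) * b * E"
    by (subst (asm) ennreal_le_iff) (use D0 a b E(2) in \<open>auto intro!: mult_nonneg_nonneg\<close>)
   then have "2 * (D * (a + 1) * E * b) \<le> 1 * (D * (a + 1) * E * b)"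
    by (simp only: mult.assoc mult_1 mult.commute[of b E])
   then have "2 \<le> (1::real)" using mult_pos_pos[OF pos b] by (rule mult_right_le_imp_le)
   then show False by simp
  qed
 qed
 then show ?thesis using Phi unfolding D_def by (metis (no_types, lifting))
qed

text \<open>A segment from \<open>x\<close> to \<open>p\<close> stays away from the origin unless the two directions are nearly opposite.\<close>
lemma segment_norm_lower_bound:
 fixes x p :: "'a::real_inner"
 assumes \<delta>: "0 \<le> \<delta>" "\<delta> \<le> 1" and xp: "x \<bullet> p \<ge> - (1 - \<delta>) * (norm x * norm p)"
  and n: "1 \<le> norm x" "1 \<le> norm p" and s: "0 \<le> s" "s \<le> 1"
 shows "\<delta> / 2 \<le> (norm ((1 - s) *\<^sub>R x + s *\<^sub>R p))\<^sup>2"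
proof -
 define A where "A = (1 - s) * norm x"
 define B where "B = s * norm p"
 have A: "A \<ge> 1 - s" and B: "B \<ge> s"
  using s n mult_left_mono[of 1 "norm x" "1 - s"] mult_left_mono[of 1 "norm p" s] by (auto simp: A_def B_def)
 have A2: "A\<^sup>2 = (1 - s)\<^sup>2 * (x \<bullet> x)" and B2: "B\<^sup>2 = s\<^sup>2 * (p \<bullet> p)"
  by (simp_all add: A_def B_def power_mult_distrib power2_norm_eq_inner)
 have "(norm ((1 - s) *\<^sub>R x + s *\<^sub>R p))\<^sup>2 = A\<^sup>2 + B\<^sup>2 + 2 * (s * (1 - s)) * (x \<bullet> p)"
  unfolding A2 B2 power2_norm_eq_inner
  by (simp add: inner_add_left inner_add_right inner_commute[of p x] power2_eq_square algebra_simps)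
 also have "\<dots> \<ge> A\<^sup>2 + B\<^sup>2 + 2 * (s * (1 - s)) * (- (1 - \<delta>) * (norm x * norm p))"
  using s xp by (intro add_left_mono mult_left_mono) auto
 also have "A\<^sup>2 + B\<^sup>2 + 2 * (s * (1 - s)) * (- (1 - \<delta>) * (norm x * norm p)) = \<delta> * (A\<^sup>2 + B\<^sup>2) + (1 - \<delta>) * (A - B)\<^sup>2"
  by (simp add: A_def B_def power2_eq_square algebra_simps)
 also have "\<dots> \<ge> \<delta> * (1 / 2)"
 proof -
  have "1 / 2 \<le> (1 - s)\<^sup>2 + s\<^sup>2" using sum_squares_bound[of "1 - s" s] zero_le_power2[of "2 * s - 1"]
   by (simp add: power2_eq_square algebra_simps)
  also have "\<dots> \<le> A\<^sup>2 + B\<^sup>2" using A B s by (intro add_mono power_mono) auto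
  finally have "\<delta> * (1 / 2) \<le> \<delta> * (A\<^sup>2 + B\<^sup>2)" using \<delta> by (rule_tac mult_left_mono) auto
  moreover have "0 \<le> (1 - \<delta>) * (A - B)\<^sup>2" using \<delta> by simp
  ultimately show ?thesis by linarith
 qed
 finally show ?thesis by simp
qed

lemma not_both_opposite:
 fixes a b w :: "'a::real_inner"
 assumes u: "norm a = 1" "norm b = 1" "norm w = 1" and d: "\<delta> = (norm (a - b))\<^sup>2 / 8"
  and a: "w \<bullet> a < - (1 - \<delta>)" and b: "w \<bullet> b < - (1 - \<delta>)"
 shows False
proof -
 have n: "(norm (w + c))\<^sup>2 < (norm (a - b) / 2)\<^sup>2" if "norm c = 1" "w \<bullet> c < - (1 - \<delta>)" for c
 proof -
  have "(norm (w + c))\<^sup>2 = 2 + 2 * (w \<bullet> c)"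
   using that u(3) by (simp add: power2_norm_eq_inner inner_add_left inner_add_right inner_commute[of c w] norm_eq_1)
  also have "\<dots> < 2 * \<delta>" using that(2) by simp
  finally show ?thesis by (simp add: d power_divide)
 qed
 have "norm (w + a) < norm (a - b) / 2" using n[OF u(1) a] by (rule power2_less_imp_less) simp
 moreover have "norm (w + b) < norm (a - b) / 2" using n[OF u(2) b] by (rule power2_less_imp_less) simp
 moreover have "norm (a - b) \<le> norm (w + a) + norm (w + b)"
  using norm_triangle_ineq4[of "w + a" "w + b"] by simp
 ultimately show False by simp
qed

context exterior_problem begin

definition ring :: "real => real => (real^'n) set" where
 "ring a b = {x \<in> \<Sigma>. a < norm (x - x0) \<and> norm (x - x0) < b}"

lemma ring_open: "open (ring a b)"
proof -
 have "ring a b = \<Sigma> \<inter> {x. a < norm (x - x0)} \<inter> {x. norm (x - x0) < b}" by (auto simp: ring_def)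
 then show ?thesis by (auto intro!: open_Int Sigma_open open_Collect_less continuous_intros)
qed

lemma dil_shift_in_Sigma: "x0 + v \<in> \<Sigma> ==> t > 0 ==> x0 + t *\<^sub>R v \<in> \<Sigma>"
 using dil_in_Sigma_iff[of t "x0 + v"] by (simp add: dil_def)

text \<open>Two non-parallel directions in the cone, with small balls around them.\<close>
lemma two_directions:
 obtains p q :: "real^'n" and r where "norm p = 3/2" "3/2 \<le> norm q" "norm (q - p) \<le> 1/4"
  "p /\<^sub>R norm p \<noteq> q /\<^sub>R norm q" "0 < r" "r \<le> 1/4"
  "\<And>v. norm (v - p) < r ==> x0 + v \<in> \<Sigma>" "\<And>v. norm (v - q) < r ==> x0 + v \<in> \<Sigma>"
proof -
 obtain y where y: "y \<in> \<Sigma>" "y \<noteq> x0"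
 proof -
  obtain z where z: "z \<in> \<Sigma>" using Sigma_nonempty by blast
  obtain e where e: "e > 0" "ball z e \<subseteq> \<Sigma>" using Sigma_open z open_contains_ball by blast
  obtain b :: "real^'n" where b: "b \<in> Basis" using nonempty_Basis by blast
  have "z + (e/2) *\<^sub>R b \<in> \<Sigma>" using e b by (auto intro!: subsetD[OF e(2)] simp: dist_norm)
  moreover have "z + (e/2) *\<^sub>R b \<noteq> z" using e(1) nonzero_Basis[OF b] by simp
  ultimately show thesis using that z by metis
 qed
 define p where "p = ((3/2) / norm (y - x0)) *\<^sub>R (y - x0)"
 have np: "norm p = 3/2" using y(2) by (simp add: p_def)
 have pS: "x0 + p \<in> \<Sigma>" unfolding p_def by (rule dil_shift_in_Sigma) (use y in auto)
 obtain s where s: "s > 0" "ball (x0 + p) s \<subseteq> \<Sigma>" using Sigma_open pS open_contains_ball by blast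
 have "2 \<le> DIM(real^'n)" using dim by simp
 then obtain e0 where "e0 \<noteq> 0" "orthogonal p e0" by (rule orthogonal_to_vector_exists)
 define e where "e = e0 /\<^sub>R norm e0"
 have e: "norm e = 1" "p \<bullet> e = 0" using \<open>e0 \<noteq> 0\<close> \<open>orthogonal p e0\<close> by (auto simp: e_def orthogonal_def)
 define t where "t = min (s/2) (1/4)"
 have t: "0 < t" "t \<le> s/2" "t \<le> 1/4" using s(1) by (auto simp: t_def)
 define q where "q = p + t *\<^sub>R e"
 have "(norm q)\<^sup>2 = (norm p)\<^sup>2 + t\<^sup>2"
  unfolding power2_norm_eq_inner using e by (simp add: q_def inner_add_left inner_add_right inner_commute[of e p] norm_eq_1 power2_eq_square)
 then have "(norm p)\<^sup>2 \<le> (norm q)\<^sup>2" by simp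
 then have nq: "3/2 \<le> norm q" using np power2_le_imp_le[OF _ norm_ge_zero] by metis
 have qp: "norm (q - p) = t" using e t by (simp add: q_def)
 have ne: "p /\<^sub>R norm p \<noteq> q /\<^sub>R norm q"
 proof
  assume "p /\<^sub>R norm p = q /\<^sub>R norm q"
  then have "(p /\<^sub>R norm p) \<bullet> e = (q /\<^sub>R norm q) \<bullet> e" by simp
  then have "(q \<bullet> e) / norm q = 0" using e(2) by (simp add: divide_inverse mult.commute)
  moreover have "q \<bullet> e = t" using e by (simp add: q_def inner_add_left norm_eq_1)
  ultimately show False using t nq by simp
 qed
 show thesis
 proof (rule that[OF np nq _ ne, of "min (s/2) (1/4)"])
  show "norm (q - p) \<le> 1/4" using qp t by simp
  show "0 < min (s/2) (1/4)" "min (s/2) (1/4) \<le> 1/4" using s by auto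
  show "x0 + v \<in> \<Sigma>" if "norm (v - p) < min (s/2) (1/4)" for v
   using that s(1) by (intro subsetD[OF s(2)]) (simp add: dist_norm norm_minus_commute)
  show "x0 + v \<in> \<Sigma>" if "norm (v - q) < min (s/2) (1/4)" for v
  proof -
   have "norm (v - p) < s" using that qp t norm_triangle_ineq[of "v - q" "q - p"] by simp
   then show ?thesis by (intro subsetD[OF s(2)]) (simp add: dist_norm norm_minus_commute)
  qed
 qed
qed

definition cring :: "real => (real^'n) set" where
 "cring \<rho> = {x \<in> \<Sigma>. \<rho> \<le> norm (x - x0) \<and> norm (x - x0) \<le> 2 * \<rho>}"

lemma cring_borel: "cring \<rho> \<in> sets borel"
proof -
 have "cring \<rho> = \<Sigma> \<inter> ({x. \<rho> \<le> norm (x - x0)} \<inter> {x. norm (x - x0) \<le> 2 * \<rho>})" by (auto simp: cring_def)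
 moreover have "closed ({x. \<rho> \<le> norm (x - x0)} \<inter> {x. norm (x - x0) \<le> 2 * \<rho>})"
  by (intro closed_Int closed_Collect_le continuous_intros)
 ultimately show ?thesis using Sigma_open by (metis borel_closed borel_open sets.Int)
qed

text \<open>Every point of the ring sees one of two fixed balls along segments that stay away from
 the vertex, and the second ball is seen by the first; the two resulting constants are
 compared on the second ball.\<close>
lemma ring_poincare:
 obtains \<Lambda> P where "4 \<le> \<Lambda>" "0 < P"
  "\<And>\<rho> f Df E. 0 < \<rho> ==> (\<And>x. x \<in> ring (\<rho> / \<Lambda>) (\<Lambda> * \<rho>) ==> GDERIV f x :> Df x) ==>
   continuous_on (ring (\<rho> / \<Lambda>) (\<Lambda> * \<rho>)) Df ==> 0 \<le> E ==>
   (\<integral>\<^sup>+z. ennreal (indicator (ring (\<rho> / \<Lambda>) (\<Lambda> * \<rho>)) z * norm (Df z) ^ CARD('n)) \<partial>lborel) = ennreal E ==>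
   \<exists>c. (\<exists>y\<in>cring \<rho>. c = f y) \<and>
    (\<integral>\<^sup>+x. ennreal (indicator (cring \<rho>) x * \<bar>f x - c\<bar> ^ CARD('n)) \<partial>lborel) \<le> ennreal (P * \<rho> ^ CARD('n) * E)"
proof -
 let ?N = "CARD('n)"
 obtain p q :: "real^'n" and r where np: "norm p = 3/2" and nq: "3/2 \<le> norm q" and qp: "norm (q - p) \<le> 1/4"
  and ne: "p /\<^sub>R norm p \<noteq> q /\<^sub>R norm q" and r: "0 < r" "r \<le> 1/4"
  and pS: "\<And>v. norm (v - p) < r ==> x0 + v \<in> \<Sigma>" and qS: "\<And>v. norm (v - q) < r ==> x0 + v \<in> \<Sigma>"
  using two_directions by blast
 have nq': "norm q \<le> 7/4" using norm_triangle_ineq2[of q p] np qp by linarith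
 define a where "a = p /\<^sub>R norm p"
 define b where "b = q /\<^sub>R norm q"
 have q0: "norm q > 0" using nq by linarith
 have "norm p > 0" using np by linarith
 then have ab: "norm a = 1" "norm b = 1" using q0 by (auto simp: a_def b_def)
 define \<delta> where "\<delta> = (norm (a - b))\<^sup>2 / 8"
 have "norm (a - b) > 0" using ne by (simp add: a_def b_def)
 then have \<delta>0: "\<delta> > 0" by (simp add: \<delta>_def)
 have "norm (a - b) \<le> 2" using norm_triangle_ineq4[of a b] ab by simp
 then have "(norm (a - b))\<^sup>2 \<le> 2\<^sup>2" by (intro power_mono) auto
 then have \<delta>1: "\<delta> \<le> 1" by (simp add: \<delta>_def)
 define e0 where "e0 = sqrt (\<delta> / 2)"
 have e0: "e0 > 0" using \<delta>0 by (simp add: e0_def)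
 define r1 where "r1 = min r (e0 / 2)"
 have r1: "0 < r1" "r1 \<le> r" "r1 \<le> e0 / 2" using r e0 by (auto simp: r1_def)
 define \<Lambda> where "\<Lambda> = max 4 (4 / e0)"
 have \<Lambda>: "4 \<le> \<Lambda>" "1 / \<Lambda> < e0 / 2"
 proof -
  show L4: "4 \<le> \<Lambda>" by (simp add: \<Lambda>_def)
  have "4 / e0 \<le> \<Lambda>" by (simp add: \<Lambda>_def)
  then have "4 \<le> \<Lambda> * e0" using e0 by (simp add: field_simps)
  then show "1 / \<Lambda> < e0 / 2" using L4 e0 by (simp add: field_simps)
 qed
 define A where "A = (3 / r1) ^ ?N"
 have A: "A > 0" using r1 by (simp add: A_def)
 define P1 where "P1 = 2 * (4 ^ ?N * 2 ^ ?N) * (A + 1)"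
 have P1: "P1 > 0" using A by (simp add: P1_def add_pos_pos)
 define P where "P = P1 * (1 + 2 ^ ?N * (1 + 2 ^ ?N * 2 * A))"
 have P: "P > 0" using P1 A by (auto simp: P_def intro!: mult_pos_pos add_pos_pos)
 show thesis
 proof (rule that[OF \<Lambda>(1) P])
  fix \<rho> E :: real and f Df
  assume \<rho>: "0 < \<rho>" and f: "\<And>x. x \<in> ring (\<rho> / \<Lambda>) (\<Lambda> * \<rho>) ==> GDERIV f x :> Df x"
   and Df: "continuous_on (ring (\<rho> / \<Lambda>) (\<Lambda> * \<rho>)) Df" and E0: "0 \<le> E"
   and E: "(\<integral>\<^sup>+z. ennreal (indicator (ring (\<rho> / \<Lambda>) (\<Lambda> * \<rho>)) z * norm (Df z) ^ ?N) \<partial>lborel) = ennreal E"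
  let ?G = "ring (\<rho> / \<Lambda>) (\<Lambda> * \<rho>)"
  define X where "X e = {x \<in> cring \<rho>. (x - x0) \<bullet> e \<ge> - (1 - \<delta>) * (norm (x - x0) * norm e)}" for e
  define Y where "Y e = ball (x0 + \<rho> *\<^sub>R e) (\<rho> * r1)" for e :: "real^'n"
  define \<beta> where "\<beta> = unit_ball_vol ?N * (\<rho> * r1) ^ ?N"
  have \<beta>: "\<beta> > 0" using \<rho> r1 by (simp add: \<beta>_def)
  define Q where "Q = P1 * \<rho> ^ ?N * E"
  have Q: "Q \<ge> 0" using P1 \<rho> E0 by (simp add: Q_def)
  have XB [measurable]: "X e \<in> sets borel" for e
  proof -
   have eq: "X e = cring \<rho> \<inter> {x. - (1 - \<delta>) * (norm (x - x0) * norm e) \<le> (x - x0) \<bullet> e}" by (auto simp: X_def)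
   have cl: "closed {x. - (1 - \<delta>) * (norm (x - x0) * norm e) \<le> (x - x0) \<bullet> e}"
    by (intro closed_Collect_le continuous_intros)
   show ?thesis unfolding eq by (rule sets.Int[OF cring_borel borel_closed[OF cl]])
  qed
  have YB [measurable]: "Y e \<in> sets borel" for e by (simp add: Y_def)
  have mX: "emeasure lborel (X e) \<le> ennreal (A * \<beta>)" for e
  proof -
   have "X e \<subseteq> ball x0 (3 * \<rho>)" using \<rho> by (auto simp: X_def cring_def dist_norm norm_minus_commute)
   then have "emeasure lborel (X e) \<le> emeasure lborel (ball x0 (3 * \<rho>))" by (intro emeasure_mono) auto
   also have "\<dots> = ennreal (unit_ball_vol ?N * (3 * \<rho>) ^ ?N)" using emeasure_ball[of "3 * \<rho>" x0] \<rho> by simp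
   also have "unit_ball_vol ?N * (3 * \<rho>) ^ ?N = A * \<beta>" using r1 by (simp add: A_def \<beta>_def power_mult_distrib power_divide)
   finally show ?thesis .
  qed
  have mY: "emeasure lborel (Y e) = ennreal \<beta>" for e
   using emeasure_ball[of "\<rho> * r1" "x0 + \<rho> *\<^sub>R e"] \<rho> r1 by (simp add: Y_def \<beta>_def)
  have scaled: "x = x0 + \<rho> *\<^sub>R ((1 / \<rho>) *\<^sub>R (x - x0))" for x using \<rho> by simp
  have Yv: "norm ((1 / \<rho>) *\<^sub>R (y - x0) - e) < r1" if "y \<in> Y e" for y e
  proof -
   have "y - x0 - \<rho> *\<^sub>R e = \<rho> *\<^sub>R ((1 / \<rho>) *\<^sub>R (y - x0) - e)" using \<rho> by (simp add: algebra_simps)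
   then have "norm (y - x0 - \<rho> *\<^sub>R e) = \<rho> * norm ((1 / \<rho>) *\<^sub>R (y - x0) - e)" using \<rho> by simp
   moreover have "norm (y - x0 - \<rho> *\<^sub>R e) < \<rho> * r1"
    using that by (simp add: Y_def dist_norm norm_minus_commute diff_diff_eq)
   ultimately show ?thesis using \<rho> by simp
  qed
  have good: "\<exists>y\<in>Y e. (\<integral>\<^sup>+x. ennreal (indicator (X e) x * \<bar>f x - f y\<bar> ^ ?N) \<partial>lborel) \<le> ennreal Q"
   and YS: "Y e \<subseteq> cring \<rho>" and XG: "X e \<subseteq> ?G" and YG: "Y e \<subseteq> ?G"
   if ne1: "3/2 \<le> norm e" and ne2: "norm e \<le> 7/4" and eS: "\<And>v. norm (v - e) < r ==> x0 + v \<in> \<Sigma>" for e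
  proof -
   have Yc: "y \<in> cring \<rho>" if y: "y \<in> Y e" for y
   proof -
    let ?v = "(1 / \<rho>) *\<^sub>R (y - x0)"
    have v: "norm (?v - e) < r1" by (rule Yv[OF y])
    have "x0 + ?v \<in> \<Sigma>" by (rule eS) (use v r1 in linarith)
    then have yS: "y \<in> \<Sigma>" using dil_shift_in_Sigma[of ?v \<rho>] \<rho> scaled[of y] by simp
    have "1 \<le> norm ?v" "norm ?v \<le> 2"
     using v r1 r ne1 ne2 norm_triangle_ineq2[of e ?v] norm_triangle_ineq2[of ?v e] norm_minus_commute[of e ?v] by linarith+
    moreover have nv: "norm ?v = norm (y - x0) / \<rho>" using \<rho> by simp
    ultimately have "\<rho> \<le> norm (y - x0)" "norm (y - x0) \<le> 2 * \<rho>" unfolding nv using \<rho> by (auto simp: pos_le_divide_eq pos_divide_le_eq)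
    then show ?thesis using yS by (simp add: cring_def)
   qed
   then show YS: "Y e \<subseteq> cring \<rho>" by blast
   have cG: "cring \<rho> \<subseteq> ?G"
   proof
    fix x assume x: "x \<in> cring \<rho>"
    have "\<rho> / \<Lambda> < \<rho>" "2 * \<rho> < \<Lambda> * \<rho>" using \<rho> \<Lambda>(1) by (auto simp: field_simps)
    then show "x \<in> ?G" using x by (auto simp: ring_def cring_def)
   qed
   show XG: "X e \<subseteq> ?G" using cG by (auto simp: X_def)
   show YG: "Y e \<subseteq> ?G" using cG YS by blast
   have seg: "closed_segment x y \<subseteq> ?G" if x: "x \<in> X e" and y: "y \<in> Y e" for x y
   proof
    fix z assume "z \<in> closed_segment x y"
    then obtain s where s: "0 \<le> s" "s \<le> 1" and z: "z = (1 - s) *\<^sub>R x + s *\<^sub>R y"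
     by (auto simp: closed_segment_def)
    have xS: "x \<in> \<Sigma>" and yS: "y \<in> \<Sigma>" using x Yc[OF y] by (auto simp: X_def cring_def)
    have zS: "z \<in> \<Sigma>" unfolding z using Sigma_convex xS yS s by (intro convexD) auto
    define U where "U = (1 / \<rho>) *\<^sub>R (x - x0)"
    define V where "V = (1 / \<rho>) *\<^sub>R (y - x0)"
    have xU: "x = x0 + \<rho> *\<^sub>R U" and yV: "y = x0 + \<rho> *\<^sub>R V" using \<rho> by (simp_all add: U_def V_def)
    have nx: "norm (x - x0) = \<rho> * norm U" and ny: "norm (y - x0) = \<rho> * norm V" using \<rho> xU yV by simp_all
    have nu: "1 \<le> norm U" "norm U \<le> 2"
     using x \<rho> mult_le_cancel_left_pos[OF \<rho>, of 1 "norm U"] mult_le_cancel_left_pos[OF \<rho>, of "norm U" 2]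
     by (auto simp: X_def cring_def nx mult.commute)
    have v: "norm (V - e) < r1" unfolding V_def by (rule Yv[OF y])
    have nv: "norm V \<le> 2"
     using Yc[OF y] mult_le_cancel_left_pos[OF \<rho>, of "norm V" 2] by (auto simp: cring_def ny mult.commute)
    have zx: "z - x0 = \<rho> *\<^sub>R ((1 - s) *\<^sub>R U + s *\<^sub>R V)"
     by (simp add: z xU yV algebra_simps)
    have "norm ((1 - s) *\<^sub>R U) \<le> (1 - s) * 2" "norm (s *\<^sub>R V) \<le> s * 2"
     using s mult_left_mono[OF nu(2), of "1 - s"] mult_left_mono[OF nv, of s] by simp_all
    then have "norm ((1 - s) *\<^sub>R U + s *\<^sub>R V) \<le> (1 - s) * 2 + s * 2" by (rule norm_triangle_le[OF add_mono])
    then have up: "norm ((1 - s) *\<^sub>R U + s *\<^sub>R V) \<le> 2" by simp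
    have "- (1 - \<delta>) * (norm (x - x0) * norm e) \<le> (x - x0) \<bullet> e" using x by (simp add: X_def)
    then have "\<rho> * (- (1 - \<delta>) * (norm U * norm e)) \<le> \<rho> * (U \<bullet> e)"
     unfolding nx using xU by (simp add: mult_ac)
    then have ue: "- (1 - \<delta>) * (norm U * norm e) \<le> U \<bullet> e" by (rule mult_left_le_imp_le[OF _ \<rho>])
    have "\<delta> / 2 \<le> (norm ((1 - s) *\<^sub>R U + s *\<^sub>R e))\<^sup>2"
     using segment_norm_lower_bound[OF _ \<delta>1 ue nu(1) _ s] \<delta>0 ne1 by simp
    then have "e0 \<le> norm ((1 - s) *\<^sub>R U + s *\<^sub>R e)" unfolding e0_def using real_le_lsqrt real_sqrt_le_mono[of "\<delta> / 2" "(norm ((1 - s) *\<^sub>R U + s *\<^sub>R e))\<^sup>2"] by simp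
    moreover have "norm ((1 - s) *\<^sub>R U + s *\<^sub>R e) \<le> norm ((1 - s) *\<^sub>R U + s *\<^sub>R V) + norm (s *\<^sub>R (V - e))"
     using norm_triangle_ineq4[of "(1 - s) *\<^sub>R U + s *\<^sub>R V" "s *\<^sub>R (V - e)"] by (simp add: algebra_simps)
    moreover have "norm (s *\<^sub>R (V - e)) \<le> r1"
     using s v mult_mono[of s 1 "norm (V - e)" r1] by simp
    ultimately have lo: "1 / \<Lambda> < norm ((1 - s) *\<^sub>R U + s *\<^sub>R V)" using r1(3) \<Lambda>(2) by linarith
    have nz: "norm (z - x0) = \<rho> * norm ((1 - s) *\<^sub>R U + s *\<^sub>R V)" unfolding zx using \<rho> by simp
    have "\<rho> * (1 / \<Lambda>) < norm (z - x0)" unfolding nz using lo \<rho> by (intro mult_strict_left_mono)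
    moreover have "norm (z - x0) \<le> \<rho> * 2" unfolding nz using up \<rho> by (intro mult_left_mono) auto
    moreover have "\<rho> * 2 < \<Lambda> * \<rho>" using \<rho> \<Lambda>(1) by simp
    ultimately show "z \<in> ?G" using zS by (simp add: ring_def)
   qed
   have d: "norm (y - x) \<le> 4 * \<rho>" if x: "x \<in> X e" and y: "y \<in> Y e" for x y
   proof -
    have "norm (x - x0) \<le> 2 * \<rho>" "norm (y - x0) \<le> 2 * \<rho>" using x Yc[OF y] by (auto simp: X_def cring_def)
    then show ?thesis using norm_triangle_ineq4[of "y - x0" "x - x0"] by simp
   qed
   have "\<exists>y\<in>Y e. (\<integral>\<^sup>+x. ennreal (indicator (X e) x * \<bar>f x - f y\<bar> ^ ?N) \<partial>lborel)
     \<le> ennreal (2 * ((4 * \<rho>) ^ ?N * 2 ^ DIM(real^'n)) * (A + 1) * E)"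
    by (rule poincare_two_sets[OF ring_open f Df XB YB XG YG seg d _ _ mX mY \<beta> _ E E0]) (use dim \<rho> A in auto)
   moreover have "2 * ((4 * \<rho>) ^ ?N * 2 ^ DIM(real^'n)) * (A + 1) * E = Q"
    by (simp add: Q_def P1_def power_mult_distrib)
   ultimately show "\<exists>y\<in>Y e. (\<integral>\<^sup>+x. ennreal (indicator (X e) x * \<bar>f x - f y\<bar> ^ ?N) \<partial>lborel) \<le> ennreal Q" by simp
  qed
  have np': "3/2 \<le> norm p" "norm p \<le> 7/4" using np by auto
  obtain y0 where y0: "y0 \<in> Y p" "(\<integral>\<^sup>+x. ennreal (indicator (X p) x * \<bar>f x - f y0\<bar> ^ ?N) \<partial>lborel) \<le> ennreal Q"
   using good[OF np' pS] by blast
  obtain y1 where y1: "y1 \<in> Y q" "(\<integral>\<^sup>+x. ennreal (indicator (X q) x * \<bar>f x - f y1\<bar> ^ ?N) \<partial>lborel) \<le> ennreal Q"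
   using good[OF nq nq' qS] by blast
  have cov: "cring \<rho> \<subseteq> X p \<union> X q"
  proof
   fix x assume x: "x \<in> cring \<rho>"
   have nx: "norm (x - x0) > 0" using x \<rho> by (auto simp: cring_def)
   show "x \<in> X p \<union> X q"
   proof (rule ccontr)
    assume "x \<notin> X p \<union> X q"
    then have lt: "(x - x0) \<bullet> p < - (1 - \<delta>) * (norm (x - x0) * norm p)" "(x - x0) \<bullet> q < - (1 - \<delta>) * (norm (x - x0) * norm q)"
     using x by (auto simp: X_def)
    have dv: "((x - x0) /\<^sub>R norm (x - x0)) \<bullet> (e /\<^sub>R norm e) < - (1 - \<delta>)"
     if "(x - x0) \<bullet> e < - (1 - \<delta>) * (norm (x - x0) * norm e)" "norm e > 0" for e
    proof -
     have "((x - x0) /\<^sub>R norm (x - x0)) \<bullet> (e /\<^sub>R norm e) = ((x - x0) \<bullet> e) / (norm (x - x0) * norm e)"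
      by (simp add: divide_inverse)
     also have "\<dots> < - (1 - \<delta>)" using that nx by (simp add: pos_divide_less_eq)
     finally show ?thesis .
    qed
    show False
    proof (rule not_both_opposite[OF ab _ \<delta>_def])
     show "norm ((x - x0) /\<^sub>R norm (x - x0)) = 1" using nx by simp
     show "((x - x0) /\<^sub>R norm (x - x0)) \<bullet> a < - (1 - \<delta>)" unfolding a_def by (rule dv[OF lt(1)]) (use np in linarith)
     show "((x - x0) /\<^sub>R norm (x - x0)) \<bullet> b < - (1 - \<delta>)" unfolding b_def by (rule dv[OF lt(2) q0])
    qed
   qed
  qed
  have Yq: "Y q \<subseteq> X p \<inter> X q"
  proof
   fix y assume y: "y \<in> Y q"
   let ?v = "(1 / \<rho>) *\<^sub>R (y - x0)"
   have v: "norm (?v - q) < r1" by (rule Yv[OF y])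
   have pos: "0 \<le> ?v \<bullet> e" if "norm (?v - e) \<le> 1/2" "3/2 \<le> norm e" for e
   proof -
    have "?v \<bullet> e = e \<bullet> e + (?v - e) \<bullet> e" by (simp add: inner_diff_left)
    moreover have "\<bar>(?v - e) \<bullet> e\<bar> \<le> (1/2) * norm e"
     using order_trans[OF Cauchy_Schwarz_ineq2 mult_right_mono[OF that(1) norm_ge_zero]] .
    moreover have "e \<bullet> e = norm e * norm e" by (simp add: power2_norm_eq_inner[symmetric] power2_eq_square)
    moreover have "(3/2) * norm e \<le> norm e * norm e" using that(2) by (intro mult_right_mono) auto
    moreover have "norm e \<ge> 0" by simp
    ultimately show ?thesis by linarith
   qed
   have "norm (?v - p) \<le> 1/2" using v r1 r qp norm_triangle_ineq[of "?v - q" "q - p"] by simp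
   then have 1: "0 \<le> ?v \<bullet> p" by (rule pos) (use np in simp)
   have 2: "0 \<le> ?v \<bullet> q" by (rule pos) (use v r1 r nq in auto)
   have "0 \<le> (y - x0) \<bullet> e" if "0 \<le> ?v \<bullet> e" for e
    using that \<rho> by (simp add: zero_le_divide_iff)
   then have "0 \<le> (y - x0) \<bullet> p" "0 \<le> (y - x0) \<bullet> q" using 1 2 by blast+
   moreover have "- (1 - \<delta>) * (norm (y - x0) * norm e) \<le> 0" for e :: "real^'n" using \<delta>1 by (simp add: mult_nonpos_nonneg)
   ultimately show "y \<in> X p \<inter> X q"
    using YS[OF nq nq' qS] y unfolding X_def by (auto intro: order_trans)
  qed
  \<comment> \<open>The two constants are compared on the second ball.\<close>
  define c where "c = f y0"
  define c1 where "c1 = f y1"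
  have cf: "continuous_on ?G f" using f by (rule GDERIV_continuous_on)
  have GB [measurable]: "?G \<in> sets borel" using ring_open by simp
  define fG where "fG x = indicator ?G x *\<^sub>R f x" for x
  have [measurable]: "fG \<in> borel_measurable borel"
   unfolding fG_def[abs_def] by (rule borel_measurable_continuous_on_indicator[OF GB cf])
  have XpG: "X p \<subseteq> ?G" and XqG: "X q \<subseteq> ?G" using XG[OF np' pS] XG[OF nq nq' qS] by auto
  have I0: "(\<integral>\<^sup>+x. ennreal (indicator (X p) x * \<bar>fG x - c\<bar> ^ ?N) \<partial>lborel) \<le> ennreal Q"
  proof -
   have "(\<integral>\<^sup>+x. ennreal (indicator (X p) x * \<bar>fG x - c\<bar> ^ ?N) \<partial>lborel) = (\<integral>\<^sup>+x. ennreal (indicator (X p) x * \<bar>f x - f y0\<bar> ^ ?N) \<partial>lborel)"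
    using XpG by (intro nn_integral_cong) (auto simp: fG_def c_def indicator_def)
   then show ?thesis using y0(2) by simp
  qed
  have I1: "(\<integral>\<^sup>+x. ennreal (indicator (X q) x * \<bar>fG x - c1\<bar> ^ ?N) \<partial>lborel) \<le> ennreal Q"
  proof -
   have "(\<integral>\<^sup>+x. ennreal (indicator (X q) x * \<bar>fG x - c1\<bar> ^ ?N) \<partial>lborel) = (\<integral>\<^sup>+x. ennreal (indicator (X q) x * \<bar>f x - f y1\<bar> ^ ?N) \<partial>lborel)"
    using XqG by (intro nn_integral_cong) (auto simp: fG_def c1_def indicator_def)
   then show ?thesis using y1(2) by simp
  qed
  have split: "\<bar>s + t\<bar> ^ ?N \<le> 2 ^ ?N * (\<bar>s\<bar> ^ ?N + \<bar>t\<bar> ^ ?N)" for s t :: real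
   using norm_add_power_le[of s t ?N] by simp
  have cc: "\<bar>c - c1\<bar> ^ ?N * \<beta> \<le> 2 ^ ?N * (2 * Q)"
  proof -
   have "ennreal (\<bar>c - c1\<bar> ^ ?N) * emeasure lborel (Y q) = (\<integral>\<^sup>+x. ennreal (\<bar>c - c1\<bar> ^ ?N) * indicator (Y q) x \<partial>lborel)"
    by (simp add: nn_integral_cmult)
   also have "\<dots> \<le> (\<integral>\<^sup>+x. ennreal (2 ^ ?N) * (ennreal (indicator (X p) x * \<bar>fG x - c\<bar> ^ ?N) + ennreal (indicator (X q) x * \<bar>fG x - c1\<bar> ^ ?N)) \<partial>lborel)"
   proof (rule nn_integral_mono)
    fix x
    show "ennreal (\<bar>c - c1\<bar> ^ ?N) * indicator (Y q) x \<le> ennreal (2 ^ ?N) * (ennreal (indicator (X p) x * \<bar>fG x - c\<bar> ^ ?N) + ennreal (indicator (X q) x * \<bar>fG x - c1\<bar> ^ ?N))"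
    proof (cases "x \<in> Y q")
     case True
     then have "x \<in> X p" "x \<in> X q" using Yq by auto
     moreover have "\<bar>c - c1\<bar> ^ ?N \<le> 2 ^ ?N * (\<bar>fG x - c\<bar> ^ ?N + \<bar>fG x - c1\<bar> ^ ?N)"
      using split[of "c - fG x" "fG x - c1"] by (simp add: abs_minus_commute)
     ultimately show ?thesis
      using True by (simp add: ennreal_plus[symmetric] ennreal_mult[symmetric] ennreal_leI del: ennreal_plus)
    qed simp
   qed
   also have "\<dots> = ennreal (2 ^ ?N) * ((\<integral>\<^sup>+x. ennreal (indicator (X p) x * \<bar>fG x - c\<bar> ^ ?N) \<partial>lborel) + (\<integral>\<^sup>+x. ennreal (indicator (X q) x * \<bar>fG x - c1\<bar> ^ ?N) \<partial>lborel))"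
    by (subst nn_integral_cmult, measurable, subst nn_integral_add) measurable
   also have "\<dots> \<le> ennreal (2 ^ ?N) * (ennreal Q + ennreal Q)"
    by (intro mult_left_mono add_mono I0 I1) auto
   also have "\<dots> = ennreal (2 ^ ?N * (2 * Q))"
    using Q by (simp add: ennreal_plus[symmetric] ennreal_mult[symmetric] del: ennreal_plus)
   finally have "ennreal (\<bar>c - c1\<bar> ^ ?N * \<beta>) \<le> ennreal (2 ^ ?N * (2 * Q))"
    using \<beta> by (simp add: mY ennreal_mult)
   then show ?thesis using Q by (subst (asm) ennreal_le_iff) auto
  qed
  have "(\<integral>\<^sup>+x. ennreal (indicator (cring \<rho>) x * \<bar>f x - c\<bar> ^ ?N) \<partial>lborel)
    \<le> (\<integral>\<^sup>+x. ennreal (indicator (X p) x * \<bar>fG x - c\<bar> ^ ?N)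
      + ennreal (2 ^ ?N) * (ennreal (indicator (X q) x * \<bar>fG x - c1\<bar> ^ ?N) + ennreal (\<bar>c - c1\<bar> ^ ?N) * indicator (X q) x) \<partial>lborel)"
  proof (rule nn_integral_mono)
   fix x
   show "ennreal (indicator (cring \<rho>) x * \<bar>f x - c\<bar> ^ ?N) \<le> ennreal (indicator (X p) x * \<bar>fG x - c\<bar> ^ ?N)
      + ennreal (2 ^ ?N) * (ennreal (indicator (X q) x * \<bar>fG x - c1\<bar> ^ ?N) + ennreal (\<bar>c - c1\<bar> ^ ?N) * indicator (X q) x)"
   proof (cases "x \<in> cring \<rho>")
    case True
    show ?thesis
    proof (cases "x \<in> X p")
     case True
     then have "fG x = f x" using XpG by (auto simp: fG_def)
     then have "ennreal (indicator (cring \<rho>) x * \<bar>f x - c\<bar> ^ ?N) \<le> ennreal (indicator (X p) x * \<bar>fG x - c\<bar> ^ ?N)"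
      using True by (auto simp: indicator_def)
     then show ?thesis by (rule order_trans) simp
    next
     case False
     then have xq: "x \<in> X q" using cov \<open>x \<in> cring \<rho>\<close> by auto
     then have fx: "fG x = f x" using XqG by (auto simp: fG_def)
     have "\<bar>f x - c\<bar> ^ ?N \<le> 2 ^ ?N * (\<bar>f x - c1\<bar> ^ ?N + \<bar>c - c1\<bar> ^ ?N)"
      using split[of "f x - c1" "c1 - c"] by (simp add: abs_minus_commute)
     then show ?thesis
      using xq False \<open>x \<in> cring \<rho>\<close> fx by (simp add: ennreal_plus[symmetric] ennreal_mult[symmetric] ennreal_leI del: ennreal_plus)
    qed
   qed simp
  qed
  also have "\<dots> = (\<integral>\<^sup>+x. ennreal (indicator (X p) x * \<bar>fG x - c\<bar> ^ ?N) \<partial>lborel)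
    + ennreal (2 ^ ?N) * ((\<integral>\<^sup>+x. ennreal (indicator (X q) x * \<bar>fG x - c1\<bar> ^ ?N) \<partial>lborel) + ennreal (\<bar>c - c1\<bar> ^ ?N) * emeasure lborel (X q))"
   by (subst nn_integral_add, measurable, subst nn_integral_cmult, measurable, subst nn_integral_add, measurable)
     (simp add: nn_integral_cmult)
  also have "\<dots> \<le> ennreal Q + ennreal (2 ^ ?N) * (ennreal Q + ennreal (\<bar>c - c1\<bar> ^ ?N) * ennreal (A * \<beta>))"
   by (intro add_mono mult_left_mono I0 I1 mX) auto
  also have "\<dots> = ennreal (Q + 2 ^ ?N * (Q + \<bar>c - c1\<bar> ^ ?N * \<beta> * A))"
   using Q A \<beta> by (simp add: ennreal_plus[symmetric] ennreal_mult[symmetric] mult_ac del: ennreal_plus)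
  also have "\<dots> \<le> ennreal (Q + 2 ^ ?N * (Q + 2 ^ ?N * (2 * Q) * A))"
   using cc A by (intro ennreal_leI add_left_mono mult_left_mono mult_right_mono) auto
  also have "Q + 2 ^ ?N * (Q + 2 ^ ?N * (2 * Q) * A) = P * \<rho> ^ ?N * E"
   by (simp add: Q_def P_def algebra_simps)
  finally have fin: "(\<integral>\<^sup>+x. ennreal (indicator (cring \<rho>) x * \<bar>f x - c\<bar> ^ ?N) \<partial>lborel) \<le> ennreal (P * \<rho> ^ ?N * E)" .
  have "y0 \<in> cring \<rho>" using YS[OF np' pS] y0(1) by blast
  then show "\<exists>c. (\<exists>y\<in>cring \<rho>. c = f y) \<and> (\<integral>\<^sup>+x. ennreal (indicator (cring \<rho>) x * \<bar>f x - c\<bar> ^ ?N) \<partial>lborel) \<le> ennreal (P * \<rho> ^ ?N * E)"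
   using fin c_def by blast
 qed
qed

end

section \<open>Admissible functions and weak solutions\<close>

lemma Lp_tendsto_cong_AE:
 fixes g h :: "'a::euclidean_space => 'b::euclidean_space"
 assumes F: "Lp_tendsto p S F g" and ae: "AE x in lebesgue_on S. g x = h x"
  and m: "\<And>n. (\<lambda>x. F n x - h x) \<in> borel_measurable (lebesgue_on S)"
 shows "Lp_tendsto p S F h"
proof -
 have *: "integrable (lebesgue_on S) (\<lambda>x. norm (F n x - h x) ^ p)"
  "(LINT x|lebesgue_on S. norm (F n x - g x) ^ p) = (LINT x|lebesgue_on S. norm (F n x - h x) ^ p)" for n
 proof -
  have i: "integrable (lebesgue_on S) (\<lambda>x. norm (F n x - g x) ^ p)" using F by (simp add: Lp_tendsto_def Lp_on_def)
  have m': "(\<lambda>x. norm (F n x - h x) ^ p) \<in> borel_measurable (lebesgue_on S)"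
   by (rule borel_measurable_power[OF measurable_compose[OF m borel_measurable_norm]])
  have e: "AE x in lebesgue_on S. norm (F n x - g x) ^ p = norm (F n x - h x) ^ p"
   using ae by eventually_elim simp
  show "integrable (lebesgue_on S) (\<lambda>x. norm (F n x - h x) ^ p)" by (rule integrable_cong_AE_imp[OF i m' e])
  show "(LINT x|lebesgue_on S. norm (F n x - g x) ^ p) = (LINT x|lebesgue_on S. norm (F n x - h x) ^ p)"
   by (rule integral_cong_AE[OF borel_measurable_integrable[OF i] m' e])
 qed
 then show ?thesis using F m by (simp add: Lp_tendsto_def Lp_on_def)
qed

lemma continuous_on_open_measurable:
 fixes f :: "'a::euclidean_space => 'b::euclidean_space"
 shows "open S ==> continuous_on S f ==> f \<in> borel_measurable (lebesgue_on S)"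
 by (rule continuous_imp_measurable_on_sets_lebesgue) auto

lemma Lp_on_extend:
 fixes f :: "'a::euclidean_space => 'b::euclidean_space"
 assumes "Lp_on p T f" "T \<subseteq> S" "open T" "open S" "continuous_on S f" "\<And>x. x \<in> S - T ==> f x = 0" "p \<ge> 1"
 shows "Lp_on p S f"
 using assms integral_lebesgue_on_subset(2)[of T S "\<lambda>x. norm (f x) ^ p"]
 by (simp add: Lp_on_def continuous_on_open_measurable)

context exterior_problem begin

lemma card1: "1 \<le> CARD('n)" using dim by simp

lemma S_ball: "open (S \<inter> ball 0 r)" "bounded (S \<inter> ball 0 r)" "S \<inter> ball 0 r \<in> sets lebesgue"
 using S_open by (auto intro: bounded_Int)

text \<open>Multiplied by a smooth cutoff, these functions become test functions of the weak formulation.\<close>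
definition admissible :: "(real^'n => real) => (real^'n => real^'n) => bool" where
 "admissible f Df \<longleftrightarrow> (\<forall>x\<in>S. GDERIV f x :> Df x) \<and> continuous_on S Df \<and>
   (\<forall>r. Lp_on CARD('n) (S \<inter> ball 0 r) f) \<and> (\<forall>r. Lp_on CARD('n) (S \<inter> ball 0 r) Df) \<and>
   (\<forall>\<^sub>F r in at_top. \<exists>F. Sobolev_limit CARD('n) (S \<inter> ball 0 r) \<Gamma> f Df F)"

lemma admissibleD:
 assumes "admissible f Df"
 shows "x \<in> S ==> GDERIV f x :> Df x" "continuous_on S Df" "continuous_on S f"
  "Lp_on CARD('n) (S \<inter> ball 0 r) f" "Lp_on CARD('n) (S \<inter> ball 0 r) Df"
  "\<forall>\<^sub>F r in at_top. \<exists>F. Sobolev_limit CARD('n) (S \<inter> ball 0 r) \<Gamma> f Df F"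
 using assms GDERIV_continuous_on[of S f Df] unfolding admissible_def by simp_all

lemma admissible_add:
 assumes f: "admissible f Df" and g: "admissible g Dg"
 shows "admissible (\<lambda>x. f x + g x) (\<lambda>x. Df x + Dg x)"
 unfolding admissible_def
proof (intro conjI ballI allI)
 show "GDERIV (\<lambda>x. f x + g x) x :> Df x + Dg x" if "x \<in> S" for x
  by (rule GDERIV_add[OF admissibleD(1)[OF f that] admissibleD(1)[OF g that]])
 show "continuous_on S (\<lambda>x. Df x + Dg x)" by (rule continuous_on_add[OF admissibleD(2)[OF f] admissibleD(2)[OF g]])
 show "Lp_on CARD('n) (S \<inter> ball 0 r) (\<lambda>x. f x + g x)" for r by (rule Lp_on_add[OF admissibleD(4)[OF f] admissibleD(4)[OF g]])
 show "Lp_on CARD('n) (S \<inter> ball 0 r) (\<lambda>x. Df x + Dg x)" for r by (rule Lp_on_add[OF admissibleD(5)[OF f] admissibleD(5)[OF g]])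
 show "\<forall>\<^sub>F r in at_top. \<exists>F. Sobolev_limit CARD('n) (S \<inter> ball 0 r) \<Gamma> (\<lambda>x. f x + g x) (\<lambda>x. Df x + Dg x) F"
  using admissibleD(6)[OF f] admissibleD(6)[OF g]
 proof eventually_elim
  fix r assume "\<exists>F. Sobolev_limit CARD('n) (S \<inter> ball 0 r) \<Gamma> f Df F" "\<exists>F. Sobolev_limit CARD('n) (S \<inter> ball 0 r) \<Gamma> g Dg F"
  then obtain F G where "Sobolev_limit CARD('n) (S \<inter> ball 0 r) \<Gamma> f Df F" "Sobolev_limit CARD('n) (S \<inter> ball 0 r) \<Gamma> g Dg G"
   by (elim exE)
  from Sobolev_limit_add[OF this] show "\<exists>F. Sobolev_limit CARD('n) (S \<inter> ball 0 r) \<Gamma> (\<lambda>x. f x + g x) (\<lambda>x. Df x + Dg x) F"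
   by (intro exI)
 qed
qed

lemma grad_const: "grad (\<lambda>x::'a::euclidean_space. c::real) x = 0"
 by (rule GDERIV_grad[OF GDERIV_const])

lemma admissible_cmult:
 assumes f: "admissible f Df"
 shows "admissible (\<lambda>x. c * f x) (\<lambda>x. c *\<^sub>R Df x)"
 unfolding admissible_def
proof (intro conjI ballI allI)
 show "GDERIV (\<lambda>x. c * f x) x :> c *\<^sub>R Df x" if "x \<in> S" for x
  by (rule GDERIV_cmult[OF admissibleD(1)[OF f that]])
 show "continuous_on S (\<lambda>x. c *\<^sub>R Df x)" by (intro continuous_intros admissibleD(2)[OF f])
 show "Lp_on CARD('n) (S \<inter> ball 0 r) (\<lambda>x. c * f x)" for r
  by (rule Lp_on_bound[OF admissibleD(4)[OF f, of r], of _ "\<bar>c\<bar>"])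
    (use admissibleD(4)[OF f, of r] in \<open>auto simp: Lp_on_def abs_mult intro!: borel_measurable_times\<close>)
 show "Lp_on CARD('n) (S \<inter> ball 0 r) (\<lambda>x. c *\<^sub>R Df x)" for r
  by (rule Lp_on_bound[OF admissibleD(5)[OF f, of r], of _ "\<bar>c\<bar>"])
    (use admissibleD(5)[OF f, of r] in \<open>auto simp: Lp_on_def intro!: borel_measurable_scaleR\<close>)
 show "\<forall>\<^sub>F r in at_top. \<exists>F. Sobolev_limit CARD('n) (S \<inter> ball 0 r) \<Gamma> (\<lambda>x. c * f x) (\<lambda>x. c *\<^sub>R Df x) F"
  using admissibleD(6)[OF f]
 proof eventually_elim
  fix r assume "\<exists>F. Sobolev_limit CARD('n) (S \<inter> ball 0 r) \<Gamma> f Df F"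
  then obtain F where "Sobolev_limit CARD('n) (S \<inter> ball 0 r) \<Gamma> f Df F" by (elim exE)
  from Sobolev_limit_mult[OF S_ball(1,2) this smooth_on_const[of c]]
  have "Sobolev_limit CARD('n) (S \<inter> ball 0 r) \<Gamma> (\<lambda>x. c * f x) (\<lambda>x. c *\<^sub>R Df x) (\<lambda>n x. c * F n x)"
   by (simp add: grad_const)
  then show "\<exists>F. Sobolev_limit CARD('n) (S \<inter> ball 0 r) \<Gamma> (\<lambda>x. c * f x) (\<lambda>x. c *\<^sub>R Df x) F"
   by (intro exI)
 qed
qed

lemma admissible_diff:
 assumes f: "admissible f Df" and g: "admissible g Dg"
 shows "admissible (\<lambda>x. f x - c * g x) (\<lambda>x. Df x - c *\<^sub>R Dg x)"
 using admissible_add[OF f admissible_cmult[OF g, of "- c"]] by simp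

lemma admissible_smooth:
 assumes s: "smooth_on UNIV \<phi>" and U: "open U" "closure \<Gamma> \<subseteq> U" "\<And>x. x \<in> U ==> \<phi> x = 0"
 shows "admissible \<phi> (grad \<phi>)"
 unfolding admissible_def
proof (intro conjI ballI allI always_eventually)
 show "GDERIV \<phi> x :> grad \<phi> x" for x by (rule smooth_on_GDERIV[OF s])
 show "continuous_on S (grad \<phi>)" by (rule smooth_on_grad_continuous[OF s])
 show "Lp_on CARD('n) (S \<inter> ball 0 r) \<phi>" "Lp_on CARD('n) (S \<inter> ball 0 r) (grad \<phi>)" for r
  by (rule smooth_Lp_on[OF S_ball(1,2) s])+
 show "\<exists>F. Sobolev_limit CARD('n) (S \<inter> ball 0 r) \<Gamma> \<phi> (grad \<phi>) F" for r
  unfolding Sobolev_limit_def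
 proof (intro exI[of _ "\<lambda>_. \<phi>"] conjI allI s)
  show "\<exists>U. open U \<and> closure \<Gamma> \<subseteq> U \<and> (\<forall>x\<in>U \<inter> closure (S \<inter> ball 0 r). \<phi> x = 0)"
   using U by (intro exI[of _ U]) auto
 qed (simp_all add: Lp_tendsto_def Lp_on_def power_0_left)
qed

definition test_pair :: "(real^'n => real) => (real^'n => real^'n) => bool" where
 "test_pair \<phi> \<psi> \<longleftrightarrow> W1p CARD('n) S \<phi> \<psi> \<and> vanishes_on_loc CARD('n) S \<Gamma> \<phi> \<and>
   (\<exists>r. AE x in lebesgue_on S. r \<le> norm x --> \<phi> x = 0)"

lemma grad_0_outside:
 assumes "smooth_on UNIV \<eta>" "\<And>x. r \<le> norm x ==> \<eta> x = 0" "r < norm x"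
 shows "grad \<eta> x = 0"
 by (rule GDERIV_0_outside[OF smooth_on_GDERIV[OF assms(1)], of r]) (use assms(2,3) in auto)

lemma admissible_times_cutoff:
 assumes f: "admissible f Df" and s: "smooth_on UNIV \<eta>" and z: "\<And>x. r \<le> norm x ==> \<eta> x = 0"
 shows "test_pair (\<lambda>x. \<eta> x * f x) (\<lambda>x. \<eta> x *\<^sub>R Df x + f x *\<^sub>R grad \<eta> x)"
proof -
 let ?D = "\<lambda>x. \<eta> x *\<^sub>R Df x + f x *\<^sub>R grad \<eta> x"
 have c\<eta>: "continuous_on A \<eta>" "continuous_on A (grad \<eta>)" for A
  using smooth_on_continuous[OF s] smooth_on_grad_continuous[OF s] by auto
 have G: "GDERIV (\<lambda>x. \<eta> x * f x) x :> ?D x" if "x \<in> S" for x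
  by (rule GDERIV_mult[OF smooth_on_GDERIV[OF s] admissibleD(1)[OF f that]])
 have cD: "continuous_on S ?D" and cf: "continuous_on S (\<lambda>x. \<eta> x * f x)"
  by (intro continuous_intros c\<eta> admissibleD(2,3)[OF f])+
 have "\<exists>B>0. \<forall>x\<in>cball 0 (r + 1). norm (\<eta> x) \<le> B" by (rule compact_continuous_bound[OF compact_cball c\<eta>(1)])
 then obtain B where B: "\<And>x. x \<in> cball 0 (r + 1) ==> norm (\<eta> x) \<le> B" by blast
 have "\<exists>B>0. \<forall>x\<in>cball 0 (r + 1). norm (grad \<eta> x) \<le> B" by (rule compact_continuous_bound[OF compact_cball c\<eta>(2)])
 then obtain B' where B': "\<And>x. x \<in> cball 0 (r + 1) ==> norm (grad \<eta> x) \<le> B'" by blast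
 let ?T = "S \<inter> ball 0 (r + 1)"
 have T: "?T \<subseteq> S" by simp
 have L1: "Lp_on CARD('n) ?T (\<lambda>x. \<eta> x * f x)"
 proof (rule Lp_on_bound[OF admissibleD(4)[OF f, of "r + 1"], of _ B])
  show "(\<lambda>x. \<eta> x * f x) \<in> borel_measurable (lebesgue_on ?T)"
   by (rule continuous_on_open_measurable[OF S_ball(1) continuous_on_subset[OF cf T]])
 qed (use B in \<open>auto simp: abs_mult intro!: mult_right_mono\<close>)
 have L2: "Lp_on CARD('n) ?T (\<lambda>x. \<eta> x *\<^sub>R Df x)"
 proof (rule Lp_on_bound[OF admissibleD(5)[OF f, of "r + 1"], of _ B])
  show "(\<lambda>x. \<eta> x *\<^sub>R Df x) \<in> borel_measurable (lebesgue_on ?T)"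
   by (rule continuous_on_open_measurable[OF S_ball(1)]) (intro continuous_intros c\<eta> continuous_on_subset[OF admissibleD(2)[OF f] T])
 qed (use B in \<open>auto intro!: mult_right_mono\<close>)
 have L3: "Lp_on CARD('n) ?T (\<lambda>x. f x *\<^sub>R grad \<eta> x)"
 proof (rule Lp_on_bound[OF admissibleD(4)[OF f, of "r + 1"], of _ B'])
  show "(\<lambda>x. f x *\<^sub>R grad \<eta> x) \<in> borel_measurable (lebesgue_on ?T)"
   by (rule continuous_on_open_measurable[OF S_ball(1)]) (intro continuous_intros c\<eta> continuous_on_subset[OF admissibleD(3)[OF f] T])
 qed (use B' in \<open>auto simp: mult.commute[of B'] intro!: mult_left_mono\<close>)
 have far: "\<eta> x = 0 \<and> grad \<eta> x = 0" if "x \<in> S - ?T" for x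
  using z[of x] grad_0_outside[OF s z, where x = x] that by auto
 have "Lp_on CARD('n) S (\<lambda>x. \<eta> x * f x)"
  by (rule Lp_on_extend[OF L1 T S_ball(1) S_open cf _ card1]) (use far in auto)
 moreover have "Lp_on CARD('n) S ?D"
  by (rule Lp_on_extend[OF Lp_on_add[OF L2 L3] T S_ball(1) S_open cD _ card1]) (use far in auto)
 moreover have hw: "has_weak_gradient S (\<lambda>x. \<eta> x * f x) ?D" by (rule has_weak_gradient_C1[OF S_open G cD])
 ultimately have W: "W1p CARD('n) S (\<lambda>x. \<eta> x * f x) ?D" by (simp add: W1p_def)
 have "vanishes_on_loc CARD('n) S \<Gamma> (\<lambda>x. \<eta> x * f x)"
  unfolding vanishes_on_loc_def using admissibleD(6)[OF f]
 proof eventually_elim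
  fix r' assume "\<exists>F. Sobolev_limit CARD('n) (S \<inter> ball 0 r') \<Gamma> f Df F"
  then obtain F where F: "Sobolev_limit CARD('n) (S \<inter> ball 0 r') \<Gamma> f Df F" by (elim exE)
  have sub: "S \<inter> ball 0 r' \<subseteq> S" by simp
  have "W1p CARD('n) (S \<inter> ball 0 r') (\<lambda>x. \<eta> x * f x) ?D"
   unfolding W1p_def using W has_weak_gradient_subset[OF hw sub S_ball(1) S_open]
   by (intro conjI Lp_on_subset[OF _ sub S_ball(3) S_lebesgue]) (simp_all add: W1p_def)
  with Sobolev_limit_mult[OF S_ball(1,2) F s]
  show "vanishes_on CARD('n) (S \<inter> ball 0 r') \<Gamma> (\<lambda>x. \<eta> x * f x)"
   unfolding vanishes_on_iff[OF S_ball(1,2) card1] by (intro exI conjI)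
 qed
 then show ?thesis unfolding test_pair_def using W z by (intro conjI exI[of _ r]) auto
qed

definition solves :: "(real^'n => real) => (real^'n => real^'n) => bool" where
 "solves v Dv \<longleftrightarrow> admissible v Dv \<and>
   (\<forall>\<phi> \<psi>. test_pair \<phi> \<psi> --> (LINT x|lebesgue_on S. flux H (Dv x) \<bullet> \<psi> x) = 0)"

lemma AE_lebesgue_on_exhaust:
 assumes "\<And>n::nat. AE x in lebesgue_on (S \<inter> ball 0 (real n)). Q x"
 shows "AE x in lebesgue_on S. Q x"
proof -
 have "AE x in lebesgue. x \<in> S \<inter> ball 0 (real n) --> Q x" for n
  using assms[of n] S_ball(3)[of "real n"] by (simp add: AE_restrict_space_iff)
 then have "AE x in lebesgue. \<forall>n. x \<in> S \<inter> ball 0 (real n) --> Q x" by (subst AE_all_countable) auto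
 then have "AE x in lebesgue. x \<in> S --> Q x"
 proof eventually_elim
  fix x assume a: "\<forall>n. x \<in> S \<inter> ball 0 (real n) --> Q x"
  obtain n where "norm x < real n" using reals_Archimedean2 by blast
  then show "x \<in> S --> Q x" using a by auto
 qed
 then show ?thesis by (simp add: AE_restrict_space_iff)
qed

lemma measurable_exhaust:
 fixes g :: "real^'n => real^'n"
 assumes "\<And>n::nat. g \<in> borel_measurable (lebesgue_on (S \<inter> ball 0 (real n)))"
 shows "g \<in> borel_measurable (lebesgue_on S)"
proof -
 have "(\<lambda>x. if x \<in> S \<inter> ball 0 (real n) then g x else 0) \<in> borel_measurable lebesgue" for n
  using assms[of n] S_ball(3)[of "real n"] by (simp only: borel_measurable_if)
 then have "(\<lambda>x. if x \<in> S then g x else 0) \<in> borel_measurable lebesgue"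
 proof (rule borel_measurable_LIMSEQ_metric)
  fix x :: "real^'n"
  obtain n where n: "norm x < real n" using reals_Archimedean2 by blast
  have "\<forall>\<^sub>F k in sequentially. (if x \<in> S then g x else 0) = (if x \<in> S \<inter> ball 0 (real k) then g x else 0)"
   using eventually_ge_at_top[of n] by eventually_elim (use n in auto)
  then show "(\<lambda>k. if x \<in> S \<inter> ball 0 (real k) then g x else 0) \<longlonglongrightarrow> (if x \<in> S then g x else 0)"
   by (rule Lim_transform_eventually[OF tendsto_const])
 qed
 then show ?thesis by (simp only: borel_measurable_if S_lebesgue)
qed

lemma overdetermined_solves:
 assumes v: "overdetermined_solution H \<Sigma> \<Omega> C v"
 obtains Dv where "solves v Dv" "C1_up_to_with S \<Gamma> v Dv" "\<And>x. x \<in> \<Gamma> ==> H (Dv x) = C"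
proof -
 obtain Dv where Dv: "C1_up_to_with S \<Gamma> v Dv" "\<And>x. x \<in> \<Gamma> ==> H (Dv x) = C"
  using v unfolding overdetermined_solution_def S_def \<Gamma>_def by metis
 obtain g where W: "\<And>r. r > 0 ==> W1p CARD('n) (S \<inter> ball 0 r) v g"
  and van: "vanishes_on_loc CARD('n) S \<Gamma> v"
  and eq: "\<And>\<phi> \<psi>. test_pair \<phi> \<psi> ==> (LINT x|lebesgue_on S. flux H (g x) \<bullet> \<psi> x) = 0"
  using v unfolding overdetermined_solution_def weak_solution_def S_def[symmetric] \<Gamma>_def[symmetric] test_pair_def
  by auto
 have G: "\<And>x. x \<in> S ==> GDERIV v x :> Dv x" and cD: "continuous_on S Dv"
  using Dv(1) continuous_on_subset[of "S \<union> \<Gamma>" Dv S] unfolding C1_up_to_with_def by auto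
 have cD': "continuous_on (S \<inter> ball 0 r) Dv" for r by (rule continuous_on_subset[OF cD]) simp
 have hw: "has_weak_gradient (S \<inter> ball 0 r) v Dv" for r
  by (rule has_weak_gradient_C1[OF S_ball(1) _ cD']) (simp add: G)
 have mD: "Dv \<in> borel_measurable (lebesgue_on (S \<inter> ball 0 r))" for r
  by (rule continuous_on_open_measurable[OF S_ball(1) cD'])
 have ae: "AE x in lebesgue_on (S \<inter> ball 0 r). k x = Dv x" if "W1p CARD('n) (S \<inter> ball 0 r) v k" for k r
  by (rule weak_gradient_unique[OF S_ball(1) _ hw]) (use that in \<open>simp add: W1p_def\<close>)
 have L1: "Lp_on CARD('n) (S \<inter> ball 0 r) v" "Lp_on CARD('n) (S \<inter> ball 0 r) Dv" if r: "r > 0" for r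
 proof -
  show "Lp_on CARD('n) (S \<inter> ball 0 r) v" using W[OF r] by (simp add: W1p_def)
  have "integrable (lebesgue_on (S \<inter> ball 0 r)) (\<lambda>x. norm (g x) ^ CARD('n))" using W[OF r] by (simp add: W1p_def Lp_on_def)
  then have "integrable (lebesgue_on (S \<inter> ball 0 r)) (\<lambda>x. norm (Dv x) ^ CARD('n))"
  proof (rule integrable_cong_AE_imp)
   show "(\<lambda>x. norm (Dv x) ^ CARD('n)) \<in> borel_measurable (lebesgue_on (S \<inter> ball 0 r))"
    by (rule borel_measurable_power[OF measurable_compose[OF mD borel_measurable_norm]])
   show "AE x in lebesgue_on (S \<inter> ball 0 r). norm (g x) ^ CARD('n) = norm (Dv x) ^ CARD('n)"
    using ae[OF W[OF r]] by eventually_elim simp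
  qed
  then show "Lp_on CARD('n) (S \<inter> ball 0 r) Dv" using mD by (simp add: Lp_on_def)
 qed
 have L: "Lp_on CARD('n) (S \<inter> ball 0 r) v" "Lp_on CARD('n) (S \<inter> ball 0 r) Dv" for r
 proof -
  have "0 < max r 1" "S \<inter> ball 0 r \<subseteq> S \<inter> ball 0 (max r 1)" by auto
  then show "Lp_on CARD('n) (S \<inter> ball 0 r) v" "Lp_on CARD('n) (S \<inter> ball 0 r) Dv"
   using Lp_on_subset[OF L1(1)] Lp_on_subset[OF L1(2)] S_ball(3) by auto
 qed
 have "\<forall>\<^sub>F r in at_top. \<exists>F. Sobolev_limit CARD('n) (S \<inter> ball 0 r) \<Gamma> v Dv F"
  using van unfolding vanishes_on_loc_def
 proof eventually_elim
  fix r assume "vanishes_on CARD('n) (S \<inter> ball 0 r) \<Gamma> v"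
  then obtain k F where k: "W1p CARD('n) (S \<inter> ball 0 r) v k" and F: "Sobolev_limit CARD('n) (S \<inter> ball 0 r) \<Gamma> v k F"
   unfolding vanishes_on_iff[OF S_ball(1,2) card1] by (elim exE conjE)
  have s: "smooth_on UNIV (F n)" for n using F by (simp add: Sobolev_limit_def)
  have "Lp_tendsto CARD('n) (S \<inter> ball 0 r) (\<lambda>n. grad (F n)) Dv"
  proof (rule Lp_tendsto_cong_AE[OF _ ae[OF k]])
   show "Lp_tendsto CARD('n) (S \<inter> ball 0 r) (\<lambda>n. grad (F n)) k" using F by (simp add: Sobolev_limit_def)
   show "(\<lambda>x. grad (F n) x - Dv x) \<in> borel_measurable (lebesgue_on (S \<inter> ball 0 r))" for n
    by (rule continuous_on_open_measurable[OF S_ball(1)])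
      (intro continuous_intros cD' smooth_on_grad_continuous[OF s])
  qed
  then have "Sobolev_limit CARD('n) (S \<inter> ball 0 r) \<Gamma> v Dv F" using F by (simp add: Sobolev_limit_def)
  then show "\<exists>F. Sobolev_limit CARD('n) (S \<inter> ball 0 r) \<Gamma> v Dv F" by (intro exI)
 qed
 then have adm: "admissible v Dv" unfolding admissible_def using G cD L by blast
 have gm: "g \<in> borel_measurable (lebesgue_on S)"
 proof (rule measurable_exhaust)
  fix n :: nat
  have "g \<in> borel_measurable (lebesgue_on (S \<inter> ball 0 (real n + 1)))" using W[of "real n + 1"] by (simp add: W1p_def Lp_on_def)
  then show "g \<in> borel_measurable (lebesgue_on (S \<inter> ball 0 (real n)))"
   by (rule measurable_restrict_mono) auto
 qed
 have gD: "AE x in lebesgue_on S. g x = Dv x"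
 proof (rule AE_lebesgue_on_exhaust)
  fix n :: nat
  have "AE x in lebesgue_on (S \<inter> ball 0 (real n + 1)). g x = Dv x" by (rule ae[OF W]) simp
  then show "AE x in lebesgue_on (S \<inter> ball 0 (real n)). g x = Dv x"
   using S_ball(3) by (auto simp: AE_restrict_space_iff elim!: eventually_mono)
 qed
 have mf: "flux H \<in> borel_measurable borel"
  unfolding flux_eq by (rule borel_measurable_continuous_onI[OF dpow_continuous[OF dim]])
 have "(LINT x|lebesgue_on S. flux H (Dv x) \<bullet> \<psi> x) = 0" if t: "test_pair \<phi> \<psi>" for \<phi> \<psi>
 proof -
  have p: "\<psi> \<in> borel_measurable (lebesgue_on S)" using t by (simp add: test_pair_def W1p_def Lp_on_def)
  have "(LINT x|lebesgue_on S. flux H (Dv x) \<bullet> \<psi> x) = (LINT x|lebesgue_on S. flux H (g x) \<bullet> \<psi> x)"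
  proof (rule integral_cong_AE)
   show "(\<lambda>x. flux H (Dv x) \<bullet> \<psi> x) \<in> borel_measurable (lebesgue_on S)"
    by (rule borel_measurable_inner[OF measurable_compose[OF continuous_on_open_measurable[OF S_open cD] mf] p])
   show "(\<lambda>x. flux H (g x) \<bullet> \<psi> x) \<in> borel_measurable (lebesgue_on S)"
    by (rule borel_measurable_inner[OF measurable_compose[OF gm mf] p])
   show "AE x in lebesgue_on S. flux H (Dv x) \<bullet> \<psi> x = flux H (g x) \<bullet> \<psi> x" using gD by eventually_elim simp
  qed
  then show ?thesis using eq[OF t] by simp
 qed
 then have "solves v Dv" unfolding solves_def using adm by blast
 then show thesis using that Dv by blast
qed

end

section \<open>Cutoffs and fluxes at geometric scales\<close>

text \<open>The constants of all later estimates: a cutoff \<open>\<zeta>\<close>, the ratio \<open>\<Lambda>\<close> of consecutive scales and the constant \<open>P\<close>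
 of the Poincare inequality, the growth and coercivity constants \<open>D\<close> and \<open>m\<close> of the flux, and an index \<open>k0\<close>
 from which on all scales lie in the exterior domain.\<close>
locale exterior_scales = exterior_problem H K T \<Sigma> \<Omega> C R x0
 for H :: "real^'n => real" and K T \<Sigma> \<Omega> C R x0 +
 fixes \<zeta> :: "real^'n => real" and \<Lambda> P B D m :: real and k0 :: nat
 assumes \<zeta>_smooth: "smooth_on UNIV \<zeta>" and \<zeta>_range: "0 \<le> \<zeta> x" "\<zeta> x \<le> 1"
  and \<zeta>_1: "norm x \<le> 1 ==> \<zeta> x = 1" and \<zeta>_0: "2 \<le> norm x ==> \<zeta> x = 0"
  and \<zeta>_grad: "norm (grad \<zeta> x) \<le> B" and B_pos: "0 < B"
  and \<Lambda>_ge: "4 \<le> \<Lambda>" and P_pos: "0 < P"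
  and poincare: "\<And>\<rho> f Df E. 0 < \<rho> ==> (\<And>x. x \<in> ring (\<rho> / \<Lambda>) (\<Lambda> * \<rho>) ==> GDERIV f x :> Df x) ==>
   continuous_on (ring (\<rho> / \<Lambda>) (\<Lambda> * \<rho>)) Df ==> 0 \<le> E ==>
   (\<integral>\<^sup>+z. ennreal (indicator (ring (\<rho> / \<Lambda>) (\<Lambda> * \<rho>)) z * norm (Df z) ^ CARD('n)) \<partial>lborel) = ennreal E ==>
   \<exists>c. (\<exists>y\<in>cring \<rho>. c = f y) \<and>
    (\<integral>\<^sup>+x. ennreal (indicator (cring \<rho>) x * \<bar>f x - c\<bar> ^ CARD('n)) \<partial>lborel) \<le> ennreal (P * \<rho> ^ CARD('n) * E)"
  and D_pos: "0 < D" and flux_bound: "norm (flux H \<xi>) \<le> D * norm \<xi> ^ (CARD('n) - 1)"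
  and m_pos: "0 < m" and flux_coercive: "m * norm \<xi> ^ CARD('n) \<le> \<xi> \<bullet> flux H \<xi>"
  and far: "x \<in> \<Sigma> ==> \<Lambda> ^ k0 \<le> norm (x - x0) ==> x \<in> S"
  and far_\<Gamma>: "closure \<Gamma> \<subseteq> {x. norm (x - x0) < \<Lambda> ^ k0}"
begin

lemma \<Lambda>_pow: "0 < \<Lambda> ^ k" "1 \<le> \<Lambda> ^ k" "j \<le> k ==> \<Lambda> ^ j \<le> \<Lambda> ^ k" "j < k ==> 4 * \<Lambda> ^ j \<le> \<Lambda> ^ k"
proof -
 show 0: "0 < \<Lambda> ^ k" for k using \<Lambda>_ge by simp
 show "1 \<le> \<Lambda> ^ k" using \<Lambda>_ge by (simp add: one_le_power)
 show le: "\<Lambda> ^ j \<le> \<Lambda> ^ k" if "j \<le> k" for j k using that \<Lambda>_ge by (simp add: power_increasing)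
 show "4 * \<Lambda> ^ j \<le> \<Lambda> ^ k" if "j < k"
 proof -
  have "4 * \<Lambda> ^ j \<le> \<Lambda> * \<Lambda> ^ j" using \<Lambda>_ge 0[of j] by (intro mult_right_mono) auto
  also have "\<dots> \<le> \<Lambda> ^ k" using le[of "Suc j" k] that by simp
  finally show ?thesis .
 qed
qed

definition z :: "nat => real^'n => real" where
 "z k x = \<zeta> (- ((1 / \<Lambda> ^ k) *\<^sub>R x0) + (1 / \<Lambda> ^ k) *\<^sub>R x)"

lemma z_smooth: "smooth_on UNIV (z k)"
 unfolding z_def[abs_def] by (rule smooth_on_affine[OF \<zeta>_smooth])

lemma z_range: "0 \<le> z k x" "z k x \<le> 1"
 unfolding z_def by (rule \<zeta>_range)+

lemma z_arg: "norm (- ((1 / \<Lambda> ^ k) *\<^sub>R x0) + (1 / \<Lambda> ^ k) *\<^sub>R x) = norm (x - x0) / \<Lambda> ^ k"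
proof -
 have "- ((1 / \<Lambda> ^ k) *\<^sub>R x0) + (1 / \<Lambda> ^ k) *\<^sub>R x = (1 / \<Lambda> ^ k) *\<^sub>R (x - x0)" by (simp add: scaleR_diff_right)
 then show ?thesis using \<Lambda>_pow(1)[of k] by (simp only: norm_scaleR) simp
qed

lemma z_1: "norm (x - x0) \<le> \<Lambda> ^ k ==> z k x = 1"
 unfolding z_def by (rule \<zeta>_1) (use z_arg[of k x] \<Lambda>_pow(1)[of k] in \<open>simp add: divide_le_eq\<close>)

lemma z_0: "2 * \<Lambda> ^ k \<le> norm (x - x0) ==> z k x = 0"
 unfolding z_def by (rule \<zeta>_0) (use z_arg[of k x] \<Lambda>_pow(1)[of k] in \<open>simp add: le_divide_eq\<close>)

lemma z_far: "2 * \<Lambda> ^ k + norm x0 \<le> norm x ==> z k x = 0"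
 by (rule z_0) (use norm_triangle_ineq2[of x x0] in linarith)

lemma z_grad: "norm (grad (z k) x) \<le> B / \<Lambda> ^ k"
proof -
 have "GDERIV (z k) x :> (1 / \<Lambda> ^ k) *\<^sub>R grad \<zeta> (- ((1 / \<Lambda> ^ k) *\<^sub>R x0) + (1 / \<Lambda> ^ k) *\<^sub>R x)"
  unfolding z_def[abs_def] by (rule GDERIV_affine[OF smooth_on_GDERIV[OF \<zeta>_smooth]])
 then have "grad (z k) x = (1 / \<Lambda> ^ k) *\<^sub>R grad \<zeta> (- ((1 / \<Lambda> ^ k) *\<^sub>R x0) + (1 / \<Lambda> ^ k) *\<^sub>R x)"
  by (rule GDERIV_grad)
 then show ?thesis
  using \<zeta>_grad[of "- ((1 / \<Lambda> ^ k) *\<^sub>R x0) + (1 / \<Lambda> ^ k) *\<^sub>R x"] \<Lambda>_pow(1)[of k]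
  by (simp add: divide_right_mono)
qed

lemma z_grad_0:
 assumes "norm (x - x0) < \<Lambda> ^ k \<or> 2 * \<Lambda> ^ k < norm (x - x0)"
 shows "grad (z k) x = 0"
 using assms
proof
 assume x: "norm (x - x0) < \<Lambda> ^ k"
 have "GDERIV (z k) x :> 0"
 proof (rule GDERIV_transform[where f="\<lambda>_. 1" and S="ball x0 (\<Lambda> ^ k)"])
  show "GDERIV (\<lambda>_. 1) x :> 0" by (rule GDERIV_const)
  show "1 = z k y" if "y \<in> ball x0 (\<Lambda> ^ k)" for y
   using z_1[of y k] that by (simp add: dist_norm norm_minus_commute)
 qed (use x in \<open>simp_all add: dist_norm norm_minus_commute\<close>)
 then show ?thesis by (rule GDERIV_grad)
next
 assume x: "2 * \<Lambda> ^ k < norm (x - x0)"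
 have "GDERIV (z k) x :> 0"
 proof (rule GDERIV_transform[where f="\<lambda>_. 0" and S="- cball x0 (2 * \<Lambda> ^ k)"])
  show "GDERIV (\<lambda>_. 0) x :> 0" by (rule GDERIV_const)
  show "0 = z k y" if "y \<in> - cball x0 (2 * \<Lambda> ^ k)" for y
   using z_0[of k y] that by (simp add: dist_norm norm_minus_commute)
 qed (use x in \<open>simp_all add: dist_norm norm_minus_commute open_Compl\<close>)
 then show ?thesis by (rule GDERIV_grad)
qed

lemma z_mult:
 assumes "j < k"
 shows "z k x *\<^sub>R grad (z j) x = grad (z j) x" "z j x *\<^sub>R grad (z k) x = 0"
proof -
 have jk: "4 * \<Lambda> ^ j \<le> \<Lambda> ^ k" "0 < \<Lambda> ^ j" using \<Lambda>_pow(1,4) assms by auto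
 show "z k x *\<^sub>R grad (z j) x = grad (z j) x"
  using z_1[of x k] z_grad_0[of x j] jk by (cases "norm (x - x0) \<le> \<Lambda> ^ k") auto
 show "z j x *\<^sub>R grad (z k) x = 0"
  using z_0[of j x] z_grad_0[of x k] jk by (cases "norm (x - x0) < \<Lambda> ^ k") auto
qed

lemma weak_equation:
 assumes v: "solves v Dv" and f: "admissible f Df"
  and s: "smooth_on UNIV \<eta>" and "\<And>x. r \<le> norm x ==> \<eta> x = 0"
 shows "(LINT x|lebesgue_on S. flux H (Dv x) \<bullet> (\<eta> x *\<^sub>R Df x + f x *\<^sub>R grad \<eta> x)) = 0"
 using v admissible_times_cutoff[OF f s, of r] assms(4) unfolding solves_def by blast

lemma flux_continuous: "continuous_on A f ==> continuous_on A (\<lambda>x. flux H (f x))"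
 unfolding flux_eq by (rule continuous_on_compose2[OF dpow_continuous[OF dim]]) auto

lemma flux_integrable:
 assumes v: "admissible v Dv" and h: "continuous_on S h" "Lp_on CARD('n) (S \<inter> ball 0 r) h"
  "\<And>x. x \<in> S ==> r \<le> norm x ==> h x = 0"
 shows "integrable (lebesgue_on S) (\<lambda>x. flux H (Dv x) \<bullet> h x)"
proof -
 let ?T = "S \<inter> ball 0 r"
 have c: "continuous_on S (\<lambda>x. flux H (Dv x) \<bullet> h x)"
  by (intro continuous_intros flux_continuous admissibleD(2)[OF v] h)
 have "integrable (lebesgue_on ?T) (\<lambda>x. flux H (Dv x) \<bullet> h x)"
 proof (rule Bochner_Integration.integrable_bound)
  show "integrable (lebesgue_on ?T) (\<lambda>x. D * (norm (Dv x) ^ CARD('n) + norm (h x) ^ CARD('n)))"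
   using admissibleD(5)[OF v, of r] h(2)
   by (intro Bochner_Integration.integrable_mult_right Bochner_Integration.integrable_add) (simp_all add: Lp_on_def)
  show "(\<lambda>x. flux H (Dv x) \<bullet> h x) \<in> borel_measurable (lebesgue_on ?T)"
   by (rule continuous_on_open_measurable[OF S_ball(1) continuous_on_subset[OF c]]) simp
  have bnd: "norm (flux H (Dv x) \<bullet> h x) \<le> D * (norm (Dv x) ^ CARD('n) + norm (h x) ^ CARD('n))" for x
  proof -
   have "norm (flux H (Dv x) \<bullet> h x) \<le> norm (flux H (Dv x)) * norm (h x)" by (simp add: Cauchy_Schwarz_ineq2)
   also have "\<dots> \<le> (D * norm (Dv x) ^ (CARD('n) - 1)) * norm (h x)" by (intro mult_right_mono flux_bound) simp
   also have "\<dots> \<le> D * (norm (Dv x) ^ CARD('n) + norm (h x) ^ CARD('n))"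
    using young_power[of "norm (Dv x)" "norm (h x)" 1 "CARD('n)"] card1 D_pos by (simp add: mult.assoc)
   finally show ?thesis .
  qed
  show "AE x in lebesgue_on ?T. norm (flux H (Dv x) \<bullet> h x) \<le> norm (D * (norm (Dv x) ^ CARD('n) + norm (h x) ^ CARD('n)))"
   by (intro AE_I2 order_trans[OF bnd]) (simp only: real_norm_def abs_ge_self)
 qed
 then show ?thesis
  by (subst integral_lebesgue_on_subset(2)[of ?T S]) (use h(3) S_ball(3) in auto)
qed

text \<open>The outward flux through a large sphere, averaged over a shell.\<close>
definition Flux :: "(real^'n => real^'n) => nat => real" where
 "Flux Dv k = - (LINT x|lebesgue_on S. flux H (Dv x) \<bullet> grad (z k) x)"

lemma Lp_smooth: "smooth_on UNIV f ==> Lp_on CARD('n) (S \<inter> ball 0 r) (grad f)"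
 by (rule smooth_Lp_on(2)[OF S_ball(1,2)])

lemma z_grad_far: "2 * \<Lambda> ^ k + norm x0 + 1 \<le> norm x ==> grad (z k) x = 0"
 by (rule z_grad_0) (use norm_triangle_ineq2[of x x0] in linarith)

lemma flux_z_integrable:
 assumes v: "admissible v Dv"
 shows "integrable (lebesgue_on S) (\<lambda>x. flux H (Dv x) \<bullet> grad (z k) x)"
 by (rule flux_integrable[OF v smooth_on_grad_continuous[OF z_smooth] Lp_smooth[OF z_smooth] z_grad_far])

text \<open>The difference of two cutoffs vanishes near \<open>\<Gamma>\<close>, so it is a test function.\<close>
lemma flux_const:
 assumes v: "solves v Dv" and k: "k0 \<le> k"
 shows "Flux Dv k = Flux Dv k0"
proof (cases "k = k0")
 case False
 with k have k: "k0 < k" by simp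
 have adv: "admissible v Dv" using v by (simp add: solves_def)
 have s: "smooth_on UNIV (\<lambda>x. 1 - z k0 x)" by (rule smooth_on_diff[OF smooth_on_const z_smooth])
 have "admissible (\<lambda>x. 1 - z k0 x) (grad (\<lambda>x. 1 - z k0 x))"
 proof (rule admissible_smooth[OF s _ far_\<Gamma>])
  show "open {x. norm (x - x0) < \<Lambda> ^ k0}" by (intro open_Collect_less continuous_intros)
  show "1 - z k0 x = 0" if "x \<in> {x. norm (x - x0) < \<Lambda> ^ k0}" for x using z_1[of x k0] that by simp
 qed
 moreover have "grad (\<lambda>x. 1 - z k0 x) = (\<lambda>x. - grad (z k0) x)"
  by (rule ext, rule GDERIV_grad) (use GDERIV_diff[OF GDERIV_const smooth_on_GDERIV[OF z_smooth]] in simp)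
 ultimately have "admissible (\<lambda>x. 1 - z k0 x) (\<lambda>x. - grad (z k0) x)" by simp
 from weak_equation[OF v this z_smooth, of "2 * \<Lambda> ^ k + norm x0" k]
 have "0 = (LINT x|lebesgue_on S. flux H (Dv x) \<bullet> (z k x *\<^sub>R (- grad (z k0) x) + (1 - z k0 x) *\<^sub>R grad (z k) x))"
  using z_far by simp
 also have "\<dots> = (LINT x|lebesgue_on S. flux H (Dv x) \<bullet> grad (z k) x - flux H (Dv x) \<bullet> grad (z k0) x)"
  by (rule Bochner_Integration.integral_cong[OF refl])
    (simp only: scaleR_minus_right z_mult[OF k] scaleR_diff_left scaleR_one, simp add: inner_diff_right)
 also have "\<dots> = Flux Dv k0 - Flux Dv k"
  by (simp add: Flux_def Bochner_Integration.integral_diff flux_z_integrable[OF adv])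
 finally show ?thesis by simp
qed simp

text \<open>Testing with \<open>z k * f\<close>. Subtracting a constant from \<open>f\<close> on the right changes only the flux term.\<close>
lemma energy_identity:
 assumes v: "solves v Dv" and f: "admissible f Df"
 shows "integrable (lebesgue_on S) (\<lambda>x. z k x * (flux H (Dv x) \<bullet> Df x))"
  "integrable (lebesgue_on S) (\<lambda>x. (f x - c) * (flux H (Dv x) \<bullet> grad (z k) x))"
  "(LINT x|lebesgue_on S. z k x * (flux H (Dv x) \<bullet> Df x))
   = - (LINT x|lebesgue_on S. (f x - c) * (flux H (Dv x) \<bullet> grad (z k) x)) + c * Flux Dv k"
proof -
 let ?r = "2 * \<Lambda> ^ k + norm x0 + 1"
 let ?v = "\<lambda>x. flux H (Dv x)"
 have adv: "admissible v Dv" using v by (simp add: solves_def)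
 have sub: "S \<inter> ball 0 ?r \<subseteq> S" by simp
 have far': "z k x = 0" if "?r \<le> norm x" for x by (rule z_far) (use that in linarith)
 note cont = admissibleD(2,3)[OF f] smooth_on_grad_continuous[OF z_smooth] smooth_on_continuous[OF z_smooth]
 have "integrable (lebesgue_on S) (\<lambda>x. ?v x \<bullet> (z k x *\<^sub>R Df x))"
 proof (rule flux_integrable[OF adv _ _, where r = ?r])
  show c: "continuous_on S (\<lambda>x. z k x *\<^sub>R Df x)" by (intro continuous_intros cont)
  show "Lp_on CARD('n) (S \<inter> ball 0 ?r) (\<lambda>x. z k x *\<^sub>R Df x)"
  proof (rule Lp_on_bound[OF admissibleD(5)[OF f, of ?r], of _ 1])
   show "(\<lambda>x. z k x *\<^sub>R Df x) \<in> borel_measurable (lebesgue_on (S \<inter> ball 0 ?r))"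
    by (rule continuous_on_open_measurable[OF S_ball(1) continuous_on_subset[OF c sub]])
   show "norm (z k x *\<^sub>R Df x) \<le> 1 * norm (Df x)" for x
    using mult_right_mono[OF z_range(2)[of k x] norm_ge_zero[of "Df x"]] z_range(1)[of k x] by simp
  qed
 qed (use far' in simp)
 then show i1: "integrable (lebesgue_on S) (\<lambda>x. z k x * (?v x \<bullet> Df x))" by simp
 have "integrable (lebesgue_on S) (\<lambda>x. ?v x \<bullet> (f x *\<^sub>R grad (z k) x))"
 proof (rule flux_integrable[OF adv _ _, where r = ?r])
  show c: "continuous_on S (\<lambda>x. f x *\<^sub>R grad (z k) x)" by (intro continuous_intros cont)
  show "Lp_on CARD('n) (S \<inter> ball 0 ?r) (\<lambda>x. f x *\<^sub>R grad (z k) x)"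
  proof (rule Lp_on_bound[OF admissibleD(4)[OF f, of ?r], of _ "B / \<Lambda> ^ k"])
   show "(\<lambda>x. f x *\<^sub>R grad (z k) x) \<in> borel_measurable (lebesgue_on (S \<inter> ball 0 ?r))"
    by (rule continuous_on_open_measurable[OF S_ball(1) continuous_on_subset[OF c sub]])
   show "norm (f x *\<^sub>R grad (z k) x) \<le> (B / \<Lambda> ^ k) * norm (f x)" for x
    using mult_left_mono[OF z_grad[of k x] norm_ge_zero[of "f x"]] by (simp add: mult.commute)
  qed
 qed (use z_grad_far in simp)
 then have i2: "integrable (lebesgue_on S) (\<lambda>x. f x * (?v x \<bullet> grad (z k) x))" by simp
 have i3: "integrable (lebesgue_on S) (\<lambda>x. c * (?v x \<bullet> grad (z k) x))"
  using flux_z_integrable[OF adv] by simp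
 show i4: "integrable (lebesgue_on S) (\<lambda>x. (f x - c) * (?v x \<bullet> grad (z k) x))"
  using Bochner_Integration.integrable_diff[OF i2 i3] by (simp add: left_diff_distrib)
 have "0 = (LINT x|lebesgue_on S. ?v x \<bullet> (z k x *\<^sub>R Df x + f x *\<^sub>R grad (z k) x))"
  using weak_equation[OF v f z_smooth, of ?r k] far' by simp
 also have "\<dots> = (LINT x|lebesgue_on S. z k x * (?v x \<bullet> Df x) + ((f x - c) * (?v x \<bullet> grad (z k) x) + c * (?v x \<bullet> grad (z k) x)))"
  by (rule Bochner_Integration.integral_cong[OF refl]) (simp add: inner_add_right algebra_simps)
 also have "\<dots> = (LINT x|lebesgue_on S. z k x * (?v x \<bullet> Df x))
   + ((LINT x|lebesgue_on S. (f x - c) * (?v x \<bullet> grad (z k) x)) + c * (LINT x|lebesgue_on S. ?v x \<bullet> grad (z k) x))"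
  using i1 i4 i3 by (subst Bochner_Integration.integral_add) (simp_all add: Bochner_Integration.integral_add)
 finally show "(LINT x|lebesgue_on S. z k x * (?v x \<bullet> Df x))
   = - (LINT x|lebesgue_on S. (f x - c) * (?v x \<bullet> grad (z k) x)) + c * Flux Dv k"
  by (simp add: Flux_def)
qed

lemma nn_integral_over_S:
 assumes A: "A \<in> sets borel" "A \<subseteq> S" and h: "continuous_on S h"
 shows "(\<integral>\<^sup>+x. ennreal (indicator A x * h x) \<partial>lborel) = (\<integral>\<^sup>+x. ennreal (indicator A x * h x) \<partial>lebesgue_on S)"
proof -
 have SB: "S \<in> sets borel" using S_open by simp
 have "(\<lambda>x. indicator A x * (indicator S x *\<^sub>R h x)) \<in> borel_measurable borel"
  by (rule borel_measurable_times[OF borel_measurable_indicator[OF A(1)] borel_measurable_continuous_on_indicator[OF SB h]])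
 moreover have "(\<lambda>x. indicator A x * (indicator S x *\<^sub>R h x)) = (\<lambda>x. indicator A x * h x)"
  using A(2) by (auto simp: fun_eq_iff indicator_def)
 ultimately have [measurable]: "(\<lambda>x. indicator A x * h x) \<in> borel_measurable borel" by simp
 have "(\<integral>\<^sup>+x. ennreal (indicator A x * h x) \<partial>lborel) = (\<integral>\<^sup>+x. ennreal (indicator A x * h x) \<partial>lebesgue)"
  by (rule nn_integral_completion[symmetric]) measurable
 also have "\<dots> = (\<integral>\<^sup>+x. ennreal (indicator A x * h x) * indicator S x \<partial>lebesgue)"
  using A(2) by (intro nn_integral_cong) (auto simp: indicator_def)
 also have "\<dots> = (\<integral>\<^sup>+x. ennreal (indicator A x * h x) \<partial>lebesgue_on S)"
  by (rule nn_integral_restrict_space[symmetric]) simp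
 finally show ?thesis .
qed

definition loc_int :: "(real^'n => real) => bool" where
 "loc_int h \<longleftrightarrow> (\<forall>r. integrable (lebesgue_on (S \<inter> ball 0 r)) h)"

lemma admissible_loc_int: "admissible f Df ==> loc_int (\<lambda>x. norm (Df x) ^ CARD('n))"
 using admissibleD(5)[of f Df] by (simp add: loc_int_def Lp_on_def)

lemma loc_int_restrict:
 assumes h: "loc_int h" and A: "A \<in> sets borel" "bounded A"
 shows "integrable (lebesgue_on S) (\<lambda>x. indicator A x * h x)"
proof -
 obtain r where r: "A \<subseteq> ball 0 r" using bounded_subset_ballD[OF A(2), of 0] by blast
 let ?T = "S \<inter> ball 0 r"
 have "A \<in> sets lebesgue" using A(1) by simp
 then have "A \<inter> ?T \<in> sets lebesgue" using S_ball(3) by (rule sets.Int)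
 then have AT: "A \<inter> ?T \<in> sets (lebesgue_on ?T)" using S_ball(3)[of r] by (subst sets_restrict_space_iff) auto
 have "integrable (lebesgue_on ?T) (\<lambda>x. h x * indicator (A \<inter> ?T) x)"
  by (rule integrable_real_mult_indicator[OF AT]) (use h in \<open>simp add: loc_int_def\<close>)
 then have "integrable (lebesgue_on ?T) (\<lambda>x. indicator A x * h x)"
  by (rule Bochner_Integration.integrable_cong[THEN iffD1, OF refl, rotated]) (auto simp: indicator_def)
 then show ?thesis
  by (subst integral_lebesgue_on_subset(2)[of ?T S]) (use r S_ball(3) in \<open>auto simp: indicator_def\<close>)
qed

definition shell :: "nat => (real^'n) set" where
 "shell k = ring (\<Lambda> ^ k / \<Lambda>) (\<Lambda> * \<Lambda> ^ k)"

lemma shell: "shell k \<in> sets borel" "bounded (shell k)" "open (shell k)"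
 and shell_S: "k0 < k ==> shell k \<subseteq> S"
proof -
 show "open (shell k)" unfolding shell_def by (rule ring_open)
 then show "shell k \<in> sets borel" by simp
 have "shell k \<subseteq> ball x0 (\<Lambda> * \<Lambda> ^ k)" by (auto simp: shell_def ring_def dist_norm norm_minus_commute)
 then show "bounded (shell k)" by (rule bounded_subset[OF bounded_ball])
 assume k: "k0 < k"
 show "shell k \<subseteq> S"
 proof
  fix x assume x: "x \<in> shell k"
  have "\<Lambda> ^ Suc k0 \<le> \<Lambda> ^ k" using \<Lambda>_pow(3)[of "Suc k0" k] k by simp
  then have "\<Lambda> ^ k0 \<le> \<Lambda> ^ k / \<Lambda>" using \<Lambda>_ge by (simp add: le_divide_eq mult.commute)
  then show "x \<in> S" using x far[of x] by (auto simp: shell_def ring_def)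
 qed
qed

lemma cring_shell: "cring (\<Lambda> ^ k) \<subseteq> shell k"
proof
 fix x assume x: "x \<in> cring (\<Lambda> ^ k)"
 have "\<Lambda> ^ k / \<Lambda> < \<Lambda> ^ k" "2 * \<Lambda> ^ k < \<Lambda> * \<Lambda> ^ k" using \<Lambda>_ge \<Lambda>_pow(1)[of k] by (auto simp: divide_less_eq)
 then show "x \<in> shell k" using x by (auto simp: shell_def ring_def cring_def)
qed

text \<open>Integration by parts against a scale-\<open>k\<close> cutoff is controlled by energies on the scale-\<open>k\<close>
 shell alone: subtracting a suitable value of \<open>f\<close> makes the Poincare inequality applicable, whose
 factor \<open>\<Lambda> ^ k\<close> cancels the size of the gradient of the cutoff.\<close>
lemma shell_estimate:
 assumes f: "admissible f Df" and k: "k0 < k" and \<epsilon>: "\<epsilon> > 0"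
  and b: "continuous_on S b" and g: "loc_int (\<lambda>x. g x ^ CARD('n))" and g0: "\<And>x. 0 \<le> g x"
  and bg: "\<And>x. norm (b x) \<le> D' * g x ^ (CARD('n) - 1)" and D': "D' \<ge> 0"
 shows "\<exists>y\<in>cring (\<Lambda> ^ k). \<bar>LINT x|lebesgue_on S. (f x - f y) * (b x \<bullet> grad (z k) x)\<bar>
  \<le> D' * (\<epsilon> * (LINT x|lebesgue_on S. indicator (shell k) x * g x ^ CARD('n))
    + (B ^ CARD('n) * P / \<epsilon> ^ (CARD('n) - 1)) * (LINT x|lebesgue_on S. indicator (shell k) x * norm (Df x) ^ CARD('n)))"
proof -
 let ?N = "CARD('n)" and ?\<rho> = "\<Lambda> ^ k"
 have kS: "shell k \<subseteq> S" by (rule shell_S[OF k])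
 have \<rho>: "0 < ?\<rho>" by (rule \<Lambda>_pow)
 define E where "E = (LINT x|lebesgue_on S. indicator (shell k) x * norm (Df x) ^ ?N)"
 have cN: "continuous_on S (\<lambda>x. norm (Df x) ^ ?N)" by (intro continuous_intros admissibleD(2)[OF f])
 have iE: "integrable (lebesgue_on S) (\<lambda>x. indicator (shell k) x * norm (Df x) ^ ?N)"
  by (rule loc_int_restrict[OF admissible_loc_int[OF f] shell(1,2)])
 have E0: "E \<ge> 0" unfolding E_def by (rule Bochner_Integration.integral_nonneg) simp
 have "(\<integral>\<^sup>+x. ennreal (indicator (shell k) x * norm (Df x) ^ ?N) \<partial>lborel) = ennreal E"
  unfolding nn_integral_over_S[OF shell(1) kS cN] E_def by (rule nn_integral_eq_integral[OF iE]) simp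
 then have "\<exists>c. (\<exists>y\<in>cring ?\<rho>. c = f y) \<and>
    (\<integral>\<^sup>+x. ennreal (indicator (cring ?\<rho>) x * \<bar>f x - c\<bar> ^ ?N) \<partial>lborel) \<le> ennreal (P * ?\<rho> ^ ?N * E)"
  unfolding shell_def
  by (intro poincare[OF \<rho> _ continuous_on_subset[OF admissibleD(2)[OF f] kS[unfolded shell_def]] E0])
    (use admissibleD(1)[OF f] kS[unfolded shell_def] in blast)
 then obtain y where y: "y \<in> cring ?\<rho>"
  and W: "(\<integral>\<^sup>+x. ennreal (indicator (cring ?\<rho>) x * \<bar>f x - f y\<bar> ^ ?N) \<partial>lborel) \<le> ennreal (P * ?\<rho> ^ ?N * E)"
  by blast
 have cS: "cring ?\<rho> \<subseteq> S" using cring_shell kS by blast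
 let ?w = "\<lambda>x. indicator (cring ?\<rho>) x * \<bar>f x - f y\<bar> ^ ?N"
 have cw: "continuous_on S (\<lambda>x. \<bar>f x - f y\<bar> ^ ?N)" by (intro continuous_intros admissibleD(3)[OF f])
 have W': "(\<integral>\<^sup>+x. ennreal (?w x) \<partial>lebesgue_on S) \<le> ennreal (P * ?\<rho> ^ ?N * E)"
  using W unfolding nn_integral_over_S[OF cring_borel cS cw] .
 have iw: "integrable (lebesgue_on S) ?w"
 proof (rule integrableI_nonneg)
  have "indicator (cring ?\<rho>) \<in> borel_measurable (lebesgue_on S)"
   using cring_borel cS by (intro borel_measurable_indicator) (simp add: sets_restrict_space_iff)
  then show "?w \<in> borel_measurable (lebesgue_on S)"
   by (rule borel_measurable_times[OF _ continuous_on_open_measurable[OF S_open cw]])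
  show "(\<integral>\<^sup>+x. ennreal (?w x) \<partial>lebesgue_on S) < \<infinity>" using W' by (rule le_less_trans) simp
 qed simp
 have Wle: "(LINT x|lebesgue_on S. ?w x) \<le> P * ?\<rho> ^ ?N * E"
  using W' nn_integral_eq_integral[OF iw] P_pos \<rho> E0 by (subst (asm) nn_integral_eq_integral[OF iw]) simp_all
 have ig: "integrable (lebesgue_on S) (\<lambda>x. indicator (shell k) x * g x ^ ?N)"
  by (rule loc_int_restrict[OF g shell(1,2)])
 define q where "q = (B / ?\<rho>) ^ ?N / \<epsilon> ^ (?N - 1)"
 have q: "q \<ge> 0" using B_pos \<rho> \<epsilon> by (simp add: q_def)
 have bd: "norm ((f x - f y) * (b x \<bullet> grad (z k) x)) \<le> D' * (\<epsilon> * (indicator (shell k) x * g x ^ ?N) + q * ?w x)"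
  if x: "x \<in> S" for x
 proof (cases "x \<in> cring ?\<rho>")
  case True
  have "norm ((f x - f y) * (b x \<bullet> grad (z k) x)) \<le> \<bar>f x - f y\<bar> * (norm (b x) * norm (grad (z k) x))"
   using Cauchy_Schwarz_ineq2[of "b x" "grad (z k) x"] by (simp add: abs_mult mult_left_mono)
  also have "\<dots> \<le> \<bar>f x - f y\<bar> * ((D' * g x ^ (?N - 1)) * (B / ?\<rho>))"
   using bg[of x] z_grad[of k x] D' g0[of x] by (intro mult_left_mono mult_mono) auto
  also have "\<dots> = D' * (g x ^ (?N - 1) * ((B / ?\<rho>) * \<bar>f x - f y\<bar>))" by simp
  also have "\<dots> \<le> D' * (\<epsilon> * g x ^ ?N + ((B / ?\<rho>) * \<bar>f x - f y\<bar>) ^ ?N / \<epsilon> ^ (?N - 1))"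
   using g0[of x] B_pos \<rho> \<epsilon> card1 by (intro mult_left_mono[OF young_power] D') auto
  also have "\<dots> = D' * (\<epsilon> * (indicator (shell k) x * g x ^ ?N) + q * ?w x)"
   using True subsetD[OF cring_shell True] by (simp add: q_def power_mult_distrib power_divide)
  finally show ?thesis .
 next
  case False
  have "x \<in> \<Sigma>" using x by (simp add: S_iff)
  then have "grad (z k) x = 0" using False by (intro z_grad_0) (auto simp: cring_def)
  then show ?thesis using D' \<epsilon> q g0[of x] by simp
 qed
 have "norm (LINT x|lebesgue_on S. (f x - f y) * (b x \<bullet> grad (z k) x))
   \<le> (LINT x|lebesgue_on S. D' * (\<epsilon> * (indicator (shell k) x * g x ^ ?N) + q * ?w x))"
 proof (rule Bochner_Integration.integral_norm_bound_integral)
  show i: "integrable (lebesgue_on S) (\<lambda>x. D' * (\<epsilon> * (indicator (shell k) x * g x ^ ?N) + q * ?w x))"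
   using ig iw by (intro Bochner_Integration.integrable_mult_right Bochner_Integration.integrable_add)
  show "integrable (lebesgue_on S) (\<lambda>x. (f x - f y) * (b x \<bullet> grad (z k) x))"
  proof (rule Bochner_Integration.integrable_bound[OF i])
   show "(\<lambda>x. (f x - f y) * (b x \<bullet> grad (z k) x)) \<in> borel_measurable (lebesgue_on S)"
    by (rule continuous_on_open_measurable[OF S_open])
      (intro continuous_intros b admissibleD(3)[OF f] smooth_on_grad_continuous[OF z_smooth])
   show "AE x in lebesgue_on S. norm ((f x - f y) * (b x \<bullet> grad (z k) x)) \<le> norm (D' * (\<epsilon> * (indicator (shell k) x * g x ^ ?N) + q * ?w x))"
    by (intro AE_I2 order_trans[OF bd]) (simp_all only: real_norm_def abs_ge_self space_lebesgue_on)
  qed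
 qed (use bd in simp)
 also have "\<dots> = D' * (\<epsilon> * (LINT x|lebesgue_on S. indicator (shell k) x * g x ^ ?N) + q * (LINT x|lebesgue_on S. ?w x))"
  using ig iw by (simp add: Bochner_Integration.integral_add)
 also have "\<dots> \<le> D' * (\<epsilon> * (LINT x|lebesgue_on S. indicator (shell k) x * g x ^ ?N) + q * (P * ?\<rho> ^ ?N * E))"
  by (intro mult_left_mono add_left_mono Wle q D')
 also have "q * (P * ?\<rho> ^ ?N * E) = (B ^ ?N * P / \<epsilon> ^ (?N - 1)) * E"
  using \<rho> \<Lambda>_ge by (auto simp: q_def power_divide)
 finally show ?thesis using y unfolding E_def by (intro bexI[of _ y]) simp_all
qed

end

section \<open>Growth and energy on shells\<close>

context elliptic_norm begin

text \<open>Strict monotonicity becomes quantitative by homogeneity: on the compact set of normalised pairs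
 at distance at least \<open>\<delta>\<close> the monotonicity bracket has a positive minimum.\<close>
lemma dpow_mono_quantitative:
 assumes p: "p \<ge> 2" and \<delta>: "\<delta> > 0"
 obtains c where "c \<ge> 0"
  "\<And>x y. norm (x - y) ^ p \<le> \<delta> * (norm x + norm y) ^ p + c * ((dpow p x - dpow p y) \<bullet> (x - y))"
proof -
 let ?q = "\<lambda>x y. (dpow p x - dpow p y) \<bullet> (x - y)"
 define A where "A = {z :: (real^'n) \<times> (real^'n). norm (fst z) + norm (snd z) = 1 \<and> \<delta> \<le> norm (fst z - snd z) ^ p}"
 have cl: "closed A" unfolding A_def
  by (intro closed_Collect_conj closed_Collect_eq closed_Collect_le continuous_intros)
 have sub: "A \<subseteq> cball 0 1 \<times> cball 0 1"
  by (auto simp: A_def) (smt (verit) norm_ge_zero)+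
 have "compact ((cball 0 1 \<times> cball 0 1) \<inter> A)"
  by (intro compact_Int_closed compact_Times compact_cball cl)
 then have "compact A" using sub by (simp only: Int_absorb1)
 have cq: "continuous_on A (\<lambda>z. ?q (fst z) (snd z))"
  by (intro continuous_intros continuous_on_compose2[OF dpow_continuous[OF p]]) auto
 have "\<exists>d>0. \<forall>z\<in>A. d \<le> ?q (fst z) (snd z)"
 proof (cases "A = {}")
  case False
  obtain z0 where z0: "z0 \<in> A" "\<forall>z\<in>A. ?q (fst z0) (snd z0) \<le> ?q (fst z) (snd z)"
   using continuous_attains_inf[OF \<open>compact A\<close> False cq] by blast
  have "fst z0 \<noteq> snd z0" using z0(1) \<delta> p by (auto simp: A_def power_0_left)
  then show ?thesis using dpow_strict_mono[OF p] z0(2) by blast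
 qed (auto intro: exI[of _ 1])
 then obtain d where d: "d > 0" "\<And>z. z \<in> A ==> d \<le> ?q (fst z) (snd z)" by blast
 show thesis
 proof (rule that[of "1 / d"])
  show "0 \<le> 1 / d" using d by simp
  fix x y :: "real^'n"
  define s where "s = norm x + norm y"
  have q0: "0 \<le> ?q x y" by (rule dpow_mono[OF p])
  show "norm (x - y) ^ p \<le> \<delta> * (norm x + norm y) ^ p + 1 / d * ?q x y"
  proof (cases "s = 0 \<or> norm (x - y) ^ p \<le> \<delta> * s ^ p")
   case True
   then show ?thesis
   proof
    assume "s = 0"
    then have "x = 0" "y = 0" unfolding s_def by (smt (verit) norm_ge_zero norm_eq_zero)+
    then show ?thesis using p by (simp add: power_0_left)
   next
    assume "norm (x - y) ^ p \<le> \<delta> * s ^ p"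
    moreover have "0 \<le> 1 / d * ?q x y" using q0 d(1) by simp
    ultimately show ?thesis unfolding s_def by linarith
   qed
  next
   case False
   have s: "s > 0" using False by (simp add: s_def less_le)
   define X Y where "X = (1 / s) *\<^sub>R x" and "Y = (1 / s) *\<^sub>R y"
   have x: "x = s *\<^sub>R X" and y: "y = s *\<^sub>R Y" using s by (simp_all add: X_def Y_def)
   have xy: "x - y = s *\<^sub>R (X - Y)" by (simp add: x y scaleR_diff_right)
   have n1: "norm X + norm Y = 1" using s by (simp add: X_def Y_def add_divide_distrib[symmetric]) (simp add: s_def)
   have nxy: "norm (x - y) ^ p = s ^ p * norm (X - Y) ^ p" using s by (simp add: xy power_mult_distrib)
   have "\<delta> * s ^ p \<le> norm (X - Y) ^ p * s ^ p" using False nxy by (simp add: mult.commute)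
   then have "\<delta> \<le> norm (X - Y) ^ p" by (rule mult_right_le_imp_le) (use s in simp)
   then have dq: "d \<le> ?q X Y" using d(2)[of "(X, Y)"] n1 by (simp add: A_def)
   have "norm (X - Y) \<le> 1" using norm_triangle_ineq4[of X Y] n1 by simp
   then have "norm (X - Y) ^ p \<le> 1" by (simp add: power_le_one)
   also have "1 \<le> 1 / d * ?q X Y" using dq d(1) by simp
   finally have "s ^ p * norm (X - Y) ^ p \<le> s ^ p * (1 / d * ?q X Y)" using s by (intro mult_left_mono) auto
   also have "\<dots> = 1 / d * ?q x y"
   proof -
    have "?q x y = (s ^ (p - 1) * s) * ?q X Y"
     unfolding xy using dpow_scale[OF p, of s] s by (simp add: x y scaleR_diff_right[symmetric])
    moreover have "s ^ (p - 1) * s = s ^ p" using p by (cases p) (auto simp: mult.commute)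
    ultimately show ?thesis by simp
   qed
   finally have "norm (x - y) ^ p \<le> 1 / d * ?q x y" unfolding nxy .
   moreover have "0 \<le> \<delta> * (norm x + norm y) ^ p" using \<delta> by simp
   ultimately show ?thesis by linarith
  qed
 qed
qed

end

text \<open>A nonnegative sequence that grows at most linearly has bounded increments infinitely often.\<close>
lemma linear_growth_bounded_increments:
 fixes e :: "nat => real"
 assumes "E > 0" and e: "\<And>n. n \<ge> n1 ==> e n \<le> E * real n" and e0: "\<And>n. 0 \<le> e n"
 shows "\<exists>j\<ge>j0. e (j + 2) - e j \<le> 3 * E"
proof (rule ccontr)
 assume "\<not> (\<exists>j\<ge>j0. e (j + 2) - e j \<le> 3 * E)"
 then have inc: "e j + 3 * E \<le> e (j + 2)" if "j \<ge> j0" for j using that by force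
 define J where "J = max j0 n1"
 have grow: "3 * E * real i \<le> e (J + 2 * i)" for i
 proof (induction i)
  case 0 then show ?case using e0[of J] by simp
 next
  case (Suc i)
  have "e (J + 2 * i) + 3 * E \<le> e (J + 2 * i + 2)" by (rule inc) (simp add: J_def)
  then show ?case using Suc by (simp add: algebra_simps)
 qed
 have "e (J + 2 * (J + 1)) \<le> E * real (J + 2 * (J + 1))" by (rule e) (simp add: J_def)
 then have "3 * E * real (J + 1) \<le> E * real (J + 2 * (J + 1))" by (rule order_trans[OF grow])
 then have "3 * real (J + 1) \<le> real (J + 2 * (J + 1))" using \<open>E > 0\<close> by (simp add: mult.assoc mult.left_commute[of 3])
 then show False by simp
qed

context exterior_scales begin

lemma log_growth_shells:
 assumes "log_growth H \<Sigma> v"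
 obtains A k1 where "A > 0"
  "\<And>k x. k1 \<le> k ==> x \<in> cring (\<Lambda> ^ k) ==> real k / A \<le> v x \<and> v x \<le> A * real k"
proof -
 obtain d R0 where d: "d > 1" and
  v: "\<And>x. x \<in> \<Sigma> ==> R0 \<le> H0 x ==> 1 / d \<le> v x / ln (H0 x) \<and> v x / ln (H0 x) \<le> d"
  using assms unfolding log_growth_def by blast
 obtain m M where m: "0 < m" "\<And>x. m * norm x \<le> H0 x" and M: "0 < M" "\<And>x. H0 x \<le> M * norm x"
  using H0_bounds_exist by blast
 define L where "L = ln \<Lambda>"
 have L: "L > 0" using \<Lambda>_ge by (simp add: L_def)
 define t0 where "t0 = 2 + 2 * norm x0 + 4 / m\<^sup>2 + 2 * M + 2 * \<bar>R0\<bar> / m"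
 obtain k2 where k2: "t0 < \<Lambda> ^ k2" using real_arch_pow[of \<Lambda> t0] \<Lambda>_ge by auto
 define A where "A = 2 * d / L + 4 * d * L"
 have "2 * d / L > 0" "4 * d * L > 0" using d L by auto
 then have A: "A > 0" "2 * d / L \<le> A" "4 * d * L \<le> A" unfolding A_def by linarith+
 show thesis
 proof (rule that[OF A(1), of "Suc k2"])
  fix k x assume k: "Suc k2 \<le> k" and x: "x \<in> cring (\<Lambda> ^ k)"
  define t where "t = norm (x - x0)"
  have tk: "\<Lambda> ^ k \<le> t" "t \<le> 2 * \<Lambda> ^ k" and xS: "x \<in> \<Sigma>" using x by (auto simp: cring_def t_def)
  have tt: "t0 < t" using k2 \<Lambda>_pow(3)[of k2 k] k tk by simp
  have pos: "0 \<le> 2 * norm x0" "0 \<le> 4 / m\<^sup>2" "0 \<le> 2 * M" "0 \<le> 2 * \<bar>R0\<bar> / m" using m M by auto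
  have t: "1 < t" "2 * norm x0 \<le> t" "4 / m\<^sup>2 \<le> t" "2 * M \<le> t" "2 * \<bar>R0\<bar> / m \<le> t"
   using tt pos unfolding t0_def by linarith+
  have nx: "t / 2 \<le> norm x" "norm x \<le> 2 * t"
   using t norm_triangle_ineq4[of x x0] norm_triangle_ineq2[of x x0] norm_triangle_ineq[of "x - x0" x0]
   unfolding t_def by auto
  have "m * (t / 2) \<le> H0 x" by (rule order_trans[OF mult_left_mono m(2)]) (use nx m in auto)
  moreover have "\<bar>R0\<bar> \<le> m * (t / 2)" using t(5) m(1) by (simp add: field_simps)
  ultimately have R: "R0 \<le> H0 x" and lo: "m * (t / 2) \<le> H0 x" by auto
  have up: "H0 x \<le> t\<^sup>2"
  proof -
   have "H0 x \<le> M * (2 * t)" by (rule order_trans[OF M(2) mult_left_mono]) (use nx M in auto)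
   also have "\<dots> = (2 * M) * t" by simp
   also have "\<dots> \<le> t * t" using t by (intro mult_right_mono) auto
   finally show ?thesis by (simp add: power2_eq_square)
  qed
  have lo': "t \<le> (H0 x)\<^sup>2"
  proof -
   have "t \<le> t * (m\<^sup>2 * t / 4)"
    using t(1,3) m(1) mult_left_mono[of 1 "m\<^sup>2 * t / 4" t] by (simp add: field_simps)
   also have "\<dots> = (m * (t / 2))\<^sup>2" by (simp add: power2_eq_square)
   also have "\<dots> \<le> (H0 x)\<^sup>2" using lo m t by (intro power_mono) auto
   finally show ?thesis .
  qed
  have Hp: "H0 x > 0" using lo m(1) t(1) mult_pos_pos[of m "t / 2"] by linarith
  have l1: "ln (H0 x) \<le> 2 * ln t"
   using ln_mono[of "H0 x" "t\<^sup>2"] up Hp t(1) by (simp add: ln_realpow)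
  have l2: "ln t \<le> 2 * ln (H0 x)"
   using ln_mono[of t "(H0 x)\<^sup>2"] lo' Hp t(1) by (simp add: ln_realpow)
  have lt0: "ln t > 0" using t(1) by simp
  have lH: "ln (H0 x) > 0" using l2 lt0 by linarith
  have vb: "ln (H0 x) / d \<le> v x" "v x \<le> d * ln (H0 x)"
   using v[OF xS R] lH d by (auto simp: field_simps)
  have lt1: "real k * L \<le> ln t"
   using ln_mono[of "\<Lambda> ^ k" t] tk \<Lambda>_pow(1)[of k] t(1) \<Lambda>_ge by (simp add: L_def ln_realpow)
  have lt2: "ln t \<le> 2 * (real k * L)"
  proof -
   have "2 * \<Lambda> ^ k \<le> \<Lambda> ^ (k + k)"
    using \<Lambda>_pow(3)[of 1 k] \<Lambda>_ge k \<Lambda>_pow(1)[of k] by (simp add: power_add mult_right_mono)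
   then have "ln t \<le> ln (\<Lambda> ^ (k + k))" using tk t(1) by (intro ln_mono) auto
   then show ?thesis using \<Lambda>_ge by (simp add: L_def ln_realpow distrib_right)
  qed
  have "real k / A \<le> real k / (2 * d / L)" using A d L by (intro divide_left_mono) auto
  also have "\<dots> = real k * L / 2 / d" using d L by (simp add: field_simps)
  also have "\<dots> \<le> ln (H0 x) / d" using lt1 l2 d by (intro divide_right_mono) auto
  also have "\<dots> \<le> v x" by (rule vb)
  finally have 1: "real k / A \<le> v x" .
  have "v x \<le> d * ln (H0 x)" by (rule vb)
  also have "\<dots> \<le> d * (2 * (2 * (real k * L)))" using l1 lt2 d by (intro mult_left_mono) auto
  also have "\<dots> = 4 * d * L * real k" by simp
  also have "\<dots> \<le> A * real k" using A by (intro mult_right_mono) auto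
  finally show "real k / A \<le> v x \<and> v x \<le> A * real k" using 1 by simp
 qed
qed

definition inner_int :: "(real^'n => real) => nat => real" where
 "inner_int h n = (LINT x|lebesgue_on S. indicator (ball x0 (\<Lambda> ^ n)) x * h x)"

definition shell_int :: "(real^'n => real) => nat => real" where
 "shell_int h k = (LINT x|lebesgue_on S. indicator (shell k) x * h x)"

lemma inner_integrable: "loc_int h ==> integrable (lebesgue_on S) (\<lambda>x. indicator (ball x0 (\<Lambda> ^ n)) x * h x)"
 by (rule loc_int_restrict) auto

lemma shell_integrable: "loc_int h ==> integrable (lebesgue_on S) (\<lambda>x. indicator (shell k) x * h x)"
 by (rule loc_int_restrict[OF _ shell(1,2)])

lemma loc_int_add: "loc_int h ==> loc_int h' ==> loc_int (\<lambda>x. a * h x + b * h' x)"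
 by (simp add: loc_int_def)

lemma inner_int_le:
 assumes "loc_int h" "loc_int h'" "\<And>x. x \<in> S ==> h x \<le> h' x"
 shows "inner_int h n \<le> inner_int h' n"
 unfolding inner_int_def
 by (rule Bochner_Integration.integral_mono[OF inner_integrable inner_integrable]) (use assms in \<open>auto intro: mult_left_mono\<close>)

lemma shell_int_le:
 assumes "loc_int h" "loc_int h'" "\<And>x. x \<in> S ==> h x \<le> h' x"
 shows "shell_int h n \<le> shell_int h' n"
 unfolding shell_int_def
 by (rule Bochner_Integration.integral_mono[OF shell_integrable shell_integrable]) (use assms in \<open>auto intro: mult_left_mono\<close>)

lemma inner_int_add:
 assumes "loc_int h" "loc_int h'"
 shows "inner_int (\<lambda>x. a * h x + b * h' x) n = a * inner_int h n + b * inner_int h' n"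
 unfolding inner_int_def using inner_integrable[OF assms(1), of n] inner_integrable[OF assms(2), of n]
 by (simp add: distrib_left mult.left_commute)

lemma shell_int_add:
 assumes "loc_int h" "loc_int h'"
 shows "shell_int (\<lambda>x. a * h x + b * h' x) n = a * shell_int h n + b * shell_int h' n"
 unfolding shell_int_def using shell_integrable[OF assms(1), of n] shell_integrable[OF assms(2), of n]
 by (simp add: distrib_left mult.left_commute)

lemma inner_int_nonneg: "(\<And>x. x \<in> S ==> 0 \<le> h x) ==> 0 \<le> inner_int h n"
 unfolding inner_int_def by (rule Bochner_Integration.integral_nonneg) simp

lemma inner_int_mono:
 assumes "loc_int h" "\<And>x. x \<in> S ==> 0 \<le> h x" "j \<le> k"
 shows "inner_int h j \<le> inner_int h k"
 unfolding inner_int_def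
proof (rule Bochner_Integration.integral_mono[OF inner_integrable inner_integrable])
 fix x assume "x \<in> space (lebesgue_on S)"
 then show "indicator (ball x0 (\<Lambda> ^ j)) x * h x \<le> indicator (ball x0 (\<Lambda> ^ k)) x * h x"
  using assms(2)[of x] \<Lambda>_pow(3)[OF assms(3)] by (intro mult_right_mono) (auto simp: indicator_def)
qed (use assms in auto)

lemma shell_int_le_increment:
 assumes h: "loc_int h" "\<And>x. x \<in> S ==> 0 \<le> h x"
 shows "shell_int h (Suc j) \<le> inner_int h (j + 2) - inner_int h j"
proof -
 have "shell_int h (Suc j) \<le> (LINT x|lebesgue_on S. indicator (ball x0 (\<Lambda> ^ (j + 2))) x * h x - indicator (ball x0 (\<Lambda> ^ j)) x * h x)"
  unfolding shell_int_def
 proof (rule Bochner_Integration.integral_mono[OF shell_integrable[OF h(1)] Bochner_Integration.integrable_diff[OF inner_integrable[OF h(1)] inner_integrable[OF h(1)]]])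
  fix x assume "x \<in> space (lebesgue_on S)"
  then have h0: "0 \<le> h x" using h(2) by simp
  have "\<Lambda> ^ j \<le> \<Lambda> ^ (j + 2)" by (rule \<Lambda>_pow) simp
  moreover have "shell (Suc j) = {x \<in> \<Sigma>. \<Lambda> ^ j < norm (x - x0) \<and> norm (x - x0) < \<Lambda> ^ (j + 2)}"
   using \<Lambda>_ge by (simp add: shell_def ring_def)
  ultimately have "indicator (shell (Suc j)) x \<le> indicator (ball x0 (\<Lambda> ^ (j + 2))) x - (indicator (ball x0 (\<Lambda> ^ j)) x :: real)"
   by (auto simp: indicator_def dist_norm norm_minus_commute)
  from mult_right_mono[OF this h0]
  show "indicator (shell (Suc j)) x * h x \<le> indicator (ball x0 (\<Lambda> ^ (j + 2))) x * h x - indicator (ball x0 (\<Lambda> ^ j)) x * h x"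
   by (simp add: left_diff_distrib)
 qed
 also have "\<dots> = inner_int h (j + 2) - inner_int h j"
  unfolding inner_int_def by (rule Bochner_Integration.integral_diff[OF inner_integrable[OF h(1)] inner_integrable[OF h(1)]])
 finally show ?thesis .
qed

lemma z_ge_indicator: "indicator (ball x0 (\<Lambda> ^ n)) x \<le> z n x"
 using z_range(1)[of n x] z_1[of x n] by (auto simp: indicator_def dist_norm norm_minus_commute)

lemma cring_integral:
 assumes \<rho>: "0 < \<rho>"
 shows "integrable (lebesgue_on S) (\<lambda>x. indicator (cring \<rho>) x :: real)"
  "(LINT x|lebesgue_on S. indicator (cring \<rho>) x) \<le> unit_ball_vol CARD('n) * (2 * \<rho>) ^ CARD('n)"
proof -
 have sub: "cring \<rho> \<subseteq> cball x0 (2 * \<rho>)" by (auto simp: cring_def dist_norm norm_minus_commute)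
 have "Lp_on 1 (S \<inter> ball 0 r) (\<lambda>x. 1::real)" for r
  by (rule Lp_on_bounded[OF S_ball_lmeasurable, of _ _ 1]) auto
 then have "loc_int (\<lambda>x. 1)" by (simp add: loc_int_def Lp_on_def)
 then have i: "integrable (lebesgue_on S) (\<lambda>x. indicator A x :: real)" if "A \<in> sets borel" "bounded A" for A
  using loc_int_restrict[of "\<lambda>x. 1" A] that by simp
 show i1: "integrable (lebesgue_on S) (\<lambda>x. indicator (cring \<rho>) x :: real)"
  by (rule i[OF cring_borel bounded_subset[OF bounded_cball sub]])
 let ?B = "cball x0 (2 * \<rho>)"
 have "(LINT x|lebesgue_on S. indicator (cring \<rho>) x) \<le> (LINT x|lebesgue_on S. indicator ?B x :: real)"
  by (rule Bochner_Integration.integral_mono[OF i1 i]) (use sub in \<open>auto simp: indicator_def\<close>)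
 also have "\<dots> = (LINT x|lebesgue_on S. indicator (?B \<inter> S) x :: real)"
  by (rule Bochner_Integration.integral_cong) (auto simp: indicator_def)
 also have "\<dots> = measure (lebesgue_on S) (?B \<inter> S)" by simp
 also have "\<dots> = measure lebesgue (?B \<inter> S)" by (rule measure_restrict_space) auto
 also have "\<dots> \<le> measure lebesgue ?B" by (rule measure_mono_fmeasurable) auto
 also have "\<dots> = unit_ball_vol CARD('n) * (2 * \<rho>) ^ CARD('n)"
  using content_cball[of "2 * \<rho>" x0] \<rho> by simp
 finally show "(LINT x|lebesgue_on S. indicator (cring \<rho>) x) \<le> unit_ball_vol CARD('n) * (2 * \<rho>) ^ CARD('n)" .
qed

end

lemma integral_zero_continuous:
 fixes h :: "'a::euclidean_space => real"
 assumes U: "open U" and h: "continuous_on U h" "\<And>x. x \<in> U ==> 0 \<le> h x"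
  and i: "integrable (lebesgue_on U) h" "(LINT x|lebesgue_on U. h x) \<le> 0" and x: "x \<in> U"
 shows "h x = 0"
proof (rule ccontr)
 assume "h x \<noteq> 0"
 then have hx: "0 < h x" using h(2)[OF x] by simp
 define V where "V = U \<inter> h -` {0<..}"
 have V: "open V" unfolding V_def by (rule continuous_open_preimage[OF h(1) U]) simp
 have ae0: "AE x in lebesgue_on U. 0 \<le> h x" by (rule AE_I2) (use h(2) in simp)
 have "(LINT x|lebesgue_on U. h x) = 0" using i(2) integral_nonneg_AE[OF ae0] by simp
 then have "AE x in lebesgue_on U. h x = 0" using integral_nonneg_eq_0_iff_AE[OF i(1) ae0] by simp
 then have "AE x in lebesgue. x \<in> U --> h x = 0" using U by (simp add: AE_restrict_space_iff)
 then have "AE x in lebesgue. x \<notin> V" by eventually_elim (auto simp: V_def)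
 then have "V \<in> null_sets lebesgue" using V by (subst AE_iff_null_sets) auto
 then have "negligible V" by (simp add: negligible_iff_null_sets)
 moreover have "x \<in> V" using x hx by (simp add: V_def)
 ultimately show False using open_not_negligible[OF V] by blast
qed

context exterior_scales begin

lemma weak_equation_integrable:
 assumes v: "admissible v Dv" and f: "admissible f Df"
  and s: "smooth_on UNIV \<eta>" and z: "\<And>x. r \<le> norm x ==> \<eta> x = 0"
 shows "integrable (lebesgue_on S) (\<lambda>x. flux H (Dv x) \<bullet> (\<eta> x *\<^sub>R Df x + f x *\<^sub>R grad \<eta> x))"
proof (rule flux_integrable[OF v _ _, where r = "r + 1"])
 show "continuous_on S (\<lambda>x. \<eta> x *\<^sub>R Df x + f x *\<^sub>R grad \<eta> x)"
  by (intro continuous_intros admissibleD(2,3)[OF f] smooth_on_continuous[OF s] smooth_on_grad_continuous[OF s])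
 have "test_pair (\<lambda>x. \<eta> x * f x) (\<lambda>x. \<eta> x *\<^sub>R Df x + f x *\<^sub>R grad \<eta> x)"
  by (rule admissible_times_cutoff[OF f s z])
 then have "Lp_on CARD('n) S (\<lambda>x. \<eta> x *\<^sub>R Df x + f x *\<^sub>R grad \<eta> x)" by (simp add: test_pair_def W1p_def)
 then show "Lp_on CARD('n) (S \<inter> ball 0 (r + 1)) (\<lambda>x. \<eta> x *\<^sub>R Df x + f x *\<^sub>R grad \<eta> x)"
  by (rule Lp_on_subset[OF _ _ S_ball(3) S_lebesgue]) simp
 fix x :: "real^'n" assume "r + 1 \<le> norm x"
 then show "\<eta> x *\<^sub>R Df x + f x *\<^sub>R grad \<eta> x = 0" using z[of x] grad_0_outside[OF s z, where x = x] by simp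
qed

text \<open>A Caccioppoli estimate with the logarithmic cutoff \<open>(1/n) * (z n + ... + z (2 n - 1))\<close>: its gradient is
 of size \<open>1 / (n * \<bar>x - x0\<bar>)\<close>, which makes up for the growth \<open>\<bar>v\<bar> \<le> const * n\<close>.\<close>
lemma energy_linear:
 assumes v: "solves v Dv" and A: "A > 0" "\<And>k x. k1 \<le> k ==> x \<in> cring (\<Lambda> ^ k) ==> \<bar>v x\<bar> \<le> A * real k"
 obtains E n1 where "E > 0" "\<And>n. n1 \<le> n ==> inner_int (\<lambda>x. norm (Dv x) ^ CARD('n)) n \<le> E * real n"
proof -
 let ?N = "CARD('n)"
 have adv: "admissible v Dv" using v by (simp add: solves_def)
 define e where "e = m / (2 * real ?N * D)"
 have e: "e > 0" using m_pos D_pos by (simp add: e_def)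
 define Kc where "Kc = real ?N * D / e ^ (?N - 1)"
 have Kc: "Kc > 0" using e D_pos by (simp add: Kc_def)
 define V where "V = unit_ball_vol (real ?N)"
 have V: "V > 0" by (simp add: V_def)
 define c where "c = 2 * A * B"
 have c: "c > 0" using A B_pos by (simp add: c_def)
 define E where "E = (2 / m) * (Kc * ((2 * c) ^ ?N * V))"
 have E: "E > 0" using m_pos Kc V c by (simp add: E_def)
 show thesis
 proof (rule that[OF E, of "max 1 (max k1 k0)"])
  fix n assume n': "max 1 (max k1 k0) \<le> n"
  then have n: "1 \<le> n" "k1 \<le> n" "k0 \<le> n" by auto
  define I where "I = {n..<2 * n}"
  have I: "finite I" "card I = n" by (auto simp: I_def)
  define \<eta> where "\<eta> x = (1 / real n) * (\<Sum>k\<in>I. z k x)" for x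
  have \<eta>s: "smooth_on UNIV \<eta>" unfolding \<eta>_def[abs_def] by (intro smooth_on_cmult smooth_on_sum z_smooth)
  have \<eta>0: "0 \<le> \<eta> x" for x using z_range(1) by (simp add: \<eta>_def sum_nonneg)
  have \<eta>one: "\<eta> x = 1" if "norm (x - x0) < \<Lambda> ^ n" for x
  proof -
   have "z k x = 1" if "k \<in> I" for k
    using \<Lambda>_pow(3)[of n k] that \<open>norm (x - x0) < \<Lambda> ^ n\<close> by (intro z_1) (auto simp: I_def)
   then show ?thesis using n I by (simp add: \<eta>_def)
  qed
  have \<eta>far: "\<eta> x = 0" if x: "2 * \<Lambda> ^ (2 * n) + norm x0 \<le> norm x" for x
  proof -
   have "z k x = 0" if "k \<in> I" for k
    using \<Lambda>_pow(3)[of k "2 * n"] that x by (intro z_far) (auto simp: I_def)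
   then show ?thesis by (simp add: \<eta>_def)
  qed
  have g\<eta>: "grad \<eta> x = (1 / real n) *\<^sub>R (\<Sum>k\<in>I. grad (z k) x)" for x
   unfolding \<eta>_def[abs_def] by (intro GDERIV_grad GDERIV_cmult GDERIV_sum smooth_on_GDERIV z_smooth)
  have g\<eta>_in: "grad \<eta> x = (1 / real n) *\<^sub>R grad (z k) x" if k: "k \<in> I" and x: "x \<in> cring (\<Lambda> ^ k)" for x k
  proof -
   have "grad (z j) x = 0" if "j \<in> I - {k}" for j
   proof (rule z_grad_0)
    have "j < k \<or> k < j" using that by auto
    then show "norm (x - x0) < \<Lambda> ^ j \<or> 2 * \<Lambda> ^ j < norm (x - x0)"
     using \<Lambda>_pow(4)[of j k] \<Lambda>_pow(4)[of k j] \<Lambda>_pow(1)[of j] \<Lambda>_pow(1)[of k] x by (auto simp: cring_def)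
   qed
   then have "(\<Sum>j\<in>I. grad (z j) x) = (\<Sum>j\<in>{k}. grad (z j) x)"
    by (intro sum.mono_neutral_right) (use k I in auto)
   then show ?thesis by (simp add: g\<eta>)
  qed
  have g\<eta>_out: "grad \<eta> x = 0" if x: "x \<in> \<Sigma>" "\<And>k. k \<in> I ==> x \<notin> cring (\<Lambda> ^ k)" for x
  proof -
   have "grad (z k) x = 0" if "k \<in> I" for k
    using x(1) x(2)[OF that] by (intro z_grad_0) (auto simp: cring_def)
   then show ?thesis by (simp add: g\<eta>)
  qed
  define Q where "Q x = (\<Sum>k\<in>I. (c / \<Lambda> ^ k) ^ ?N * indicator (cring (\<Lambda> ^ k)) x)" for x
  have qQ: "(\<bar>v x\<bar> * norm (grad \<eta> x)) ^ ?N \<le> Q x" if x: "x \<in> S" for x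
  proof (cases "\<exists>k\<in>I. x \<in> cring (\<Lambda> ^ k)")
   case True
   then obtain k where k: "k \<in> I" "x \<in> cring (\<Lambda> ^ k)" by blast
   have "\<bar>v x\<bar> \<le> A * real k" by (rule A(2)) (use k n in \<open>auto simp: I_def\<close>)
   also have "\<dots> \<le> A * (2 * real n)" using k(1) A(1) by (intro mult_left_mono) (auto simp: I_def)
   finally have vb: "\<bar>v x\<bar> \<le> A * (2 * real n)" .
   have "norm ((1 / real n) *\<^sub>R grad (z k) x) = (1 / real n) * norm (grad (z k) x)" by simp
   also have "\<dots> \<le> (1 / real n) * (B / \<Lambda> ^ k)" by (intro mult_left_mono z_grad) simp
   finally have "\<bar>v x\<bar> * norm (grad \<eta> x) \<le> (A * (2 * real n)) * ((1 / real n) * (B / \<Lambda> ^ k))"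
    unfolding g\<eta>_in[OF k] using A(1) by (intro mult_mono vb) simp_all
   also have "\<dots> = c / \<Lambda> ^ k" using n by (simp add: c_def)
   finally have "(\<bar>v x\<bar> * norm (grad \<eta> x)) ^ ?N \<le> (c / \<Lambda> ^ k) ^ ?N * indicator (cring (\<Lambda> ^ k)) x"
    using k(2) by (simp add: power_mono)
   also have "\<dots> \<le> Q x" unfolding Q_def
    by (rule member_le_sum[OF k(1) _ I(1)]) (use c \<Lambda>_pow(1) in \<open>simp add: less_imp_le\<close>)
   finally show ?thesis .
  next
   case False
   then have "grad \<eta> x = 0" using x by (intro g\<eta>_out) (auto simp: S_iff)
   moreover have "0 \<le> Q x" unfolding Q_def using c \<Lambda>_pow(1) by (intro sum_nonneg) (simp add: less_imp_le)
   ultimately show ?thesis by (simp add: power_0_left)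
  qed
  have s: "smooth_on UNIV (\<lambda>x. \<eta> x ^ ?N)" by (rule smooth_on_power[OF \<eta>s])
  have sz: "\<eta> x ^ ?N = 0" if "2 * \<Lambda> ^ (2 * n) + norm x0 \<le> norm x" for x
   using \<eta>far[OF that] by (simp add: power_0_left)
  have gs: "grad (\<lambda>x. \<eta> x ^ ?N) x = (real ?N * \<eta> x ^ (?N - 1)) *\<^sub>R grad \<eta> x" for x
   by (rule GDERIV_grad[OF GDERIV_power[OF smooth_on_GDERIV[OF \<eta>s]]])
  let ?f = "\<lambda>x. flux H (Dv x) \<bullet> (\<eta> x ^ ?N *\<^sub>R Dv x + v x *\<^sub>R grad (\<lambda>x. \<eta> x ^ ?N) x)"
  have f0: "(LINT x|lebesgue_on S. ?f x) = 0" by (rule weak_equation[OF v adv s sz])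
  have fi: "integrable (lebesgue_on S) ?f" by (rule weak_equation_integrable[OF adv adv s sz])
  let ?d = "\<lambda>x. indicator (ball x0 (\<Lambda> ^ n)) x * norm (Dv x) ^ ?N"
  have di: "integrable (lebesgue_on S) ?d" by (rule inner_integrable[OF admissible_loc_int[OF adv]])
  have Qi: "integrable (lebesgue_on S) Q"
   unfolding Q_def[abs_def] using cring_integral(1)[OF \<Lambda>_pow(1)]
   by (intro Bochner_Integration.integrable_sum Bochner_Integration.integrable_mult_right)
  have bound: "(m / 2) * ?d x - Kc * Q x \<le> ?f x" if x: "x \<in> S" for x
  proof -
   let ?a = "flux H (Dv x)" and ?X = "\<eta> x * norm (Dv x)" and ?Y = "\<bar>v x\<bar> * norm (grad \<eta> x)"
   have 1: "m * ?X ^ ?N \<le> ?a \<bullet> (\<eta> x ^ ?N *\<^sub>R Dv x)"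
    using mult_left_mono[OF flux_coercive[of "Dv x"] zero_le_power[OF \<eta>0[of x], of ?N]]
    by (simp add: power_mult_distrib inner_commute mult_ac)
   have "\<bar>?a \<bullet> grad \<eta> x\<bar> \<le> norm ?a * norm (grad \<eta> x)" by (rule Cauchy_Schwarz_ineq2)
   also have "\<dots> \<le> (D * norm (Dv x) ^ (?N - 1)) * norm (grad \<eta> x)" by (intro mult_right_mono flux_bound) simp
   finally have "(real ?N * \<eta> x ^ (?N - 1) * \<bar>v x\<bar>) * \<bar>?a \<bullet> grad \<eta> x\<bar>
     \<le> (real ?N * \<eta> x ^ (?N - 1) * \<bar>v x\<bar>) * ((D * norm (Dv x) ^ (?N - 1)) * norm (grad \<eta> x))"
    using \<eta>0[of x] by (intro mult_left_mono) auto
   also have "\<dots> = real ?N * D * (?X ^ (?N - 1) * ?Y)" by (simp add: power_mult_distrib)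
   also have "\<dots> \<le> real ?N * D * (e * ?X ^ ?N + ?Y ^ ?N / e ^ (?N - 1))"
    using \<eta>0[of x] e card1 D_pos by (intro mult_left_mono young_power) auto
   also have "\<dots> = (m / 2) * ?X ^ ?N + Kc * ?Y ^ ?N"
    using D_pos by (simp add: e_def Kc_def distrib_left)
   also have "\<dots> \<le> (m / 2) * ?X ^ ?N + Kc * Q x" using qQ[OF x] Kc by simp
   finally have "(real ?N * \<eta> x ^ (?N - 1) * \<bar>v x\<bar>) * \<bar>?a \<bullet> grad \<eta> x\<bar> \<le> (m / 2) * ?X ^ ?N + Kc * Q x" .
   moreover have "\<bar>?a \<bullet> (v x *\<^sub>R grad (\<lambda>x. \<eta> x ^ ?N) x)\<bar> = (real ?N * \<eta> x ^ (?N - 1) * \<bar>v x\<bar>) * \<bar>?a \<bullet> grad \<eta> x\<bar>"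
    using \<eta>0[of x] by (simp add: gs abs_mult)
   ultimately have "(m / 2) * ?X ^ ?N - Kc * Q x \<le> ?f x" using 1 unfolding inner_add_right by linarith
   moreover have "?d x \<le> ?X ^ ?N" using \<eta>one[of x] \<eta>0[of x] by (auto simp: indicator_def dist_norm norm_minus_commute)
   then have "(m / 2) * ?d x \<le> (m / 2) * ?X ^ ?N" using m_pos by (intro mult_left_mono) auto
   ultimately show ?thesis by linarith
  qed
  have "(LINT x|lebesgue_on S. (m / 2) * ?d x - Kc * Q x) \<le> (LINT x|lebesgue_on S. ?f x)"
   by (rule Bochner_Integration.integral_mono[OF Bochner_Integration.integrable_diff[OF Bochner_Integration.integrable_mult_right[OF di] Bochner_Integration.integrable_mult_right[OF Qi]] fi])
     (use bound in simp)
  also have "(LINT x|lebesgue_on S. (m / 2) * ?d x - Kc * Q x) = (m / 2) * inner_int (\<lambda>x. norm (Dv x) ^ ?N) n - Kc * (LINT x|lebesgue_on S. Q x)"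
   using di Qi by (simp add: inner_int_def)
  finally have 1: "(m / 2) * inner_int (\<lambda>x. norm (Dv x) ^ ?N) n \<le> Kc * (LINT x|lebesgue_on S. Q x)" using f0 by simp
  have "(LINT x|lebesgue_on S. Q x) = (\<Sum>k\<in>I. (c / \<Lambda> ^ k) ^ ?N * (LINT x|lebesgue_on S. indicator (cring (\<Lambda> ^ k)) x))"
   unfolding Q_def using cring_integral(1)[OF \<Lambda>_pow(1)]
   by (subst Bochner_Integration.integral_sum) auto
  also have "\<dots> \<le> (\<Sum>k\<in>I. (2 * c) ^ ?N * V)"
  proof (rule sum_mono)
   fix k
   have "(c / \<Lambda> ^ k) ^ ?N * (LINT x|lebesgue_on S. indicator (cring (\<Lambda> ^ k)) x) \<le> (c / \<Lambda> ^ k) ^ ?N * (V * (2 * \<Lambda> ^ k) ^ ?N)"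
    unfolding V_def using cring_integral(2)[OF \<Lambda>_pow(1)] c \<Lambda>_pow(1)[of k] by (intro mult_left_mono) (auto simp: less_imp_le)
   also have "\<dots> = (c / \<Lambda> ^ k * (2 * \<Lambda> ^ k)) ^ ?N * V" 
    by (simp only: power_mult_distrib[of "c / \<Lambda> ^ k" "2 * \<Lambda> ^ k"]) (simp only: mult_ac)
   also have "c / \<Lambda> ^ k * (2 * \<Lambda> ^ k) = 2 * c" using \<Lambda>_ge by simp
   finally show "(c / \<Lambda> ^ k) ^ ?N * (LINT x|lebesgue_on S. indicator (cring (\<Lambda> ^ k)) x) \<le> (2 * c) ^ ?N * V" .
  qed
  also have "\<dots> = real n * ((2 * c) ^ ?N * V)" using I by simp
  finally have "(m / 2) * inner_int (\<lambda>x. norm (Dv x) ^ ?N) n \<le> Kc * (real n * ((2 * c) ^ ?N * V))"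
   using 1 Kc by (meson mult_left_mono less_imp_le order_trans)
  from mult_left_mono[OF this, of "2 / m"] show "inner_int (\<lambda>x. norm (Dv x) ^ ?N) n \<le> E * real n"
   using m_pos by (simp add: E_def mult_ac)
 qed
qed

end

section \<open>Comparison of two solutions\<close>

context exterior_scales begin

text \<open>The comparison argument. With \<open>b\<close> the difference of the two fluxes and \<open>f = v - \<mu> y\<close>, equality of
 the total fluxes allows a constant to be subtracted from \<open>f\<close> in
 \<open>I k = \<integral> z k * (b \<bullet> Df) = - \<integral> (f - c) * (b \<bullet> grad (z k))\<close>, so \<open>I k\<close> is controlled by the energy on
 the scale-\<open>k\<close> shell. On infinitely many shells this energy is bounded; hence \<open>\<integral> b \<bullet> Df\<close> converges, its
 shell contributions tend to \<open>0\<close>, and quantitative monotonicity improves the bound on \<open>I k\<close> to \<open>0\<close>.\<close>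
lemma solutions_proportional:
 assumes v: "solves v Dv" and y: "solves y Dy" and \<mu>: "\<mu> \<ge> 0"
  and fl: "Flux Dv k0 = \<mu> ^ (CARD('n) - 1) * Flux Dy k0"
  and Ev: "E1 > 0" "\<And>n. n1 \<le> n ==> inner_int (\<lambda>x. norm (Dv x) ^ CARD('n)) n \<le> E1 * real n"
  and Ey: "E2 > 0" "\<And>n. n2 \<le> n ==> inner_int (\<lambda>x. norm (Dy x) ^ CARD('n)) n \<le> E2 * real n"
  and x: "x \<in> S"
 shows "Dv x = \<mu> *\<^sub>R Dy x"
proof -
 let ?N = "CARD('n)"
 have adv: "admissible v Dv" and ady: "admissible y Dy" using v y by (simp_all add: solves_def)
 define f where "f x = v x - \<mu> * y x" for x
 define Df where "Df x = Dv x - \<mu> *\<^sub>R Dy x" for x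
 define b where "b x = flux H (Dv x) - flux H (\<mu> *\<^sub>R Dy x)" for x
 define g where "g x = norm (Dv x) + \<mu> * norm (Dy x)" for x
 define p where "p x = b x \<bullet> Df x" for x
 have adf: "admissible f Df" unfolding f_def[abs_def] Df_def[abs_def] by (rule admissible_diff[OF adv ady])
 have fluxl: "flux H (\<mu> *\<^sub>R Dy x) = \<mu> ^ (?N - 1) *\<^sub>R flux H (Dy x)" for x
  unfolding flux_eq by (rule dpow_scale[OF dim \<mu>])
 have cDv: "continuous_on S Dv" and cDy: "continuous_on S Dy" and cDf: "continuous_on S Df"
  using admissibleD(2) adv ady adf by auto
 have cb: "continuous_on S b" unfolding b_def[abs_def] by (intro continuous_intros flux_continuous cDv cDy)
 have cp: "continuous_on S p" unfolding p_def[abs_def] by (intro continuous_intros cb cDf)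
 have p0: "0 \<le> p x" for x unfolding p_def b_def Df_def flux_eq by (rule dpow_mono[OF dim])
 have g0: "0 \<le> g x" for x using \<mu> by (simp add: g_def)
 have bg: "norm (b x) \<le> (2 * D) * g x ^ (?N - 1)" for x
 proof -
  have "norm (b x) \<le> norm (flux H (Dv x)) + norm (flux H (\<mu> *\<^sub>R Dy x))" unfolding b_def by (rule norm_triangle_ineq4)
  also have "\<dots> \<le> D * norm (Dv x) ^ (?N - 1) + D * norm (\<mu> *\<^sub>R Dy x) ^ (?N - 1)" by (intro add_mono flux_bound)
  also have "\<dots> \<le> D * g x ^ (?N - 1) + D * g x ^ (?N - 1)"
   using D_pos \<mu> by (intro add_mono mult_left_mono power_mono) (auto simp: g_def)
  finally show ?thesis by simp
 qed
 have Dfg: "norm (Df x) \<le> g x" for x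
  using norm_triangle_ineq4[of "Dv x" "\<mu> *\<^sub>R Dy x"] \<mu> by (simp add: Df_def g_def)
 define hv where "hv x = norm (Dv x) ^ ?N" for x
 define hy where "hy x = norm (Dy x) ^ ?N" for x
 define hf where "hf x = norm (Df x) ^ ?N" for x
 define hg where "hg x = g x ^ ?N" for x
 have li: "loc_int hv" "loc_int hy" "loc_int hf"
  unfolding hv_def[abs_def] hy_def[abs_def] hf_def[abs_def] by (rule admissible_loc_int adv ady adf)+
 have cg: "continuous_on S g" unfolding g_def[abs_def] by (intro continuous_intros cDv cDy)
 have hg_le: "hg x \<le> 2 ^ ?N * hv x + (2 ^ ?N * \<mu> ^ ?N) * hy x" for x
  using norm_add_power_le[of "norm (Dv x)" "\<mu> * norm (Dy x)" ?N] g0[of x] \<mu>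
  by (simp add: hg_def hv_def hy_def g_def power_mult_distrib distrib_left)
 have li_bound: "loc_int h" if "continuous_on S h" "loc_int h'" "\<And>x. \<bar>h x\<bar> \<le> h' x" for h h' :: "real^'n => real"
  unfolding loc_int_def
 proof
  fix r
  show "integrable (lebesgue_on (S \<inter> ball 0 r)) h"
  proof (rule Bochner_Integration.integrable_bound)
   show "integrable (lebesgue_on (S \<inter> ball 0 r)) h'" using that(2) by (simp add: loc_int_def)
   show "h \<in> borel_measurable (lebesgue_on (S \<inter> ball 0 r))"
    by (rule continuous_on_open_measurable[OF S_ball(1) continuous_on_subset[OF that(1)]]) simp
   show "AE x in lebesgue_on (S \<inter> ball 0 r). norm (h x) \<le> norm (h' x)"
    by (rule AE_I2) (use that(3) in \<open>auto intro: order_trans[OF _ abs_ge_self]\<close>)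
  qed
 qed
 have lg: "loc_int hg"
 proof (rule li_bound)
  show "continuous_on S hg" unfolding hg_def[abs_def] by (intro continuous_intros cg)
  show "loc_int (\<lambda>x. 2 ^ ?N * hv x + (2 ^ ?N * \<mu> ^ ?N) * hy x)" by (rule loc_int_add[OF li(1,2)])
  show "\<bar>hg x\<bar> \<le> 2 ^ ?N * hv x + (2 ^ ?N * \<mu> ^ ?N) * hy x" for x using hg_le[of x] g0[of x] by (simp add: hg_def)
 qed
 have lp: "loc_int p"
 proof (rule li_bound[OF cp])
  show "loc_int (\<lambda>x. (2 * D) * hg x + 0 * hg x)" by (rule loc_int_add[OF lg lg])
  fix x
  have "\<bar>p x\<bar> \<le> norm (b x) * norm (Df x)" unfolding p_def by (rule Cauchy_Schwarz_ineq2)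
  also have "\<dots> \<le> ((2 * D) * g x ^ (?N - 1)) * g x" using D_pos g0[of x] by (intro mult_mono bg Dfg) auto
  also have "\<dots> = (2 * D) * hg x" unfolding hg_def using card1 by (simp add: power_eq_if mult_ac)
  finally show "\<bar>p x\<bar> \<le> (2 * D) * hg x + 0 * hg x" by simp
 qed
 \<comment> \<open>Bounded energy on infinitely many shells.\<close>
 define E where "E = 2 ^ ?N * E1 + (2 ^ ?N * \<mu> ^ ?N) * E2"
 have E: "E > 0" using Ev(1) Ey(1) \<mu> by (simp add: E_def add_pos_nonneg)
 have inner_hg: "inner_int hg n \<le> E * real n" if "max n1 n2 \<le> n" for n
 proof -
  have "inner_int hg n \<le> 2 ^ ?N * inner_int hv n + (2 ^ ?N * \<mu> ^ ?N) * inner_int hy n"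
   unfolding inner_int_add[OF li(1,2), symmetric] by (rule inner_int_le[OF lg loc_int_add[OF li(1,2)] hg_le])
  also have "\<dots> \<le> 2 ^ ?N * (E1 * real n) + (2 ^ ?N * \<mu> ^ ?N) * (E2 * real n)"
   using Ev(2)[of n] Ey(2)[of n] that \<mu> unfolding hv_def[abs_def] hy_def[abs_def]
   by (intro add_mono mult_left_mono) auto
  finally show ?thesis by (simp add: E_def algebra_simps)
 qed
 define G where "G = 3 * E"
 have G: "G > 0" using E by (simp add: G_def)
 have hg0: "0 \<le> hg x" for x using g0[of x] by (simp add: hg_def)
 have good: "\<exists>j\<ge>j0. shell_int hg (Suc j) \<le> G" for j0
 proof -
  have "\<exists>j\<ge>j0. inner_int hg (j + 2) - inner_int hg j \<le> 3 * E"
   by (rule linear_growth_bounded_increments[OF E inner_hg inner_int_nonneg[OF hg0]])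
  then obtain j where "j \<ge> j0" "inner_int hg (j + 2) - inner_int hg j \<le> G" unfolding G_def by blast
  then have "shell_int hg (Suc j) \<le> G" using shell_int_le_increment[OF lg hg0, of j] by linarith
  with \<open>j \<ge> j0\<close> show ?thesis by blast
 qed
 \<comment> \<open>Control of the monotonicity integral by a single shell.\<close>
 have key: "inner_int p n \<le> (2 * D) * (\<epsilon> * shell_int hg k + (B ^ ?N * P / \<epsilon> ^ (?N - 1)) * shell_int hf k)"
  if k: "k0 < k" "n \<le> k" and \<epsilon>: "\<epsilon> > 0" for n k \<epsilon>
 proof -
  let ?J = "\<lambda>Dw c. (LINT x|lebesgue_on S. (f x - c) * (flux H (Dw x) \<bullet> grad (z k) x))"
  have "\<exists>y\<in>cring (\<Lambda> ^ k). \<bar>LINT x|lebesgue_on S. (f x - f y) * (b x \<bullet> grad (z k) x)\<bar>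
    \<le> (2 * D) * (\<epsilon> * shell_int hg k + (B ^ ?N * P / \<epsilon> ^ (?N - 1)) * shell_int hf k)"
   unfolding shell_int_def hg_def hf_def
   by (rule shell_estimate[OF adf k(1) \<epsilon> cb lg[unfolded hg_def[abs_def]] g0 bg]) (use D_pos in simp)
  then obtain c where c: "\<bar>LINT x|lebesgue_on S. (f x - c) * (b x \<bullet> grad (z k) x)\<bar>
    \<le> (2 * D) * (\<epsilon> * shell_int hg k + (B ^ ?N * P / \<epsilon> ^ (?N - 1)) * shell_int hf k)" by blast
  note iv = energy_identity(1)[OF v adf, where k=k] energy_identity(2,3)[OF v adf, where k=k and c=c]
   and iy = energy_identity(1)[OF y adf, where k=k] energy_identity(2,3)[OF y adf, where k=k and c=c]
  have bz: "b x \<bullet> q = flux H (Dv x) \<bullet> q - \<mu> ^ (?N - 1) * (flux H (Dy x) \<bullet> q)" for x q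
   by (simp add: b_def fluxl inner_diff_left)
  have zp: "z k x * p x = z k x * (flux H (Dv x) \<bullet> Df x) - \<mu> ^ (?N - 1) * (z k x * (flux H (Dy x) \<bullet> Df x))" for x
   unfolding p_def bz by (simp add: algebra_simps)
  have izp: "integrable (lebesgue_on S) (\<lambda>x. z k x * p x)"
   unfolding zp by (intro Bochner_Integration.integrable_diff iv(1) Bochner_Integration.integrable_mult_right iy(1))
  have fb: "(f x - c) * (b x \<bullet> grad (z k) x) = (f x - c) * (flux H (Dv x) \<bullet> grad (z k) x) - \<mu> ^ (?N - 1) * ((f x - c) * (flux H (Dy x) \<bullet> grad (z k) x))" for x
   unfolding bz by (simp add: algebra_simps)
  have "(LINT x|lebesgue_on S. z k x * p x) = (LINT x|lebesgue_on S. z k x * (flux H (Dv x) \<bullet> Df x))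
    - \<mu> ^ (?N - 1) * (LINT x|lebesgue_on S. z k x * (flux H (Dy x) \<bullet> Df x))"
   unfolding zp using iv(1) iy(1) by simp
  also have "\<dots> = - (?J Dv c - \<mu> ^ (?N - 1) * ?J Dy c) + c * (Flux Dv k - \<mu> ^ (?N - 1) * Flux Dy k)"
   unfolding iv(3) iy(3) by (simp add: algebra_simps)
  also have "Flux Dv k - \<mu> ^ (?N - 1) * Flux Dy k = 0"
   using flux_const[OF v, of k] flux_const[OF y, of k] k(1) fl by simp
  also have "?J Dv c - \<mu> ^ (?N - 1) * ?J Dy c = (LINT x|lebesgue_on S. (f x - c) * (b x \<bullet> grad (z k) x))"
   unfolding fb using iv(2) iy(2) by simp
  finally have "(LINT x|lebesgue_on S. z k x * p x) \<le> \<bar>LINT x|lebesgue_on S. (f x - c) * (b x \<bullet> grad (z k) x)\<bar>" by simp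
  moreover have "inner_int p n \<le> (LINT x|lebesgue_on S. z k x * p x)"
  proof -
   have "inner_int p n \<le> inner_int p k" by (rule inner_int_mono[OF lp p0 k(2)])
   also have "\<dots> \<le> (LINT x|lebesgue_on S. z k x * p x)"
    unfolding inner_int_def
    by (rule Bochner_Integration.integral_mono[OF inner_integrable[OF lp] izp]) (intro mult_right_mono z_ge_indicator p0)
   finally show ?thesis .
  qed
  ultimately show ?thesis using c by linarith
 qed
 have hf_hg: "shell_int hf k \<le> shell_int hg k" for k
  by (rule shell_int_le[OF li(3) lg]) (use Dfg in \<open>simp add: hf_def hg_def power_mono\<close>)
 define M where "M = (2 * D) * (1 * G + (B ^ ?N * P / 1 ^ (?N - 1)) * G)"
 have bounded: "inner_int p n \<le> M" for n
 proof -
  obtain j where j: "j \<ge> n + k0" "shell_int hg (Suc j) \<le> G" using good by blast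
  have "inner_int p n \<le> (2 * D) * (1 * shell_int hg (Suc j) + (B ^ ?N * P / 1 ^ (?N - 1)) * shell_int hf (Suc j))"
   by (rule key) (use j in auto)
  also have "\<dots> \<le> M"
   unfolding M_def using j(2) hf_hg[of "Suc j"] D_pos B_pos P_pos by (intro mult_left_mono add_mono) auto
  finally show ?thesis .
 qed
 have "mono (inner_int p)" by (intro monoI inner_int_mono lp p0)
 then have "convergent (inner_int p)"
  by (intro Bseq_mono_convergent BseqI'[of _ M]) (use bounded inner_int_nonneg[OF p0] in \<open>auto simp: mono_def\<close>)
 then obtain l where l: "inner_int p \<longlonglongrightarrow> l" by (auto simp: convergent_def)
 have "(\<lambda>j. inner_int p (j + 2) - inner_int p j) \<longlonglongrightarrow> l - l"
  by (intro tendsto_diff l LIMSEQ_ignore_initial_segment)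
 then have shell_lim: "(\<lambda>j. inner_int p (j + 2) - inner_int p j) \<longlonglongrightarrow> 0" by simp
 have zero: "inner_int p n \<le> 0" for n
 proof (rule field_le_epsilon)
  fix \<tau> :: real assume \<tau>: "\<tau> > 0"
  define \<epsilon> where "\<epsilon> = \<tau> / (4 * D * G)"
  have \<epsilon>: "\<epsilon> > 0" using \<tau> D_pos G by (simp add: \<epsilon>_def)
  define Q where "Q = (2 * D) * (B ^ ?N * P / \<epsilon> ^ (?N - 1))"
  have Q: "Q > 0" using D_pos B_pos P_pos \<epsilon> by (simp add: Q_def)
  define \<delta> where "\<delta> = \<tau> / (4 * Q * G)"
  have \<delta>: "\<delta> > 0" using \<tau> Q G by (simp add: \<delta>_def)
  obtain c where c: "c \<ge> 0" "\<And>x y. norm (x - y) ^ ?N \<le> \<delta> * (norm x + norm y) ^ ?N + c * ((dpow ?N x - dpow ?N y) \<bullet> (x - y))"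
   using dpow_mono_quantitative[OF dim \<delta>] by blast
  have hf_le: "hf x \<le> \<delta> * hg x + c * p x" for x
   using c(2)[of "Dv x" "\<mu> *\<^sub>R Dy x"] \<mu> by (simp add: hf_def hg_def g_def p_def b_def Df_def flux_eq)
  have "\<forall>\<^sub>F j in sequentially. inner_int p (j + 2) - inner_int p j < \<tau> / (4 * (Q * c + 1))"
   by (rule order_tendstoD(2)[OF shell_lim]) (use \<tau> Q c(1) in \<open>simp add: add_nonneg_pos\<close>)
  then obtain j1 where j1: "\<And>j. j \<ge> j1 ==> inner_int p (j + 2) - inner_int p j < \<tau> / (4 * (Q * c + 1))"
   unfolding eventually_sequentially by blast
  obtain j where j: "j \<ge> n + k0 + j1" "shell_int hg (Suc j) \<le> G" using good by blast
  have sp: "shell_int p (Suc j) \<le> \<tau> / (4 * (Q * c + 1))"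
   using shell_int_le_increment[OF lp p0, of j] j1[of j] j(1) by linarith
  have "shell_int hf (Suc j) \<le> \<delta> * shell_int hg (Suc j) + c * shell_int p (Suc j)"
   unfolding shell_int_add[OF lg lp, symmetric] by (rule shell_int_le[OF li(3) loc_int_add[OF lg lp] hf_le])
  also have "\<dots> \<le> \<delta> * G + c * (\<tau> / (4 * (Q * c + 1)))"
   using j(2) sp \<delta> c(1) by (intro add_mono mult_left_mono) auto
  finally have "Q * shell_int hf (Suc j) \<le> Q * (\<delta> * G + c * (\<tau> / (4 * (Q * c + 1))))" using Q by (intro mult_left_mono) auto
  also have "\<dots> = \<tau> / 4 + (Q * c) * \<tau> / (4 * (Q * c + 1))" using Q G by (simp add: \<delta>_def field_simps)
  also have "(Q * c) * \<tau> / (4 * (Q * c + 1)) \<le> \<tau> / 4"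
  proof -
   have "0 < Q * c + 1" using Q c(1) by (simp add: add_nonneg_pos)
   then show ?thesis using \<tau> by (simp add: divide_le_eq field_simps)
  qed
  finally have 1: "Q * shell_int hf (Suc j) \<le> \<tau> / 2" by simp
  have "(2 * D) * (\<epsilon> * shell_int hg (Suc j)) \<le> (2 * D) * (\<epsilon> * G)" using j(2) \<epsilon> D_pos by (intro mult_left_mono) auto
  also have "\<dots> = \<tau> / 2" using D_pos G by (simp add: \<epsilon>_def)
  finally have 2: "(2 * D) * (\<epsilon> * shell_int hg (Suc j)) \<le> \<tau> / 2" .
  have "inner_int p n \<le> (2 * D) * (\<epsilon> * shell_int hg (Suc j) + (B ^ ?N * P / \<epsilon> ^ (?N - 1)) * shell_int hf (Suc j))"
   by (rule key) (use j(1) \<epsilon> in auto)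
  also have "\<dots> = (2 * D) * (\<epsilon> * shell_int hg (Suc j)) + Q * shell_int hf (Suc j)"
   by (simp add: Q_def distrib_left)
  finally show "inner_int p n \<le> 0 + \<tau>" using 1 2 by linarith
 qed
 obtain n where n: "norm (x - x0) < \<Lambda> ^ n" using real_arch_pow[of \<Lambda>] \<Lambda>_ge by auto
 let ?U = "S \<inter> ball x0 (\<Lambda> ^ n)"
 have U: "open ?U" "?U \<subseteq> S" using S_open by auto
 have Ul: "?U \<in> sets lebesgue" using U(1) by simp
 have restr: "integral\<^sup>L (lebesgue_on S) (\<lambda>x. indicator (ball x0 (\<Lambda> ^ n)) x * p x) = integral\<^sup>L (lebesgue_on ?U) (\<lambda>x. indicator (ball x0 (\<Lambda> ^ n)) x * p x)"
  "integrable (lebesgue_on S) (\<lambda>x. indicator (ball x0 (\<Lambda> ^ n)) x * p x) \<longleftrightarrow> integrable (lebesgue_on ?U) (\<lambda>x. indicator (ball x0 (\<Lambda> ^ n)) x * p x)"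
  by (rule integral_lebesgue_on_subset[OF U(2) S_lebesgue Ul]; simp)+
 have "p x = 0"
 proof (rule integral_zero_continuous[OF U(1) continuous_on_subset[OF cp U(2)] p0])
  have "integrable (lebesgue_on ?U) (\<lambda>x. indicator (ball x0 (\<Lambda> ^ n)) x * p x)" using restr(2) inner_integrable[OF lp] by blast
  then show "integrable (lebesgue_on ?U) p"
   by (rule Bochner_Integration.integrable_cong[THEN iffD1, OF refl, rotated]) simp
  have "(LINT x|lebesgue_on ?U. p x) = (LINT x|lebesgue_on ?U. indicator (ball x0 (\<Lambda> ^ n)) x * p x)"
   by (rule Bochner_Integration.integral_cong) simp_all
  then show "(LINT x|lebesgue_on ?U. p x) \<le> 0" using zero[of n] restr(1) unfolding inner_int_def by simp
  show "x \<in> ?U" using x n by (simp add: dist_norm norm_minus_commute)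
 qed
 then show ?thesis using dpow_strict_mono[OF dim, of "Dv x" "\<mu> *\<^sub>R Dy x"]
  unfolding p_def b_def Df_def flux_eq by (metis less_irrefl)
qed

end

section \<open>Uniqueness\<close>

context exterior_problem begin

lemma agree_on_\<Gamma>:
 fixes f h :: "real^'n => 'b::metric_space"
 assumes f: "continuous_on (S \<union> \<Gamma>) f" and h: "continuous_on (S \<union> \<Gamma>) h"
  and eq: "\<And>x. x \<in> S ==> f x = h x" and x: "x \<in> \<Gamma>"
 shows "f x = h x"
proof -
 define d where "d n = dil (1 + inverse (real (Suc n))) x" for n
 have dS: "d n \<in> S" for n
 proof -
  have t: "0 < 1 + inverse (real (Suc n))" "1 < 1 + inverse (real (Suc n))" by (auto simp: add_pos_pos)
  have "rad (d n) = (1 + inverse (real (Suc n))) * R" using rad_dil[OF t(1), of x] x by (simp add: d_def \<Gamma>_iff)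
  moreover have "1 * R < (1 + inverse (real (Suc n))) * R" using t(2) R_pos by (rule mult_strict_right_mono)
  moreover have "d n \<in> \<Sigma>" unfolding d_def using dil_in_Sigma_iff[OF t(1)] x by (simp add: \<Gamma>_iff)
  ultimately show ?thesis by (simp add: S_iff)
 qed
 have "(\<lambda>n. x0 + (1 + inverse (real (Suc n))) *\<^sub>R (x - x0)) \<longlonglongrightarrow> x0 + (1 + 0) *\<^sub>R (x - x0)"
  by (intro tendsto_intros LIMSEQ_inverse_real_of_nat)
 then have lim: "d \<longlonglongrightarrow> x" by (simp add: d_def[abs_def] dil_def)
 have "(\<lambda>n. f (d n)) \<longlonglongrightarrow> f x" by (rule continuous_on_tendsto_compose[OF f lim]) (use x dS in auto)
 moreover have "(\<lambda>n. h (d n)) \<longlonglongrightarrow> h x" by (rule continuous_on_tendsto_compose[OF h lim]) (use x dS in auto)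
 ultimately show ?thesis using eq[OF dS] LIMSEQ_unique by simp
qed

lemma \<Gamma>_nonempty: "\<Gamma> \<noteq> {}"
proof -
 obtain y where y: "y \<in> \<Sigma>" "y \<noteq> x0" using Sigma_nonempty two_directions
 proof -
  obtain p q :: "real^'n" and r where "norm p = 3/2" "0 < r" "\<And>v. norm (v - p) < r ==> x0 + v \<in> \<Sigma>"
   using two_directions by metis
  from this(3)[of p] this(1,2) show thesis by (intro that[of "x0 + p"]) auto
 qed
 have r: "rad y > 0" using y(2) by (simp add: rad_pos_iff)
 then have t: "R / rad y > 0" using R_pos by simp
 have "dil (R / rad y) y \<in> \<Gamma>" unfolding \<Gamma>_iff using dil_in_Sigma_iff[OF t] y(1) rad_dil[OF t, of y] r by simp
 then show ?thesis by blast
qed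

text \<open>A function with vanishing gradient that vanishes on \<open>\<Gamma>\<close> in the Sobolev sense is zero. The approximating
 functions \<open>F n\<close> are inserted into the dilation identity; the nonnegative bounded function
 \<open>t\<^sup>2 / (1 + t\<^sup>2)\<close> of \<open>F n\<close> rules out cancellation and needs no higher integrability.\<close>
lemma zero_gradient_zero:
 assumes f: "admissible f Df" and D0: "\<And>x. x \<in> S ==> Df x = 0" and x1: "x1 \<in> S"
 shows "f x1 = 0"
proof -
 let ?N = "CARD('n)"
 obtain r1 where r1: "\<And>r. r \<ge> r1 ==> \<exists>F. Sobolev_limit ?N (S \<inter> ball 0 r) \<Gamma> f Df F"
  using admissibleD(6)[OF f] unfolding eventually_at_top_linorder by blast
 define s where "s = \<bar>r1\<bar> + norm (x1 - x0) + 1"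
 define r where "r = s + norm x0"
 have s: "s > 0" "norm (x1 - x0) < s" by (auto simp: s_def add_nonneg_pos)
 have rr: "r \<ge> r1" unfolding r_def s_def using norm_ge_zero[of x0] norm_ge_zero[of "x1 - x0"] abs_ge_self[of r1] by linarith
 obtain F where F: "Sobolev_limit ?N (S \<inter> ball 0 r) \<Gamma> f Df F" using r1[OF rr] by blast
 let ?T = "S \<inter> ball 0 r"
 have TS: "?T \<subseteq> S" by simp
 have in_ball: "norm x < r" if "norm (x - x0) < s" for x
  using that norm_triangle_ineq2[of x x0] by (simp add: r_def)
 have Fs: "smooth_on UNIV (F n)" for n using F by (simp add: Sobolev_limit_def)
 define h where "h t = t\<^sup>2 / (1 + t\<^sup>2)" for t :: real
 define h' where "h' t = 2 * t / (1 + t\<^sup>2)\<^sup>2" for t :: real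
 have nz: "1 + t\<^sup>2 \<noteq> 0" for t :: real by (smt (verit) zero_le_power2)
 have hD: "(h has_real_derivative h' t) (at t)" for t
  unfolding h_def[abs_def] h'_def using nz[of t]
  by (auto intro!: derivative_eq_intros simp: power2_eq_square field_simps)
 have hc: "continuous_on A h" "continuous_on A h'" for A
  unfolding h_def[abs_def] h'_def[abs_def] using nz by (auto intro!: continuous_intros)
 have "0 \<le> h t" for t
  unfolding h_def by (intro divide_nonneg_nonneg add_nonneg_nonneg zero_le_power2 zero_le_one)
 moreover have "h t = 0 \<longleftrightarrow> t = 0" for t
  by (simp only: h_def divide_eq_0_iff nz) simp
 moreover have "h t \<le> 1" for t
  unfolding h_def divide_le_eq_1_pos[OF add_pos_nonneg[OF zero_less_one zero_le_power2[of t]]] by simp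
 ultimately have h0: "h 0 = 0" "0 \<le> h t" "h t \<le> 1" "h t = 0 \<longleftrightarrow> t = 0" for t
  by simp_all
 have h'1: "\<bar>h' t\<bar> \<le> 1" for t
 proof -
  have "2 * \<bar>t\<bar> \<le> 1 + t\<^sup>2" using zero_le_power2[of "\<bar>t\<bar> - 1"] by (simp add: power2_eq_square algebra_simps)
  also have "\<dots> \<le> (1 + t\<^sup>2)\<^sup>2" by (rule self_le_power) simp_all
  finally show ?thesis unfolding h'_def abs_divide by (simp add: divide_le_eq abs_mult)
 qed
 have hlip: "\<bar>h a - h b\<bar> \<le> \<bar>a - b\<bar>" for a b
 proof -
  have "norm (h a - h b) \<le> 1 * norm (a - b)"
   by (rule field_differentiable_bound[of UNIV h h']) (use hD h'1 in auto)
  then show ?thesis by simp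
 qed
 define k where "k x = flat 0 (1 - (1 / s\<^sup>2) * ((x - x0) \<bullet> (x - x0)))" for x :: "real^'n"
 define q where "q x = flat 2 (1 - (1 / s\<^sup>2) * ((x - x0) \<bullet> (x - x0)))" for x :: "real^'n"
 have flat_cont: "continuous_on A (flat j)" for A j
  by (rule smooth_on_continuous[OF flat_smooth])
 have kc: "continuous_on A k" and qc: "continuous_on A q" for A
  unfolding k_def[abs_def] q_def[abs_def]
  by (intro continuous_on_compose2[OF flat_cont[of UNIV]] continuous_intros; simp)+
 have out: "k x = 0 \<and> q x = 0" if "s \<le> norm (x - x0)" for x
 proof -
  have "s\<^sup>2 \<le> (norm (x - x0))\<^sup>2" using that s by (intro power_mono) auto
  then have "1 - (1 / s\<^sup>2) * ((x - x0) \<bullet> (x - x0)) \<le> 0" using s by (simp add: power2_norm_eq_inner le_divide_eq)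
  then show ?thesis by (simp add: k_def q_def flat_def)
 qed
 have kD: "GDERIV k x :> (- (2 / s\<^sup>2) * q x) *\<^sub>R (x - x0)" for x
 proof -
  have i: "GDERIV (\<lambda>x. (x - x0) \<bullet> (x - x0)) x :> 2 *\<^sub>R (x - x0)"
   unfolding gderiv_def by (auto intro!: derivative_eq_intros simp: inner_commute inner_scaleR_right)
  have "GDERIV (\<lambda>x. 1 - (1 / s\<^sup>2) * ((x - x0) \<bullet> (x - x0))) x :> 0 - (1 / s\<^sup>2) *\<^sub>R (2 *\<^sub>R (x - x0))"
   by (intro GDERIV_diff GDERIV_const GDERIV_cmult i)
  from GDERIV_DERIV_compose[OF this flat_DERIV[of 0]]
  show ?thesis unfolding k_def[abs_def] q_def by (simp add: mult.commute numeral_2_eq_2)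
 qed
 define DhF where "DhF n x = h' (F n x) *\<^sub>R grad (F n) x" for n x
 have hF: "GDERIV (\<lambda>x. h (F n x)) x :> DhF n x" for n x
  unfolding DhF_def by (rule GDERIV_DERIV_compose[OF smooth_on_GDERIV[OF Fs] hD])
 have DhFc: "continuous_on A (DhF n)" and hFc: "continuous_on A (\<lambda>x. h (F n x))" for A n
  unfolding DhF_def[abs_def]
  by (intro continuous_intros continuous_on_compose2[OF hc(1)[of UNIV]] continuous_on_compose2[OF hc(2)[of UNIV]]
    smooth_on_continuous[OF Fs] smooth_on_grad_continuous[OF Fs]; simp)+
 define W where "W x = (w x * k x) *\<^sub>R (x - x0)" for x
 define Z where "Z x = w x * ((2 / s\<^sup>2) * q x * ((x - x0) \<bullet> (x - x0)))" for x
 have Wc: "continuous_on S W" and Zc: "continuous_on S Z"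
  unfolding W_def[abs_def] Z_def[abs_def] by (intro continuous_intros w_continuous kc qc)+
 have flat_le: "flat j t \<le> 2" if "j = 0 \<or> j = 2" for j t using that flat_bounds(2,4)[of t] by auto
 have bnd: "norm (W x) \<le> (1 / R ^ ?N) * 2 * s" "norm (Z x) \<le> (1 / R ^ ?N) * ((2 / s\<^sup>2) * 2 * s\<^sup>2)" if x: "x \<in> S" for x
 proof -
  have 0: "0 \<le> (1 / R ^ ?N) * 2 * s" "0 \<le> (1 / R ^ ?N) * ((2 / s\<^sup>2) * 2 * s\<^sup>2)" using R_pos s by auto
  have wb: "0 \<le> w x" "w x \<le> 1 / R ^ ?N" using w_bound[OF x] by auto
  have kq: "0 \<le> k x" "k x \<le> 2" "0 \<le> q x" "q x \<le> 2" unfolding k_def q_def using flat_le flat_bounds(1) by auto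
  show "norm (W x) \<le> (1 / R ^ ?N) * 2 * s"
  proof (cases "s \<le> norm (x - x0)")
   case True then show ?thesis using out[of x] 0 by (simp add: W_def)
  next
   case False
   have "norm (W x) = w x * k x * norm (x - x0)" using wb kq by (simp add: W_def)
   also have "\<dots> \<le> (1 / R ^ ?N) * 2 * s" using wb kq False R_pos by (intro mult_mono) auto
   finally show ?thesis .
  qed
  show "norm (Z x) \<le> (1 / R ^ ?N) * ((2 / s\<^sup>2) * 2 * s\<^sup>2)"
  proof (cases "s \<le> norm (x - x0)")
   case True then show ?thesis using out[of x] 0 by (simp add: Z_def)
  next
   case False
   then have "(norm (x - x0))\<^sup>2 \<le> s\<^sup>2" by (intro power_mono) auto
   then have "(x - x0) \<bullet> (x - x0) \<le> s\<^sup>2" by (simp add: power2_norm_eq_inner)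
   then have "w x * ((2 / s\<^sup>2) * q x * ((x - x0) \<bullet> (x - x0))) \<le> (1 / R ^ ?N) * ((2 / s\<^sup>2) * 2 * s\<^sup>2)"
    using wb kq R_pos s by (intro mult_mono) auto
   moreover have "0 \<le> Z x" using wb kq by (simp add: Z_def)
   ultimately show ?thesis by (simp add: Z_def)
  qed
 qed
 have Tm: "?T \<in> lmeasurable" by (rule S_ball_lmeasurable)
 have meas: "g \<in> borel_measurable (lebesgue_on ?T)" if "continuous_on S g" for g :: "real^'n => 'c::euclidean_space"
  by (rule continuous_on_open_measurable[OF S_ball(1) continuous_on_subset[OF that TS]])
 have identity: "(LINT x|lebesgue_on ?T. W x \<bullet> DhF n x) = (LINT x|lebesgue_on ?T. Z x \<bullet> h (F n x))" for n
 proof -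
  obtain U where U: "open U" "closure \<Gamma> \<subseteq> U" "\<forall>x\<in>U \<inter> closure ?T. F n x = 0"
   using F unfolding Sobolev_limit_def by blast
  obtain \<delta> where \<delta>: "\<delta> > 0" "\<And>x. x \<in> \<Sigma> ==> R \<le> rad x ==> rad x < R * (1 + \<delta>) ==> x \<in> U"
   using collar[OF U(1,2)] by blast
  let ?D = "\<lambda>x. h (F n x) *\<^sub>R ((- (2 / s\<^sup>2) * q x) *\<^sub>R (x - x0)) + k x *\<^sub>R DhF n x"
  have "(LINT x|lebesgue_on S. w x * ((x - x0) \<bullet> ?D x)) = 0"
  proof (rule integral_radial_derivative[OF _ _ _ \<delta>(1)])
   show "GDERIV (\<lambda>x. h (F n x) * k x) x :> ?D x" for x by (rule GDERIV_mult[OF hF kD])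
   show "continuous_on UNIV ?D" by (intro continuous_intros hFc DhFc kc qc)
   show "h (F n x) * k x = 0" if "s \<le> norm (x - x0)" for x using out[OF that] by simp
   show "h (F n x) * k x = 0" if x: "x \<in> S" "rad x < R * (1 + \<delta>)" for x
   proof (cases "norm (x - x0) < s")
    case True
    then have "x \<in> ?T" using x in_ball by simp
    then have "x \<in> U \<inter> closure ?T" using \<delta>(2)[of x] x closure_subset[of ?T] by (auto simp: S_iff)
    then show ?thesis using U(3) h0(1) by simp
   qed (use out[of x] in simp)
  qed
  also have "(LINT x|lebesgue_on S. w x * ((x - x0) \<bullet> ?D x)) = (LINT x|lebesgue_on ?T. w x * ((x - x0) \<bullet> ?D x))"
  proof (rule integral_lebesgue_on_subset(1)[OF TS S_lebesgue S_ball(3)])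
   fix x assume "x \<in> S - ?T"
   then have "s \<le> norm (x - x0)" using in_ball[of x] by force
   then show "w x * ((x - x0) \<bullet> ?D x) = 0" using out[of x] by simp
  qed
  also have "\<dots> = (LINT x|lebesgue_on ?T. W x \<bullet> DhF n x - Z x \<bullet> h (F n x))"
  proof (rule Bochner_Integration.integral_cong[OF refl])
   have aux: "a * (b * (- c * q' * A) + k' * D') = a * k' * D' - a * (c * q' * A) * b" for a b c q' A k' D' :: real
    by (simp add: algebra_simps)
   show "w x * ((x - x0) \<bullet> ?D x) = W x \<bullet> DhF n x - Z x \<bullet> h (F n x)" for x
    by (simp only: W_def Z_def inner_add_right inner_scaleR_right inner_scaleR_left inner_real_def aux)
  qed
  also have "\<dots> = (LINT x|lebesgue_on ?T. W x \<bullet> DhF n x) - (LINT x|lebesgue_on ?T. Z x \<bullet> h (F n x))"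
  proof (rule Bochner_Integration.integral_diff)
   obtain b1 where b1: "\<And>x. x \<in> cball 0 r ==> norm (DhF n x) \<le> b1"
    using compact_continuous_bound[OF compact_cball DhFc[of "cball 0 r" n]] by blast
   have "Lp_on 1 ?T (\<lambda>x. W x \<bullet> DhF n x)"
   proof (rule Lp_on_bounded[OF Tm meas])
    show "continuous_on S (\<lambda>x. W x \<bullet> DhF n x)" by (intro continuous_intros Wc DhFc)
    show "norm (W x \<bullet> DhF n x) \<le> ((1 / R ^ ?N) * 2 * s) * b1" if "x \<in> ?T" for x
    proof -
     have "norm (W x \<bullet> DhF n x) \<le> norm (W x) * norm (DhF n x)" by (simp add: Cauchy_Schwarz_ineq2)
     also have "\<dots> \<le> ((1 / R ^ ?N) * 2 * s) * b1" using bnd(1)[of x] b1[of x] that R_pos s by (intro mult_mono) auto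
     finally show ?thesis .
    qed
   qed
   then show "integrable (lebesgue_on ?T) (\<lambda>x. W x \<bullet> DhF n x)" by (rule Lp_on_imp_integrable[OF _ Tm]) simp
   have "Lp_on 1 ?T (\<lambda>x. Z x \<bullet> h (F n x))"
   proof (rule Lp_on_bounded[OF Tm meas])
    show "continuous_on S (\<lambda>x. Z x \<bullet> h (F n x))" by (intro continuous_intros Zc hFc)
    show "norm (Z x \<bullet> h (F n x)) \<le> ((1 / R ^ ?N) * ((2 / s\<^sup>2) * 2 * s\<^sup>2)) * 1" if "x \<in> ?T" for x
     unfolding inner_real_def norm_mult using bnd(2)[of x] h0(2,3)[of "F n x"] that R_pos s by (intro mult_mono) auto
   qed
   then show "integrable (lebesgue_on ?T) (\<lambda>x. Z x \<bullet> h (F n x))" by (rule Lp_on_imp_integrable[OF _ Tm]) simp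
  qed
  finally show ?thesis by simp
 qed
 have fc: "continuous_on S f" by (rule admissibleD(3)[OF f])
 have hfc: "continuous_on S (\<lambda>x. h (f x))" by (rule continuous_on_compose2[OF hc(1)[of UNIV] fc]) simp
 have "Lp_tendsto ?N ?T (\<lambda>n x. h (F n x)) (\<lambda>x. h (f x))"
 proof (rule Lp_tendsto_bound[where B = 1])
  show "Lp_tendsto ?N ?T F f" using F by (simp add: Sobolev_limit_def)
  show "(\<lambda>x. h (F n x) - h (f x)) \<in> borel_measurable (lebesgue_on ?T)" for n by (rule meas) (intro continuous_intros hFc hfc)
  show "norm (h (F n x) - h (f x)) \<le> 1 * norm (F n x - f x)" for n x using hlip by simp
 qed
 then have lim1: "(\<lambda>n. LINT x|lebesgue_on ?T. Z x \<bullet> h (F n x)) \<longlonglongrightarrow> (LINT x|lebesgue_on ?T. Z x \<bullet> h (f x))"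
 proof (rule Lp_tendsto_integral[OF _ Tm card1 meas[OF Zc] bnd(2)])
  have "Lp_on 1 ?T (\<lambda>x. h (f x))" by (rule Lp_on_bounded[OF Tm meas[OF hfc], of 1]) (use h0(2,3) in simp)
  then show "integrable (lebesgue_on ?T) (\<lambda>x. h (f x))" by (rule Lp_on_imp_integrable[OF _ Tm]) simp
 qed simp
 have "Lp_tendsto ?N ?T DhF (\<lambda>x. 0)"
 proof (rule Lp_tendsto_bound[where B = 1])
  show "Lp_tendsto ?N ?T (\<lambda>n. grad (F n)) Df" using F by (simp add: Sobolev_limit_def)
  show "(\<lambda>x. DhF n x - 0) \<in> borel_measurable (lebesgue_on ?T)" for n by (rule meas) (intro continuous_intros DhFc)
  show "norm (DhF n x - 0) \<le> 1 * norm (grad (F n) x - Df x)" if "x \<in> ?T" for n x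
   using D0[of x] that mult_right_mono[OF h'1[of "F n x"] norm_ge_zero[of "grad (F n) x"]] by (simp add: DhF_def)
 qed
 then have "(\<lambda>n. LINT x|lebesgue_on ?T. W x \<bullet> DhF n x) \<longlonglongrightarrow> (LINT x|lebesgue_on ?T. W x \<bullet> 0)"
  by (rule Lp_tendsto_integral[OF _ Tm card1 meas[OF Wc] bnd(1)]) simp_all
 then have "(LINT x|lebesgue_on ?T. Z x \<bullet> h (f x)) = 0"
  using LIMSEQ_unique[OF lim1] unfolding identity by simp
 then have I0: "(LINT x|lebesgue_on ?T. Z x * h (f x)) \<le> 0" by simp
 have Z0: "0 \<le> Z x" if "x \<in> S" for x
  using w_bound[OF that] flat_bounds(1) by (simp add: Z_def q_def)
 have "Z x1 * h (f x1) = 0"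
 proof (rule integral_zero_continuous[OF S_ball(1) _ _ _ I0])
  show c: "continuous_on ?T (\<lambda>x. Z x * h (f x))" by (rule continuous_on_subset[OF _ TS]) (intro continuous_intros Zc hfc)
  show "0 \<le> Z x * h (f x)" if "x \<in> ?T" for x using that Z0[of x] h0(2) by simp
  have "Lp_on 1 ?T (\<lambda>x. Z x * h (f x))"
  proof (rule Lp_on_bounded[OF Tm continuous_on_open_measurable[OF S_ball(1) c]])
   show "norm (Z x * h (f x)) \<le> ((1 / R ^ ?N) * ((2 / s\<^sup>2) * 2 * s\<^sup>2)) * 1" if "x \<in> ?T" for x
    unfolding norm_mult using bnd(2)[of x] h0(2,3)[of "f x"] that R_pos s by (intro mult_mono) auto
  qed
  then show "integrable (lebesgue_on ?T) (\<lambda>x. Z x * h (f x))" by (rule Lp_on_imp_integrable[OF _ Tm]) simp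
  show "x1 \<in> ?T" using x1 in_ball s(2) by simp
 qed
 moreover have "0 < Z x1"
 proof -
  have "0 < w x1" using x1 rad_pos_iff[of x1] S_x0[OF x1] by (simp add: w_def)
  moreover have n: "0 < (x1 - x0) \<bullet> (x1 - x0)" using S_x0[OF x1] by simp
  moreover have "(x1 - x0) \<bullet> (x1 - x0) < s\<^sup>2"
   using power_strict_mono[OF s(2) norm_ge_zero, of 2] by (simp add: power2_norm_eq_inner)
  then have "0 < q x1" using s by (simp add: q_def flat_def divide_less_eq)
  ultimately show ?thesis using s unfolding Z_def by simp
 qed
 ultimately show ?thesis using h0(4)[of "f x1"] by simp
qed

end

context exterior_scales begin

text \<open>On shells of bounded energy, \<open>\<integral> z k * (flux \<bullet> Dv) \<ge> 0\<close> equals the total flux times a value of \<open>v\<close> on the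
 shell up to a bounded error, and these values tend to infinity.\<close>
lemma Flux_nonneg:
 assumes v: "solves v Dv" and g: "log_growth H \<Sigma> v"
 shows "0 \<le> Flux Dv k0"
proof (rule ccontr)
 let ?N = "CARD('n)" and ?h = "\<lambda>x. norm (Dv x) ^ CARD('n)"
 assume "\<not> 0 \<le> Flux Dv k0"
 then have neg: "Flux Dv k0 < 0" by simp
 have adv: "admissible v Dv" using v by (simp add: solves_def)
 have cDv: "continuous_on S Dv" by (rule admissibleD(2)[OF adv])
 obtain A k1 where A: "A > 0" and gr: "\<And>k x. k1 \<le> k ==> x \<in> cring (\<Lambda> ^ k) ==> real k / A \<le> v x \<and> v x \<le> A * real k"
  using log_growth_shells[OF g] by blast
 have abs: "\<bar>v x\<bar> \<le> A * real k" if "k1 \<le> k" "x \<in> cring (\<Lambda> ^ k)" for k x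
 proof -
  have "0 \<le> real k / A" using A by simp
  then show ?thesis using gr[OF that] by linarith
 qed
 obtain E n1 where E: "E > 0" "\<And>n. n1 \<le> n ==> inner_int ?h n \<le> E * real n"
  using energy_linear[OF v A abs] by blast
 have li: "loc_int ?h" by (rule admissible_loc_int[OF adv])
 define M where "M = D * (1 * (3 * E) + (B ^ ?N * P / 1 ^ (?N - 1)) * (3 * E))"
 obtain j1 :: nat where j1: "A * (M + 1) / (- Flux Dv k0) < real j1" using reals_Archimedean2 by blast
 have "\<exists>j\<ge>k1 + k0 + j1. inner_int ?h (j + 2) - inner_int ?h j \<le> 3 * E"
  by (rule linear_growth_bounded_increments[OF E inner_int_nonneg]) (assumption | rule zero_le_power norm_ge_zero)+
 then obtain j where j: "j \<ge> k1 + k0 + j1" "inner_int ?h (j + 2) - inner_int ?h j \<le> 3 * E" by blast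
 have sh: "shell_int ?h (Suc j) \<le> 3 * E" using shell_int_le_increment[OF li, of j] j(2) by simp
 let ?k = "Suc j"
 have "\<exists>y\<in>cring (\<Lambda> ^ ?k). \<bar>LINT x|lebesgue_on S. (v x - v y) * (flux H (Dv x) \<bullet> grad (z ?k) x)\<bar>
   \<le> D * (1 * shell_int ?h ?k + (B ^ ?N * P / 1 ^ (?N - 1)) * shell_int ?h ?k)"
  unfolding shell_int_def
  by (rule shell_estimate[OF adv _ _ flux_continuous[OF cDv] li]) (use j(1) D_pos flux_bound in auto)
 then obtain y where y: "y \<in> cring (\<Lambda> ^ ?k)" and
  est: "\<bar>LINT x|lebesgue_on S. (v x - v y) * (flux H (Dv x) \<bullet> grad (z ?k) x)\<bar>
   \<le> D * (1 * shell_int ?h ?k + (B ^ ?N * P / 1 ^ (?N - 1)) * shell_int ?h ?k)" by blast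
 note est
 also have "\<dots> \<le> M" unfolding M_def using sh D_pos B_pos P_pos by (intro mult_left_mono add_mono) auto
 finally have est': "\<bar>LINT x|lebesgue_on S. (v x - v y) * (flux H (Dv x) \<bullet> grad (z ?k) x)\<bar> \<le> M" .
 have "0 \<le> flux H (Dv x) \<bullet> Dv x" for x
 proof -
  have "0 \<le> m * norm (Dv x) ^ ?N" using m_pos by simp
  then show ?thesis using flux_coercive[of "Dv x"] by (simp add: inner_commute)
 qed
 then have "0 \<le> (LINT x|lebesgue_on S. z ?k x * (flux H (Dv x) \<bullet> Dv x))"
  by (intro Bochner_Integration.integral_nonneg mult_nonneg_nonneg z_range)
 also have "\<dots> \<le> M + v y * Flux Dv k0"
  using energy_identity(3)[OF v adv, of ?k "v y"] est' flux_const[OF v, of ?k] j(1) by simp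
 finally have "v y * (- Flux Dv k0) \<le> M" by simp
 moreover have "M + 1 < v y * (- Flux Dv k0)"
 proof -
  have "A * (M + 1) / (- Flux Dv k0) < real ?k" using j1 j(1) by linarith
  then have "M + 1 < (real ?k / A) * (- Flux Dv k0)" using neg A by (simp add: field_simps)
  also have "\<dots> \<le> v y * (- Flux Dv k0)" using gr[OF _ y] j(1) neg by (intro mult_right_mono) auto
  finally show ?thesis .
 qed
 ultimately show False by simp
qed

text \<open>The equation, the growth and the Dirichlet condition leave \<open>v = \<mu> u\<close> with \<open>\<mu> \<ge> 0\<close>; the condition on
 \<open>H (Dv)\<close> fixes \<open>\<mu> = 1\<close>.\<close>
lemma unique_solution:
 assumes v: "overdetermined_solution H \<Sigma> \<Omega> C v" and x: "x \<in> S \<union> \<Gamma>"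
 shows "v x = u x"
proof -
 let ?N = "CARD('n)"
 obtain Dv where Dv: "solves v Dv" "C1_up_to_with S \<Gamma> v Dv" "\<And>x. x \<in> \<Gamma> ==> H (Dv x) = C"
  using overdetermined_solves[OF v] by blast
 obtain Dy where Dy: "solves u Dy" "C1_up_to_with S \<Gamma> u Dy" "\<And>x. x \<in> \<Gamma> ==> H (Dy x) = C"
  using overdetermined_solves[OF u_solution] by blast
 have adv: "admissible v Dv" and ady: "admissible u Dy" using Dv(1) Dy(1) by (simp_all add: solves_def)
 have Dy_eq: "Dy x = Du x" if "x \<in> S" for x
  by (rule GDERIV_unique[OF admissibleD(1)[OF ady that] u_GDERIV[OF S_x0[OF that]]])
 have gv: "log_growth H \<Sigma> v" using v by (simp add: overdetermined_solution_def)
 have energy: "\<exists>E n1. E > 0 \<and> (\<forall>n\<ge>n1. inner_int (\<lambda>x. norm (Df x) ^ ?N) n \<le> E * real n)"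
  if f: "solves f Df" and g: "log_growth H \<Sigma> f" for f Df
 proof -
  obtain A k1 where A: "A > 0" and gr: "\<And>k x. k1 \<le> k ==> x \<in> cring (\<Lambda> ^ k) ==> real k / A \<le> f x \<and> f x \<le> A * real k"
   using log_growth_shells[OF g] by blast
  have abs: "\<bar>f x\<bar> \<le> A * real k" if "k1 \<le> k" "x \<in> cring (\<Lambda> ^ k)" for k x
  proof -
   have "0 \<le> real k / A" using A by simp
   then show ?thesis using gr[OF that] by linarith
  qed
  show ?thesis using energy_linear[OF f A abs] by blast
 qed
 obtain E1 n1 where E1: "E1 > 0" "\<And>n. n1 \<le> n ==> inner_int (\<lambda>x. norm (Dv x) ^ ?N) n \<le> E1 * real n"
  using energy[OF Dv(1) gv] by blast
 obtain E2 n2 where E2: "E2 > 0" "\<And>n. n2 \<le> n ==> inner_int (\<lambda>x. norm (Dy x) ^ ?N) n \<le> E2 * real n"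
  using energy[OF Dy(1) u_log_growth] by blast
 obtain x2 where x2: "x2 \<in> \<Gamma>" using \<Gamma>_nonempty by blast
 have N1: "0 < ?N - 1" using dim by simp
 have S_ne: "dil 2 x2 \<in> S" using x2 R_pos rad_dil[of 2 x2] dil_in_Sigma_iff[of 2 x2] by (simp add: S_iff \<Gamma>_iff)
 \<comment> \<open>A vanishing total flux would make \<open>u\<close> proportional to \<open>0\<close>.\<close>
 have "Flux Dy k0 \<noteq> 0"
 proof
  assume 0: "Flux Dy k0 = 0"
  have "Dy (dil 2 x2) = 0 *\<^sub>R Dy (dil 2 x2)"
   by (rule solutions_proportional[OF Dy(1) Dy(1) _ _ E2 E2 S_ne]) (use 0 in simp_all)
  then have "Du (dil 2 x2) = 0" using Dy_eq[OF S_ne] by simp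
  then show False using Du_radial[OF S_x0[OF S_ne]] C_pos R_pos by simp
 qed
 then have Fy: "0 < Flux Dy k0" using Flux_nonneg[OF Dy(1) u_log_growth] by simp
 define \<mu> where "\<mu> = root (?N - 1) (Flux Dv k0 / Flux Dy k0)"
 have q0: "0 \<le> Flux Dv k0 / Flux Dy k0" using Fy Flux_nonneg[OF Dv(1) gv] by simp
 have \<mu>: "\<mu> \<ge> 0" unfolding \<mu>_def by (rule real_root_ge_zero[OF q0])
 have "\<mu> ^ (?N - 1) = Flux Dv k0 / Flux Dy k0" unfolding \<mu>_def by (rule real_root_pow_pos2[OF N1 q0])
 then have fl: "Flux Dv k0 = \<mu> ^ (?N - 1) * Flux Dy k0" using Fy by simp
 have propo: "Dv x = \<mu> *\<^sub>R Dy x" if "x \<in> S" for x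
  by (rule solutions_proportional[OF Dv(1) Dy(1) \<mu> fl E1 E2 that])
 have vu: "v x = \<mu> * u x" if "x \<in> S" for x
 proof -
  have "v x - \<mu> * u x = 0"
   by (rule zero_gradient_zero[OF admissible_diff[OF adv ady] _ that]) (simp add: propo)
  then show ?thesis by simp
 qed
 have cv: "continuous_on (S \<union> \<Gamma>) v" "continuous_on (S \<union> \<Gamma>) Dv" and cu: "continuous_on (S \<union> \<Gamma>) u" "continuous_on (S \<union> \<Gamma>) Dy"
  using Dv(2) Dy(2) by (simp_all add: C1_up_to_with_def)
 have "Dv x2 = \<mu> *\<^sub>R Dy x2"
  by (rule agree_on_\<Gamma>[OF cv(2) _ propo x2]) (intro continuous_intros cu)
 then have HC: "C = H (\<mu> *\<^sub>R Dy x2)" using Dv(3)[OF x2] by simp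
 have "\<mu> = 1"
 proof (cases "\<mu> = 0")
  case True then show ?thesis using HC H_0 C_pos by simp
 next
  case False
  then have "C = \<mu> * C" using HC H_scale[of \<mu> "Dy x2"] \<mu> Dy(3)[OF x2] by simp
  then show ?thesis using C_pos by simp
 qed
 then have eq: "v x = u x" if "x \<in> S" for x using vu[OF that] by simp
 show ?thesis using x eq agree_on_\<Gamma>[OF cv(1) cu(1) eq] by blast
qed

end

lemma (in exterior_problem) exterior_scales_exist:
 "\<exists>\<zeta> \<Lambda> P B D m k0. exterior_scales H K T \<Sigma> \<Omega> C R x0 \<zeta> \<Lambda> P B D m k0"
proof -
 obtain \<zeta> :: "real^'n => real" where \<zeta>: "smooth_on UNIV \<zeta>" "\<And>x. 0 \<le> \<zeta> x \<and> \<zeta> x \<le> 1"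
  "\<And>x. norm x \<le> 1 ==> \<zeta> x = 1" "\<And>x. 2 \<le> norm x ==> \<zeta> x = 0"
  using cutoff_exists by blast
 obtain B where B: "B > 0" "\<And>x. norm (grad \<zeta> x) \<le> B" using smooth_compact_grad_bounded[OF \<zeta>(1,4)] by blast
 obtain D where D: "D > 0" "\<And>\<xi>. norm (dpow CARD('n) \<xi>) \<le> D * norm \<xi> ^ (CARD('n) - 1)"
  using dpow_bound_exists[OF dim] by blast
 obtain m0 where m0: "0 < m0" "\<And>\<xi>. m0 * norm \<xi> \<le> H \<xi>" using bounds_exist by blast
 obtain m1 where m1: "0 < m1" "\<And>x. m1 * norm (x - x0) \<le> rad x" using rad_bounds by metis
 obtain M1 where M1: "0 < M1" "\<And>x. rad x \<le> M1 * norm (x - x0)" using rad_bounds by metis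
 show ?thesis
 proof (rule ring_poincare)
 fix \<Lambda> P :: real
 assume \<Lambda>: "4 \<le> \<Lambda>" "0 < P" and
  poi: "\<And>\<rho> f Df E. 0 < \<rho> ==> (\<And>x. x \<in> ring (\<rho> / \<Lambda>) (\<Lambda> * \<rho>) ==> GDERIV f x :> Df x) ==>
   continuous_on (ring (\<rho> / \<Lambda>) (\<Lambda> * \<rho>)) Df ==> 0 \<le> E ==>
   (\<integral>\<^sup>+z. ennreal (indicator (ring (\<rho> / \<Lambda>) (\<Lambda> * \<rho>)) z * norm (Df z) ^ CARD('n)) \<partial>lborel) = ennreal E ==>
   \<exists>c. (\<exists>y\<in>cring \<rho>. c = f y) \<and>
    (\<integral>\<^sup>+x. ennreal (indicator (cring \<rho>) x * \<bar>f x - c\<bar> ^ CARD('n)) \<partial>lborel) \<le> ennreal (P * \<rho> ^ CARD('n) * E)"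
 obtain k0 where k0: "R / m1 < \<Lambda> ^ k0" using real_arch_pow[of \<Lambda> "R / m1"] \<Lambda>(1) by auto
 have "exterior_scales H K T \<Sigma> \<Omega> C R x0 \<zeta> \<Lambda> P B D (m0 ^ CARD('n)) k0"
 proof (unfold_locales)
  show "smooth_on UNIV \<zeta>" "0 < B" "4 \<le> \<Lambda>" "0 < P" "0 < D" by fact+
  show "0 \<le> \<zeta> x" "\<zeta> x \<le> 1" "norm (grad \<zeta> x) \<le> B" for x using \<zeta>(2)[of x] B(2)[of x] by auto
  show "\<zeta> x = 1" if "norm x \<le> 1" for x by (rule \<zeta>(3)[OF that])
  show "\<zeta> x = 0" if "2 \<le> norm x" for x by (rule \<zeta>(4)[OF that])
  show "norm (flux H \<xi>) \<le> D * norm \<xi> ^ (CARD('n) - 1)" for \<xi> using D(2)[of \<xi>] by (simp add: flux_eq)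
  show "0 < m0 ^ CARD('n)" using m0 by simp
  show "m0 ^ CARD('n) * norm \<xi> ^ CARD('n) \<le> \<xi> \<bullet> flux H \<xi>" for \<xi>
   unfolding flux_eq dpow_inner_self[OF dim] power_mult_distrib[symmetric]
   by (intro power_mono m0(2)) (use m0(1) in simp)
  show "x \<in> S" if "x \<in> \<Sigma>" "\<Lambda> ^ k0 \<le> norm (x - x0)" for x
  proof -
   have "R < m1 * norm (x - x0)" using k0 that(2) m1(1) by (simp add: divide_less_eq mult.commute less_le_trans)
   then show ?thesis using that(1) m1(2)[of x] by (simp add: S_iff)
  qed
  show "closure \<Gamma> \<subseteq> {x. norm (x - x0) < \<Lambda> ^ k0}"
  proof
   fix x assume "x \<in> closure \<Gamma>"
   then have "m1 * norm (x - x0) \<le> R" using closure_\<Gamma>_rad m1(2)[of x] by (meson order_trans)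
   then have "norm (x - x0) \<le> R / m1" using m1(1) by (simp add: le_divide_eq mult.commute)
   then show "x \<in> {x. norm (x - x0) < \<Lambda> ^ k0}" using k0 by simp
  qed
 next
  fix \<rho> :: real and f Df and E :: real
  assume "0 < \<rho>" "\<And>x. x \<in> ring (\<rho> / \<Lambda>) (\<Lambda> * \<rho>) ==> GDERIV f x :> Df x"
   "continuous_on (ring (\<rho> / \<Lambda>) (\<Lambda> * \<rho>)) Df" "0 \<le> E"
   "(\<integral>\<^sup>+z. ennreal (indicator (ring (\<rho> / \<Lambda>) (\<Lambda> * \<rho>)) z * norm (Df z) ^ CARD('n)) \<partial>lborel) = ennreal E"
  then show "\<exists>c. (\<exists>y\<in>cring \<rho>. c = f y) \<and>
    (\<integral>\<^sup>+x. ennreal (indicator (cring \<rho>) x * \<bar>f x - c\<bar> ^ CARD('n)) \<partial>lborel) \<le> ennreal (P * \<rho> ^ CARD('n) * E)"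
   by (rule poi)
 qed
 then show "\<exists>\<zeta> \<Lambda> P B D m k0. exterior_scales H K T \<Sigma> \<Omega> C R x0 \<zeta> \<Lambda> P B D m k0" by blast
 qed
qed

lemma (in exterior_problem) log_profile_unique_solution:
 defines "f \<equiv> \<lambda>x. C * R * ln (dual_fun H (x - x0) / R)"
 shows "Ck_on 2 (UNIV - {x0}) f" "overdetermined_solution H \<Sigma> \<Omega> C f"
  "overdetermined_solution H \<Sigma> \<Omega> C v ==> x \<in> ext_dom \<Sigma> \<Omega> \<union> Gamma0 \<Sigma> \<Omega> ==> v x = f x"
proof -
 have fu: "f = u" by (simp add: f_def u_def[abs_def] rad_def[abs_def])
 show "Ck_on 2 (UNIV - {x0}) f" "overdetermined_solution H \<Sigma> \<Omega> C f"
  unfolding fu by (rule u_C2 u_solution)+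
 assume v: "overdetermined_solution H \<Sigma> \<Omega> C v" and x: "x \<in> ext_dom \<Sigma> \<Omega> \<union> Gamma0 \<Sigma> \<Omega>"
 obtain \<zeta> \<Lambda> P B D m k0 where "exterior_scales H K T \<Sigma> \<Omega> C R x0 \<zeta> \<Lambda> P B D m k0"
  using exterior_scales_exist by blast
 then interpret exterior_scales H K T \<Sigma> \<Omega> C R x0 \<zeta> \<Lambda> P B D m k0 .
 show "v x = f x" unfolding fu by (rule unique_solution[OF v]) (use x in \<open>simp add: S_def \<Gamma>_def\<close>)
qed


theorem proposition1p1:
  fixes H :: "real^'n \<Rightarrow> real"
    and K :: "'n set" and T \<Sigma> \<Omega> :: "(real^'n) set"
    and C R :: real and x0 :: "real^'n" and u :: "real^'n \<Rightarrow> real"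
  assumes "2 \<le> CARD('n)"
    and "open_convex_cone_without_lines (coord_subspace (- K)) T"
    and "\<Sigma> = product_cone K T"
    and "Ck_on 2 (UNIV - {0}) H"
    and "pos_homogeneous H"
    and "\<forall>\<xi>\<in>sphere 0 1. 0 < H \<xi>"
    and "uniformly_elliptic H"
    and "0 < C" and "0 < R"
    and "x0 \<in> coord_subspace K"
    and "\<Omega> = dual_ball H x0 R"
    and "u = (\<lambda>x. C * R * ln (dual_fun H (x - x0) / R))"
  shows "Ck_on 2 (UNIV - {x0}) u \<and>
         overdetermined_solution H \<Sigma> \<Omega> C u \<and>
         (\<forall>v. overdetermined_solution H \<Sigma> \<Omega> C v \<longrightarrow>
              (\<forall>x \<in> ext_dom \<Sigma> \<Omega> \<union> Gamma0 \<Sigma> \<Omega>. v x = u x))"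
proof -
  have "exterior_problem H K T \<Sigma> \<Omega> C R x0"
    by unfold_locales (rule assms)+
  from exterior_problem.log_profile_unique_solution[OF this]
  show ?thesis unfolding assms(12) by blast
qed

end
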